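(* Let $X$ be the limit space (with metric $d_X$) of the following iterated graph system: $V_1=\{1,\dots,8\}$, $E_1=\{\{1,3\},\{3,4\},\{4,6\},\{6,7\},\{2,3\},\{3,5\},\{5,6\},\{6,8\},\{4,5\}\}$, $I=\{a,b\}$, $\phi_-(a)=1$, $\phi_-(b)=2$, $\phi_+(a)=7$, $\phi_+(b)=8$, and, for every edge $\{v,w\}\in E_1$, $\phi_{v,\{v,w\}}=\phi_-$ if $v<w$ and $\phi_{v,\{v,w\}}=\phi_+$ if $v>w$; with scaling constant $L_*=4$. Then $X$ is $\frac{\log 9}{\log 4}$-Ahlfors regular, satisfies the combinatorial $\frac32$-Loewner property, and is approximately self-similar. Its (Ahlfors regular) conformal dimension is equal to $\frac32$, and it is not attained. In particular, $X$ is not quasisymmetric to a Loewner space.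
   Context: $\mathbb N=\{1,2,\dots\}$; $B(x,r)$ is the open ball; $\mathcal H^Q$ is the $Q$-dimensional Hausdorff measure. Graphs are finite and simple; edges are 2-element sets of vertices. Iterated graph systems. An iterated graph system consists of a connected graph $G_1=(V_1,E_1)$, a nonempty finite set $I$, and for every $e\in E_1$ and $v\in e$ an injective map $\phi_{v,e}:I\to V_1$ whose image $I_{v,e}$ is an independent set of $G_1$, with $I_{v,e}\cap I_{w,e}=\emptyset$ for $e=\{v,w\}$. Graphs $G_n=(V_n,E_n)$ with maps $\phi_{v,e}:I\to V_1$ ($v\in e\in E_n$) are defined recursively: $V_{n+1}=(V_1\times E_n)/\sim$, where $(\phi_{x,e}(c),e)\sim(\phi_{x,f}(c),f)$ whenever $e,f\in E_n$ share the endpoint $x$ and $c\in I$; the class of $(z,e)$ is $[z,e]$; $E_{n+1}=\{\{[z_1,e],[z_2,e]\}:\{z_1,z_2\}\in E_1,\ e\in E_n\}$; and $\phi_{[z_1,e],\{[z_1,e],[z_2,e]\}}=\phi_{z_1,\{z_1,z_2\}}$. Define $\pi_{n+1}:E_{n+1}\to E_n$ by $\pi_{n+1}(\{[z_1,e],[z_2,e]\})=e$. Limit space. Let $d_{G_n}$ be the path metric on $V_n$, $d_n=L_*^{-n}d_{G_n}$, and $d_n(e,f)=\min_{x\in e,y\in f}d_n(x,y)$ for $e,f\in E_n$. Let $\Sigma=\{(e_i)_{i\ge1}: e_i\in E_i,\ \pi_{i+1}(e_{i+1})=e_i\}$ and $X=\Sigma/\sim$, where $(e_i)\sim(f_i)$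 iff $e_i\cap f_i\ne\emptyset$ for all $i$; the metric is $d_X([(e_i)],[(f_i)])=\lim_{n\to\infty}d_n(e_n,f_n)$. Approximate self-similarity. A map is $L$-biLipschitz if it distorts distances by a factor in $[1/L,L]$. A metric space $(X,d)$ is approximately self-similar if there is $L\ge 1$ such that for every $x\in X$ and $r\in(0,\mathrm{diam}(X)]$ there are an open set $U_{x,r}\subset X$ and an $L$-biLipschitz map $f_{x,r}$ from $(B(x,r),d/r)$ onto $U_{x,r}$. Ahlfors regularity. For $Q>0$, a compact metric space $X$ is $Q$-Ahlfors regular if there is $C>1$ with $C^{-1}r^Q\le\mathcal H^Q(B(x,r))\le Cr^Q$ for all $x\in X$, $r\in(0,\mathrm{diam}(X)]$. Quasisymmetry and conformal dimension. A homeomorphism $f:(X,d_X)\to(Y,d_Y)$ is a quasisymmetry if there is a homeomorphism $\eta:[0,\infty)\to[0,\infty)$ with $\frac{d_Y(f(x),f(y))}{d_Y(f(x),f(z))}\le\eta\left(\frac{d_X(x,y)}{d_X(x,z)}\right)$ for all $x,y,z\in X$, $x\ne z$; then $X$ is quasisymmetric to $Y$. $\mathcal G_{\rm AR}(X,d)$ is the set of metrics $\hat d$ on $X$ such that $\mathrm{id}:(X,d)\to(X,\hat d)$ is a quasisymmetry and $(X,\hat d)$ is $\widehat Q$-Ahlfors regular for some $\widehat Q>0$. The conformal dimension $\dim_{\rm AR}(X)$ is the infimum of all $\widehat Q$ such that some $\hat d\in\mathcal G_{\rm AR}(X,d)$ is $\widehat Q$-Ahlfors regular; it is attained if this infimum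 is a minimum. Loewner spaces. Let $Q\in(1,\infty)$ and let $X$ be compact and $Q$-Ahlfors regular. For a family $\Gamma$ of curves, $\mathrm{Mod}_Q(\Gamma)=\inf\int_X\rho^Q\,d\mathcal H^Q$ over Borel $\rho:X\to[0,\infty]$ with $\int_\gamma\rho\,ds\ge1$ for all rectifiable $\gamma\in\Gamma$. $\Gamma(E,F)$ is the collection of rectifiable curves connecting $E$ to $F$. A non-degenerate continuum is a compact connected set of positive diameter, and $\Delta(E,F)=d(E,F)/\min\{\mathrm{diam}(E),\mathrm{diam}(F)\}$. $X$ is $Q$-Loewner if it is $Q$-Ahlfors regular and there is an increasing $\varphi:[0,\infty)\to[0,\infty)$, $\varphi(t)>0$ for $t>0$, with $\mathrm{Mod}_Q(\Gamma(E,F))\ge\varphi(\Delta(E,F)^{-1})$ for all (disjoint) non-degenerate continua $E,F$. A Loewner space is a space that is $Q$-Loewner for some $Q\in(1,\infty)$. Discrete modulus. Let $\alpha,L_*>1$. An $\alpha$-approximation of a compact metric space $X$ is a sequence of graphs $\mathbb G_m=(\mathbb V_m,\mathbb E_m)$, $m\in\mathbb N$, where $\mathbb V_m$ is a collection of subsets of $X$ covering $X$; distinct $v,u\in \mathbb V_m$ are joined by an edge iff $v\cap u\neq\emptyset$; every $v\in \mathbb V_m$ has a point $z_v\in v$ with $B(z_v,\alpha^{-1}L_*^{-m})\subset v\subset B(z_v,\alpha L_*^{-m})$; and the balls $B(z_v,\alpha^{-1}L_*^{-m})$, $v\in\mathbb V_m$, are pairwise disjoint. For $F\subset X$ put $\mathbb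 G_m[F]=\{v\in \mathbb V_m: v\cap F\ne\emptyset\}$. For a family $\Gamma$ of continuous curves in $X$ (identified with their images), $\mathrm{Mod}^D_p(\Gamma,\mathbb G_m)=\inf\sum_{v\in \mathbb V_m}\rho(v)^p$ over all $\rho:\mathbb V_m\to[0,\infty)$ with $\sum_{v\in \mathbb G_m[\gamma]}\rho(v)\ge1$ for all $\gamma\in\Gamma$. Combinatorial Loewner property. For $Q>1$, a compact metric space $X$ satisfies the combinatorial $Q$-Loewner property if, for an $\alpha$-approximation $\{\mathbb G_m\}$ with scale parameter $L_*$ (the property does not depend on this choice), there are positive increasing functions $\varphi$ on $(0,\infty)$ and $\psi$ on $(0,1)$ with $\lim_{t\to0}\psi(t)=0$ such that: (1) if $F_1,F_2\subset X$ are disjoint non-degenerate continua with $L_*^{-n}\le\min\{\mathrm{diam}(F_1),\mathrm{diam}(F_2)\}$, then $\varphi(\Delta(F_1,F_2)^{-1})\le\mathrm{Mod}_Q^D(\Gamma(F_1,F_2),\mathbb G_{n+m})$ for all $m\in\mathbb N$; (2) if $x\in X$, $r\ge L_*^{-n}$ and $C>1$, then $\mathrm{Mod}^D_Q(\Gamma(\overline{B(x,r)},X\setminus B(x,Cr)),\mathbb G_{n+m})\le\psi(C^{-1})$ for all $m\in\mathbb N$. *)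

theory Defs
  imports "HOL-Analysis.Analysis" "HOL-Library.FSet"
begin

section \<open>Metric notions\<close>

text \<open>
  Metric spaces are elements of the library type \<open>'a metric\<close> (a carrier with a distance).
  Diameters are taken in the extended half-line, so that they are also meaningful for unbounded
  sets; the diameter of the empty set is 0.
\<close>

definition mdiam :: "'a metric \<Rightarrow> 'a set \<Rightarrow> ennreal" where
  "mdiam m S = (SUP x\<in>S. SUP y\<in>S. ennreal (mdist m x y))"

definition msetdist :: "'a metric \<Rightarrow> 'a set \<Rightarrow> 'a set \<Rightarrow> real" where
  "msetdist m S T = Inf {mdist m x y | x y. x \<in> S \<and> y \<in> T}"

text \<open>Real powers on \<open>[0,\<infinity>]\<close>; only used with exponents \<open>p > 0\<close>.\<close>

definition epowr :: "ennreal \<Rightarrow> real \<Rightarrow> ennreal" where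
  "epowr x p = (if x = \<infinity> then \<infinity> else ennreal (enn2real x powr p))"

definition hausdorff_content :: "'a metric \<Rightarrow> real \<Rightarrow> real \<Rightarrow> 'a set \<Rightarrow> ennreal" where
  "hausdorff_content m Q \<delta> A =
     (INF U\<in>{U :: nat \<Rightarrow> 'a set. A \<subseteq> (\<Union>i. U i) \<and> (\<forall>i. U i \<subseteq> mspace m \<and> mdiam m (U i) \<le> ennreal \<delta>)}.
        (\<Sum>i. epowr (mdiam m (U i)) Q))"

text \<open>The Hausdorff measure (without normalising constant) of an arbitrary subset \<open>A\<close>, and the
  associated Borel measure, needed for integration.\<close>

definition hausdorff :: "'a metric \<Rightarrow> real \<Rightarrow> 'a set \<Rightarrow> ennreal" where
  "hausdorff m Q A = (SUP \<delta>\<in>{0<..}. hausdorff_content m Q \<delta> A)"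

definition hausdorff_measure :: "'a metric \<Rightarrow> real \<Rightarrow> 'a measure" where
  "hausdorff_measure m Q =
     measure_of (mspace m) {U. openin (mtopology_of m) U} (hausdorff m Q)"

definition ahlfors_regular :: "real \<Rightarrow> 'a metric \<Rightarrow> bool" where
  "ahlfors_regular Q m \<longleftrightarrow>
     Q > 0 \<and> compact_space (mtopology_of m) \<and>
     (\<exists>C>1. \<forall>x\<in>mspace m. \<forall>r>0. ennreal r \<le> mdiam m (mspace m) \<longrightarrow>
        ennreal (r powr Q / C) \<le> hausdorff m Q (mball_of m x r) \<and>
        hausdorff m Q (mball_of m x r) \<le> ennreal (C * r powr Q))"

definition approximately_self_similar :: "'a metric \<Rightarrow> bool" where
  "approximately_self_similar m \<longleftrightarrow>
     (\<exists>L\<ge>1. \<forall>x\<in>mspace m. \<forall>r>0. ennreal r \<le> mdiam m (mspace m) \<longrightarrow>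
        (\<exists>U f. openin (mtopology_of m) U \<and> f ` mball_of m x r = U \<and>
           (\<forall>y\<in>mball_of m x r. \<forall>z\<in>mball_of m x r.
              1 / L * (mdist m y z / r) \<le> mdist m (f y) (f z) \<and>
              mdist m (f y) (f z) \<le> L * (mdist m y z / r))))"


section \<open>Quasisymmetries and conformal dimension\<close>

definition quasisymmetry :: "'a metric \<Rightarrow> 'b metric \<Rightarrow> ('a \<Rightarrow> 'b) \<Rightarrow> bool" where
  "quasisymmetry m m' f \<longleftrightarrow>
     homeomorphic_map (mtopology_of m) (mtopology_of m') f \<and>
     (\<exists>\<eta> \<theta> :: real \<Rightarrow> real. homeomorphism {0..} {0..} \<eta> \<theta> \<and>
        (\<forall>x\<in>mspace m. \<forall>y\<in>mspace m. \<forall>z\<in>mspace m. x \<noteq> z \<longrightarrow>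
           mdist m' (f x) (f y) / mdist m' (f x) (f z) \<le> \<eta> (mdist m x y / mdist m x z)))"

definition quasisymmetric :: "'a metric \<Rightarrow> 'b metric \<Rightarrow> bool" where
  "quasisymmetric m m' \<longleftrightarrow> (\<exists>f. quasisymmetry m m' f)"

definition ar_gauge :: "'a metric \<Rightarrow> 'a metric set" where
  "ar_gauge m = {m'. mspace m' = mspace m \<and> quasisymmetry m m' id \<and> (\<exists>Q>0. ahlfors_regular Q m')}"

definition ar_exponents :: "'a metric \<Rightarrow> real set" where
  "ar_exponents m = {Q. \<exists>m'\<in>ar_gauge m. ahlfors_regular Q m'}"

text \<open>The infimum is taken in the extended reals, so that it is \<open>\<infinity>\<close> if the gauge is empty.\<close>

definition conformal_dimension :: "'a metric \<Rightarrow> ereal" where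
  "conformal_dimension m = Inf (ereal ` ar_exponents m)"

definition conformal_dimension_attained :: "'a metric \<Rightarrow> bool" where
  "conformal_dimension_attained m \<longleftrightarrow> conformal_dimension m \<in> ereal ` ar_exponents m"


section \<open>Curves, modulus and Loewner spaces\<close>

text \<open>Curves are parametrised on \<open>[0,1]\<close>. \<open>curve_length m \<gamma> t\<close> is the length of the restriction of
  \<open>\<gamma>\<close> to \<open>[0,t]\<close>.\<close>

definition curve_length :: "'a metric \<Rightarrow> (real \<Rightarrow> 'a) \<Rightarrow> real \<Rightarrow> ennreal" where
  "curve_length m \<gamma> t =
     (SUP ts\<in>{ts. sorted ts \<and> set ts \<subseteq> {0..t}}.
        \<Sum>i<length ts - 1. ennreal (mdist m (\<gamma> (ts ! i)) (\<gamma> (ts ! Suc i))))"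

definition rectifiable :: "'a metric \<Rightarrow> (real \<Rightarrow> 'a) \<Rightarrow> bool" where
  "rectifiable m \<gamma> \<longleftrightarrow> pathin (mtopology_of m) \<gamma> \<and> curve_length m \<gamma> 1 < \<infinity>"

text \<open>The integral of \<open>\<rho>\<close> along a rectifiable curve via its arc-length parametrisation:
  the point at arc length \<open>u\<close> is \<open>\<gamma> t\<close> for any \<open>t\<close> with \<open>curve_length m \<gamma> t = u\<close>, since \<open>\<gamma>\<close> is constant
  between two such parameters.\<close>

definition curve_integral :: "'a metric \<Rightarrow> ('a \<Rightarrow> ennreal) \<Rightarrow> (real \<Rightarrow> 'a) \<Rightarrow> ennreal" where
  "curve_integral m \<rho> \<gamma> =
     (\<integral>\<^sup>+u\<in>{0..enn2real (curve_length m \<gamma> 1)}.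
        \<rho> (\<gamma> (SOME t. t \<in> {0..1} \<and> curve_length m \<gamma> t = ennreal u)) \<partial>lborel)"

definition curves_between :: "'a metric \<Rightarrow> 'a set \<Rightarrow> 'a set \<Rightarrow> (real \<Rightarrow> 'a) set" where
  "curves_between m E F = {\<gamma>. rectifiable m \<gamma> \<and> \<gamma> 0 \<in> E \<and> \<gamma> 1 \<in> F}"

definition modulus :: "'a metric \<Rightarrow> real \<Rightarrow> (real \<Rightarrow> 'a) set \<Rightarrow> ennreal" where
  "modulus m Q \<Gamma> =
     (INF \<rho>\<in>{\<rho> \<in> borel_measurable (hausdorff_measure m Q).
               \<forall>\<gamma>\<in>\<Gamma>. rectifiable m \<gamma> \<longrightarrow> 1 \<le> curve_integral m \<rho> \<gamma>}.
        (\<integral>\<^sup>+x. epowr (\<rho> x) Q \<partial>hausdorff_measure m Q))"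

definition nondegenerate_continuum :: "'a metric \<Rightarrow> 'a set \<Rightarrow> bool" where
  "nondegenerate_continuum m E \<longleftrightarrow>
     compactin (mtopology_of m) E \<and> connectedin (mtopology_of m) E \<and> mdiam m E > 0"

definition relative_distance :: "'a metric \<Rightarrow> 'a set \<Rightarrow> 'a set \<Rightarrow> real" where
  "relative_distance m E F = msetdist m E F / enn2real (min (mdiam m E) (mdiam m F))"

definition Q_loewner :: "real \<Rightarrow> 'a metric \<Rightarrow> bool" where
  "Q_loewner Q m \<longleftrightarrow>
     1 < Q \<and> ahlfors_regular Q m \<and>
     (\<exists>\<phi> :: real \<Rightarrow> real. mono_on {0..} \<phi> \<and> (\<forall>t\<ge>0. \<phi> t \<ge> 0) \<and> (\<forall>t>0. \<phi> t > 0) \<and>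
        (\<forall>E F. nondegenerate_continuum m E \<longrightarrow> nondegenerate_continuum m F \<longrightarrow> E \<inter> F = {} \<longrightarrow>
           ennreal (\<phi> (inverse (relative_distance m E F))) \<le> modulus m Q (curves_between m E F)))"

definition loewner_space :: "'a metric \<Rightarrow> bool" where
  "loewner_space m \<longleftrightarrow> (\<exists>Q. Q_loewner Q m)"


section \<open>Discrete modulus and the combinatorial Loewner property\<close>

text \<open>A graph is a pair of a vertex set and a set of edges. The value of \<open>G\<close> at 0 is irrelevant:
  approximations are indexed by \<open>{1,2,...}\<close>.\<close>

definition alpha_approximation ::
    "'a metric \<Rightarrow> real \<Rightarrow> real \<Rightarrow> (nat \<Rightarrow> 'a set set \<times> 'a set set set) \<Rightarrow> bool" where
  "alpha_approximation m \<alpha> L G \<longleftrightarrow>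
     (\<forall>k\<ge>1. finite (fst (G k)) \<and> \<Union> (fst (G k)) = mspace m \<and>
        snd (G k) = {{v, u} | v u. v \<in> fst (G k) \<and> u \<in> fst (G k) \<and> v \<noteq> u \<and> v \<inter> u \<noteq> {}} \<and>
        (\<exists>z. (\<forall>v\<in>fst (G k). z v \<in> v \<and>
                 mball_of m (z v) (inverse \<alpha> * inverse L ^ k) \<subseteq> v \<and>
                 v \<subseteq> mball_of m (z v) (\<alpha> * inverse L ^ k)) \<and>
             (\<forall>v\<in>fst (G k). \<forall>u\<in>fst (G k). v \<noteq> u \<longrightarrow>
                 mball_of m (z v) (inverse \<alpha> * inverse L ^ k) \<inter>
                 mball_of m (z u) (inverse \<alpha> * inverse L ^ k) = {})))"

definition discrete_modulus ::
    "real \<Rightarrow> (real \<Rightarrow> 'a) set \<Rightarrow> 'a set set \<times> 'a set set set \<Rightarrow> ennreal" where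
  "discrete_modulus p \<Gamma> G =
     (INF \<rho>\<in>{\<rho> :: 'a set \<Rightarrow> real. (\<forall>v\<in>fst G. \<rho> v \<ge> 0) \<and>
               (\<forall>\<gamma>\<in>\<Gamma>. (\<Sum>v\<in>{v \<in> fst G. v \<inter> \<gamma> ` {0..1} \<noteq> {}}. \<rho> v) \<ge> 1)}.
        ennreal (\<Sum>v\<in>fst G. \<rho> v powr p))"

definition combinatorial_loewner :: "real \<Rightarrow> 'a metric \<Rightarrow> bool" where
  "combinatorial_loewner Q m \<longleftrightarrow>
     1 < Q \<and> compact_space (mtopology_of m) \<and>
     (\<exists>\<alpha> L G. 1 < \<alpha> \<and> 1 < L \<and> alpha_approximation m \<alpha> L G \<and>
       (\<exists>\<phi> \<psi> :: real \<Rightarrow> real.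
          mono_on {0<..} \<phi> \<and> (\<forall>t>0. \<phi> t > 0) \<and>
          mono_on {0<..<1} \<psi> \<and> (\<forall>t\<in>{0<..<1}. \<psi> t > 0) \<and> (\<psi> \<longlongrightarrow> 0) (at_right 0) \<and>
          (\<forall>E F. \<forall>n\<ge>1. nondegenerate_continuum m E \<longrightarrow> nondegenerate_continuum m F \<longrightarrow>
             E \<inter> F = {} \<longrightarrow> ennreal (inverse L ^ n) \<le> min (mdiam m E) (mdiam m F) \<longrightarrow>
             (\<forall>k\<ge>1. ennreal (\<phi> (inverse (relative_distance m E F)))
                     \<le> discrete_modulus Q (curves_between m E F) (G (n + k)))) \<and>
          (\<forall>x\<in>mspace m. \<forall>r C. \<forall>n\<ge>1. inverse L ^ n \<le> r \<longrightarrow> 1 < C \<longrightarrow>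
             (\<forall>k\<ge>1. discrete_modulus Q
                       (curves_between m (mtopology_of m closure_of mball_of m x r)
                          (mspace m - mball_of m x (C * r))) (G (n + k))
                     \<le> ennreal (\<psi> (inverse C))))))"


section \<open>Iterated graph systems\<close>

record ('v, 'i) igs =
  igs_verts :: "'v set"
  igs_edges :: "'v set set"
  igs_labels :: "'i set"
  igs_phi :: "'v \<Rightarrow> 'v set \<Rightarrow> 'i \<Rightarrow> 'v"  \<comment> \<open>\<open>igs_phi S v e\<close> is relevant for \<open>v \<in> e \<in> igs_edges S\<close>\<close>

definition iterated_graph_system :: "('v, 'i) igs \<Rightarrow> bool" where
  "iterated_graph_system S \<longleftrightarrow>
     finite (igs_verts S) \<and> igs_verts S \<noteq> {} \<and>
     (\<forall>e\<in>igs_edges S. e \<subseteq> igs_verts S \<and> card e = 2) \<and>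
     (\<forall>x\<in>igs_verts S. \<forall>y\<in>igs_verts S. (x, y) \<in> {(u, v). {u, v} \<in> igs_edges S}\<^sup>*) \<and>
     finite (igs_labels S) \<and> igs_labels S \<noteq> {} \<and>
     (\<forall>e\<in>igs_edges S. \<forall>v\<in>e.
        inj_on (igs_phi S v e) (igs_labels S) \<and>
        igs_phi S v e ` igs_labels S \<subseteq> igs_verts S \<and>
        (\<forall>e'\<in>igs_edges S. \<not> e' \<subseteq> igs_phi S v e ` igs_labels S) \<and>
        (\<forall>w\<in>e. w \<noteq> v \<longrightarrow> igs_phi S v e ` igs_labels S \<inter> igs_phi S w e ` igs_labels S = {}))"

text \<open>
  The vertices of all the graphs \<open>G\<^sub>n\<close> live in one type: a vertex of \<open>G\<^sub>1\<close> is \<open>Base v\<close>, and a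
  vertex \<open>[z,e]\<close> of \<open>G\<^bsub>n+1\<^esub>\<close> is its own equivalence class, a finite set of pairs of a vertex of
  \<open>G\<^sub>1\<close> and an edge of \<open>G\<^sub>n\<close>. Edges of \<open>G\<^sub>n\<close> are two-element finite sets.
\<close>

datatype 'v vtx = Base (base: 'v) | Glued "('v \<times> 'v vtx fset) fset"

record ('v, 'i) level =
  lv_verts :: "'v vtx set"
  lv_edges :: "'v vtx fset set"
  lv_phi :: "'v vtx \<Rightarrow> 'v vtx fset \<Rightarrow> 'i \<Rightarrow> 'v"

definition glue_rel ::
    "('v, 'i) igs \<Rightarrow> ('v, 'i) level \<Rightarrow> (('v \<times> 'v vtx fset) \<times> ('v \<times> 'v vtx fset)) set" where
  "glue_rel S G = {((lv_phi G x e c, e), (lv_phi G x f c, f)) | x e f c.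
     e \<in> lv_edges G \<and> f \<in> lv_edges G \<and> x |\<in>| e \<and> x |\<in>| f \<and> c \<in> igs_labels S}"

text \<open>\<open>glue_rel\<close> is symmetric, so its reflexive transitive closure is the generated equivalence
  relation; \<open>glue S G z e\<close> is the class \<open>[z,e]\<close>.\<close>

definition glue :: "('v, 'i) igs \<Rightarrow> ('v, 'i) level \<Rightarrow> 'v \<Rightarrow> 'v vtx fset \<Rightarrow> 'v vtx" where
  "glue S G z e = Glued (Abs_fset ((glue_rel S G)\<^sup>* `` {(z, e)}))"

definition next_level :: "('v, 'i) igs \<Rightarrow> ('v, 'i) level \<Rightarrow> ('v, 'i) level" where
  "next_level S G =
    \<lparr> lv_verts = {glue S G z e | z e. z \<in> igs_verts S \<and> e \<in> lv_edges G},
      lv_edges = {{|glue S G z\<^sub>1 e, glue S G z\<^sub>2 e|} | z\<^sub>1 z\<^sub>2 e. {z\<^sub>1, z\<^sub>2} \<in> igs_edges S \<and> e \<in> lv_edges G},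
      lv_phi = (\<lambda>x e'. THE g. \<exists>z\<^sub>1 z\<^sub>2 e. {z\<^sub>1, z\<^sub>2} \<in> igs_edges S \<and> e \<in> lv_edges G \<and>
                  x = glue S G z\<^sub>1 e \<and> e' = {|glue S G z\<^sub>1 e, glue S G z\<^sub>2 e|} \<and>
                  g = igs_phi S z\<^sub>1 {z\<^sub>1, z\<^sub>2}) \<rparr>"

text \<open>Levels are counted from 0: \<open>igs_level S k\<close> is the graph \<open>G\<^bsub>k+1\<^esub>\<close> with its maps \<open>\<phi>\<close>.\<close>

primrec igs_level :: "('v, 'i) igs \<Rightarrow> nat \<Rightarrow> ('v, 'i) level" where
  "igs_level S 0 =
    \<lparr> lv_verts = Base ` igs_verts S,
      lv_edges = (\<lambda>e. Abs_fset (Base ` e)) ` igs_edges S,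
      lv_phi = (\<lambda>x e. igs_phi S (base x) (base ` fset e)) \<rparr>"
| "igs_level S (Suc k) = next_level S (igs_level S k)"

definition igs_proj :: "('v, 'i) igs \<Rightarrow> nat \<Rightarrow> 'v vtx fset \<Rightarrow> 'v vtx fset" where
  "igs_proj S k e' = (THE e. e \<in> lv_edges (igs_level S k) \<and>
     (\<exists>z\<^sub>1 z\<^sub>2. {z\<^sub>1, z\<^sub>2} \<in> igs_edges S \<and>
        e' = {|glue S (igs_level S k) z\<^sub>1 e, glue S (igs_level S k) z\<^sub>2 e|}))"

definition path_dist :: "('v, 'i) level \<Rightarrow> 'v vtx \<Rightarrow> 'v vtx \<Rightarrow> nat" where
  "path_dist G x y = (LEAST n. (x, y) \<in> {(u, v). {|u, v|} \<in> lv_edges G} ^^ n)"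

definition level_dist :: "('v, 'i) igs \<Rightarrow> real \<Rightarrow> nat \<Rightarrow> 'v vtx \<Rightarrow> 'v vtx \<Rightarrow> real" where
  "level_dist S L k x y = inverse L ^ (k + 1) * real (path_dist (igs_level S k) x y)"

definition edge_dist :: "('v, 'i) igs \<Rightarrow> real \<Rightarrow> nat \<Rightarrow> 'v vtx fset \<Rightarrow> 'v vtx fset \<Rightarrow> real" where
  "edge_dist S L k e f = Min {level_dist S L k x y | x y. x |\<in>| e \<and> y |\<in>| f}"

definition igs_symbols :: "('v, 'i) igs \<Rightarrow> (nat \<Rightarrow> 'v vtx fset) set" where
  "igs_symbols S = {e. \<forall>k. e k \<in> lv_edges (igs_level S k) \<and> igs_proj S k (e (Suc k)) = e k}"

definition igs_equiv :: "('v, 'i) igs \<Rightarrow> ((nat \<Rightarrow> 'v vtx fset) \<times> (nat \<Rightarrow> 'v vtx fset)) set" where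
  "igs_equiv S = {(e, f). e \<in> igs_symbols S \<and> f \<in> igs_symbols S \<and> (\<forall>k. e k |\<inter>| f k \<noteq> {||})}"

definition igs_points :: "('v, 'i) igs \<Rightarrow> (nat \<Rightarrow> 'v vtx fset) set set" where
  "igs_points S = igs_symbols S // igs_equiv S"

text \<open>The limit is required to exist and to be the same for all representatives. Outside the
  carrier the distance is set to 0, since \<open>Metric_space\<close> asks for symmetry and nonnegativity on the
  whole type.\<close>

definition igs_dist ::
    "('v, 'i) igs \<Rightarrow> real \<Rightarrow> (nat \<Rightarrow> 'v vtx fset) set \<Rightarrow> (nat \<Rightarrow> 'v vtx fset) set \<Rightarrow> real" where
  "igs_dist S L x y =
     (if x \<in> igs_points S \<and> y \<in> igs_points S
      then THE l. \<forall>e\<in>x. \<forall>f\<in>y. (\<lambda>k. edge_dist S L k (e k) (f k)) \<longlonglongrightarrow> l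
      else 0)"

definition igs_limit :: "('v, 'i) igs \<Rightarrow> real \<Rightarrow> (nat \<Rightarrow> 'v vtx fset) set metric" where
  "igs_limit S L = metric (igs_points S, igs_dist S L)"


section \<open>The example\<close>

datatype label = Label_a | Label_b

primrec phi_minus :: "label \<Rightarrow> nat" where
  "phi_minus Label_a = 1"
| "phi_minus Label_b = 2"

primrec phi_plus :: "label \<Rightarrow> nat" where
  "phi_plus Label_a = 7"
| "phi_plus Label_b = 8"

definition example_igs :: "(nat, label) igs" where
  "example_igs =
    \<lparr> igs_verts = {1..8},
      igs_edges = {{1,3}, {3,4}, {4,6}, {6,7}, {2,3}, {3,5}, {5,6}, {6,8}, {4,5}},
      igs_labels = {Label_a, Label_b},
      igs_phi = (\<lambda>v e. if \<exists>w\<in>e. v < w then phi_minus else phi_plus) \<rparr>"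

lemma iterated_graph_system_example: "iterated_graph_system example_igs"
proof -
  let ?R = "{(u, v). {u, v} \<in> igs_edges example_igs}"
  have symR: "sym ?R"
    by (auto simp: sym_def insert_commute)
  have E: "(3,1) \<in> ?R" "(3,2) \<in> ?R" "(3,4) \<in> ?R" "(3,5) \<in> ?R" "(4,6) \<in> ?R" "(6,7) \<in> ?R" "(6,8) \<in> ?R"
    by (auto simp: example_igs_def doubleton_eq_iff)
  have 3: "(3, x) \<in> ?R\<^sup>*" if "x \<in> {1..8}" for x
  proof -
    have "x \<in> {1,2,3,4,5,6,7,8}"
      using that by auto
    moreover have "(3,4) \<in> ?R\<^sup>*"
      using E by (blast intro: r_into_rtrancl)
    moreover from this have 6: "(3,6) \<in> ?R\<^sup>*"
      using E(5) by (rule rtrancl_into_rtrancl)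
    moreover have "(3,7) \<in> ?R\<^sup>*" "(3,8) \<in> ?R\<^sup>*"
      using 6 E(6,7) by (blast intro: rtrancl_into_rtrancl)+
    ultimately show ?thesis
      using E(1-4) by (blast intro: r_into_rtrancl)
  qed
  have "(x, y) \<in> ?R\<^sup>*" if "x \<in> {1..8}" "y \<in> {1..8}" for x y
    using 3[OF that(1)] 3[OF that(2)] sym_rtrancl[OF symR] by (meson rtrancl_trans symD)
  then show ?thesis
    unfolding iterated_graph_system_def
    by (auto simp: example_igs_def inj_on_def)
qed

end

theory Submission
  imports Defs
begin

text \<open>
  Cells of the limit space are coded by words in the nine edges of the first graph. A function on the
  vertices of one level extends linearly to the next one, with slope \<open>1/4\<close> across every edge except
  \<open>{4,5}\<close>, across which the extension is constant; conversely averaging over the two children of every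
  vertex contracts the \<open>3/2\<close>-energy, because it ignores the edge \<open>{4,5}\<close> and the other eight edges satisfy
  \<open>8 * (1/4) powr (3/2) = 1\<close>. The two operations give matching upper and lower bounds for the
  \<open>3/2\<close>-modulus, hence the combinatorial Loewner property, and the contraction also shows that no
  Ahlfors regular metric in the gauge has exponent below \<open>3/2\<close>. Giving the edge \<open>{4,5}\<close> a small weight \<open>d\<close>
  instead of \<open>1/4\<close> produces quasisymmetric metrics of dimension \<open>Q\<close> with \<open>8 * (1/4) powr Q + d powr Q = 1\<close>,
  and \<open>Q\<close> tends to \<open>3/2\<close> as \<open>d\<close> tends to 0. The exponent \<open>3/2\<close> itself is not attained: the sum of the
  \<open>3/2\<close>-th powers of the diameters of the level-\<open>n\<close> cells avoiding \<open>{4,5}\<close> is bounded below for every \<open>n\<close>, but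
  each of these cells contains a comparable subcell over \<open>{4,5}\<close>, and all these subcells are disjoint, so
  that in a \<open>3/2\<close>-regular metric the sums would be summable over \<open>n\<close>. A Loewner image of exponent \<open>Q\<close> is
  excluded in the same way if \<open>Q \<le> 3/2\<close>; if \<open>Q > 3/2\<close>, a weight \<open>d\<close> with exponent below \<open>Q\<close> gives test functions
  for which the \<open>Q\<close>-modulus of the curves joining two opposite cells vanishes.
\<close>

section \<open>Words and vertices\<close>

text \<open>A path distance is the supremum of differences of potentials whose increment across each
  edge is at most its weight, and all metrics below are limits of distances in this dual form
  (\<open>Dn\<close>). No path is then followed through the levels: potentials are pushed down by
  \<open>lin_ext\<close> and pulled back by reading off one label, and the errors form geometric
  series. The extension has increment 0 across {4,5}, so it stays admissible for every weight
  \<open>d > 0\<close>.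

  Since 4 and 5 are inner vertices, two adjacent cells can differ in weight through one pair of
  letters only, so their weights are comparable up to the factor \<open>4 * d\<close> at all levels
  (\<open>wt_vert\<close>). Which codes describe the same point depends on adjacency alone. Hence
  all weighted metrics live on one set with the same cells, and comparing two of them reduces to
  comparing weights along a single code.

  The averaging estimate rests on the edge-disjoint paths 1-3-4-6-7 and 2-3-5-6-8, which use every
  edge except {4,5} once. Eight edges in paths of length 4 single out the exponent, by 4 powr (3/2)
  = 8.\<close>

datatype ltr = L13 | L23 | L34 | L35 | L45 | L46 | L56 | L67 | L68

lemma UNIV_ltr: "(UNIV :: ltr set) = {L13, L23, L34, L35, L45, L46, L56, L67, L68}"
  by (auto intro: ltr.exhaust)

instance ltr :: finite
  by standard (simp add: UNIV_ltr)

primrec lo :: "ltr \<Rightarrow> nat" where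
  "lo L13 = 1" | "lo L23 = 2" | "lo L34 = 3" | "lo L35 = 3" | "lo L45 = 4"
| "lo L46 = 4" | "lo L56 = 5" | "lo L67 = 6" | "lo L68 = 6"

primrec hi :: "ltr \<Rightarrow> nat" where
  "hi L13 = 3" | "hi L23 = 3" | "hi L34 = 4" | "hi L35 = 5" | "hi L45 = 5"
| "hi L46 = 6" | "hi L56 = 6" | "hi L67 = 7" | "hi L68 = 8"

definition num :: "ltr \<Rightarrow> bool \<Rightarrow> nat" where
  "num f s = (if s then hi f else lo f)"

text \<open>\<open>Some False\<close> stands for label a and \<open>Some True\<close> for label b;
  \<open>None\<close> marks the inner vertices 3, 4, 5, 6. The vertices 1, 2 occur only as lower
  ends and 7, 8 only as upper ends, so a boundary end \<open>s\<close> of a child is always glued to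
  the end \<open>s\<close> of its parent; \<open>vert\<close> relies on this.\<close>

definition outl :: "ltr \<Rightarrow> bool \<Rightarrow> bool option" where
  "outl f s = (if num f s = 1 \<or> num f s = 7 then Some False
     else if num f s = 2 \<or> num f s = 8 then Some True else None)"

text \<open>
  An edge of level \<open>n\<close> is a word of length \<open>n\<close>, the head being the letter chosen last; the single edge of
  level 0 is replaced by \<open>G\<^sub>1\<close> at level 1. The ends of the edge \<open>w\<close> are \<open>vert w False\<close> and \<open>vert w True\<close>.
  A vertex is either an end of the edge of level 0, or the copy with label \<open>c\<close> (\<open>False\<close> for \<open>a\<close>,
  \<open>True\<close> for \<open>b\<close>) of an older vertex, or one of the vertices 3, 4, 5, 6 of the graph replacing the edge \<open>w\<close>.
\<close>

datatype cv = Root bool | Ch cv bool | New "ltr list" nat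

primrec vert :: "ltr list \<Rightarrow> bool \<Rightarrow> cv" where
  "vert [] s = Root s"
| "vert (f # w) s = (case outl f s of Some c \<Rightarrow> Ch (vert w s) c | None \<Rightarrow> New w (num f s))"

definition adj :: "ltr list \<Rightarrow> ltr list \<Rightarrow> bool" where
  "adj w w' \<longleftrightarrow> (\<exists>s s'. vert w s = vert w' s')"

lemma adj_refl [simp]: "adj w w"
  by (auto simp: adj_def)

lemma adj_sym: "adj w w' \<Longrightarrow> adj w' w"
  unfolding adj_def by metis

lemma vert_simps [simp]:
  "vert (L13 # w) False = Ch (vert w False) False" "vert (L13 # w) True = New w 3"
  "vert (L23 # w) False = Ch (vert w False) True" "vert (L23 # w) True = New w 3"
  "vert (L34 # w) False = New w 3" "vert (L34 # w) True = New w 4"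
  "vert (L35 # w) False = New w 3" "vert (L35 # w) True = New w 5"
  "vert (L45 # w) False = New w 4" "vert (L45 # w) True = New w 5"
  "vert (L46 # w) False = New w 4" "vert (L46 # w) True = New w 6"
  "vert (L56 # w) False = New w 5" "vert (L56 # w) True = New w 6"
  "vert (L67 # w) False = New w 6" "vert (L67 # w) True = Ch (vert w True) False"
  "vert (L68 # w) False = New w 6" "vert (L68 # w) True = Ch (vert w True) True"
  by (simp_all add: outl_def num_def)

lemmas vert_Cons = vert.simps(2)
declare vert_Cons [simp del]

lemma vert_neq: "vert w False \<noteq> vert w True"
proof (cases w)
  case (Cons f w')
  then show ?thesis by (cases f) simp_all
qed simp

lemma vert_inj [simp]: "vert w s = vert w s' \<longleftrightarrow> s = s'"
  using vert_neq[of w] by (cases s; cases s') auto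

text \<open>There are no multiple edges. Every edge of the first graph has an end among 3, 4, 5, 6,
  and such a vertex \<open>New v z\<close> remembers its parent word; once the parents agree, the
  letters are told apart by their pairs of ends.\<close>

lemma vert_pair_inj:
  assumes "{vert w False, vert w True} = {vert w' False, vert w' True}" "length w = length w'"
  shows "w = w'"
proof (cases w)
  case Nil
  then show ?thesis using assms by simp
next
  case (Cons f v)
  then obtain g v' where w': "w' = g # v'" using assms by (cases w') auto
  have *: "\<exists>s z. vert (f # v) s = New v z" by (cases f) (auto intro: exI[of _ True] exI[of _ False])
  have **: "v = v'"
  proof -
    obtain s z where "vert (f # v) s = New v z" using * by blast
    then have "New v z \<in> {vert w' False, vert w' True}" using assms Cons by (cases s) auto
    then show ?thesis unfolding w' by (cases g) auto
  qed
  then show ?thesis using assms(1) Cons w' vert_neq[of v]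
    by (cases f; cases g) (auto simp: doubleton_eq_iff)
qed

lemma vert_sign:
  assumes "vert (f # w) s = vert (g # w') s'" 
  shows "(\<exists>c. outl f s = Some c \<and> outl g s' = Some c \<and> vert w s = vert w' s') \<or>
     (outl f s = None \<and> outl g s' = None \<and> w = w' \<and> num f s = num g s')"
  using assms by (auto simp: vert_Cons split: option.splits)

lemma outl_unique: "outl f s = Some c \<Longrightarrow> outl g s = Some c \<Longrightarrow> f = g"
  by (cases f; cases g; cases s; auto simp: outl_def num_def)

lemma adj_Cons: "adj (f # w) (g # w') \<Longrightarrow> adj w w'"
  unfolding adj_def using vert_sign by blast

lemma adj_append:
  assumes "adj (v @ w) (v' @ w')" "length v = length v'" shows "adj w w'"
  using assms(2,1) by (induction v v' rule: list_induct2) (auto dest: adj_Cons)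

lemma vert_append_eq_iff:
  assumes "length v = length v'"
  shows "vert (v @ w) s = vert (v' @ w) s' \<longleftrightarrow> vert v s = vert v' s'"
  using assms
proof (induction v v' arbitrary: s s' rule: list_induct2)
  case (Cons f v g v')
  then show ?case by (auto simp: vert_Cons split: option.splits)
qed simp

lemma adj_append_iff:
  assumes "length v = length v'"
  shows "adj (v @ w) (v' @ w) \<longleftrightarrow> adj v v'"
  unfolding adj_def vert_append_eq_iff[OF assms] ..

definition words :: "nat \<Rightarrow> ltr list set" where
  "words n = {w. length w = n}"

lemma finite_words [simp]: "finite (words n)"
proof -
  have "words n = {w. set w \<subseteq> UNIV \<and> length w = n}" by (auto simp: words_def)
  then show ?thesis using finite_lists_length_eq[of "UNIV::ltr set" n] by simp
qed

lemma words_0 [simp]: "words 0 = {[]}"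
  by (auto simp: words_def)

lemma words_Suc: "words (Suc n) = (\<lambda>(f, w). f # w) ` (UNIV \<times> words n)"
  by (auto simp: words_def length_Suc_conv image_iff)

lemma sum_words_Suc:
  fixes h :: "ltr list \<Rightarrow> 'b :: comm_monoid_add"
  shows "(\<Sum>w\<in>words (Suc n). h w) = (\<Sum>w\<in>words n. \<Sum>f\<in>UNIV. h (f # w))"
proof -
  have "(\<Sum>w\<in>words (Suc n). h w) = (\<Sum>p\<in>UNIV \<times> words n. h (fst p # snd p))"
    unfolding words_Suc by (subst sum.reindex) (auto simp: inj_on_def case_prod_beta)
  also have "\<dots> = (\<Sum>f\<in>UNIV. \<Sum>w\<in>words n. h (f # w))"
    by (simp add: sum.cartesian_product case_prod_beta)
  finally show ?thesis by (simp add: sum.swap[of _ "words n"])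
qed

lemma sum_ltr: "(\<Sum>f\<in>UNIV. h f) = (h L13 + h L23 + h L34 + h L35 + h L45 + h L46 + h L56 + h L67 + h L68 :: 'b :: comm_monoid_add)"
  unfolding UNIV_ltr by (simp add: add.assoc)

section \<open>Vertex degrees and stars of cells\<close>

definition inc :: "cv \<Rightarrow> (ltr list \<times> bool) set" where
  "inc v = {(w, s). vert w s = v}"

lemma inc_New: "inc (New w z) \<subseteq> (\<lambda>(f, s). (f # w, s)) ` {(f, s). outl f s = None \<and> num f s = z}"
proof
  fix p assume "p \<in> inc (New w z)"
  then obtain v s where p: "p = (v, s)" "vert v s = New w z" by (auto simp: inc_def)
  then obtain f v' where v: "v = f # v'" by (cases v) auto
  then show "p \<in> (\<lambda>(f, s). (f # w, s)) ` {(f, s). outl f s = None \<and> num f s = z}"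
    using p by (auto simp: vert_Cons split: option.splits)
qed

lemma card_inner: "card {(f, s). outl f s = None \<and> num f s = z} \<le> 4"
proof -
  consider "z = 3" | "z = 4" | "z = 5" | "z = 6" | "z \<notin> {3,4,5,6}" by auto
  then show ?thesis
  proof cases
    case 1
    have "{(f, s). outl f s = None \<and> num f s = z} \<subseteq> set [(L13,True),(L23,True),(L34,False),(L35,False)]"
    proof clarify
      fix f s assume "outl f s = None" "z = num f s"
      then show "(f, s) \<in> set [(L13,True),(L23,True),(L34,False),(L35,False)]"
        using 1 by (cases f; cases s; simp add: num_def)
    qed
    from card_mono[OF _ this] show ?thesis by simp
  next
    case 2
    have "{(f, s). outl f s = None \<and> num f s = z} \<subseteq> set [(L34,True),(L45,False),(L46,False)]"
    proof clarify
      fix f s assume "outl f s = None" "z = num f s"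
      then show "(f, s) \<in> set [(L34,True),(L45,False),(L46,False)]"
        using 2 by (cases f; cases s; simp add: num_def)
    qed
    from card_mono[OF _ this] show ?thesis by simp
  next
    case 3
    have "{(f, s). outl f s = None \<and> num f s = z} \<subseteq> set [(L35,True),(L45,True),(L56,False)]"
    proof clarify
      fix f s assume "outl f s = None" "z = num f s"
      then show "(f, s) \<in> set [(L35,True),(L45,True),(L56,False)]"
        using 3 by (cases f; cases s; simp add: num_def)
    qed
    from card_mono[OF _ this] show ?thesis by simp
  next
    case 4
    have "{(f, s). outl f s = None \<and> num f s = z} \<subseteq> set [(L46,True),(L56,True),(L67,False),(L68,False)]"
    proof clarify
      fix f s assume "outl f s = None" "z = num f s"
      then show "(f, s) \<in> set [(L46,True),(L56,True),(L67,False),(L68,False)]"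
        using 4 by (cases f; cases s; simp add: num_def)
    qed
    from card_mono[OF _ this] show ?thesis by simp
  next
    case 5
    have *: "False" if "outl f s = None" "num f s = z" for f s
      using that 5 by (cases f; cases s; simp add: num_def outl_def)
    have "{(f, s). outl f s = None \<and> num f s = z} = {}"
      using * by auto
    then show ?thesis by (metis card.empty zero_le)
  qed
qed

text \<open>Degrees do not grow with the level: for each side at most one letter carries a given
  label, so the copy \<open>Ch v c\<close> has at most the degree of \<open>v\<close>, and the
  vertices 3, 4, 5, 6 have degree at most 4 in the first graph.\<close>

lemma inc_card: "finite (inc v) \<and> card (inc v) \<le> 4"
proof (induction v)
  case (Root b)
  have "vert w s = Root b \<longleftrightarrow> w = [] \<and> s = b" for w s
    by (cases w) (auto simp: vert_Cons split: option.splits)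
  then have "inc (Root b) = {([], b)}" by (auto simp: inc_def)
  then show ?case by simp
next
  case (Ch v c)
  have *: "inc (Ch v c) \<subseteq> (\<lambda>(w, s). ((THE f. outl f s = Some c) # w, s)) ` inc v"
  proof
    fix p assume "p \<in> inc (Ch v c)"
    then obtain w' s where p: "p = (w', s)" "vert w' s = Ch v c" by (auto simp: inc_def)
    then obtain f w where w: "w' = f # w" by (cases w') auto
    then have a: "outl f s = Some c" "vert w s = v" using p by (auto simp: vert_Cons split: option.splits)
    then have "(THE f. outl f s = Some c) = f" using outl_unique by blast
    with a p w show "p \<in> (\<lambda>(w, s). ((THE f. outl f s = Some c) # w, s)) ` inc v"
      by (force simp: inc_def image_iff)
  qed
  then show ?case using Ch
    by (meson card_image_le card_mono finite_imageI finite_subset le_trans)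
next
  case (New w z)
  have f: "finite {(f :: ltr, s :: bool). outl f s = None \<and> num f s = z}" by simp
  have "card (inc (New w z)) \<le> card ((\<lambda>(f, s). (f # w, s)) ` {(f, s). outl f s = None \<and> num f s = z})"
    by (rule card_mono[OF _ inc_New]) (use f in blast)
  also have "\<dots> \<le> 4" using card_image_le[OF f] card_inner le_trans by blast
  finally show ?case using finite_subset[OF inc_New] f by blast
qed

definition star :: "ltr list \<Rightarrow> ltr list set" where
  "star w = {w'. length w' = length w \<and> adj w w'}"

lemma star_card: "finite (star w)" "card (star w) \<le> 8"
proof -
  have *: "star w \<subseteq> fst ` inc (vert w False) \<union> fst ` inc (vert w True)"
  proof
    fix w' assume "w' \<in> star w"
    then obtain s s' where "vert w s = vert w' s'" by (auto simp: star_def adj_def)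
    then have "(w', s') \<in> inc (vert w s)" by (auto simp: inc_def)
    then show "w' \<in> fst ` inc (vert w False) \<union> fst ` inc (vert w True)"
      by (cases s) (auto simp: rev_image_eqI)
  qed
  have f: "finite (fst ` inc (vert w False) \<union> fst ` inc (vert w True))" using inc_card by blast
  show "finite (star w)" using finite_subset[OF * f] .
  have "card (star w) \<le> card (fst ` inc (vert w False) \<union> fst ` inc (vert w True))" 
    by (rule card_mono[OF f *])
  also have "\<dots> \<le> card (fst ` inc (vert w False)) + card (fst ` inc (vert w True))"
    by (rule card_Un_le)
  also have "\<dots> \<le> 4 + 4" using inc_card card_image_le by (meson add_mono le_trans)
  finally show "card (star w) \<le> 8" by simp
qed

lemma star_self [simp]: "w \<in> star w" by (simp add: star_def)

section \<open>Infinite codes and their prefixes\<close>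

primrec pre :: "(nat \<Rightarrow> ltr) \<Rightarrow> nat \<Rightarrow> ltr list" where
  "pre \<omega> 0 = []"
| "pre \<omega> (Suc n) = \<omega> n # pre \<omega> n"

lemma length_pre [simp]: "length (pre \<omega> n) = n"
  by (induction n) auto

lemma pre_eq_iff: "pre \<omega> n = pre \<omega>' n \<longleftrightarrow> (\<forall>i<n. \<omega> i = \<omega>' i)"
  by (induction n) (auto simp: less_Suc_eq)

text \<open>Words grow at the head, so the code has to be assembled from the far end: the first
  \<open>length w\<close> letters of \<open>ext w \<tau>\<close> spell \<open>w\<close>, oldest
  letter first, and the later ones are those of \<open>\<tau>\<close>.\<close>

primrec ext :: "ltr list \<Rightarrow> (nat \<Rightarrow> ltr) \<Rightarrow> nat \<Rightarrow> ltr" where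
  "ext [] \<tau> = \<tau>"
| "ext (f # w) \<tau> = ext w (\<lambda>n. case n of 0 \<Rightarrow> f | Suc k \<Rightarrow> \<tau> k)"

lemma pre_case: "pre (\<lambda>n. case n of 0 \<Rightarrow> f | Suc k \<Rightarrow> \<tau> k) (Suc k) = pre \<tau> k @ [f]"
  by (induction k) auto

lemma pre_ext: "pre (ext w \<tau>) (length w + k) = pre \<tau> k @ w"
proof (induction w arbitrary: \<tau> k)
  case (Cons f w)
  have "pre (ext (f # w) \<tau>) (length (f # w) + k) = pre (ext w (\<lambda>n. case n of 0 \<Rightarrow> f | Suc k \<Rightarrow> \<tau> k)) (length w + Suc k)"
    by simp
  also have "\<dots> = pre (\<lambda>n. case n of 0 \<Rightarrow> f | Suc k \<Rightarrow> \<tau> k) (Suc k) @ w"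
    by (rule Cons.IH)
  finally show ?case by (simp only: pre_case) simp
qed simp

lemma pre_ext_len [simp]: "pre (ext w \<tau>) (length w) = w"
  using pre_ext[of w \<tau> 0] by simp

lemma pre_add: "pre \<omega> (n + k) = pre (\<lambda>i. \<omega> (n + i)) k @ pre \<omega> n"
  by (induction k) auto

lemma ext_pre: "ext (pre \<omega> n) (\<lambda>i. \<omega> (n + i)) = \<omega>"
proof
  fix i
  have "pre (ext (pre \<omega> n) (\<lambda>i. \<omega> (n + i))) (n + Suc i) = pre \<omega> (n + Suc i)"
    using pre_ext[of "pre \<omega> n" "\<lambda>i. \<omega> (n + i)" "Suc i"] pre_add[of \<omega> n "Suc i"] by simp
  then show "ext (pre \<omega> n) (\<lambda>i. \<omega> (n + i)) i = \<omega> i"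
    unfolding pre_eq_iff by simp
qed

lemma pre_drop: "n \<le> m \<Longrightarrow> \<exists>v. pre \<omega> m = v @ pre \<omega> n \<and> length v = m - n"
  using pre_add[of \<omega> n "m - n"] by auto

lemma adj_pre_mono: "adj (pre \<omega> m) (pre \<omega>' m) \<Longrightarrow> n \<le> m \<Longrightarrow> adj (pre \<omega> n) (pre \<omega>' n)"
  using pre_drop[of n m \<omega>] pre_drop[of n m \<omega>'] adj_append by fastforce

section \<open>Weights, potentials and distances\<close>

definition sc :: "real \<Rightarrow> ltr \<Rightarrow> real" where
  "sc d f = (if f = L45 then d else 1/4)"

primrec wt :: "real \<Rightarrow> ltr list \<Rightarrow> real" where
  "wt d [] = 1"
| "wt d (f # w) = sc d f * wt d w"

lemma wt_quarter: "wt (1/4) w = (1/4) ^ length w"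
  by (induction w) (auto simp: sc_def)

definition gr :: "(cv \<Rightarrow> real) \<Rightarrow> ltr list \<Rightarrow> real" where
  "gr u w = u (vert w True) - u (vert w False)"

definition kap :: "ltr \<Rightarrow> real" where
  "kap f = (if f = L45 then 0 else 1/4)"

text \<open>The graph distance to the lower side {1,2}, divided by 4. That 4 and 5 have the same
  height makes the extension flat across {4,5}.\<close>

definition hgt :: "nat \<Rightarrow> real" where
  "hgt z = (if z = 3 then 1/4 else if z = 6 then 3/4 else 1/2)"

definition lin_ext :: "(cv \<Rightarrow> real) \<Rightarrow> cv \<Rightarrow> real" where
  "lin_ext u v = (case v of Ch v' c \<Rightarrow> u v' | New w z \<Rightarrow> u (vert w False) + hgt z * gr u w | Root b \<Rightarrow> 0)"

lemma lin_ext_simps [simp]: "lin_ext u (Ch v c) = u v" "lin_ext u (New w z) = u (vert w False) + hgt z * gr u w"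
  by (simp_all add: lin_ext_def)

lemma gr_lin_ext: "gr (lin_ext u) (f # w) = kap f * gr u w"
  by (cases f) (simp_all add: gr_def kap_def hgt_def algebra_simps)

lemma lin_ext_const: "gr u w = 0 \<Longrightarrow> lin_ext u (vert (f # w) s) = u (vert w False)"
  by (cases f; cases s) (simp_all add: gr_def)

lemma gr_lin_ext_pow0:
  assumes "gr u w = 0" shows "gr ((lin_ext ^^ length v) u) (v @ w) = 0"
  using assms by (induction v) (simp_all add: gr_lin_ext)

lemma lin_ext_pow_const:
  assumes "gr u w = 0"
  shows "(lin_ext ^^ length v) u (vert (v @ w) s) = u (vert w False)"
proof (induction v arbitrary: s)
  case Nil
  then show ?case using assms by (cases s) (auto simp: gr_def)
next
  case (Cons f v)
  then show ?case using lin_ext_const[OF gr_lin_ext_pow0[OF assms]] by simp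
qed

section \<open>Distances as suprema over potentials\<close>

definition Lip :: "real \<Rightarrow> nat \<Rightarrow> (cv \<Rightarrow> real) \<Rightarrow> bool" where
  "Lip d n u \<longleftrightarrow> (\<forall>w. length w = n \<longrightarrow> \<bar>gr u w\<bar> \<le> wt d w)"

lemma LipI: "(\<And>w. length w = n \<Longrightarrow> \<bar>gr u w\<bar> \<le> wt d w) \<Longrightarrow> Lip d n u"
  by (simp add: Lip_def)

lemma LipD: "Lip d n u \<Longrightarrow> length w = n \<Longrightarrow> \<bar>gr u w\<bar> \<le> wt d w"
  by (simp add: Lip_def)

text \<open>For \<open>d = 1/4\<close> this is the rescaled path metric of level \<open>n\<close>,
  as \<open>level_dist_Dn\<close> shows.\<close>

definition Dn :: "real \<Rightarrow> nat \<Rightarrow> cv \<Rightarrow> cv \<Rightarrow> real" where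
  "Dn d n v v' = (SUP u\<in>{u. Lip d n u}. u v - u v')"

definition dd :: "real \<Rightarrow> (nat \<Rightarrow> ltr) \<Rightarrow> (nat \<Rightarrow> ltr) \<Rightarrow> real" where
  "dd d \<omega> \<omega>' = lim (\<lambda>n. Dn d n (vert (pre \<omega> n) False) (vert (pre \<omega>' n) False))"

lemma Lip_0: "0 < d \<Longrightarrow> Lip d n (\<lambda>_. 0)"
proof -
  assume d: "0 < d"
  have "0 \<le> wt d w" for w using d by (induction w) (auto simp: sc_def)
  then show ?thesis by (simp add: Lip_def gr_def)
qed

context
  fixes d :: real
  assumes d: "0 < d" "d \<le> 1/4"
begin

lemma sc_bounds: "0 < sc d f" "sc d f \<le> 1/4" "d \<le> sc d f"
  using d by (auto simp: sc_def)

lemma wt_pos: "0 < wt d w"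
  by (induction w) (auto intro!: mult_pos_pos sc_bounds)

lemma wt_append_le: "wt d (v @ w) \<le> (1/4) ^ length v * wt d w"
proof (induction v)
  case (Cons f v)
  have "sc d f * wt d (v @ w) \<le> 1/4 * ((1/4) ^ length v * wt d w)"
    by (intro mult_mono Cons sc_bounds) (use wt_pos less_imp_le in auto)
  then show ?case by simp
qed simp

lemma wt_le: "wt d w \<le> (1/4) ^ length w"
  using wt_append_le[of w "[]"] by simp

lemma wt_append_ge: "d ^ length v * wt d w \<le> wt d (v @ w)"
proof (induction v)
  case (Cons f v)
  have "d * (d ^ length v * wt d w) \<le> sc d f * wt d (v @ w)"
    by (intro mult_mono Cons sc_bounds) (use wt_pos[of w] sc_bounds[of f] d in \<open>auto intro: mult_nonneg_nonneg less_imp_le\<close>)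
  then show ?case by simp
qed simp

lemma wt_pre_le: "wt d (pre \<omega> (n + k)) \<le> (1/4) ^ k * wt d (pre \<omega> n)"
  using wt_append_le[of "pre (\<lambda>i. \<omega> (n + i)) k" "pre \<omega> n"] by (simp add: pre_add)

lemma wt_pre_ge: "d ^ k * wt d (pre \<omega> n) \<le> wt d (pre \<omega> (n + k))"
  using wt_append_ge[of "pre (\<lambda>i. \<omega> (n + i)) k" "pre \<omega> n"] by (simp add: pre_add)

text \<open>As long as the shared vertex is a copy of an older one, both letters lie on the boundary
  and carry the weight 1/4, which changes both weights by the same factor. When the vertex is inner,
  the parents coincide, and a single pair of letters with weights between \<open>d\<close> and 1/4
  costs the factor \<open>4 * d\<close>.\<close>

lemma wt_vert:
  assumes "length w = length w'" "vert w s = vert w' s'"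
  shows "4 * d * wt d w' \<le> wt d w"
  using assms
proof (induction w w' arbitrary: s s' rule: list_induct2)
  case Nil
  then show ?case using d by simp
next
  case (Cons f w g w')
  from vert_sign[OF Cons.prems] consider
      c where "outl f s = Some c" "outl g s' = Some c" "vert w s = vert w' s'"
    | "w = w'" by auto
  then show ?case
  proof cases
    case 1
    have "f \<noteq> L45" "g \<noteq> L45" using 1 by (auto simp: outl_def num_def split: if_splits)
    then show ?thesis using Cons.IH[OF 1(3)] by (simp add: sc_def)
  next
    case 2
    have "4 * d * wt d (g # w) \<le> d * wt d w"
      using sc_bounds[of g] wt_pos[of w] d by (simp add: mult.assoc[symmetric])
    also have "\<dots> \<le> wt d (f # w)" using sc_bounds[of f] wt_pos[of w] by simp
    finally show ?thesis using 2 by simp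
  qed
qed

lemma wt_adj: "length w = length w' \<Longrightarrow> adj w w' \<Longrightarrow> 4 * d * wt d w' \<le> wt d w"
  unfolding adj_def using wt_vert by blast

lemma Lip_lin_ext: "Lip d n u \<Longrightarrow> Lip d (Suc n) (lin_ext u)"
proof (rule LipI)
  fix w :: "ltr list" assume u: "Lip d n u" and "length w = Suc n"
  then obtain f v where w: "w = f # v" "length v = n" by (cases w) auto
  have "\<bar>gr (lin_ext u) w\<bar> = kap f * \<bar>gr u v\<bar>"
    by (simp add: w gr_lin_ext abs_mult) (simp add: kap_def)
  also have "\<dots> \<le> sc d f * wt d v"
    using LipD[OF u w(2)] sc_bounds[of f] wt_pos[of v] by (intro mult_mono) (auto simp: kap_def sc_def)
  finally show "\<bar>gr (lin_ext u) w\<bar> \<le> wt d w" using w by simp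
qed

lemma Lip_lin_ext_pow: "Lip d n u \<Longrightarrow> Lip d (n + k) ((lin_ext ^^ k) u)"
  by (induction k) (simp_all add: Lip_lin_ext)

text \<open>The first graph has diameter 4, and the increment across each of its edges is at most a
  quarter of the weight of \<open>w\<close>.\<close>

lemma Lip_child:
  assumes "Lip d (Suc n) u" "length w = n"
  shows "\<bar>u (vert (f # w) s) - u (Ch (vert w t) c)\<bar> \<le> wt d w"
proof -
  have 1: "\<bar>gr u (g # w)\<bar> \<le> wt d w / 4" for g
  proof -
    have "\<bar>gr u (g # w)\<bar> \<le> sc d g * wt d w" using LipD[OF assms(1), of "g # w"] assms(2) by simp
    also have "\<dots> \<le> 1/4 * wt d w" using sc_bounds wt_pos[of w] by (intro mult_right_mono) auto
    finally show ?thesis by simp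
  qed
  note * = 1[of L13] 1[of L23] 1[of L34] 1[of L35] 1[of L45] 1[of L46] 1[of L56] 1[of L67] 1[of L68]
  note ** = *[unfolded gr_def vert_simps abs_le_iff] wt_pos[of w]
  show ?thesis
    using ** unfolding abs_le_iff
    by (cases f; cases s; cases t; cases c; simp only: vert_simps; linarith)
qed

lemma Lip_restr:
  assumes "Lip d (Suc n) u" shows "Lip d n (\<lambda>v. u (Ch v False))"
proof (rule LipI)
  fix w :: "ltr list" assume "length w = n"
  then show "\<bar>gr (\<lambda>v. u (Ch v False)) w\<bar> \<le> wt d w"
    using Lip_child[OF assms, of w L13 False True False] by (simp add: gr_def abs_minus_commute)
qed

lemma Lip_bounded:
  assumes "Lip d n u" "length w = n" "length w' = n"
  shows "u (vert w s) - u (vert w' s') \<le> 4"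
proof -
  \<comment> \<open>The right-hand side is 1 plus twice the sum of (1/4)^i over i < n: level 0
    contributes 1, and every further level one detour inside a single cell for each of the two
    vertices.\<close>
  have "u (vert w s) - u (vert w' s') \<le> 1 + (8/3) * (1 - (1/4)^n)"
    using assms
  proof (induction n arbitrary: u w w' s s')
    case 0
    then have "\<bar>gr u []\<bar> \<le> 1" unfolding Lip_def by (metis wt.simps(1) list.size(3))
    then show ?case using 0 by (cases s; cases s') (auto simp: gr_def)
  next
    case (Suc n)
    from Suc.prems obtain f v where w: "w = f # v" "length v = n" by (cases w) auto
    from Suc.prems obtain g v' where w': "w' = g # v'" "length v' = n" by (cases w') auto
    have "u (Ch (vert v False) False) - u (Ch (vert v' False) False) \<le> 1 + (8/3) * (1 - (1/4)^n)"
      using Suc.IH[OF Lip_restr[OF Suc.prems(1)] w(2) w'(2)] .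
    moreover have "\<bar>u (vert w s) - u (Ch (vert v False) False)\<bar> \<le> (1/4)^n"
      "\<bar>u (vert w' s') - u (Ch (vert v' False) False)\<bar> \<le> (1/4)^n"
      using Lip_child[OF Suc.prems(1) w(2), of f s False False] wt_le[of v]
        Lip_child[OF Suc.prems(1) w'(2), of g s' False False] wt_le[of v'] w w' by auto
    ultimately show ?case unfolding power_Suc by argo
  qed
  also have "\<dots> \<le> 4" using zero_le_power[of "1/4::real" n] by argo
  finally show ?thesis .
qed

lemma Dn_upper:
  assumes "Lip d n u" "length w = n" "length w' = n"
  shows "u (vert w s) - u (vert w' s') \<le> Dn d n (vert w s) (vert w' s')"
  unfolding Dn_def
proof (rule cSUP_upper)
  show "bdd_above ((\<lambda>u. u (vert w s) - u (vert w' s')) ` {u. Lip d n u})"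
    using Lip_bounded assms by (intro bdd_aboveI[of _ 4]) auto
qed (use assms in auto)

lemma Dn_least:
  assumes "\<And>u. Lip d n u \<Longrightarrow> u v - u v' \<le> B" shows "Dn d n v v' \<le> B"
  unfolding Dn_def by (rule cSUP_least) (use assms Lip_0[OF d(1)] in auto)

lemma Dn_nonneg: "length w = n \<Longrightarrow> length w' = n \<Longrightarrow> 0 \<le> Dn d n (vert w s) (vert w' s')"
  using Dn_upper[OF Lip_0[OF d(1)]] by simp

lemma Lip_uminus: "Lip d n u \<Longrightarrow> Lip d n (\<lambda>v. - u v)"
  by (auto simp: Lip_def gr_def abs_minus_commute)

lemma Dn_commute_le: "length w = n \<Longrightarrow> length w' = n \<Longrightarrow> Dn d n (vert w s) (vert w' s') \<le> Dn d n (vert w' s') (vert w s)"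
  using Dn_upper[OF Lip_uminus] by (intro Dn_least) force

lemma Dn_commute: "length w = n \<Longrightarrow> length w' = n \<Longrightarrow> Dn d n (vert w s) (vert w' s') = Dn d n (vert w' s') (vert w s)"
  using Dn_commute_le by (simp add: antisym)

lemma Dn_triangle:
  assumes "length w = n" "length w' = n" "length w'' = n"
  shows "Dn d n (vert w s) (vert w'' s'') \<le> Dn d n (vert w s) (vert w' s') + Dn d n (vert w' s') (vert w'' s'')"
proof (rule Dn_least)
  fix u assume "Lip d n u"
  from Dn_upper[OF this assms(1,2), of s s'] Dn_upper[OF this assms(2,3), of s' s'']
  show "u (vert w s) - u (vert w'' s'') \<le> Dn d n (vert w s) (vert w' s') + Dn d n (vert w' s') (vert w'' s'')"
    by linarith
qed

abbreviation an :: "(nat \<Rightarrow> ltr) \<Rightarrow> (nat \<Rightarrow> ltr) \<Rightarrow> nat \<Rightarrow> real" where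
  "an \<omega> \<omega>' \<equiv> \<lambda>n. Dn d n (vert (pre \<omega> n) False) (vert (pre \<omega>' n) False)"

lemma an_step: "\<bar>an \<omega> \<omega>' (Suc n) - an \<omega> \<omega>' n\<bar> \<le> wt d (pre \<omega> n) + wt d (pre \<omega>' n)"
proof -
  have "an \<omega> \<omega>' (Suc n) \<le> an \<omega> \<omega>' n + (wt d (pre \<omega> n) + wt d (pre \<omega>' n))"
  proof (rule Dn_least)
    fix u assume u: "Lip d (Suc n) u"
    from Lip_child[OF this, of "pre \<omega> n" "\<omega> n" False False False] 
      Lip_child[OF this, of "pre \<omega>' n" "\<omega>' n" False False False]
      Dn_upper[OF Lip_restr[OF u], of "pre \<omega> n" "pre \<omega>' n" False False]
    show "u (vert (pre \<omega> (Suc n)) False) - u (vert (pre \<omega>' (Suc n)) False) \<le> an \<omega> \<omega>' n + (wt d (pre \<omega> n) + wt d (pre \<omega>' n))"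
      by simp
  qed
  moreover have "an \<omega> \<omega>' n \<le> an \<omega> \<omega>' (Suc n) + (wt d (pre \<omega> n) + wt d (pre \<omega>' n))"
  proof (rule Dn_least)
    fix u assume "Lip d n u"
    then have u: "Lip d (Suc n) (lin_ext u)" by (rule Lip_lin_ext)
    from Lip_child[OF this, of "pre \<omega> n" "\<omega> n" False False False] 
      Lip_child[OF this, of "pre \<omega>' n" "\<omega>' n" False False False]
      Dn_upper[OF u, of "pre \<omega> (Suc n)" "pre \<omega>' (Suc n)" False False]
    show "u (vert (pre \<omega> n) False) - u (vert (pre \<omega>' n) False) \<le> an \<omega> \<omega>' (Suc n) + (wt d (pre \<omega> n) + wt d (pre \<omega>' n))"
      by simp
  qed
  ultimately show ?thesis by linarith
qed

lemma dd_limit: "an \<omega> \<omega>' \<longlonglongrightarrow> dd d \<omega> \<omega>'"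
  and dd_approx: "\<bar>dd d \<omega> \<omega>' - an \<omega> \<omega>' n\<bar> \<le> 4/3 * (wt d (pre \<omega> n) + wt d (pre \<omega>' n))"
proof -
  define a where "a = an \<omega> \<omega>'"
  \<comment> \<open>The factor 4/3 is 1 / (1 - 1/4): since weights shrink by 4 per level, the bound
    of \<open>an_step\<close> is at most \<open>b n - b (Suc n)\<close>. Hence a - b increases and a
    + b decreases.\<close>
  define b where "b n = 4/3 * (wt d (pre \<omega> n) + wt d (pre \<omega>' n))" for n
  have W: "wt d (pre \<omega> (Suc n)) \<le> wt d (pre \<omega> n) / 4" for \<omega> n
    using wt_pre_le[of \<omega> n 1] by simp
  have ab: "a n - b n \<le> a (Suc n) - b (Suc n)" "a (Suc n) + b (Suc n) \<le> a n + b n" for n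
    using an_step[of n \<omega> \<omega>'] W[of \<omega> n] W[of \<omega>' n] unfolding a_def b_def by argo+
  have inc: "incseq (\<lambda>n. a n - b n)" and dec: "decseq (\<lambda>n. a n + b n)"
    using ab by (auto intro: incseq_SucI decseq_SucI)
  have b0: "b n \<ge> 0" for n unfolding b_def using wt_pos[of "pre \<omega> n"] wt_pos[of "pre \<omega>' n"] by simp
  have bb: "a n - b n \<le> a m + b m" for n m
    using incseqD[OF inc, of n "max n m"] decseqD[OF dec, of m "max n m"] b0[of "max n m"] by simp
  have "b \<longlonglongrightarrow> 0"
  proof (rule tendsto_sandwich[of "\<lambda>_. 0" b _ "\<lambda>n. 8/3 * (1/4)^n"])
    show "\<forall>\<^sub>F n in sequentially. b n \<le> 8/3 * (1/4)^n"
    proof (intro always_eventually allI)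
      show "b n \<le> 8/3 * (1/4)^n" for n
        unfolding b_def using wt_le[of "pre \<omega> n"] wt_le[of "pre \<omega>' n"] by simp
    qed
    show "(\<lambda>n. 8/3 * (1/4)^n) \<longlonglongrightarrow> (0::real)"
      by (intro tendsto_mult_right_zero LIMSEQ_power_zero) auto
  qed (use b0 in auto)
  obtain L where L: "(\<lambda>n. a n - b n) \<longlonglongrightarrow> L" "\<And>i. a i - b i \<le> L"
    using incseq_convergent[OF inc, of "a 0 + b 0"] bb by blast
  have aL: "a \<longlonglongrightarrow> L" using tendsto_add[OF L(1) \<open>b \<longlonglongrightarrow> 0\<close>] by simp
  have "L \<le> a n + b n" for n
    using LIMSEQ_le_const2[OF L(1), of "a n + b n"] bb by blast
  then have *: "\<bar>L - a n\<bar> \<le> b n" for n using L(2)[of n] by (smt (verit))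
  have "dd d \<omega> \<omega>' = L" using limI[OF aL] unfolding dd_def a_def .
  then show "an \<omega> \<omega>' \<longlonglongrightarrow> dd d \<omega> \<omega>'" 
    "\<bar>dd d \<omega> \<omega>' - an \<omega> \<omega>' n\<bar> \<le> 4/3 * (wt d (pre \<omega> n) + wt d (pre \<omega>' n))"
    using aL *[of n] unfolding a_def b_def by auto
qed

lemma dd_nonneg: "0 \<le> dd d \<omega> \<omega>'"
  using LIMSEQ_le_const[OF dd_limit] Dn_nonneg by (metis length_pre)

lemma dd_commute: "dd d \<omega> \<omega>' = dd d \<omega>' \<omega>"
  unfolding dd_def using Dn_commute by simp

lemma dd_triangle: "dd d \<omega> \<omega>'' \<le> dd d \<omega> \<omega>' + dd d \<omega>' \<omega>''"
  by (rule LIMSEQ_le[OF dd_limit tendsto_add[OF dd_limit dd_limit]]) (auto intro!: Dn_triangle)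

lemma dd_upper:
  assumes "adj (pre \<omega> n) (pre \<omega>' n)"
  shows "dd d \<omega> \<omega>' \<le> 2 / d * wt d (pre \<omega> n)"
proof -
  define w w' where "w = pre \<omega> n" "w' = pre \<omega>' n"
  have len: "length w = n" "length w' = n" by (auto simp: w_w'_def)
  obtain s s' where s: "vert w s = vert w' s'" using assms by (auto simp: adj_def w_w'_def)
  have e: "Dn d n (vert w False) (vert w s) \<le> wt d w" if "length w = n" for w s
  proof (rule Dn_least)
    fix u assume "Lip d n u"
    from LipD[OF this that] show "u (vert w False) - u (vert w s) \<le> wt d w"
      using wt_pos[of w] unfolding gr_def by (cases s) auto
  qed
  have e': "Dn d n (vert w' s') (vert w' False) \<le> wt d w'" 
    using e[OF len(2), of s'] Dn_commute[OF len(2) len(2), of s' False] by simp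
  have "an \<omega> \<omega>' n \<le> wt d w + wt d w'"
    using Dn_triangle[OF len(1) len(1) len(2), of False False s] e[OF len(1), of s] e' s
    unfolding w_w'_def by simp
  then have 1: "dd d \<omega> \<omega>' \<le> 7/3 * (wt d w + wt d w')"
    using dd_approx[of \<omega> \<omega>' n] unfolding w_w'_def by argo
  have "4 * d * wt d w' \<le> wt d w"
    using wt_adj assms len by (simp add: w_w'_def)
  then have 2: "wt d w' \<le> wt d w / (4 * d)" using d by (simp add: field_simps)
  have "wt d w \<le> wt d w / (4 * d)" using d wt_pos[of w] by (simp add: field_simps)
  with 1 2 have "dd d \<omega> \<omega>' \<le> 7/3 * (2 * (wt d w / (4 * d)))" by argo
  also have "\<dots> \<le> 2 / d * wt d w" using d wt_pos[of w] by (simp add: field_simps)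
  finally show ?thesis by (simp add: w_w'_def)
qed

text \<open>The potential equal to \<open>4 * d * wt d w\<close> at both ends of
  \<open>w = pre \<omega> n\<close> and 0 at all other vertices is admissible by
  \<open>wt_adj\<close>. It is constant on the edges of both codes, so its extensions keep the same
  gap at all later levels.\<close>

lemma dd_lower:
  assumes "\<not> adj (pre \<omega> n) (pre \<omega>' n)"
  shows "4 * d * wt d (pre \<omega> n) \<le> dd d \<omega> \<omega>'"
proof -
  define w where "w = pre \<omega> n"
  define u where "u v = (if \<exists>s. v = vert w s then 4 * d * wt d w else 0)" for v
  have len: "length w = n" by (simp add: w_def)
  have u: "Lip d n u"
  proof (rule LipI)
    fix x :: "ltr list" assume x: "length x = n"
    show "\<bar>gr u x\<bar> \<le> wt d x"
    proof (cases "adj x w")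
      case True
      then have "4 * d * wt d w \<le> wt d x" using wt_adj x len by simp
      then show ?thesis using wt_pos[of x] wt_pos[of w] d by (auto simp: gr_def u_def)
    next
      case False
      then have "u (vert x s) = 0" for s by (auto simp: u_def adj_def)
      then show ?thesis using wt_pos[of x] by (simp add: gr_def)
    qed
  qed
  have g: "gr u w = 0" by (auto simp: gr_def u_def)
  have g': "gr u (pre \<omega>' n) = 0" "u (vert (pre \<omega>' n) False) = 0"
    using assms unfolding adj_def w_def[symmetric] by (auto simp: gr_def u_def) metis+
  have "4 * d * wt d w \<le> an \<omega> \<omega>' (k + n)" for k
  proof -
    have p: "pre \<omega> (k + n) = pre (\<lambda>i. \<omega> (n + i)) k @ w" "pre \<omega>' (k + n) = pre (\<lambda>i. \<omega>' (n + i)) k @ pre \<omega>' n"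
      using pre_add[of _ n k] by (auto simp: w_def add.commute)
    have "(lin_ext ^^ k) u (vert (pre \<omega> (k + n)) False) = 4 * d * wt d w"
      using lin_ext_pow_const[OF g, of "pre (\<lambda>i. \<omega> (n + i)) k" False] unfolding p by (auto simp: u_def)
    moreover have "(lin_ext ^^ k) u (vert (pre \<omega>' (k + n)) False) = 0"
      using lin_ext_pow_const[OF g'(1), of "pre (\<lambda>i. \<omega>' (n + i)) k" False] g'(2) unfolding p by simp
    ultimately show ?thesis
      using Dn_upper[OF Lip_lin_ext_pow[OF u, of k], of "pre \<omega> (k + n)" "pre \<omega>' (k + n)" False False]
      by (simp add: add.commute)
  qed
  moreover have "(\<lambda>k. an \<omega> \<omega>' (k + n)) \<longlonglongrightarrow> dd d \<omega> \<omega>'" 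
    using LIMSEQ_ignore_initial_segment[OF dd_limit] .
  ultimately show ?thesis unfolding w_def by (intro LIMSEQ_le_const) auto
qed

lemma dd_eq_0_iff: "dd d \<omega> \<omega>' = 0 \<longleftrightarrow> (\<forall>n. adj (pre \<omega> n) (pre \<omega>' n))"
proof
  assume "dd d \<omega> \<omega>' = 0"
  then show "\<forall>n. adj (pre \<omega> n) (pre \<omega>' n)"
    using dd_lower wt_pos d by (smt (verit) mult_pos_pos)
next
  assume a: "\<forall>n. adj (pre \<omega> n) (pre \<omega>' n)"
  have "dd d \<omega> \<omega>' \<le> 2 / d * (1/4)^n" for n
  proof -
    have "dd d \<omega> \<omega>' \<le> 2 / d * wt d (pre \<omega> n)" using dd_upper a by blast
    also have "\<dots> \<le> 2 / d * (1/4)^n" using wt_le[of "pre \<omega> n"] d by (intro mult_left_mono) auto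
    finally show ?thesis .
  qed
  moreover have "(\<lambda>n. 2 / d * (1/4)^n) \<longlonglongrightarrow> (0::real)"
    by (intro tendsto_mult_right_zero LIMSEQ_power_zero) auto
  ultimately have "dd d \<omega> \<omega>' \<le> 0" using LIMSEQ_le_const by blast
  then show "dd d \<omega> \<omega>' = 0" using dd_nonneg by (simp add: antisym)
qed

end

section \<open>Hausdorff measures\<close>

lemma mdiam_le: "(\<And>x y. x \<in> S \<Longrightarrow> y \<in> S \<Longrightarrow> mdist m x y \<le> B) \<Longrightarrow> mdiam m S \<le> ennreal B"
  unfolding mdiam_def by (intro SUP_least ennreal_leI) auto

lemma mdist_le_mdiam: "x \<in> S \<Longrightarrow> y \<in> S \<Longrightarrow> ennreal (mdist m x y) \<le> mdiam m S"
  unfolding mdiam_def by (meson SUP_upper2 order_refl)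

lemma mdiam_mono: "S \<subseteq> T \<Longrightarrow> mdiam m S \<le> mdiam m T"
  unfolding mdiam_def by (intro SUP_subset_mono order_refl)

lemma mdiam_empty [simp]: "mdiam m {} = 0"
  by (simp add: mdiam_def bot_ennreal)

lemma epowr_0 [simp]: "epowr 0 p = 0"
  by (simp add: epowr_def)

lemma epowr_ennreal: "0 \<le> x \<Longrightarrow> epowr (ennreal x) p = ennreal (x powr p)"
  by (simp add: epowr_def)

lemma epowr_mono: "x \<le> y \<Longrightarrow> 0 \<le> p \<Longrightarrow> epowr x p \<le> epowr y p"
  by (auto simp: epowr_def top_unique less_top enn2real_mono intro!: ennreal_leI powr_mono2)

lemma content_le_finite:
  assumes "finite I" "A \<subseteq> (\<Union>i\<in>I. U i)" "\<And>i. i \<in> I \<Longrightarrow> U i \<subseteq> mspace m"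
    "\<And>i. i \<in> I \<Longrightarrow> mdiam m (U i) \<le> ennreal \<delta>"
  shows "hausdorff_content m Q \<delta> A \<le> (\<Sum>i\<in>I. epowr (mdiam m (U i)) Q)"
proof -
  obtain h where h: "bij_betw h {0..<card I} I" 
    using ex_bij_betw_nat_finite[OF assms(1)] by blast
  define V where "V n = (if n < card I then U (h n) else {})" for n
  have hI: "h n \<in> I" if "n < card I" for n using h that by (auto simp: bij_betw_def)
  have "A \<subseteq> (\<Union>n. V n)"
  proof
    fix x assume "x \<in> A"
    then obtain i where i: "i \<in> I" "x \<in> U i" using assms by blast
    then obtain n where "n < card I" "h n = i" using h unfolding bij_betw_def by (metis atLeastLessThan_iff imageE)
    then show "x \<in> (\<Union>n. V n)" using i by (auto simp: V_def intro!: exI[of _ n])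
  qed
  then have "hausdorff_content m Q \<delta> A \<le> (\<Sum>n. epowr (mdiam m (V n)) Q)"
    unfolding hausdorff_content_def using assms hI by (intro INF_lower) (auto simp: V_def)
  also have "\<dots> = (\<Sum>n\<in>{0..<card I}. epowr (mdiam m (V n)) Q)"
    by (intro suminf_finite) (auto simp: V_def)
  also have "\<dots> = (\<Sum>n\<in>{0..<card I}. epowr (mdiam m (U (h n))) Q)"
    by (intro sum.cong) (auto simp: V_def)
  also have "\<dots> = (\<Sum>i\<in>I. epowr (mdiam m (U i)) Q)"
    using sum.reindex_bij_betw[OF h, of "\<lambda>i. epowr (mdiam m (U i)) Q"] by simp
  finally show ?thesis .
qed

lemma content_antimono: "\<delta> \<le> \<delta>' \<Longrightarrow> hausdorff_content m Q \<delta>' A \<le> hausdorff_content m Q \<delta> A"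
  unfolding hausdorff_content_def
  by (intro INF_superset_mono) (auto intro: order_trans ennreal_leI)

lemma content_mono: "A \<subseteq> B \<Longrightarrow> hausdorff_content m Q \<delta> A \<le> hausdorff_content m Q \<delta> B"
  unfolding hausdorff_content_def by (intro INF_superset_mono) auto

lemma content_le_hausdorff: "0 < \<delta> \<Longrightarrow> hausdorff_content m Q \<delta> A \<le> hausdorff m Q A"
  unfolding hausdorff_def by (intro SUP_upper) auto

lemma hausdorff_mono: "A \<subseteq> B \<Longrightarrow> hausdorff m Q A \<le> hausdorff m Q B"
  unfolding hausdorff_def by (intro SUP_mono) (auto intro: content_mono)

lemma hausdorff_least:
  "(\<And>\<delta>. 0 < \<delta> \<Longrightarrow> hausdorff_content m Q \<delta> A \<le> B) \<Longrightarrow> hausdorff m Q A \<le> B"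
  unfolding hausdorff_def by (intro SUP_least) auto

lemma hausdorff_empty: "hausdorff m Q {} = 0"
proof -
  have "hausdorff m Q {} \<le> 0"
  proof (rule hausdorff_least)
    fix \<delta> :: real
    show "hausdorff_content m Q \<delta> {} \<le> 0"
      using content_le_finite[of "{}" "{}" "\<lambda>_. {}" m \<delta> Q] by simp
  qed
  then show ?thesis by simp
qed

lemma INF_add_const_ennreal:
  "I \<noteq> {} \<Longrightarrow> (INF i\<in>I. f i + c) = (INF i\<in>I. f i) + (c :: ennreal)"
  using continuous_at_Inf_mono[of "\<lambda>x. x + c" "f ` I"]
  using continuous_add[of "at_right (Inf (f ` I))", of "\<lambda>x. x" "\<lambda>x. c"]
  by (auto simp: mono_def image_comp)

lemma INF_const_add_ennreal:
  "I \<noteq> {} \<Longrightarrow> (INF i\<in>I. c + f i) = c + (INF i\<in>I. f i :: ennreal)"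
  using INF_add_const_ennreal[of I f c] by (simp add: ac_simps)

lemma content_Un: "hausdorff_content m Q \<delta> (A \<union> B) \<le> hausdorff_content m Q \<delta> A + hausdorff_content m Q \<delta> B"
proof -
  let ?S = "\<lambda>A. {U :: nat \<Rightarrow> 'a set. A \<subseteq> (\<Union>i. U i) \<and> (\<forall>i. U i \<subseteq> mspace m \<and> mdiam m (U i) \<le> ennreal \<delta>)}"
  let ?f = "\<lambda>U :: nat \<Rightarrow> 'a set. (\<Sum>i. epowr (mdiam m (U i)) Q)"
  have 1: "hausdorff_content m Q \<delta> (A \<union> B) \<le> ?f U + ?f V" if U: "U \<in> ?S A" and V: "V \<in> ?S B" for U V
  proof -
    define W where "W n = (if even n then U (n div 2) else V (n div 2))" for n
    have UW: "U n = W (2 * n)" and VW: "V n = W (2 * n + 1)" for n by (auto simp: W_def)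
    have "A \<union> B \<subseteq> (\<Union>n. W n)"
    proof
      fix x assume "x \<in> A \<union> B"
      then consider n where "x \<in> U n" | n where "x \<in> V n" using U V by auto
      then show "x \<in> (\<Union>n. W n)" using UW VW by cases (metis UNIV_I UN_iff)+
    qed
    moreover have "\<forall>i. W i \<subseteq> mspace m \<and> mdiam m (W i) \<le> ennreal \<delta>"
      using U V by (auto simp: W_def)
    ultimately have "hausdorff_content m Q \<delta> (A \<union> B) \<le> ?f W"
      unfolding hausdorff_content_def by (intro INF_lower) auto
    also have "?f W = ?f U + ?f V"
    proof -
      have s: "summable g" for g :: "nat \<Rightarrow> ennreal" by simp
      have "(\<lambda>n. \<Sum>i<2 * n. epowr (mdiam m (W i)) Q) \<longlonglongrightarrow> ?f W"
        using LIMSEQ_subseq_LIMSEQ[OF summable_LIMSEQ[OF s, of "\<lambda>i. epowr (mdiam m (W i)) Q"], of "\<lambda>n. 2 * n"]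
        by (auto simp: strict_mono_def o_def)
      moreover have "(\<Sum>i<2 * n. epowr (mdiam m (W i)) Q) = (\<Sum>i<n. epowr (mdiam m (U i)) Q) + (\<Sum>i<n. epowr (mdiam m (V i)) Q)" for n
        by (induction n) (auto simp: UW VW algebra_simps)
      moreover have "(\<lambda>n. (\<Sum>i<n. epowr (mdiam m (U i)) Q) + (\<Sum>i<n. epowr (mdiam m (V i)) Q)) \<longlonglongrightarrow> ?f U + ?f V"
        by (intro tendsto_add summable_LIMSEQ s)
      ultimately show ?thesis using LIMSEQ_unique by auto
    qed
    finally show ?thesis .
  qed
  show ?thesis
  proof (cases "?S A = {} \<or> ?S B = {}")
    case True
    have *: "(INF U\<in>S. ?f U) = top" if "S = {}" for S using that by simp
    have "hausdorff_content m Q \<delta> A = top \<or> hausdorff_content m Q \<delta> B = top"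
      unfolding hausdorff_content_def using True *[of "?S A"] *[of "?S B"] by argo
    then show ?thesis by auto
  next
    case False
    have "hausdorff_content m Q \<delta> (A \<union> B) \<le> (INF U\<in>?S A. INF V\<in>?S B. ?f U + ?f V)"
      by (intro INF_greatest 1)
    also have "\<dots> = (INF U\<in>?S A. ?f U + (INF V\<in>?S B. ?f V))"
      using False by (intro INF_cong refl) (subst INF_const_add_ennreal, auto)
    also have "\<dots> = (INF U\<in>?S A. ?f U) + (INF V\<in>?S B. ?f V)"
      using False by (subst INF_add_const_ennreal, auto)
    finally show ?thesis unfolding hausdorff_content_def .
  qed
qed

lemma hausdorff_Un: "hausdorff m Q (A \<union> B) \<le> hausdorff m Q A + hausdorff m Q B"
  by (intro hausdorff_least order_trans[OF content_Un] add_mono content_le_hausdorff)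

lemma hausdorff_UN:
  assumes "finite I" shows "hausdorff m Q (\<Union>i\<in>I. A i) \<le> (\<Sum>i\<in>I. hausdorff m Q (A i))"
  using assms
proof (induction I)
  case (insert i I)
  then show ?case using hausdorff_Un[of m Q "A i" "\<Union>i\<in>I. A i"] by (auto intro: order_trans add_left_mono)
qed (simp add: hausdorff_empty)

text \<open>A set of diameter below \<open>\<eta>\<close> cannot meet both \<open>A\<close> and
  \<open>B\<close>, so a fine cover of the union splits into a cover of \<open>A\<close> and one of
  \<open>B\<close>. This additivity on separated sets replaces measurability when disjoint balls are
  counted later.\<close>

lemma hausdorff_separated_Un:
  assumes "0 < \<eta>" "\<And>x y. x \<in> A \<Longrightarrow> y \<in> B \<Longrightarrow> \<eta> \<le> mdist m x y"
  shows "hausdorff m Q A + hausdorff m Q B \<le> hausdorff m Q (A \<union> B)"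
proof -
  have 1: "hausdorff_content m Q \<delta> A + hausdorff_content m Q \<delta>' B \<le> hausdorff m Q (A \<union> B)"
    if \<delta>: "0 < \<delta>" "0 < \<delta>'" for \<delta> \<delta>'
  proof -
    define \<epsilon> where "\<epsilon> = min (min \<delta> \<delta>') (\<eta> / 2)"
    have \<epsilon>: "0 < \<epsilon>" "\<epsilon> \<le> \<delta>" "\<epsilon> \<le> \<delta>'" "\<epsilon> < \<eta>" using that assms by (auto simp: \<epsilon>_def)
    have "hausdorff_content m Q \<epsilon> A + hausdorff_content m Q \<epsilon> B \<le> hausdorff_content m Q \<epsilon> (A \<union> B)"
      unfolding hausdorff_content_def[of m Q \<epsilon> "A \<union> B"]
    proof (rule INF_greatest, clarify)
      fix U :: "nat \<Rightarrow> 'a set" assume U: "A \<union> B \<subseteq> (\<Union>i. U i)" "\<forall>i. U i \<subseteq> mspace m \<and> mdiam m (U i) \<le> ennreal \<epsilon>"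
      define V where "V i = (if U i \<inter> A \<noteq> {} then U i else {})" for i
      define W where "W i = (if U i \<inter> A = {} then U i else {})" for i
      have no: False if "x \<in> U i" "y \<in> U i" "x \<in> A" "y \<in> B" for x y i
      proof -
        have "ennreal (mdist m x y) \<le> ennreal \<epsilon>" using mdist_le_mdiam[OF that(1,2)] U(2) order_trans by blast
        then show False using assms(2)[OF that(3,4)] \<epsilon> by (simp add: ennreal_le_iff)
      qed
      have "A \<subseteq> (\<Union>i. V i)" using U(1) by (fastforce simp: V_def)
      moreover have "\<forall>i. V i \<subseteq> mspace m \<and> mdiam m (V i) \<le> ennreal \<epsilon>" using U(2) by (auto simp: V_def)
      ultimately have a: "hausdorff_content m Q \<epsilon> A \<le> (\<Sum>i. epowr (mdiam m (V i)) Q)"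
        unfolding hausdorff_content_def by (intro INF_lower) auto
      have "B \<subseteq> (\<Union>i. W i)"
      proof
        fix y assume "y \<in> B"
        moreover then obtain i where "y \<in> U i" using U(1) by blast
        ultimately show "y \<in> (\<Union>i. W i)" using no unfolding W_def by (intro UN_I[of i]) auto
      qed
      moreover have "\<forall>i. W i \<subseteq> mspace m \<and> mdiam m (W i) \<le> ennreal \<epsilon>" using U(2) by (auto simp: W_def)
      ultimately have b: "hausdorff_content m Q \<epsilon> B \<le> (\<Sum>i. epowr (mdiam m (W i)) Q)"
        unfolding hausdorff_content_def by (intro INF_lower) auto
      have "(\<Sum>i. epowr (mdiam m (V i)) Q) + (\<Sum>i. epowr (mdiam m (W i)) Q) = (\<Sum>i. epowr (mdiam m (V i)) Q + epowr (mdiam m (W i)) Q)"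
        by (intro suminf_add) auto
      also have "\<dots> = (\<Sum>i. epowr (mdiam m (U i)) Q)"
        by (intro suminf_cong) (auto simp: V_def W_def)
      finally show "hausdorff_content m Q \<epsilon> A + hausdorff_content m Q \<epsilon> B \<le> (\<Sum>i. epowr (mdiam m (U i)) Q)"
        using add_mono[OF a b] by simp
    qed
    then have "hausdorff_content m Q \<epsilon> A + hausdorff_content m Q \<epsilon> B \<le> hausdorff m Q (A \<union> B)"
      using content_le_hausdorff[OF \<epsilon>(1)] order_trans by blast
    then show ?thesis using add_mono[OF content_antimono[OF \<epsilon>(2)] content_antimono[OF \<epsilon>(3)]] order_trans by blast
  qed
  have "hausdorff m Q A + hausdorff m Q B = (SUP \<delta>\<in>{0<..}. hausdorff_content m Q \<delta> A + hausdorff m Q B)"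
    unfolding hausdorff_def[of m Q A] by (subst ennreal_SUP_add_left) auto
  also have "\<dots> = (SUP \<delta>\<in>{0<..}. SUP \<delta>'\<in>{0<..}. hausdorff_content m Q \<delta> A + hausdorff_content m Q \<delta>' B)"
    unfolding hausdorff_def[of m Q B] by (subst ennreal_SUP_add_right) auto
  also have "\<dots> \<le> hausdorff m Q (A \<union> B)"
    by (intro SUP_least 1) auto
  finally show ?thesis .
qed

lemma hausdorff_separated_UN:
  assumes "finite I" "0 < \<eta>" "\<And>i j x y. i \<in> I \<Longrightarrow> j \<in> I \<Longrightarrow> i \<noteq> j \<Longrightarrow> x \<in> A i \<Longrightarrow> y \<in> A j \<Longrightarrow> \<eta> \<le> mdist m x y"
  shows "(\<Sum>i\<in>I. hausdorff m Q (A i)) \<le> hausdorff m Q (\<Union>i\<in>I. A i)"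
  using assms(1,3)
proof (induction I)
  case (insert i I)
  have "(\<Sum>i\<in>insert i I. hausdorff m Q (A i)) = hausdorff m Q (A i) + (\<Sum>i\<in>I. hausdorff m Q (A i))"
    using insert by simp
  also have "\<dots> \<le> hausdorff m Q (A i) + hausdorff m Q (\<Union>i\<in>I. A i)"
    by (intro add_left_mono insert.IH insert.prems) auto
  also have "\<dots> \<le> hausdorff m Q (A i \<union> (\<Union>i\<in>I. A i))"
  proof (rule hausdorff_separated_Un[OF assms(2)])
    fix x y assume "x \<in> A i" "y \<in> (\<Union>i\<in>I. A i)"
    then obtain j where "j \<in> I" "y \<in> A j" by blast
    then show "\<eta> \<le> mdist m x y" using insert.prems[of i j x y] insert.hyps \<open>x \<in> A i\<close> by auto
  qed
  finally show ?case by simp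
qed simp

section \<open>Coded limit spaces\<close>

lemma outl_L34: "outl L34 s = None"
  by (cases s) (simp_all add: outl_def num_def)

abbreviation cantor :: "(nat \<Rightarrow> ltr) topology" where
  "cantor \<equiv> product_topology (\<lambda>_. discrete_topology UNIV) UNIV"

lemma topspace_cantor [simp]: "topspace cantor = UNIV"
  by (simp add: topspace_product_topology)

lemma compact_cantor: "compact_space cantor"
  by (simp add: compact_space_product_topology compact_space_discrete_topology)

lemma openin_cylinder: "openin cantor {\<omega>. pre \<omega> n = w}"
proof (cases "length w = n")
  case True
  define \<tau> where "\<tau> = (\<lambda>_::nat. L13 :: ltr)"
  define \<alpha> where "\<alpha> = ext w \<tau>"
  have w: "w = pre \<alpha> n" using True pre_ext_len[of w \<tau>] by (simp add: \<alpha>_def)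
  have "{\<omega>. pre \<omega> n = w} = (\<Pi>\<^sub>E i\<in>UNIV. if i < n then {\<alpha> i} else UNIV)"
    unfolding w pre_eq_iff by (auto simp: PiE_iff split: if_splits)
  also have "openin cantor \<dots>"
  proof (rule product_topology_basis)
    show "finite {i. (if i < n then {\<alpha> i} else UNIV) \<noteq> topspace (discrete_topology UNIV)}"
      by (rule finite_subset[of _ "{..<n}"]) auto
  qed auto
  finally show ?thesis .
next
  case False
  then have "{\<omega>. pre \<omega> n = w} = {}" using length_pre by auto
  then show ?thesis by simp
qed

lemma closedin_cylinder: "closedin cantor {\<omega>. pre \<omega> n = w}"
proof -
  have "UNIV - {\<omega>. pre \<omega> n = w} = (\<Union>v\<in>{v. v \<noteq> w}. {\<omega>. pre \<omega> n = v})" by auto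
  then have "openin cantor (UNIV - {\<omega>. pre \<omega> n = w})" using openin_cylinder by auto
  then show ?thesis by (simp add: closedin_def)
qed

lemma compactin_cylinder: "compactin cantor {\<omega>. pre \<omega> n = w}"
  using closedin_compact_space[OF compact_cantor closedin_cylinder] .

lemma scale_exists:
  assumes d: "0 < d" "d \<le> 1/4" and r: "0 < r" "r \<le> 1"
  obtains n where "r \<le> wt d (pre \<omega> n)" "d * wt d (pre \<omega> n) < r"
proof -
  have "\<exists>n. wt d (pre \<omega> n) < r"
  proof -
    obtain n where "(1/4::real) ^ n < r" using real_arch_pow_inv[of r "1/4"] r by auto
    then show ?thesis using wt_le[OF d, of "pre \<omega> n"] by (auto intro!: exI[of _ n])
  qed
  define k where "k = (LEAST n. wt d (pre \<omega> n) < r)"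
  have k: "wt d (pre \<omega> k) < r" unfolding k_def by (rule LeastI_ex) fact
  then obtain n where n: "k = Suc n" using r by (cases k) auto
  have "\<not> wt d (pre \<omega> n) < r" using not_less_Least[of n "\<lambda>n. wt d (pre \<omega> n) < r"] n k_def by simp
  moreover have "d * wt d (pre \<omega> n) < r" using wt_pre_ge[OF d, of 1 \<omega> n] k n by simp
  ultimately show ?thesis using that[of n] by linarith
qed

lemma scale_exists':
  assumes d: "0 < d" "d \<le> 1/4" and r: "0 < r" "r \<le> 1"
  obtains n where "wt d (pre \<omega> n) < r" "d * r \<le> wt d (pre \<omega> n)"
proof -
  obtain n where n: "d * r \<le> wt d (pre \<omega> n)" "d * wt d (pre \<omega> n) < d * r"
    using scale_exists[OF d, of "d * r" \<omega>] d r by (auto simp: mult_le_one)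
  then show ?thesis using that[of n] d by simp
qed

text \<open>The theory is developed for any parametrisation of a point set by codes with these
  fibres. The points of the limit space, which are classes of sequences of edges, enter only at the
  end through \<open>PP\<close>.\<close>

locale coding =
  fixes P :: "(nat \<Rightarrow> ltr) \<Rightarrow> 'p"
  assumes P_eq_iff: "P \<omega> = P \<omega>' \<longleftrightarrow> (\<forall>n. adj (pre \<omega> n) (pre \<omega>' n))"
begin

definition code :: "'p \<Rightarrow> nat \<Rightarrow> ltr" where
  "code x = (SOME \<omega>. P \<omega> = x)"

lemma P_code: "x \<in> range P \<Longrightarrow> P (code x) = x"
  unfolding code_def using someI_ex[of "\<lambda>\<omega>. P \<omega> = x"] by blast

definition pd :: "real \<Rightarrow> 'p \<Rightarrow> 'p \<Rightarrow> real" where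
  "pd d x y = (if x \<in> range P \<and> y \<in> range P then dd d (code x) (code y) else 0)"

definition MX :: "real \<Rightarrow> 'p metric" where
  "MX d = metric (range P, pd d)"

definition cell :: "ltr list \<Rightarrow> 'p set" where
  "cell w = P ` {\<omega>. pre \<omega> (length w) = w}"

lemma cell_subset: "cell w \<subseteq> range P"
  by (auto simp: cell_def)

lemma P_in_cell: "P \<omega> \<in> cell (pre \<omega> n)"
  by (auto simp: cell_def)

lemma cellE:
  assumes "x \<in> cell w" obtains \<tau> where "x = P (ext w \<tau>)"
proof -
  obtain \<omega> where \<omega>: "x = P \<omega>" "pre \<omega> (length w) = w" using assms by (auto simp: cell_def)
  then have "ext w (\<lambda>i. \<omega> (length w + i)) = \<omega>" using ext_pre[of \<omega> "length w"] by simp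
  then show ?thesis using that \<omega> by metis
qed

lemma cell_ext: "P (ext w \<tau>) \<in> cell w"
  by (auto simp: cell_def)

lemma cell_nonempty: "cell w \<noteq> {}"
  using cell_ext by blast

lemma P_in_cellD: "P \<omega> \<in> cell w \<Longrightarrow> adj (pre \<omega> (length w)) w"
  unfolding cell_def using P_eq_iff by (metis (mono_tags, lifting) image_iff mem_Collect_eq)

lemma cell_append: "cell (v @ w) \<subseteq> cell w"
proof
  fix x assume "x \<in> cell (v @ w)"
  then obtain \<omega> where "x = P \<omega>" "pre \<omega> (length (v @ w)) = v @ w" by (auto simp: cell_def)
  moreover then have "pre \<omega> (length w) = w"
    using pre_drop[of "length w" "length (v @ w)" \<omega>] by auto
  ultimately show "x \<in> cell w" using P_in_cell[of \<omega> "length w"] by simp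
qed

lemma cell_Cons: "cell (f # w) \<subseteq> cell w"
  using cell_append[of "[f]"] by simp

lemma range_cells: "range P = (\<Union>w\<in>words n. cell w)"
proof
  show "range P \<subseteq> (\<Union>w\<in>words n. cell w)"
  proof
    fix x assume "x \<in> range P"
    then obtain \<omega> where "x = P \<omega>" by blast
    then show "x \<in> (\<Union>w\<in>words n. cell w)"
      using P_in_cell[of \<omega> n] by (intro UN_I[of "pre \<omega> n"]) (auto simp: words_def)
  qed
qed (use cell_subset in blast)

lemma cell_split: "cell w = (\<Union>v\<in>words n. cell (v @ w))"
proof
  show "cell w \<subseteq> (\<Union>v\<in>words n. cell (v @ w))"
  proof
    fix x assume "x \<in> cell w"
    then obtain \<tau> where "x = P (ext w \<tau>)" by (rule cellE)
    then have "x \<in> cell (pre \<tau> n @ w)" using P_in_cell[of "ext w \<tau>" "length w + n"] by (simp add: pre_ext)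
    then show "x \<in> (\<Union>v\<in>words n. cell (v @ w))" by (intro UN_I[of "pre \<tau> n"]) (auto simp: words_def)
  qed
qed (use cell_append in blast)

lemma adj_cells:
  assumes "adj w w'" "length w = length w'" shows "cell w \<inter> cell w' \<noteq> {}"
proof -
  obtain s s' where s: "vert w s = vert w' s'" using assms by (auto simp: adj_def)
  \<comment> \<open>Repeating \<open>L13\<close> at a lower end, or \<open>L67\<close> at an upper
    end, follows the copy with label a through all levels, so the two codes keep sharing this
    vertex.\<close>
  define t where "t s = (if s then L67 else L13)" for s
  have 1: "outl (t s) s = Some False" for s by (cases s) (auto simp: t_def outl_def num_def)
  have 2: "vert (pre (\<lambda>_. t s) n @ w) s = vert (pre (\<lambda>_. t s') n @ w') s'" for n
    by (induction n) (auto simp: vert_Cons 1 s)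
  have "adj (pre (ext w (\<lambda>_. t s)) n) (pre (ext w' (\<lambda>_. t s')) n)" for n
  proof (rule adj_pre_mono)
    show "adj (pre (ext w (\<lambda>_. t s)) (length w + n)) (pre (ext w' (\<lambda>_. t s')) (length w + n))"
      unfolding adj_def using 2[of n] pre_ext[of w' "\<lambda>_. t s'" n] pre_ext[of w "\<lambda>_. t s" n] assms(2) by metis
  qed simp
  then have "P (ext w (\<lambda>_. t s)) = P (ext w' (\<lambda>_. t s'))" unfolding P_eq_iff by blast
  then show ?thesis using cell_ext by (metis disjoint_iff)
qed

lemma cells_adj:
  assumes "cell w \<inter> cell w' \<noteq> {}" "length w = length w'" shows "adj w w'"
proof -
  obtain x where x: "x \<in> cell w" "x \<in> cell w'" using assms by blast
  then obtain \<omega> where "x = P \<omega>" "pre \<omega> (length w) = w" by (auto simp: cell_def)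
  then show ?thesis using P_in_cellD[of \<omega> w'] x assms by simp
qed

context
  fixes d :: real
  assumes d: "0 < d" "d \<le> 1/4"
begin

lemma pd_P: "pd d (P \<omega>) (P \<omega>') = dd d \<omega> \<omega>'"
proof -
  have *: "dd d (code (P \<omega>)) \<omega> = 0" for \<omega>
    using P_code[of "P \<omega>"] P_eq_iff dd_eq_0_iff[OF d] by auto
  have "dd d (code (P \<omega>)) (code (P \<omega>')) = dd d \<omega> \<omega>'"
    using dd_triangle[OF d, of "code (P \<omega>)" "code (P \<omega>')" \<omega>] dd_triangle[OF d, of \<omega> "code (P \<omega>')" \<omega>']
      dd_triangle[OF d, of \<omega> \<omega>' "code (P \<omega>)"] dd_triangle[OF d, of "code (P \<omega>)" \<omega>' "code (P \<omega>')"]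
      *[of \<omega>] *[of \<omega>'] dd_commute[OF d] by (smt (verit))
  then show ?thesis by (simp add: pd_def)
qed

lemma Metric_space_pd: "Metric_space (range P) (pd d)"
proof
  fix x y
  show "0 \<le> pd d x y" by (simp add: pd_def dd_nonneg[OF d])
  show "pd d x y = pd d y x" by (simp add: pd_def dd_commute[OF d])
next
  fix x y assume "x \<in> range P" "y \<in> range P"
  then show "pd d x y = 0 \<longleftrightarrow> x = y" using pd_P P_eq_iff dd_eq_0_iff[OF d] by auto
next
  fix x y z assume "x \<in> range P" "y \<in> range P" "z \<in> range P"
  then show "pd d x z \<le> pd d x y + pd d y z" using pd_P dd_triangle[OF d] by auto
qed

lemma mspace_MX [simp]: "mspace (MX d) = range P"
  unfolding MX_def by (rule Metric_space.mspace_metric[OF Metric_space_pd])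

lemma mdist_MX [simp]: "mdist (MX d) = pd d"
  unfolding MX_def by (rule Metric_space.mdist_metric[OF Metric_space_pd])

lemma pd_upper: "adj (pre \<omega> n) (pre \<omega>' n) \<Longrightarrow> pd d (P \<omega>) (P \<omega>') \<le> 2 / d * wt d (pre \<omega> n)"
  unfolding pd_P by (rule dd_upper[OF d])

lemma pd_lower: "\<not> adj (pre \<omega> n) (pre \<omega>' n) \<Longrightarrow> 4 * d * wt d (pre \<omega> n) \<le> pd d (P \<omega>) (P \<omega>')"
  unfolding pd_P by (rule dd_lower[OF d])

lemma pd_le: "pd d x y \<le> 2 / d"
proof (cases "x \<in> range P \<and> y \<in> range P")
  case True
  then show ?thesis using pd_upper[of _ 0] by fastforce
next
  case False
  then have "pd d x y = 0" unfolding pd_def by argo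
  then show ?thesis using d by simp
qed

lemma cell_pd: "x \<in> cell w \<Longrightarrow> y \<in> cell w \<Longrightarrow> pd d x y \<le> 2 / d * wt d w"
proof -
  assume "x \<in> cell w" "y \<in> cell w"
  then obtain \<omega> \<omega>' where "x = P \<omega>" "pre \<omega> (length w) = w" "y = P \<omega>'" "pre \<omega>' (length w) = w"
    by (auto simp: cell_def)
  then show ?thesis using pd_upper[of \<omega> "length w" \<omega>'] by simp
qed

lemma cell_mdiam: "mdiam (MX d) (cell w) \<le> ennreal (2 / d * wt d w)"
  using cell_pd by (intro mdiam_le) (simp only: mdist_MX)

lemma ball_star:
  assumes "P \<omega>' \<in> mball_of (MX d) (P \<omega>) r" "r \<le> 4 * d * wt d (pre \<omega> n)"
  shows "adj (pre \<omega> n) (pre \<omega>' n)"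
proof (rule ccontr)
  assume "\<not> adj (pre \<omega> n) (pre \<omega>' n)"
  from pd_lower[OF this] show False using assms by simp
qed

lemma continuous_P: "continuous_map cantor (mtopology_of (MX d)) P"
  unfolding mtopology_of_def Metric_space.continuous_map_to_metric[OF Metric_space_mspace_mdist]
proof (intro ballI allI impI)
  fix \<omega> and \<epsilon> :: real assume "0 < \<epsilon>"
  then obtain n where "(1/4::real) ^ n < \<epsilon> * d / 2" using real_arch_pow_inv[of "\<epsilon> * d / 2" "1/4"] d by auto
  then have n: "2 / d * (1/4::real) ^ n < \<epsilon>" using d by (simp add: field_simps)
  have "P \<omega>' \<in> Metric_space.mball (mspace (MX d)) (mdist (MX d)) (P \<omega>) \<epsilon>" if "pre \<omega>' n = pre \<omega> n" for \<omega>'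
  proof -
    have "pd d (P \<omega>) (P \<omega>') \<le> 2 / d * wt d (pre \<omega> n)" using that pd_upper by simp
    also have "\<dots> \<le> 2 / d * (1/4) ^ n" using wt_le[OF d, of "pre \<omega> n"] d by (intro mult_left_mono) auto
    finally show ?thesis using n by (simp add: Metric_space.in_mball[OF Metric_space_pd])
  qed
  then show "\<exists>U. openin cantor U \<and> \<omega> \<in> U \<and> (\<forall>y\<in>U. P y \<in> Metric_space.mball (mspace (MX d)) (mdist (MX d)) (P \<omega>) \<epsilon>)"
    by (intro exI[of _ "{\<omega>'. pre \<omega>' n = pre \<omega> n}"]) (auto intro: openin_cylinder)
qed

lemma compactin_cell: "compactin (mtopology_of (MX d)) (cell w)"
  unfolding cell_def by (rule image_compactin[OF compactin_cylinder continuous_P])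

lemma compact_MX: "compact_space (mtopology_of (MX d))"
  using compactin_cell[of "[]"] unfolding compact_space_def by (simp add: cell_def)

lemma closedin_cell: "closedin (mtopology_of (MX d)) (cell w)"
proof (rule compactin_imp_closedin[OF _ compactin_cell])
  show "Hausdorff_space (mtopology_of (MX d))"
    unfolding mtopology_of_def by (rule Metric_space.Hausdorff_space_mtopology[OF Metric_space_mspace_mdist])
qed

text \<open>Both ends of \<open>L34\<close> are inner vertices, so every cell of its level that
  touches the cell of \<open>\<omega>\<close> has the same parent. This is the standard source of
  points lying well inside a cell.\<close>

lemma ball_inside_cell:
  assumes s: "\<omega> n = L34"
  shows "mball_of (MX d) (P \<omega>) (4 * d * wt d (pre \<omega> (Suc n))) \<subseteq> cell (pre \<omega> n)"
proof
  fix y assume y: "y \<in> mball_of (MX d) (P \<omega>) (4 * d * wt d (pre \<omega> (Suc n)))"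
  then obtain \<omega>' where \<omega>': "y = P \<omega>'" by auto
  from y have "adj (pre \<omega> (Suc n)) (pre \<omega>' (Suc n))" unfolding \<omega>' by (rule ball_star) simp
  then have "adj (L34 # pre \<omega> n) (\<omega>' n # pre \<omega>' n)" using s by simp
  then obtain s s' where "vert (L34 # pre \<omega> n) s = vert (\<omega>' n # pre \<omega>' n) s'" by (auto simp: adj_def)
  then have "pre \<omega>' n = pre \<omega> n"
    using vert_sign outl_L34 by (metis option.distinct(1))
  then show "y \<in> cell (pre \<omega> n)" using \<omega>' P_in_cell[of \<omega>' n] by simp
qed

end

end

section \<open>Ahlfors regularity\<close>

text \<open>By the equation for \<open>Q\<close> the powers of the letter weights sum to 1, so
  \<open>wt d w powr Q\<close> is the mass of the cell of \<open>w\<close> under a self-similar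
  measure.\<close>

lemma sum_powr_words:
  assumes d: "0 < d" "d \<le> 1/4" and Q: "8 * (1/4) powr Q + d powr Q = 1"
  shows "(\<Sum>v\<in>words n. wt d (v @ w) powr Q) = wt d w powr Q"
proof (induction n)
  case (Suc n)
  have "(\<Sum>f\<in>UNIV. wt d (f # v @ w) powr Q) = wt d (v @ w) powr Q" for v
  proof -
    have "(\<Sum>f\<in>UNIV. wt d (f # v @ w) powr Q) = (\<Sum>f\<in>UNIV. sc d f powr Q) * wt d (v @ w) powr Q"
      unfolding sum_distrib_right
      using sc_bounds[OF d] wt_pos[OF d] by (intro sum.cong refl) (simp add: powr_mult less_imp_le)
    also have "(\<Sum>f\<in>UNIV. sc d f powr Q) = 1"
      using Q unfolding sum_ltr by (simp add: sc_def)
    finally show ?thesis by simp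
  qed
  then show ?case using Suc by (simp add: sum_words_Suc)
qed simp

lemma sum_UN_le:
  fixes h :: "'b \<Rightarrow> real"
  assumes "finite I" "\<And>i. i \<in> I \<Longrightarrow> finite (A i)" "\<And>x. 0 \<le> h x"
  shows "(\<Sum>x\<in>(\<Union>i\<in>I. A i). h x) \<le> (\<Sum>i\<in>I. \<Sum>x\<in>A i. h x)"
  using assms(1,2)
proof (induction I)
  case (insert i I)
  have "sum h (A i \<union> (\<Union>i\<in>I. A i)) \<le> sum h (A i) + sum h (\<Union>i\<in>I. A i)"
    using sum.union_inter[of "A i" "\<Union>i\<in>I. A i" h] insert sum_nonneg[of "A i \<inter> (\<Union>i\<in>I. A i)" h] assms(3) by auto
  then show ?case using insert by auto
qed simp

text \<open>All words of \<open>T\<close> are extended to a common length, at which the masses are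
  compared word by word.\<close>

lemma cylinder_cover:
  assumes d: "0 < d" "d \<le> 1/4" and Q: "8 * (1/4) powr Q + d powr Q = 1"
    and T: "finite T" "\<And>\<omega>. pre \<omega> (length w) = w \<Longrightarrow> \<exists>v\<in>T. pre \<omega> (length v) = v"
  shows "wt d w powr Q \<le> (\<Sum>v\<in>T. wt d v powr Q)"
proof -
  define N where "N = Max (insert (length w) (length ` T))"
  have N: "length w \<le> N" "\<And>v. v \<in> T \<Longrightarrow> length v \<le> N"
    using T(1) unfolding N_def by (auto intro: Max_ge)
  define X where "X v = (\<lambda>y. y @ v) ` words (N - length v)" for v :: "ltr list"
  have finX: "finite (X v)" for v by (simp add: X_def)
  have sumX: "(\<Sum>x\<in>X v. wt d x powr Q) = wt d v powr Q" for v
    unfolding X_def using sum_powr_words[OF d Q, of v "N - length v"]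
    by (subst sum.reindex) (auto simp: inj_on_def)
  have "X w \<subseteq> (\<Union>v\<in>T. X v)"
  proof
    fix x assume x: "x \<in> X w"
    then have lx: "length x = N" using N by (auto simp: X_def words_def)
    define \<omega> where "\<omega> = ext x (\<lambda>_. L13)"
    have px: "pre \<omega> N = x" using lx pre_ext_len[of x] by (auto simp: \<omega>_def)
    obtain y where y: "x = y @ w" using x by (auto simp: X_def)
    obtain u where "pre \<omega> N = u @ pre \<omega> (length w)" using pre_drop[OF N(1)] by blast
    then have "pre \<omega> (length w) = w" using y px by simp
    then obtain v where v: "v \<in> T" "pre \<omega> (length v) = v" using T(2) by blast
    obtain u where "pre \<omega> N = u @ pre \<omega> (length v)" "length u = N - length v" using pre_drop[OF N(2)[OF v(1)]] by blast
    then have "x \<in> X v" using v px by (auto simp: X_def words_def)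
    then show "x \<in> (\<Union>v\<in>T. X v)" using v by blast
  qed
  then have "(\<Sum>x\<in>X w. wt d x powr Q) \<le> (\<Sum>x\<in>(\<Union>v\<in>T. X v). wt d x powr Q)"
    by (intro sum_mono2) (auto simp: T finX)
  also have "\<dots> \<le> (\<Sum>v\<in>T. \<Sum>x\<in>X v. wt d x powr Q)"
    by (intro sum_UN_le) (auto simp: T finX)
  finally show ?thesis by (simp add: sumX)
qed

context coding
begin

context
  fixes d Q :: real
  assumes d: "0 < d" "d \<le> 1/4" and Qpos: "0 < Q" and Q: "8 * (1/4) powr Q + d powr Q = 1"
begin

lemma hausdorff_cell_le: "hausdorff (MX d) Q (cell w) \<le> ennreal ((2 / d * wt d w) powr Q)"
proof (rule hausdorff_least)
  fix \<delta> :: real assume "0 < \<delta>"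
  then obtain k where "(1/4::real) ^ k < \<delta> * d / 2" using real_arch_pow_inv[of "\<delta> * d / 2" "1/4"] d by auto
  then have k: "2 / d * (1/4::real) ^ k < \<delta>" using d by (simp add: field_simps)
  have "hausdorff_content (MX d) Q \<delta> (cell w) \<le> (\<Sum>v\<in>words k. epowr (mdiam (MX d) (cell (v @ w))) Q)"
  proof (rule content_le_finite)
    fix v assume v: "v \<in> words k"
    show "cell (v @ w) \<subseteq> mspace (MX d)" using cell_subset d by simp
    have "wt d (v @ w) \<le> (1/4) ^ length (v @ w)" by (rule wt_le[OF d])
    also have "\<dots> \<le> (1/4) ^ k" using v by (intro power_decreasing) (auto simp: words_def)
    finally have "2 / d * wt d (v @ w) \<le> 2 / d * (1/4) ^ k" using d by (intro mult_left_mono) auto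
    then show "mdiam (MX d) (cell (v @ w)) \<le> ennreal \<delta>"
      using cell_mdiam[OF d, of "v @ w"] k by (meson ennreal_leI order_trans less_imp_le)
  next
    show "cell w \<subseteq> (\<Union>v\<in>words k. cell (v @ w))" using cell_split by auto
  qed simp
  also have "\<dots> \<le> (\<Sum>v\<in>words k. ennreal ((2 / d * wt d (v @ w)) powr Q))"
  proof (rule sum_mono)
    fix v
    have "epowr (mdiam (MX d) (cell (v @ w))) Q \<le> epowr (ennreal (2 / d * wt d (v @ w))) Q"
      by (intro epowr_mono cell_mdiam[OF d]) (use Qpos in simp)
    also have "\<dots> = ennreal ((2 / d * wt d (v @ w)) powr Q)"
      using d wt_pos[OF d, of "v @ w"] by (intro epowr_ennreal) simp
    finally show "epowr (mdiam (MX d) (cell (v @ w))) Q \<le> ennreal ((2 / d * wt d (v @ w)) powr Q)" .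
  qed
  also have "\<dots> = ennreal (\<Sum>v\<in>words k. (2 / d * wt d (v @ w)) powr Q)"
    by (intro sum_ennreal) auto
  also have "(\<Sum>v\<in>words k. (2 / d * wt d (v @ w)) powr Q) = (\<Sum>v\<in>words k. (2 / d) powr Q * wt d (v @ w) powr Q)"
    by (intro sum.cong refl powr_mult)
  also have "\<dots> = (2 / d) powr Q * wt d w powr Q"
    unfolding sum_distrib_left[symmetric] sum_powr_words[OF d Q] ..
  also have "\<dots> = (2 / d * wt d w) powr Q"
    using d wt_pos[OF d, of w] by (subst powr_mult) auto
  finally show "hausdorff_content (MX d) Q \<delta> (cell w) \<le> ennreal ((2 / d * wt d w) powr Q)" .
qed

text \<open>A set of diameter \<open>t\<close> lies in at most 8 cells of weight at most
  \<open>2 * t / (16 * d ^ 3)\<close>: one factor \<open>4 * d\<close> comes from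
  \<open>ball_star\<close>, a second one from comparing adjacent cells, and a factor
  \<open>d\<close> from the choice of level in \<open>scale_exists\<close>.\<close>

definition KE :: real where "KE = 8 * (2 / (16 * d ^ 3)) powr Q"

lemma small_set_cover:
  assumes "U \<subseteq> range P" "mdiam (MX d) U \<le> ennreal t" "0 < t"
  obtains S where "finite S" "\<And>\<omega>. P \<omega> \<in> U \<Longrightarrow> \<exists>v\<in>S. pre \<omega> (length v) = v"
    "(\<Sum>v\<in>S. wt d v powr Q) \<le> KE * t powr Q"
proof (cases "U = {}")
  case True
  then show ?thesis using that[of "{}"] by (simp add: KE_def)
next
  case False
  then obtain \<omega> where \<omega>: "P \<omega> \<in> U" using assms by blast
  have dist: "pd d (P \<omega>) (P \<omega>') < 2 * t" if "P \<omega>' \<in> U" for \<omega>'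
  proof -
    have "ennreal (pd d (P \<omega>) (P \<omega>')) \<le> ennreal t"
      using mdist_le_mdiam[OF \<omega> that, of "MX d"] assms(2) d by (simp add: order_trans)
    then show ?thesis using assms(3) by (simp add: ennreal_le_iff)
  qed
  show ?thesis
  proof (cases "2 * t / (4 * d) \<le> 1")
    case True
    have "0 < 2 * t / (4 * d)" using assms d by simp
    from scale_exists[OF d this True, of \<omega>] obtain n where
      n: "2 * t / (4 * d) \<le> wt d (pre \<omega> n)" "d * wt d (pre \<omega> n) < 2 * t / (4 * d)" by blast
    have n1: "2 * t \<le> 4 * d * wt d (pre \<omega> n)" using n(1) d by (simp add: field_simps)
    show ?thesis
    proof (rule that[of "star (pre \<omega> n)"])
      fix \<omega>' assume "P \<omega>' \<in> U"
      then have "P \<omega>' \<in> mball_of (MX d) (P \<omega>) (2 * t)" using dist d by simp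
      from ball_star[OF d this n1] show "\<exists>v\<in>star (pre \<omega> n). pre \<omega>' (length v) = v"
        by (intro bexI[of _ "pre \<omega>' n"]) (auto simp: star_def)
    next
      have "(\<Sum>v\<in>star (pre \<omega> n). wt d v powr Q) \<le> of_nat (card (star (pre \<omega> n))) * ((2 / (16 * d ^ 3)) * t) powr Q"
      proof (rule sum_bounded_above)
        fix v assume "v \<in> star (pre \<omega> n)"
        then have "4 * d * wt d v \<le> wt d (pre \<omega> n)" using wt_adj[OF d] by (auto simp: star_def)
        then have "d * (4 * d * wt d v) \<le> d * wt d (pre \<omega> n)" using d by (intro mult_left_mono) auto
        then have "d * (4 * d * wt d v) \<le> 2 * t / (4 * d)" using n(2) by linarith
        then have "wt d v \<le> 2 / (16 * d ^ 3) * t" using d by (simp add: field_simps power3_eq_cube)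
        then show "wt d v powr Q \<le> (2 / (16 * d ^ 3) * t) powr Q"
          using wt_pos[OF d, of v] Qpos by (intro powr_mono2) auto
      qed
      also have "\<dots> \<le> 8 * ((2 / (16 * d ^ 3)) * t) powr Q"
        using star_card(2)[of "pre \<omega> n"] by (intro mult_right_mono) auto
      finally show "(\<Sum>v\<in>star (pre \<omega> n). wt d v powr Q) \<le> KE * t powr Q"
        unfolding KE_def mult.assoc using powr_mult[of "2 / (16 * d ^ 3)" t Q] d assms(3) by argo
    qed (rule star_card)
  next
    case False
    show ?thesis
    proof (rule that[of "{[]}"])
      have dQ: "1 \<le> 8 * (2 / (16 * d ^ 3) * t) powr Q"
      proof -
        have "2 * t / (4 * d) > 1" using False by simp
        moreover have "4 * d \<ge> 16 * d ^ 3"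
        proof -
          have "d * d \<le> 1/4 * (1/4)" using d by (intro mult_mono) auto
          then have "4 * d * (4 * (d * d)) \<le> 4 * d * 1" using d by (intro mult_left_mono) auto
          then show ?thesis by (simp add: power3_eq_cube)
        qed
        ultimately have "2 * t / (16 * d ^ 3) > 1" using d assms(3)
          by (smt (verit) divide_left_mono mult_pos_pos zero_less_power)
        then have "1 powr Q \<le> (2 / (16 * d ^ 3) * t) powr Q" using Qpos by (intro powr_mono2) auto
        then show ?thesis by simp
      qed
      also have "8 * (2 / (16 * d ^ 3) * t) powr Q = KE * t powr Q"
        unfolding KE_def mult.assoc using powr_mult[of "2 / (16 * d ^ 3)" t Q] d assms(3) by argo
      finally show "(\<Sum>v\<in>{[]}. wt d v powr Q) \<le> KE * t powr Q" by simp
    qed auto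
  qed
qed

text \<open>The mass distribution principle. Each member of a countable cover is contained in
  finitely many cylinders of comparable mass. Cylinders are open in the Cantor space, so compactness
  leaves finitely many of them, and \<open>cylinder_cover\<close> bounds their mass from
  below.\<close>

lemma hausdorff_cell_ge: "ennreal (wt d w powr Q) \<le> ennreal KE * hausdorff (MX d) Q (cell w)"
proof -
  have KE0: "0 < KE" using d by (simp add: KE_def)
  have "ennreal (wt d w powr Q) \<le> ennreal KE * (\<Sum>i. epowr (mdiam (MX d) (U i)) Q)"
    if U: "cell w \<subseteq> (\<Union>i. U i)" "\<forall>i. U i \<subseteq> mspace (MX d) \<and> mdiam (MX d) (U i) \<le> ennreal 1" for U :: "nat \<Rightarrow> 'p set"
  proof (rule ennreal_le_epsilon)
    fix e :: real assume e: "0 < e"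
    define s where "s i = enn2real (mdiam (MX d) (U i))" for i
    have s: "mdiam (MX d) (U i) = ennreal (s i)" "0 \<le> s i" for i
      using U(2) unfolding s_def by (auto simp: ennreal_enn2real_if top_unique dest: spec[of _ i])
    \<comment> \<open>\<open>small_set_cover\<close> needs a positive diameter bound, but members of
      the cover may be single points. Each \<open>s i\<close> is therefore enlarged to
      \<open>t i\<close> with \<open>t i powr Q = s i powr Q + b i\<close>, at a total cost of
      \<open>e\<close> after multiplication by \<open>KE\<close>.\<close>
    define b where "b i = e / KE * (1/2) ^ Suc i" for i
    have b: "0 < b i" for i using e KE0 by (simp add: b_def)
    define t where "t i = (s i powr Q + b i) powr (1 / Q)" for i
    have tQ: "t i powr Q = s i powr Q + b i" for i
      unfolding t_def using Qpos b[of i] add_nonneg_pos[of "s i powr Q" "b i"] by (simp add: powr_powr)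
    have tpos: "0 < t i" for i unfolding t_def using b[of i] add_nonneg_pos[of "s i powr Q" "b i"] by simp
    have st: "s i \<le> t i" for i
    proof (rule ccontr)
      assume "\<not> s i \<le> t i"
      then have "t i powr Q \<le> s i powr Q" using tpos[of i] Qpos by (intro powr_mono2) auto
      then show False using tQ[of i] b[of i] by simp
    qed
    have "\<exists>S. finite S \<and> (\<forall>\<omega>. P \<omega> \<in> U i \<longrightarrow> (\<exists>v\<in>S. pre \<omega> (length v) = v)) \<and>
       (\<Sum>v\<in>S. wt d v powr Q) \<le> KE * t i powr Q" for i
    proof -
      have "U i \<subseteq> range P" "mdiam (MX d) (U i) \<le> ennreal (t i)"
        using U(2) d s(1)[of i] st[of i] by (auto intro: ennreal_leI)
      from small_set_cover[OF this tpos] show ?thesis by metis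
    qed
    then obtain S where S: "\<And>i. finite (S i)" "\<And>i \<omega>. P \<omega> \<in> U i \<Longrightarrow> \<exists>v\<in>S i. pre \<omega> (length v) = v"
      "\<And>i. (\<Sum>v\<in>S i. wt d v powr Q) \<le> KE * t i powr Q"
      by metis
    define C where "C i = (\<Union>v\<in>S i. {\<omega>. pre \<omega> (length v) = v})" for i
    have "\<exists>\<F>. finite \<F> \<and> \<F> \<subseteq> range C \<and> {\<omega>. pre \<omega> (length w) = w} \<subseteq> \<Union>\<F>"
    proof -
      have "\<forall>U\<in>range C. openin cantor U" unfolding C_def using openin_cylinder by auto
      moreover have "{\<omega>. pre \<omega> (length w) = w} \<subseteq> \<Union> (range C)"
      proof
        fix \<omega> assume "\<omega> \<in> {\<omega>. pre \<omega> (length w) = w}"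
        then have "P \<omega> \<in> cell w" by (auto simp: cell_def)
        then obtain i where "P \<omega> \<in> U i" using U(1) by blast
        then have "\<omega> \<in> C i" using S(2) unfolding C_def by blast
        then show "\<omega> \<in> \<Union> (range C)" by blast
      qed
      ultimately show ?thesis using compactin_cylinder[of "length w" w] unfolding compactin_def by blast
    qed
    then obtain J where J: "finite J" "{\<omega>. pre \<omega> (length w) = w} \<subseteq> (\<Union>i\<in>J. C i)"
      by (metis finite_subset_image)
    have "wt d w powr Q \<le> (\<Sum>v\<in>(\<Union>i\<in>J. S i). wt d v powr Q)"
    proof (rule cylinder_cover[OF d Q])
      show "finite (\<Union>i\<in>J. S i)" using J S by auto
      fix \<omega> assume "pre \<omega> (length w) = w"
      then have "\<omega> \<in> (\<Union>i\<in>J. C i)" using J(2) by blast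
      then show "\<exists>v\<in>(\<Union>i\<in>J. S i). pre \<omega> (length v) = v" by (auto simp: C_def)
    qed
    also have "\<dots> \<le> (\<Sum>i\<in>J. \<Sum>v\<in>S i. wt d v powr Q)" by (intro sum_UN_le) (use J S in auto)
    also have "\<dots> \<le> (\<Sum>i\<in>J. KE * (s i powr Q + b i))" using S(3) tQ by (intro sum_mono) simp
    also have "\<dots> = KE * (\<Sum>i\<in>J. s i powr Q + b i)" by (simp add: sum_distrib_left)
    finally have "ennreal (wt d w powr Q) \<le> ennreal (KE * (\<Sum>i\<in>J. s i powr Q + b i))" by (rule ennreal_leI)
    also have "\<dots> = ennreal KE * (\<Sum>i\<in>J. ennreal (s i powr Q + b i))"
    proof -
      have nn: "0 \<le> s i powr Q + b i" for i using b[of i] by (simp add: add_nonneg_nonneg)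
      show ?thesis using KE0 nn by (subst sum_ennreal) (auto simp: ennreal_mult sum_nonneg)
    qed
    also have "\<dots> \<le> ennreal KE * (\<Sum>i. ennreal (s i powr Q + b i))"
      by (intro mult_left_mono sum_le_suminf) (use J in auto)
    also have "(\<Sum>i. ennreal (s i powr Q + b i)) = (\<Sum>i. ennreal (s i powr Q)) + (\<Sum>i. ennreal (b i))"
      using b by (subst suminf_add) (auto simp: less_imp_le)
    also have "(\<Sum>i. ennreal (b i)) = ennreal (e / KE)"
    proof -
      have "b sums (e / KE)"
        using sums_mult[OF power_half_series, of "e / KE"] unfolding b_def by simp
      then show ?thesis using b by (simp add: suminf_ennreal2 sums_iff less_imp_le)
    qed
    also have "(\<Sum>i. ennreal (s i powr Q)) = (\<Sum>i. epowr (mdiam (MX d) (U i)) Q)"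
      using s by (simp add: epowr_ennreal)
    also have "ennreal KE * ((\<Sum>i. epowr (mdiam (MX d) (U i)) Q) + ennreal (e / KE)) =
       ennreal KE * (\<Sum>i. epowr (mdiam (MX d) (U i)) Q) + ennreal e"
      using KE0 e by (simp add: distrib_left ennreal_mult[symmetric])
    finally show "ennreal (wt d w powr Q) \<le> ennreal KE * (\<Sum>i. epowr (mdiam (MX d) (U i)) Q) + ennreal e" .
  qed
  then have *: "ennreal (wt d w powr Q) / ennreal KE \<le> (\<Sum>i. epowr (mdiam (MX d) (U i)) Q)"
    if "cell w \<subseteq> (\<Union>i. U i)" "\<forall>i. U i \<subseteq> mspace (MX d) \<and> mdiam (MX d) (U i) \<le> ennreal 1" for U :: "nat \<Rightarrow> 'p set"
    using that KE0 by (intro divide_le_posI_ennreal) (auto simp: mult.commute)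
  have "ennreal (wt d w powr Q) / ennreal KE \<le> hausdorff_content (MX d) Q 1 (cell w)"
    unfolding hausdorff_content_def using * by (intro INF_greatest) auto
  also have "\<dots> \<le> hausdorff (MX d) Q (cell w)" by (rule content_le_hausdorff) simp
  finally have "ennreal KE * (ennreal (wt d w powr Q) / ennreal KE) \<le> ennreal KE * hausdorff (MX d) Q (cell w)"
    by (rule mult_left_mono) simp
  moreover have "ennreal KE * (ennreal (wt d w powr Q) / ennreal KE) = ennreal (wt d w powr Q)"
    using KE0 by (simp add: divide_ennreal ennreal_mult[symmetric])
  ultimately show ?thesis by simp
qed

lemma ahlfors_MX: "ahlfors_regular Q (MX d)"
proof -
  have KE0: "0 < KE" using d by (simp add: KE_def)
  define C1 where "C1 = 8 * (2 / d / (16 * d ^ 3)) powr Q"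
  \<comment> \<open>By \<open>scale_exists'\<close>, a ball of radius \<open>r\<close> contains a
    cell of weight at least \<open>(d * d / 2) * r\<close>.\<close>
  define C2 where "C2 = KE / (d * d / 2) powr Q"
  have upper: "hausdorff (MX d) Q (mball_of (MX d) x r) \<le> ennreal (C1 * r powr Q)"
    if x: "x \<in> range P" and r: "0 < r" for x r
  proof -
    obtain \<omega> where \<omega>: "x = P \<omega>" using x by blast
    have e: "8 * (2 / d * (r / (16 * d ^ 3))) powr Q = C1 * r powr Q"
      unfolding C1_def using powr_mult[of "2 / d / (16 * d ^ 3)" r Q] d r by simp
    show ?thesis
    proof (cases "r / (4 * d) \<le> 1")
      case True
      have "0 < r / (4 * d)" using r d by simp
      from scale_exists[OF d this True, of \<omega>] obtain n where
        n: "r / (4 * d) \<le> wt d (pre \<omega> n)" "d * wt d (pre \<omega> n) < r / (4 * d)" by blast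
      have n1: "r \<le> 4 * d * wt d (pre \<omega> n)" using n(1) d by (simp add: field_simps)
      have "mball_of (MX d) x r \<subseteq> (\<Union>v\<in>star (pre \<omega> n). cell v)"
      proof
        fix y assume y: "y \<in> mball_of (MX d) x r"
        then obtain \<omega>' where \<omega>': "y = P \<omega>'" using d by auto
        have "adj (pre \<omega> n) (pre \<omega>' n)" using ball_star[OF d _ n1] y unfolding \<omega> \<omega>' .
        then show "y \<in> (\<Union>v\<in>star (pre \<omega> n). cell v)"
          unfolding \<omega>' using P_in_cell[of \<omega>' n] by (intro UN_I[of "pre \<omega>' n"]) (auto simp: star_def)
      qed
      then have "hausdorff (MX d) Q (mball_of (MX d) x r) \<le> hausdorff (MX d) Q (\<Union>v\<in>star (pre \<omega> n). cell v)"
        by (rule hausdorff_mono)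
      also have "\<dots> \<le> (\<Sum>v\<in>star (pre \<omega> n). hausdorff (MX d) Q (cell v))"
        by (rule hausdorff_UN[OF star_card(1)])
      also have "\<dots> \<le> of_nat (card (star (pre \<omega> n))) * ennreal ((2 / d * (r / (16 * d ^ 3))) powr Q)"
      proof (rule sum_bounded_above)
        fix v assume "v \<in> star (pre \<omega> n)"
        then have "4 * d * wt d v \<le> wt d (pre \<omega> n)" using wt_adj[OF d] by (auto simp: star_def)
        then have "d * (4 * d * wt d v) \<le> d * wt d (pre \<omega> n)" using d by (intro mult_left_mono) auto
        then have "d * (4 * d * wt d v) \<le> r / (4 * d)" using n(2) by linarith
        then have "wt d v \<le> r / (16 * d ^ 3)" using d by (simp add: field_simps power3_eq_cube)
        then have "2 / d * wt d v \<le> 2 / d * (r / (16 * d ^ 3))" using d by (intro mult_left_mono) auto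
        then have "(2 / d * wt d v) powr Q \<le> (2 / d * (r / (16 * d ^ 3))) powr Q"
          using wt_pos[OF d, of v] Qpos d by (intro powr_mono2) auto
        then show "hausdorff (MX d) Q (cell v) \<le> ennreal ((2 / d * (r / (16 * d ^ 3))) powr Q)"
          using hausdorff_cell_le[of v] by (meson ennreal_leI order_trans)
      qed
      also have "\<dots> \<le> of_nat 8 * ennreal ((2 / d * (r / (16 * d ^ 3))) powr Q)"
        using star_card(2)[of "pre \<omega> n"] by (intro mult_right_mono of_nat_mono) auto
      also have "\<dots> = ennreal (8 * (2 / d * (r / (16 * d ^ 3))) powr Q)"
        by (simp add: ennreal_mult)
      finally show ?thesis unfolding e .
    next
      case False
      have "4 * d \<ge> 16 * d ^ 3"
      proof -
        have "d * d \<le> 1/4 * (1/4)" using d by (intro mult_mono) auto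
        then have "4 * d * (4 * (d * d)) \<le> 4 * d * 1" using d by (intro mult_left_mono) auto
        then show ?thesis by (simp add: power3_eq_cube)
      qed
      moreover have "r > 4 * d" using False d by (simp add: field_simps)
      ultimately have "1 \<le> r / (16 * d ^ 3)" using d by simp
      then have "2 / d * 1 \<le> 2 / d * (r / (16 * d ^ 3))" using d by (intro mult_left_mono) auto
      then have "(2 / d) powr Q \<le> (2 / d * (r / (16 * d ^ 3))) powr Q" using d Qpos by (intro powr_mono2) auto
      then have 1: "(2 / d) powr Q \<le> C1 * r powr Q" unfolding e[symmetric] by (smt (verit) powr_ge_zero)
      have "mball_of (MX d) x r \<subseteq> cell []" using d by (auto simp: cell_def)
      then have "hausdorff (MX d) Q (mball_of (MX d) x r) \<le> hausdorff (MX d) Q (cell [])" by (rule hausdorff_mono)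
      also have "\<dots> \<le> ennreal ((2 / d) powr Q)" using hausdorff_cell_le[of "[]"] by simp
      finally show ?thesis using 1 by (meson ennreal_leI order_trans)
    qed
  qed
  have lower: "ennreal (r powr Q / C2) \<le> hausdorff (MX d) Q (mball_of (MX d) x r)"
    if x: "x \<in> range P" and r: "0 < r" "ennreal r \<le> mdiam (MX d) (range P)" for x r
  proof -
    obtain \<omega> where \<omega>: "x = P \<omega>" using x by blast
    have "mdiam (MX d) (range P) \<le> ennreal (2 / d)" using d pd_le[OF d] by (intro mdiam_le) simp
    then have "ennreal r \<le> ennreal (2 / d)" using r(2) by simp
    then have "r \<le> 2 / d" using r d by (simp add: ennreal_le_iff)
    then have r': "0 < d * r / 2" "d * r / 2 \<le> 1" using r d by (auto simp: field_simps)
    from scale_exists'[OF d this, of \<omega>] obtain n where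
      n: "wt d (pre \<omega> n) < d * r / 2" "d * (d * r / 2) \<le> wt d (pre \<omega> n)" by blast
    have "2 / d * wt d (pre \<omega> n) < r" using n(1) d by (simp add: field_simps)
    then have "cell (pre \<omega> n) \<subseteq> mball_of (MX d) x r"
    proof (intro subsetI)
      fix y assume y: "y \<in> cell (pre \<omega> n)"
      show "y \<in> mball_of (MX d) x r"
        using cell_pd[OF d P_in_cell[of \<omega> n] y] cell_subset y \<open>2 / d * wt d (pre \<omega> n) < r\<close> d unfolding \<omega> by auto
    qed
    have "(d * d / 2) powr Q * r powr Q = (d * (d * r / 2)) powr Q"
      using powr_mult[of "d * d / 2" r Q] d r by (simp add: mult.assoc)
    also have "\<dots> \<le> wt d (pre \<omega> n) powr Q" using n(2) d r Qpos by (intro powr_mono2) auto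
    finally have "r powr Q / C2 * KE \<le> wt d (pre \<omega> n) powr Q"
      unfolding C2_def using KE0 d by (simp add: field_simps)
    then have "ennreal (r powr Q / C2 * KE) \<le> ennreal (wt d (pre \<omega> n) powr Q)" by (rule ennreal_leI)
    also have "\<dots> \<le> ennreal KE * hausdorff (MX d) Q (cell (pre \<omega> n))" by (rule hausdorff_cell_ge)
    also have "\<dots> \<le> ennreal KE * hausdorff (MX d) Q (mball_of (MX d) x r)"
      by (intro mult_left_mono hausdorff_mono) (use \<open>cell (pre \<omega> n) \<subseteq> mball_of (MX d) x r\<close> in auto)
    finally have "ennreal KE * ennreal (r powr Q / C2) \<le> ennreal KE * hausdorff (MX d) Q (mball_of (MX d) x r)"
      using KE0 by (simp add: ennreal_mult[symmetric] C2_def mult.commute)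
    then show ?thesis using KE0 by (simp add: ennreal_mult_le_mult_iff)
  qed
  have C2: "0 < C2" unfolding C2_def using KE0 d by simp
  define C where "C = max 2 (max C1 C2)"
  have C: "C > 1" "C1 \<le> C" "C2 \<le> C" by (auto simp: C_def)
  show ?thesis
    unfolding ahlfors_regular_def
  proof (intro conjI exI[of _ C] ballI allI impI)
    fix x and r :: real assume x: "x \<in> mspace (MX d)" and r: "0 < r" "ennreal r \<le> mdiam (MX d) (mspace (MX d))"
    have "r powr Q / C \<le> r powr Q / C2" using C C2 by (intro divide_left_mono) auto
    then show "ennreal (r powr Q / C) \<le> hausdorff (MX d) Q (mball_of (MX d) x r)"
      using lower[of x r] x r d by (auto intro: order_trans[OF ennreal_leI])
    have "C1 * r powr Q \<le> C * r powr Q" using C by (intro mult_right_mono) auto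
    then show "hausdorff (MX d) Q (mball_of (MX d) x r) \<le> ennreal (C * r powr Q)"
      using upper[of x r] x r d by (auto intro: order_trans[OF _ ennreal_leI])
  qed (use Qpos compact_MX[OF d] C in auto)
qed

end

end

section \<open>Quasisymmetric deformations\<close>

text \<open>The control function of a power quasisymmetry: linear for small ratios, of exponent
  \<open>s\<close> for large ones.\<close>

lemma homeomorphism_max_powr:
  fixes s K a :: real
  assumes "1 \<le> s" "0 < K" "0 < a"
  shows "homeomorphism {0..} {0..} (\<lambda>t. K * max (a * t) ((a * t) powr s)) (\<lambda>y. min (y / K) ((y / K) powr (1 / s)) / a)"
proof (rule homeomorphismI)
  show "continuous_on {0..} (\<lambda>t. K * max (a * t) ((a * t) powr s))"
    using assms by (intro continuous_on_mult continuous_on_const continuous_on_max continuous_on_id continuous_on_powr') auto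
  show "continuous_on {0..} (\<lambda>y. min (y / K) ((y / K) powr (1 / s)) / a)"
    using assms by (intro continuous_on_divide continuous_on_const continuous_on_min continuous_on_id continuous_on_powr') auto
  show "(\<lambda>t. K * max (a * t) ((a * t) powr s)) ` {0..} \<subseteq> {0..}"
    using assms by (auto simp: max_def)
  show "(\<lambda>y. min (y / K) ((y / K) powr (1 / s)) / a) ` {0..} \<subseteq> {0..}"
    using assms by (auto simp: min_def)
  have le: "x powr s \<le> x" if "0 \<le> x" "x \<le> 1" for x :: real
    using powr_mono'[of 1 s x] that assms by (cases "x = 0") auto
  have ge: "x \<le> x powr s" if "1 \<le> x" for x :: real
    using powr_mono[of 1 s x] that assms by auto
  have le': "x powr (1 / s) \<le> x" if "1 \<le> x" for x :: real
    using powr_mono[of "1 / s" 1 x] that assms by auto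
  have ge': "x \<le> x powr (1 / s)" if "0 \<le> x" "x \<le> 1" for x :: real
    using powr_mono'[of "1 / s" 1 x] that assms by (cases "x = 0") auto
  fix x :: real assume x: "x \<in> {0..}"
  show "min (K * max (a * x) ((a * x) powr s) / K) ((K * max (a * x) ((a * x) powr s) / K) powr (1 / s)) / a = x"
  proof (cases "a * x \<le> 1")
    case True
    then show ?thesis using le[of "a * x"] ge'[of "a * x"] x assms by (simp add: max_absorb1 min_absorb1)
  next
    case False
    then have "1 \<le> (a * x) powr s" using ge[of "a * x"] by simp
    then show ?thesis using False ge[of "a * x"] le'[of "(a * x) powr s"] x assms
      by (simp add: max_absorb2 min_absorb2 powr_powr)
  qed
  define z where "z = x / K"
  have z: "0 \<le> z" "K * z = x" using x assms by (auto simp: z_def)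
  show "K * max (a * (min (x / K) ((x / K) powr (1 / s)) / a)) ((a * (min (x / K) ((x / K) powr (1 / s)) / a)) powr s) = x"
    unfolding z_def[symmetric]
  proof (cases "z \<le> 1")
    case True
    then show "K * max (a * (min z (z powr (1 / s)) / a)) ((a * (min z (z powr (1 / s)) / a)) powr s) = x"
      using le[of z] ge'[of z] z assms by (simp add: max_absorb1 min_absorb1)
  next
    case False
    then have "1 powr (1 / s) \<le> z powr (1 / s)" using assms by (intro powr_mono2) auto
    then show "K * max (a * (min z (z powr (1 / s)) / a)) ((a * (min z (z powr (1 / s)) / a)) powr s) = x"
      using False ge[of "z powr (1 / s)"] le'[of z] z assms by (simp add: max_absorb2 min_absorb2 powr_powr)
  qed
qed

context coding
begin

lemma continuous_id:
  assumes a: "0 < a" "a \<le> 1/4" and b: "0 < b" "b \<le> 1/4"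
  shows "continuous_map (mtopology_of (MX a)) (mtopology_of (MX b)) id"
  unfolding mtopology_of_def Metric_space.metric_continuous_map[OF Metric_space_mspace_mdist Metric_space_mspace_mdist]
proof (intro conjI ballI allI impI)
  fix x and \<epsilon> :: real assume "x \<in> mspace (MX a)" "0 < \<epsilon>"
  then obtain \<omega> where \<omega>: "x = P \<omega>" using a by auto
  obtain n where "(1/4::real) ^ n < \<epsilon> * b / 2" using real_arch_pow_inv[of "\<epsilon> * b / 2" "1/4"] b \<open>0 < \<epsilon>\<close> by auto
  then have n: "2 / b * (1/4::real) ^ n < \<epsilon>" using b by (simp add: field_simps)
  show "\<exists>\<delta>>0. \<forall>y. y \<in> mspace (MX a) \<and> mdist (MX a) x y < \<delta> \<longrightarrow> mdist (MX b) (id x) (id y) < \<epsilon>"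
  proof (intro exI[of _ "4 * a * wt a (pre \<omega> n)"] conjI allI impI)
    show "0 < 4 * a * wt a (pre \<omega> n)" using a wt_pos[OF a] by simp
    fix y assume y: "y \<in> mspace (MX a) \<and> mdist (MX a) x y < 4 * a * wt a (pre \<omega> n)"
    then obtain \<omega>' where \<omega>': "y = P \<omega>'" using a by auto
    have "adj (pre \<omega> n) (pre \<omega>' n)" using y pd_lower[OF a, of \<omega> n \<omega>'] a unfolding \<omega> \<omega>' by auto
    from pd_upper[OF b this] have "pd b x y \<le> 2 / b * wt b (pre \<omega> n)" unfolding \<omega> \<omega>' .
    also have "\<dots> \<le> 2 / b * (1/4) ^ n" using wt_le[OF b, of "pre \<omega> n"] b by (intro mult_left_mono) auto
    finally show "mdist (MX b) (id x) (id y) < \<epsilon>" using n b by simp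
  qed
qed (use a b in auto)

lemma separation_level:
  assumes "P \<omega> \<noteq> P \<omega>'"
  obtains n where "adj (pre \<omega> n) (pre \<omega>' n)" "\<not> adj (pre \<omega> (Suc n)) (pre \<omega>' (Suc n))"
proof -
  have ex: "\<exists>n. \<not> adj (pre \<omega> n) (pre \<omega>' n)" using assms P_eq_iff by blast
  define N where "N = (LEAST n. \<not> adj (pre \<omega> n) (pre \<omega>' n))"
  have N: "\<not> adj (pre \<omega> N) (pre \<omega>' N)" using LeastI_ex[OF ex] unfolding N_def .
  then obtain n where n: "N = Suc n" by (cases N) auto
  then have "adj (pre \<omega> n) (pre \<omega>' n)" using not_less_Least[of n "\<lambda>n. \<not> adj (pre \<omega> n) (pre \<omega>' n)"] N_def by auto
  then show ?thesis using that N n by blast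
qed

text \<open>In either metric the distance of two points is comparable to the weight of the cell of
  \<open>x\<close> at the level at which they separate. From one level to the next this weight drops
  by a factor between \<open>d\<close> and 1/4, whereas it drops by exactly 1/4 in the original
  metric. So ratios of distances are preserved linearly if \<open>y\<close> separates from
  \<open>x\<close> after \<open>z\<close>, and up to the exponent \<open>log 4 (1 / d)\<close>
  otherwise. The 32 in the control function is 8 / (1/4), the quotient of the two comparison
  constants for \<open>d = 1/4\<close>.\<close>

lemma quasisymmetry_id:
  assumes d: "0 < d" "d \<le> 1/4"
  shows "quasisymmetry (MX (1/4)) (MX d) id"
proof -
  have q: "0 < (1/4::real)" "(1/4::real) \<le> 1/4" by auto
  define s where "s = log 4 (1 / d)"
  have s4: "4 powr s = 1 / d" using d by (simp add: s_def)
  have "log 4 4 \<le> log 4 (1 / d)" using d by (subst log_le_cancel_iff) (auto simp: field_simps)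
  then have s: "1 \<le> s" by (simp add: s_def)
  \<comment> \<open>The constant 2 / d of \<open>pd_upper\<close> over the constant 4 * d of
    \<open>pd_lower\<close>, with a further factor \<open>d\<close> because the lower bound is read
    off one level later.\<close>
  define K where "K = 1 / (2 * d ^ 3)"
  have K: "0 < K" using d by (simp add: K_def)
  have main: "pd d x y / pd d x z \<le> K * max (32 * (pd (1/4) x y / pd (1/4) x z)) ((32 * (pd (1/4) x y / pd (1/4) x z)) powr s)"
    (is "_ \<le> K * max (32 * ?t) _")
    if xyz: "x \<in> range P" "y \<in> range P" "z \<in> range P" "x \<noteq> z" for x y z
  proof (cases "x = y")
    case True
    have "pd d y y = 0" "0 \<le> ?t" using Metric_space.zero[OF Metric_space_pd[OF d]] 
       Metric_space.nonneg[OF Metric_space_pd[OF q]] xyz by auto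
    then show ?thesis using True K by (simp add: max_def)
  next
    case False
    obtain \<omega> \<omega>' \<omega>'' where w: "x = P \<omega>" "y = P \<omega>'" "z = P \<omega>''" using xyz by blast
    obtain n where n: "adj (pre \<omega> n) (pre \<omega>' n)" "\<not> adj (pre \<omega> (Suc n)) (pre \<omega>' (Suc n))"
      using separation_level False w by metis
    obtain m where m: "adj (pre \<omega> m) (pre \<omega>'' m)" "\<not> adj (pre \<omega> (Suc m)) (pre \<omega>'' (Suc m))"
      using separation_level xyz(4) w by metis
    define W where "W = (\<lambda>k. wt d (pre \<omega> k))"
    have W: "0 < W k" for k unfolding W_def by (rule wt_pos[OF d])
    have Wle: "W (i + k) \<le> (1/4) ^ k * W i" and Wge: "d ^ k * W i \<le> W (i + k)" for i k
      unfolding W_def using wt_pre_le[OF d] wt_pre_ge[OF d] by auto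
    define Q where "Q = (1/4::real) ^ n / (1/4) ^ m"
    have Q0: "0 < Q" by (simp add: Q_def)
    have t: "Q \<le> 32 * ?t"
    proof -
      have "(1/4) ^ n / 4 \<le> pd (1/4) x y" using pd_lower[OF q n(2)] unfolding w wt_quarter by simp
      moreover have "pd (1/4) x z \<le> 8 * (1/4) ^ m" using pd_upper[OF q m(1)] unfolding w wt_quarter by simp
      moreover have "0 < pd (1/4) x z" using pd_lower[OF q m(2)] unfolding w wt_quarter by (smt (verit) zero_less_power divide_pos_pos mult_pos_pos)
      ultimately have "((1/4) ^ n / 4) / (8 * (1/4) ^ m) \<le> ?t" by (intro frac_le) (auto simp: Metric_space.nonneg[OF Metric_space_pd[OF q]])
      then show ?thesis by (simp add: Q_def field_simps)
    qed
    have "pd d x y / pd d x z \<le> (2 / d * W n) / (4 * d * (d * W m))"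
    proof (rule frac_le)
      show "pd d x y \<le> 2 / d * W n" using pd_upper[OF d n(1)] unfolding w W_def .
      have "4 * d * (d * W m) \<le> 4 * d * W (Suc m)" using Wge[of 1 m] d by (intro mult_left_mono) auto
      also have "\<dots> \<le> pd d x z" using pd_lower[OF d m(2)] unfolding w W_def .
      finally show "4 * d * (d * W m) \<le> pd d x z" .
    qed (use d W in \<open>auto intro: less_imp_le\<close>)
    also have "\<dots> = K * (W n / W m)" using d W[of m] by (simp add: K_def field_simps power3_eq_cube)
    also have "\<dots> \<le> K * max (32 * ?t) ((32 * ?t) powr s)"
    proof (intro mult_left_mono)
      show "W n / W m \<le> max (32 * ?t) ((32 * ?t) powr s)"
      proof (cases "m \<le> n")
        case True
        then have "W n \<le> (1/4) ^ (n - m) * W m" using Wle[of m "n - m"] by simp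
        then have "W n / W m \<le> (1/4) ^ (n - m)" using W[of m] by (simp add: field_simps)
        also have "\<dots> = Q" using True by (simp add: Q_def power_diff)
        finally show ?thesis using t by simp
      next
        case False
        then have "d ^ (m - n) * W n \<le> W m" using Wge[of "m - n" n] by simp
        then have "W n / W m \<le> (1 / d) ^ (m - n)" using W[of m] d by (simp add: field_simps power_divide)
        also have "\<dots> = (4 powr s) powr real (m - n)" using d by (simp add: s4 powr_realpow)
        also have "\<dots> = (4 powr real (m - n)) powr s" by (simp add: powr_powr mult.commute)
        also have "4 powr real (m - n) = Q"
        proof -
          have "(1/4::real) ^ m = (1/4) ^ n * (1/4) ^ (m - n)" using False by (simp add: power_add[symmetric])
          then show ?thesis by (simp add: Q_def powr_realpow field_simps power_divide)
        qed
        also have "Q powr s \<le> (32 * ?t) powr s" using t Q0 s by (intro powr_mono2) auto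
        finally show ?thesis by simp
      qed
    qed (use K in simp)
    finally show ?thesis .
  qed
  have "homeomorphic_map (mtopology_of (MX (1/4))) (mtopology_of (MX d)) id"
    unfolding homeomorphic_map_maps homeomorphic_maps_def
    by (intro exI[of _ id]) (use continuous_id[OF q d] continuous_id[OF d q] in auto)
  then show ?thesis
    unfolding quasisymmetry_def
    using homeomorphism_max_powr[OF s K, of 32] main d
    by (intro conjI exI[of _ "\<lambda>t. K * max (32 * t) ((32 * t) powr s)"]
        exI[of _ "\<lambda>y. min (y / K) ((y / K) powr (1 / s)) / 32"]) auto
qed

end

section \<open>Averaging and energy\<close>

lemma mdist_self [simp]: "x \<in> mspace m \<Longrightarrow> mdist m x x = 0"
  by simp

definition avg :: "(cv \<Rightarrow> real) \<Rightarrow> cv \<Rightarrow> real" where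
  "avg u v = (u (Ch v False) + u (Ch v True)) / 2"

primrec chs :: "cv \<Rightarrow> bool list \<Rightarrow> cv" where
  "chs v [] = v"
| "chs v (c # cs) = Ch (chs v cs) c"

lemma avg_pow_ge:
  assumes "\<And>cs. length cs = k \<Longrightarrow> c \<le> u (chs v cs)"
  shows "c \<le> (avg ^^ k) u v"
  using assms
proof (induction k arbitrary: u)
  case (Suc k)
  have "c \<le> (avg ^^ k) (avg u) v"
  proof (rule Suc.IH)
    fix cs :: "bool list" assume "length cs = k"
    then show "c \<le> avg u (chs v cs)"
      using Suc.prems[of "False # cs"] Suc.prems[of "True # cs"] by (simp add: avg_def)
  qed
  then show ?case by (simp add: funpow_swap1)
qed (metis chs.simps(1) funpow_0 list.size(3))

lemma avg_pow_le:
  assumes "\<And>cs. length cs = k \<Longrightarrow> u (chs v cs) \<le> c"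
  shows "(avg ^^ k) u v \<le> c"
  using assms
proof (induction k arbitrary: u)
  case (Suc k)
  have "(avg ^^ k) (avg u) v \<le> c"
  proof (rule Suc.IH)
    fix cs :: "bool list" assume "length cs = k"
    then show "avg u (chs v cs) \<le> c"
      using Suc.prems[of "False # cs"] Suc.prems[of "True # cs"] by (simp add: avg_def)
  qed
  then show ?case by (simp add: funpow_swap1)
qed (metis chs.simps(1) funpow_0 list.size(3))

definition side :: "bool \<Rightarrow> ltr set" where
  "side s = (if s then {L67, L68} else {L13, L23})"

lemma chs_vert: "\<exists>x. length x = length cs \<and> set x \<subseteq> side s \<and> chs (vert w s) cs = vert (x @ w) s"
proof (induction cs)
  case (Cons c cs)
  then obtain x where x: "length x = length cs" "set x \<subseteq> side s" "chs (vert w s) cs = vert (x @ w) s" by blast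
  define f where "f = (if s then if c then L68 else L67 else if c then L23 else L13)"
  have "f \<in> side s" "vert (f # x @ w) s = Ch (vert (x @ w) s) c" by (auto simp: f_def side_def)
  then show ?case using x by (intro exI[of _ "f # x"]) auto
qed auto

definition good :: "nat \<Rightarrow> ltr list set" where
  "good n = {w \<in> words n. L45 \<notin> set w}"

lemma finite_good [simp]: "finite (good n)"
  by (simp add: good_def)

lemma good_0 [simp]: "good 0 = {[]}"
  by (auto simp: good_def)

lemma sum_good_Suc:
  fixes h :: "ltr list \<Rightarrow> real"
  shows "(\<Sum>w\<in>good (Suc n). h w) = (\<Sum>w\<in>good n. \<Sum>f\<in>- {L45}. h (f # w))"
proof -
  have g: "good (Suc n) = (\<lambda>(f, w). f # w) ` ((- {L45}) \<times> good n)"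
    by (auto simp: good_def words_def length_Suc_conv image_iff)
  have "(\<Sum>w\<in>good (Suc n). h w) = (\<Sum>p\<in>(- {L45}) \<times> good n. h (fst p # snd p))"
    unfolding g by (subst sum.reindex) (auto simp: inj_on_def case_prod_beta)
  also have "\<dots> = (\<Sum>f\<in>- {L45}. \<Sum>w\<in>good n. h (f # w))"
    by (simp add: sum.cartesian_product case_prod_beta)
  finally show ?thesis by (simp add: sum.swap[of _ "good n"])
qed

lemma Compl_L45: "- {L45} = {L13, L23, L34, L35, L46, L56, L67, L68}"
  using UNIV_ltr by auto

text \<open>Twice the increment is the sum of u(7) - u(1) and u(8) - u(2), each telescoped along its
  own path of four edges.\<close>

lemma gr_avg: "\<bar>gr (avg u) w\<bar> \<le> (\<Sum>f\<in>- {L45}. \<bar>gr u (f # w)\<bar>) / 2"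
proof -
  have "2 * gr (avg u) w = gr u (L13 # w) + gr u (L23 # w) + gr u (L34 # w) + gr u (L46 # w)
      + gr u (L35 # w) + gr u (L56 # w) + gr u (L67 # w) + gr u (L68 # w)"
    by (simp add: gr_def avg_def field_simps)
  then show ?thesis unfolding Compl_L45 by simp
qed

lemma powr_three_halves: "0 \<le> x \<Longrightarrow> x powr (3/2) = sqrt x ^ 3"
  by (cases "x = 0") (simp_all add: powr_half_sqrt[symmetric] powr_powr flip: powr_numeral)

text \<open>Half the sum of eight numbers is four times their mean, and 4 powr (3/2) is the number
  of terms. Jensen's inequality thus costs no constant at this exponent, which is why the estimate
  can be iterated over all levels.\<close>

lemma jensen8:
  fixes x :: "ltr \<Rightarrow> real" assumes "\<And>f. 0 \<le> x f"
  shows "((\<Sum>f\<in>- {L45}. x f) / 2) powr (3/2) \<le> (\<Sum>f\<in>- {L45}. x f powr (3/2))"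
proof -
  define a where "a = (\<Sum>f\<in>- {L45}. x f) / 8"
  define t where "t = sqrt a"
  have a: "0 \<le> a" unfolding a_def using assms by (simp add: sum_nonneg)
  then have t: "0 \<le> t" "t\<^sup>2 = a" by (auto simp: t_def)
  have c: "card (- {L45}) = 8" unfolding Compl_L45 by simp
  \<comment> \<open>tangent line of \<open>x powr (3/2)\<close> at the mean; the gap is \<open>(s - t)\<^sup>2 (s + t/2)\<close>\<close>
  have tangent: "t ^ 3 + 3/2 * t * (x f - a) \<le> x f powr (3/2)" for f
  proof -
    define s where "s = sqrt (x f)"
    have s: "0 \<le> s" "s\<^sup>2 = x f" using assms by (auto simp: s_def)
    have "0 \<le> (s - t)\<^sup>2 * (s + t / 2)" using s t by simp
    also have "\<dots> = s ^ 3 - t ^ 3 - 3/2 * t * (s\<^sup>2 - t\<^sup>2)"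
      by (simp add: power2_eq_square power3_eq_cube field_simps)
    finally show ?thesis using powr_three_halves[OF assms, of f] s t by (simp add: s_def)
  qed
  have "((\<Sum>f\<in>- {L45}. x f) / 2) powr (3/2) = sqrt (4 * a) ^ 3"
    using powr_three_halves[of "4 * a"] a by (simp add: a_def)
  also have "\<dots> = 8 * t ^ 3" by (simp add: real_sqrt_mult t_def power_mult_distrib)
  also have "\<dots> = (\<Sum>f\<in>- {L45}. t ^ 3 + 3/2 * t * (x f - a))"
  proof -
    have "(\<Sum>f\<in>- {L45}. x f - a) = 0" by (simp add: sum_subtractf c a_def)
    then show ?thesis by (simp only: sum.distrib sum_distrib_left[symmetric] sum_constant c)
  qed
  also have "\<dots> \<le> (\<Sum>f\<in>- {L45}. x f powr (3/2))" by (intro sum_mono tangent)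
  finally show ?thesis .
qed

lemma energy_avg: "\<bar>gr (avg u) w\<bar> powr (3/2) \<le> (\<Sum>f\<in>- {L45}. \<bar>gr u (f # w)\<bar> powr (3/2))"
proof -
  have "\<bar>gr (avg u) w\<bar> powr (3/2) \<le> ((\<Sum>f\<in>- {L45}. \<bar>gr u (f # w)\<bar>) / 2) powr (3/2)"
    using gr_avg by (intro powr_mono2) auto
  also have "\<dots> \<le> (\<Sum>f\<in>- {L45}. \<bar>gr u (f # w)\<bar> powr (3/2))" by (rule jensen8) simp
  finally show ?thesis .
qed

lemma energy_avg_pow: "\<bar>gr ((avg ^^ k) u) w\<bar> powr (3/2) \<le> (\<Sum>v\<in>good k. \<bar>gr u (v @ w)\<bar> powr (3/2))"
proof (induction k arbitrary: u)
  case (Suc k)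
  have "\<bar>gr ((avg ^^ k) (avg u)) w\<bar> powr (3/2) \<le> (\<Sum>v\<in>good k. \<bar>gr (avg u) (v @ w)\<bar> powr (3/2))"
    by (rule Suc.IH)
  also have "\<dots> \<le> (\<Sum>v\<in>good k. \<Sum>f\<in>- {L45}. \<bar>gr u (f # v @ w)\<bar> powr (3/2))"
    by (intro sum_mono energy_avg)
  also have "\<dots> = (\<Sum>v\<in>good (Suc k). \<bar>gr u (v @ w)\<bar> powr (3/2))"
    by (simp add: sum_good_Suc)
  finally show ?case by (simp add: funpow_swap1)
qed simp

text \<open>The form in which quasisymmetry is used below: \<open>\<eta>\<close> is bounded on each
  compact interval \<open>{0..C}\<close>. Multiplying out the quotient also admits
  \<open>x = z\<close>.\<close>

lemma quasisymmetry_weak: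
  assumes "quasisymmetry m m' f"
  obtains H :: "real \<Rightarrow> real" where "\<And>C. 1 \<le> H C"
    "\<And>C x y z. x \<in> mspace m \<Longrightarrow> y \<in> mspace m \<Longrightarrow> z \<in> mspace m \<Longrightarrow> mdist m x y \<le> C * mdist m x z \<Longrightarrow>
      mdist m' (f x) (f y) \<le> H C * mdist m' (f x) (f z)"
proof -
  obtain \<eta> \<theta> :: "real \<Rightarrow> real" where \<eta>: "homeomorphism {0..} {0..} \<eta> \<theta>"
    and q: "\<And>x y z. x \<in> mspace m \<Longrightarrow> y \<in> mspace m \<Longrightarrow> z \<in> mspace m \<Longrightarrow> x \<noteq> z \<Longrightarrow>
           mdist m' (f x) (f y) / mdist m' (f x) (f z) \<le> \<eta> (mdist m x y / mdist m x z)"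
    and hom: "homeomorphic_map (mtopology_of m) (mtopology_of m') f"
    using assms unfolding quasisymmetry_def by blast
  have inj: "inj_on f (mspace m)" and im: "f ` mspace m = mspace m'"
    using homeomorphic_imp_injective_map[OF hom] homeomorphic_imp_surjective_map[OF hom] by auto
  have "\<exists>B. \<forall>t\<in>{0..C}. \<eta> t \<le> B" for C
  proof -
    have "continuous_on {0..C} \<eta>" 
      using \<eta> unfolding homeomorphism_def by (auto intro: continuous_on_subset)
    then have "bounded (\<eta> ` {0..C})" by (intro compact_imp_bounded compact_continuous_image) auto
    then show ?thesis by (auto simp: bounded_iff abs_le_iff)
  qed
  then have "\<forall>C. \<exists>B. \<forall>t\<in>{0..C}. \<eta> t \<le> B" by blast
  then obtain B where "\<forall>C. \<forall>t\<in>{0..C}. \<eta> t \<le> B C" by (rule choice[THEN exE])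
  then have B: "\<And>C t. 0 \<le> t \<Longrightarrow> t \<le> C \<Longrightarrow> \<eta> t \<le> B C" by simp
  show ?thesis
  proof (rule that[of "\<lambda>C. max 1 (B C)"])
    fix C x y z assume xyz: "x \<in> mspace m" "y \<in> mspace m" "z \<in> mspace m" "mdist m x y \<le> C * mdist m x z"
    show "mdist m' (f x) (f y) \<le> max 1 (B C) * mdist m' (f x) (f z)"
    proof (cases "x = z")
      case True
      then have "mdist m x y \<le> 0" using xyz by simp
      then have "x = y" using xyz by (metis mdist_nonneg mdist_zero antisym)
      moreover have "f y \<in> mspace m'" using im xyz by blast
      ultimately show ?thesis using True by simp
    next
      case False
      have p: "0 < mdist m x z" using False xyz by (metis mdist_nonneg mdist_zero order_less_le)
      have "f x \<noteq> f z" using inj xyz False by (auto dest: inj_onD)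
      then have p': "0 < mdist m' (f x) (f z)" using xyz im by (metis imageI mdist_nonneg mdist_zero order_less_le)
      have "mdist m' (f x) (f y) / mdist m' (f x) (f z) \<le> \<eta> (mdist m x y / mdist m x z)" using q xyz False by blast
      also have "\<dots> \<le> B C" using p xyz(4) by (intro B) (auto simp: field_simps)
      also have "\<dots> \<le> max 1 (B C)" by simp
      finally show ?thesis using p' by (simp add: field_simps)
    qed
  qed simp
qed

lemma hausdorff_finite:
  assumes "ahlfors_regular Q m"
  shows "hausdorff m Q (mspace m) < top"
proof (cases "\<exists>x\<in>mspace m. \<exists>y\<in>mspace m. x \<noteq> y")
  case True
  then obtain x0 y0 where xy: "x0 \<in> mspace m" "y0 \<in> mspace m" "x0 \<noteq> y0" by blast
  define r where "r = mdist m x0 y0"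
  have r: "0 < r" using xy by (metis mdist_nonneg mdist_zero order_less_le r_def)
  have rd: "ennreal r \<le> mdiam m (mspace m)" unfolding r_def using xy by (intro mdist_le_mdiam)
  obtain C where C: "\<And>x. x \<in> mspace m \<Longrightarrow> hausdorff m Q (mball_of m x r) \<le> ennreal (C * r powr Q)"
    using assms r rd unfolding ahlfors_regular_def by blast
  have cpt: "compactin (mtopology_of m) (mspace m)"
    using assms unfolding ahlfors_regular_def compact_space_def by simp
  have op: "openin (mtopology_of m) (mball_of m x r)" for x
    unfolding mtopology_of_def mball_of_def by (rule Metric_space.openin_mball[OF Metric_space_mspace_mdist])
  have "\<exists>\<F>. finite \<F> \<and> \<F> \<subseteq> (\<lambda>x. mball_of m x r) ` mspace m \<and> mspace m \<subseteq> \<Union>\<F>"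
  proof -
    have "\<forall>U\<in>(\<lambda>x. mball_of m x r) ` mspace m. openin (mtopology_of m) U" using op by blast
    moreover have "mspace m \<subseteq> \<Union> ((\<lambda>x. mball_of m x r) ` mspace m)"
    proof
      fix x assume "x \<in> mspace m"
      then show "x \<in> \<Union> ((\<lambda>x. mball_of m x r) ` mspace m)"
        using r by (intro UN_I[of x]) auto
    qed
    ultimately show ?thesis using cpt unfolding compactin_def by blast
  qed
  then obtain F where F: "finite F" "F \<subseteq> mspace m" "mspace m \<subseteq> (\<Union>x\<in>F. mball_of m x r)"
    by (metis finite_subset_image)
  have "hausdorff m Q (mspace m) \<le> (\<Sum>x\<in>F. hausdorff m Q (mball_of m x r))"
    using hausdorff_mono[OF F(3)] hausdorff_UN[OF F(1)] order_trans by blast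
  also have "\<dots> \<le> (\<Sum>x\<in>F. ennreal (C * r powr Q))" using C F by (intro sum_mono) auto
  also have "\<dots> < top" using F by (simp add: ennreal_mult_less_top of_nat_less_top)
  finally show ?thesis .
next
  \<comment> \<open>In a space with at most one point no radius is admissible in the definition of
    regularity, so the measure is bounded by a direct cover.\<close>
  case False
  have "mdiam m (mspace m) = 0"
  proof -
    have "mdiam m (mspace m) \<le> ennreal 0"
    proof (rule mdiam_le)
      fix x y assume "x \<in> mspace m" "y \<in> mspace m"
      then show "mdist m x y \<le> 0" using False mdist_zero[of x m y] by fastforce
    qed
    then show ?thesis by simp
  qed
  then have "hausdorff m Q (mspace m) \<le> 0"
    using content_le_finite[of "{()}" "mspace m" "\<lambda>_. mspace m" m _ Q] by (intro hausdorff_least) simp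
  then show ?thesis by simp
qed

definition setd :: "'a metric \<Rightarrow> 'a set \<Rightarrow> 'a \<Rightarrow> real" where
  "setd m A x = (INF z\<in>A. mdist m x z)"

lemma setd_le: "z \<in> A \<Longrightarrow> setd m A x \<le> mdist m x z"
  unfolding setd_def by (intro cINF_lower bdd_belowI[of _ 0]) auto

lemma setd_ge: "A \<noteq> {} \<Longrightarrow> (\<And>z. z \<in> A \<Longrightarrow> c \<le> mdist m x z) \<Longrightarrow> c \<le> setd m A x"
  unfolding setd_def by (intro cINF_greatest) auto

lemma setd_lip1:
  assumes "A \<subseteq> mspace m" "x \<in> mspace m" "y \<in> mspace m" "A \<noteq> {}"
  shows "setd m A x - setd m A y \<le> mdist m x y"
proof -
  have "setd m A x - mdist m x y \<le> setd m A y"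
  proof (rule setd_ge[OF assms(4)])
    fix z assume "z \<in> A"
    then show "setd m A x - mdist m x y \<le> mdist m y z"
      using setd_le[of z A m x] mdist_triangle[of x m y z] assms by auto
  qed
  then show ?thesis by simp
qed

lemma setd_lip:
  assumes "A \<subseteq> mspace m" "x \<in> mspace m" "y \<in> mspace m" "A \<noteq> {}"
  shows "\<bar>setd m A x - setd m A y\<bar> \<le> mdist m x y"
  using setd_lip1[OF assms] setd_lip1[OF assms(1,3,2,4)] by (simp add: mdist_commute abs_le_iff)

section \<open>Quasisymmetric images\<close>

context coding
begin

text \<open>The point of the limit space at the vertex \<open>vert w s\<close>. Following the copies
  with label a makes it depend on the vertex only, see \<open>corner_eq\<close>.\<close>

definition corner :: "ltr list \<Rightarrow> bool \<Rightarrow> 'p" where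
  "corner w s = P (ext w (\<lambda>_. if s then L67 else L13))"

lemma corner_in_cell: "corner w s \<in> cell w"
  unfolding corner_def by (rule cell_ext)

lemma corner_eq:
  assumes s: "vert w s = vert w' s'" and l: "length w = length w'"
  shows "corner w s = corner w' s'"
proof -
  define t where "t s = (if s then L67 else L13)" for s
  have 1: "outl (t s) s = Some False" for s by (cases s) (auto simp: t_def outl_def num_def)
  have 2: "vert (pre (\<lambda>_. t s) n @ w) s = vert (pre (\<lambda>_. t s') n @ w') s'" for n
    by (induction n) (auto simp: vert_Cons 1 s)
  have "adj (pre (ext w (\<lambda>_. t s)) n) (pre (ext w' (\<lambda>_. t s')) n)" for n
  proof (rule adj_pre_mono)
    show "adj (pre (ext w (\<lambda>_. t s)) (length w + n)) (pre (ext w' (\<lambda>_. t s')) (length w + n))"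
      unfolding adj_def using 2[of n] pre_ext[of w' "\<lambda>_. t s'" n] pre_ext[of w "\<lambda>_. t s" n] l by metis
  qed simp
  then show ?thesis unfolding corner_def t_def[symmetric] P_eq_iff by blast
qed

lemma disjoint_cells: "\<not> adj w w' \<Longrightarrow> length w = length w' \<Longrightarrow> cell w \<inter> cell w' = {}"
  using cells_adj by blast

lemma cell_two_points: "\<exists>x\<in>cell w. \<exists>y\<in>cell w. x \<noteq> y"
proof -
  have "\<not> adj (L13 # w) (L67 # w)"
  proof
    assume "adj (L13 # w) (L67 # w)"
    then obtain s s' where "vert (L13 # w) s = vert (L67 # w) s'" by (auto simp: adj_def)
    then show False by (cases s; cases s') (auto)
  qed
  then have d: "cell (L13 # w) \<inter> cell (L67 # w) = {}" by (intro disjoint_cells) auto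
  obtain x where x: "x \<in> cell (L13 # w)" using cell_nonempty[of "L13 # w"] by auto
  obtain y where y: "y \<in> cell (L67 # w)" using cell_nonempty[of "L67 # w"] by auto
  have "x \<noteq> y" using d x y by auto
  then show ?thesis using subsetD[OF cell_Cons x] subsetD[OF cell_Cons y] by (intro bexI)
qed

text \<open>Both ends of \<open>L45\<close> are inner, so the cell of \<open>L45 # w'\<close> meets
  only cells of its level with the parent \<open>w'\<close>. A point shared with the cell of
  \<open>L45 # w\<close> for a shorter word \<open>w\<close> would make \<open>L45\<close> a letter
  of \<open>w'\<close>.\<close>

lemma L45_cells_disjoint:
  assumes w: "L45 \<notin> set w" "L45 \<notin> set w'" "w \<noteq> w'"
  shows "cell (L45 # w) \<inter> cell (L45 # w') = {}"
proof -
  have *: "cell (L45 # w) \<inter> cell (L45 # w') = {}"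
    if w: "L45 \<notin> set w" "L45 \<notin> set w'" "w \<noteq> w'" and le: "length w \<le> length w'" for w w'
  proof (rule ccontr)
    assume "cell (L45 # w) \<inter> cell (L45 # w') \<noteq> {}"
    then obtain x where x: "x \<in> cell (L45 # w)" "x \<in> cell (L45 # w')" by blast
    from x(1) obtain \<omega> where \<omega>: "x = P \<omega>" "pre \<omega> (length (L45 # w)) = L45 # w" by (auto simp: cell_def)
    have "adj (pre \<omega> (length (L45 # w'))) (L45 # w')" using P_in_cellD[of \<omega> "L45 # w'"] x(2) \<omega>(1) by blast
    then obtain s s' where "vert (\<omega> (length w') # pre \<omega> (length w')) s = vert (L45 # w') s'"
      by (auto simp: adj_def)
    from vert_sign[OF this] have "pre \<omega> (length w') = w'" by (auto simp: outl_def num_def split: if_splits)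
    moreover obtain y where "pre \<omega> (length (L45 # w')) = y @ L45 # w" "length y = length w' - length w"
      using pre_drop[of "length (L45 # w)" "length (L45 # w')" \<omega>] le \<omega>(2) by auto
    ultimately have "\<omega> (length w') # w' = y @ L45 # w" "length y = length w' - length w" by auto
    then show False using w by (cases y) auto
  qed
  show ?thesis
  proof (cases "length w \<le> length w'")
    case True then show ?thesis using * w by blast
  next
    case False then show ?thesis using *[of w' w] w by (auto simp: Int_commute)
  qed
qed

end

text \<open>One setting for two uses: Loewner spaces with an arbitrary quasisymmetry
  \<open>f\<close>, and the metrics of the gauge with \<open>f = id\<close>.\<close>

locale qs_target = coding P for P :: "(nat \<Rightarrow> ltr) \<Rightarrow> 'p" +
  fixes Y :: "'b metric" and f :: "'p \<Rightarrow> 'b" and Q :: real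
  assumes qs: "quasisymmetry (MX (1/4)) Y f" and ar: "ahlfors_regular Q Y"
begin

lemma quarter: "0 < (1/4::real)" "(1/4::real) \<le> 1/4" by auto

lemma Qpos: "0 < Q" using ar by (simp add: ahlfors_regular_def)

lemma f_inj: "inj_on f (range P)" and f_im: "f ` range P = mspace Y"
proof -
  have "homeomorphic_map (mtopology_of (MX (1/4))) (mtopology_of Y) f"
    using qs unfolding quasisymmetry_def by (rule conjunct1)
  from homeomorphic_imp_injective_map[OF this] homeomorphic_imp_surjective_map[OF this]
  show "inj_on f (range P)" "f ` range P = mspace Y"
    by (simp_all only: topspace_mtopology_of mspace_MX[OF quarter])
qed

lemma f_cell: "f ` cell w \<subseteq> mspace Y"
  using f_im cell_subset by blast

lemma cell_range: "x \<in> cell w \<Longrightarrow> x \<in> range P"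
  using cell_subset[of w] by blast

lemma f_in_cell: "x \<in> cell w \<Longrightarrow> f x \<in> mspace Y"
  using f_cell[of w] by blast

lemma f_eqD: "f x = f y \<Longrightarrow> x \<in> cell w \<Longrightarrow> y \<in> cell w' \<Longrightarrow> x = y"
  using f_inj cell_range[of x w] cell_range[of y w'] by (auto dest: inj_onD)

lemma Y_bounded: "\<exists>B\<ge>0. \<forall>x\<in>mspace Y. \<forall>y\<in>mspace Y. mdist Y x y \<le> B"
proof -
  have "compactin (mtopology_of Y) (mspace Y)"
    using ar unfolding ahlfors_regular_def compact_space_def by simp
  then have "Metric_space.mbounded (mspace Y) (mdist Y) (mspace Y)"
    unfolding mtopology_of_def by (rule Metric_space.compactin_imp_mbounded[OF Metric_space_mspace_mdist])
  then obtain B where "\<forall>x\<in>mspace Y. \<forall>y\<in>mspace Y. mdist Y x y \<le> B"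
    unfolding Metric_space.mbounded_alt[OF Metric_space_mspace_mdist] by auto
  then show ?thesis by (intro exI[of _ "max 0 B"]) (auto intro: max.coboundedI2)
qed

definition D :: "ltr list \<Rightarrow> real" where
  "D w = enn2real (mdiam Y (f ` cell w))"

lemma mdiam_Y: "S \<subseteq> mspace Y \<Longrightarrow> mdiam Y S = ennreal (enn2real (mdiam Y S))"
proof -
  assume S: "S \<subseteq> mspace Y"
  obtain B where "0 \<le> B" "\<forall>x\<in>mspace Y. \<forall>y\<in>mspace Y. mdist Y x y \<le> B" using Y_bounded by blast
  then have "mdiam Y S \<le> ennreal B" using S by (intro mdiam_le) auto
  also have "\<dots> < top" by simp
  finally show ?thesis by simp
qed

lemma D_ge: "x \<in> cell w \<Longrightarrow> y \<in> cell w \<Longrightarrow> mdist Y (f x) (f y) \<le> D w"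
proof -
  assume "x \<in> cell w" "y \<in> cell w"
  then have "ennreal (mdist Y (f x) (f y)) \<le> mdiam Y (f ` cell w)" by (intro mdist_le_mdiam) auto
  then have "ennreal (mdist Y (f x) (f y)) \<le> ennreal (D w)" using mdiam_Y[OF f_cell] unfolding D_def by metis
  then show ?thesis by (simp add: D_def ennreal_le_iff)
qed

lemma D_nonneg: "0 \<le> D w" by (simp add: D_def)

lemma D_le: "(\<And>x y. x \<in> cell w \<Longrightarrow> y \<in> cell w \<Longrightarrow> mdist Y (f x) (f y) \<le> B) \<Longrightarrow> 0 \<le> B \<Longrightarrow> D w \<le> B"
proof -
  assume "\<And>x y. x \<in> cell w \<Longrightarrow> y \<in> cell w \<Longrightarrow> mdist Y (f x) (f y) \<le> B" and B: "0 \<le> B"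
  then have "mdiam Y (f ` cell w) \<le> ennreal B" by (intro mdiam_le) auto
  then have "ennreal (D w) \<le> ennreal B" using mdiam_Y[OF f_cell] unfolding D_def by metis
  then show ?thesis using B by (simp add: ennreal_le_iff)
qed

lemma D_pos: "0 < D w"
proof -
  obtain x y where xy: "x \<in> cell w" "y \<in> cell w" "x \<noteq> y" using cell_two_points by blast
  then have "f x \<noteq> f y" using f_eqD[of x y w w] by blast
  then have "0 < mdist Y (f x) (f y)" using mdist_zero[of "f x" Y "f y"] f_in_cell[OF xy(1)] f_in_cell[OF xy(2)]
    mdist_nonneg[of Y "f x" "f y"] by linarith
  then show ?thesis using D_ge[OF xy(1,2)] by simp
qed

lemma D_mono: "cell v \<subseteq> cell w \<Longrightarrow> D v \<le> D w"
  by (intro D_le D_nonneg D_ge) auto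

definition HH :: "real \<Rightarrow> real" where
  "HH = (SOME H. (\<forall>C. 1 \<le> H C) \<and> (\<forall>C x y z. x \<in> range P \<longrightarrow> y \<in> range P \<longrightarrow> z \<in> range P \<longrightarrow>
     pd (1/4) x y \<le> C * pd (1/4) x z \<longrightarrow> mdist Y (f x) (f y) \<le> H C * mdist Y (f x) (f z)))"

lemma HH1: "1 \<le> HH C"
  and HH: "x \<in> range P \<Longrightarrow> y \<in> range P \<Longrightarrow> z \<in> range P \<Longrightarrow> pd (1/4) x y \<le> C * pd (1/4) x z \<Longrightarrow>
     mdist Y (f x) (f y) \<le> HH C * mdist Y (f x) (f z)"
proof -
  have "\<exists>H. (\<forall>C. 1 \<le> H C) \<and> (\<forall>C x y z. x \<in> range P \<longrightarrow> y \<in> range P \<longrightarrow> z \<in> range P \<longrightarrow>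
     pd (1/4) x y \<le> C * pd (1/4) x z \<longrightarrow> mdist Y (f x) (f y) \<le> H C * mdist Y (f x) (f z))"
    using quasisymmetry_weak[OF qs] by (metis mspace_MX[OF quarter] mdist_MX[OF quarter])
  from someI_ex[OF this] show "1 \<le> HH C" "x \<in> range P \<Longrightarrow> y \<in> range P \<Longrightarrow> z \<in> range P \<Longrightarrow> pd (1/4) x y \<le> C * pd (1/4) x z \<Longrightarrow>
     mdist Y (f x) (f y) \<le> HH C * mdist Y (f x) (f z)"
    unfolding HH_def[symmetric] by blast+
qed

text \<open>Every point of the cell is within \<open>8 * (1/4) ^ length w\<close> of
  \<open>x\<close>, hence closer than \<open>8 * K\<close> times the distance from \<open>x\<close>
  to \<open>z\<close>, and quasisymmetry transports this comparison. The factor 2 is the triangle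
  inequality through \<open>f x\<close>.\<close>

lemma D_le_outside:
  assumes x: "x \<in> cell w" and z: "z \<in> range P" and far: "(1/4) ^ length w \<le> K * pd (1/4) x z"
  shows "D w \<le> 2 * HH (8 * K) * mdist Y (f x) (f z)"
proof -
  have "mdist Y (f x) (f y) \<le> HH (8 * K) * mdist Y (f x) (f z)" if y: "y \<in> cell w" for y
  proof (rule HH)
    have "pd (1/4) x y \<le> 8 * (1/4) ^ length w"
      using cell_pd[OF quarter x y] by (simp add: wt_quarter)
    also have "\<dots> \<le> 8 * (K * pd (1/4) x z)" using far by simp
    finally show "pd (1/4) x y \<le> 8 * K * pd (1/4) x z" by simp
  qed (use cell_range[OF x] cell_range[OF y] z in auto)
  note 1 = this
  have "D w \<le> HH (8 * K) * mdist Y (f x) (f z) + HH (8 * K) * mdist Y (f x) (f z)"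
  proof (rule D_le)
    fix y y' assume y: "y \<in> cell w" "y' \<in> cell w"
    have "mdist Y (f y) (f y') \<le> mdist Y (f y) (f x) + mdist Y (f x) (f y')"
      using f_in_cell[OF x] f_in_cell[OF y(1)] f_in_cell[OF y(2)] by (intro mdist_triangle)
    then show "mdist Y (f y) (f y') \<le> HH (8 * K) * mdist Y (f x) (f z) + HH (8 * K) * mdist Y (f x) (f z)"
      using 1[OF y(1)] 1[OF y(2)] mdist_commute[of Y "f y" "f x"] by linarith
  qed (use HH1[of "8 * K"] in auto)
  then show ?thesis by (simp add: mult_ac)
qed

text \<open>A point well inside the subcell over \<open>L45\<close>: by
  \<open>ball_inside_cell\<close> its ball of radius \<open>(1/4) ^ (length w + 2)\<close> stays in
  \<open>cell (L45 # w)\<close>.\<close>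

definition ctr :: "ltr list \<Rightarrow> 'p" where
  "ctr w = P (ext (L34 # L45 # w) (\<lambda>_. L34))"

lemma ctr_cell: "ctr w \<in> cell (L45 # w)" "ctr w \<in> cell w"
  using cell_ext[of "L34 # L45 # w" "\<lambda>_. L34"] cell_Cons[of L34 "L45 # w"] cell_Cons[of L45 w] unfolding ctr_def by blast+

text \<open>128 is 8 * 16: the ball around \<open>ctr w\<close> is smaller than
  \<open>(1/4) ^ length w\<close> by the factor 16, and 8 is the constant of
  \<open>D_le_outside\<close>.\<close>

definition H0 :: real where "H0 = 2 * HH 128"

lemma H0: "2 \<le> H0" using HH1[of 128] by (simp add: H0_def)

lemma ctr_ball: "mball_of Y (f (ctr w)) (D w / H0) \<subseteq> f ` cell (L45 # w)"
proof
  fix p assume p: "p \<in> mball_of Y (f (ctr w)) (D w / H0)"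
  then obtain z where z: "z \<in> range P" "p = f z" using f_im by auto
  show "p \<in> f ` cell (L45 # w)"
  proof (rule ccontr)
    assume "p \<notin> f ` cell (L45 # w)"
    then have zn: "z \<notin> cell (L45 # w)" using z by blast
    define \<omega> where "\<omega> = ext (L34 # L45 # w) (\<lambda>_. L34)"
    have p2: "pre \<omega> (Suc (Suc (length w))) = L34 # L45 # w"
      using pre_ext_len[of "L34 # L45 # w"] unfolding \<omega>_def by (simp del: pre_ext_len pre.simps)
    have l34: "\<omega> (Suc (length w)) = L34" and p1: "pre \<omega> (Suc (length w)) = L45 # w" using p2 by simp_all
    have "mball_of (MX (1/4)) (ctr w) ((1/4) ^ (length w + 2)) \<subseteq> cell (L45 # w)"
      using ball_inside_cell[OF quarter, of \<omega> "Suc (length w)", OF l34] unfolding p1 p2 \<omega>_def[symmetric] ctr_def by (simp add: wt_quarter sc_def)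
    then have "\<not> pd (1/4) (ctr w) z < (1/4) ^ (length w + 2)"
    proof (intro notI)
      assume lt: "pd (1/4) (ctr w) z < (1/4) ^ (length w + 2)"
      have "z \<in> mball_of (MX (1/4)) (ctr w) ((1/4) ^ (length w + 2))"
        unfolding in_mball_of mspace_MX[OF quarter] mdist_MX[OF quarter] using lt z(1) cell_range[OF ctr_cell(1)] by simp
      then show False using zn \<open>mball_of (MX (1/4)) (ctr w) ((1/4) ^ (length w + 2)) \<subseteq> cell (L45 # w)\<close> by blast
    qed
    then have "D w \<le> 2 * HH (8 * 16) * mdist Y (f (ctr w)) (f z)"
      using z ctr_cell(2) by (intro D_le_outside) auto
    moreover have "mdist Y (f (ctr w)) (f z) < D w / H0" using p z by auto
    ultimately show False using H0 D_pos[of w] by (simp add: H0_def field_simps)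
  qed
qed

lemma mass_bound:
  obtains T where "0 \<le> T" "\<And>N. (\<Sum>n<N. \<Sum>w\<in>good n. D w powr Q) \<le> T"
proof -
  have fin: "hausdorff Y Q (mspace Y) < top" by (rule hausdorff_finite[OF ar])
  define M where "M = enn2real (hausdorff Y Q (mspace Y))"
  have M: "hausdorff Y Q (mspace Y) = ennreal M" "0 \<le> M" using fin by (auto simp: M_def)
  obtain C where C: "C > 1" "\<And>x r. x \<in> mspace Y \<Longrightarrow> r > 0 \<Longrightarrow> ennreal r \<le> mdiam Y (mspace Y) \<Longrightarrow>
        ennreal (r powr Q / C) \<le> hausdorff Y Q (mball_of Y x r)"
    using ar unfolding ahlfors_regular_def by blast
  have "(\<Sum>n<N. \<Sum>w\<in>good n. D w powr Q) \<le> C * (2 * H0) powr Q * M" for N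
  proof -
    define I where "I = (SIGMA n:{..<N}. good n)"
    have finI: "finite I" by (simp add: I_def)
    \<comment> \<open>The balls of the full radius \<open>D / H0\<close> lie in disjoint sets. Half
      the radius leaves a positive gap between any two of the finitely many balls, as
      \<open>hausdorff_separated_UN\<close> demands.\<close>
    define B where "B p = mball_of Y (f (ctr (snd p))) (D (snd p) / (2 * H0))" for p :: "nat \<times> ltr list"
    have I: "L45 \<notin> set (snd p)" "length (snd p) = fst p" if "p \<in> I" for p
      using that by (auto simp: I_def good_def words_def)
    have sub: "B p \<subseteq> f ` cell (L45 # snd p)" for p
    proof -
      have "D (snd p) / (2 * H0) \<le> D (snd p) / H0" using H0 D_pos[of "snd p"] by (intro divide_left_mono) auto
      then have "B p \<subseteq> mball_of Y (f (ctr (snd p))) (D (snd p) / H0)" unfolding B_def by auto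
      then show ?thesis using ctr_ball[of "snd p"] by blast
    qed
    define \<eta> where "\<eta> = Min (insert 1 ((\<lambda>p. D (snd p) / (2 * H0)) ` I))"
    have \<eta>: "0 < \<eta>" unfolding \<eta>_def using finI D_pos H0 by (subst Min_gr_iff) auto
    have \<eta>le: "\<eta> \<le> D (snd p) / (2 * H0)" if "p \<in> I" for p
      unfolding \<eta>_def using finI that by (intro Min_le) auto
    have "(\<Sum>p\<in>I. hausdorff Y Q (B p)) \<le> hausdorff Y Q (\<Union>p\<in>I. B p)"
    proof (rule hausdorff_separated_UN[OF finI \<eta>])
      fix p q x y assume pq: "p \<in> I" "q \<in> I" "p \<noteq> q" and x: "x \<in> B p" and y: "y \<in> B q"
      have ne: "snd p \<noteq> snd q" using pq(3) I(2)[OF pq(1)] I(2)[OF pq(2)] by (metis prod.expand)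
      show "\<eta> \<le> mdist Y x y"
      proof (rule ccontr)
        assume "\<not> \<eta> \<le> mdist Y x y"
        then have l: "mdist Y x y < D (snd p) / (2 * H0)" using \<eta>le[OF pq(1)] by simp
        have "mdist Y (f (ctr (snd p))) y \<le> mdist Y (f (ctr (snd p))) x + mdist Y x y"
          using x y unfolding B_def by (intro mdist_triangle) auto
        also have "\<dots> < D (snd p) / H0" using x l unfolding B_def by (auto simp: field_simps)
        finally have "y \<in> mball_of Y (f (ctr (snd p))) (D (snd p) / H0)" using x y unfolding B_def by auto
        then have "y \<in> f ` cell (L45 # snd p)" using ctr_ball[of "snd p"] by blast
        moreover have "y \<in> f ` cell (L45 # snd q)" using y sub[of q] by blast
        ultimately obtain a b where ab: "a \<in> cell (L45 # snd p)" "b \<in> cell (L45 # snd q)" "f a = f b" by auto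
        then have "a = b" using f_eqD by blast
        then show False using ab(1,2) L45_cells_disjoint[of "snd p" "snd q"] I(1)[OF pq(1)] I(1)[OF pq(2)] ne by blast
      qed
    qed
    also have "\<dots> \<le> hausdorff Y Q (mspace Y)" by (intro hausdorff_mono) (auto simp: B_def)
    finally have 1: "(\<Sum>p\<in>I. hausdorff Y Q (B p)) \<le> ennreal M" using M by simp
    have "(\<Sum>p\<in>I. ennreal ((D (snd p) / (2 * H0)) powr Q / C)) \<le> (\<Sum>p\<in>I. hausdorff Y Q (B p))"
    proof (rule sum_mono)
      fix p assume "p \<in> I"
      show "ennreal ((D (snd p) / (2 * H0)) powr Q / C) \<le> hausdorff Y Q (B p)"
        unfolding B_def
      proof (rule C(2))
        show "f (ctr (snd p)) \<in> mspace Y" using f_in_cell[OF ctr_cell(1)] .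
        show "D (snd p) / (2 * H0) > 0" using D_pos H0 by simp
        have "D (snd p) / (2 * H0) \<le> D (snd p) / 1" using H0 D_pos[of "snd p"] by (intro divide_left_mono) auto
        then have "ennreal (D (snd p) / (2 * H0)) \<le> ennreal (D (snd p))" by (intro ennreal_leI) simp
        also have "\<dots> = mdiam Y (f ` cell (snd p))" unfolding D_def using mdiam_Y[OF f_cell] by simp
        also have "\<dots> \<le> mdiam Y (mspace Y)" by (intro mdiam_mono f_cell)
        finally show "ennreal (D (snd p) / (2 * H0)) \<le> mdiam Y (mspace Y)" .
      qed
    qed
    with 1 have "ennreal (\<Sum>p\<in>I. (D (snd p) / (2 * H0)) powr Q / C) \<le> ennreal M"
      using C(1) by (subst sum_ennreal[symmetric]) auto
    then have "(\<Sum>p\<in>I. (D (snd p) / (2 * H0)) powr Q / C) \<le> M" using M by (simp add: ennreal_le_iff)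
    also have "(\<Sum>p\<in>I. (D (snd p) / (2 * H0)) powr Q / C) = (\<Sum>p\<in>I. D (snd p) powr Q) / ((2 * H0) powr Q * C)"
      unfolding sum_divide_distrib using D_nonneg H0 by (intro sum.cong refl) (simp add: powr_divide)
    finally have "(\<Sum>p\<in>I. D (snd p) powr Q) \<le> C * (2 * H0) powr Q * M"
      using C(1) H0 by (simp add: divide_le_eq mult_ac)
    moreover have "(\<Sum>p\<in>I. D (snd p) powr Q) = (\<Sum>n<N. \<Sum>w\<in>good n. D w powr Q)"
      unfolding I_def by (subst sum.Sigma) (auto simp: case_prod_beta)
    ultimately show ?thesis by simp
  qed
  then show ?thesis using that[of "C * (2 * H0) powr Q * M"] C M by simp
qed

text \<open>The potential is the distance in \<open>Y\<close> to the image of the two lower cells,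
  read at the corners of the level-\<open>n\<close> cells. Averaging it down to the single edge of
  level 0 leaves an increment of at least \<open>c\<close>, because all copies of the upper end lie
  in the two upper cells. The contraction of energy bounds this increment by the cells avoiding
  \<open>L45\<close>, on each of which the potential varies by at most \<open>D w\<close>.\<close>

lemma energy_bound:
  obtains c where "0 < c" "\<And>n. 1 \<le> n \<Longrightarrow> c \<le> (\<Sum>w\<in>good n. D w powr (3/2))"
proof -
  define A where "A = cell [L13] \<union> cell [L23]"
  define g where "g x = setd Y (f ` A) (f x)" for x
  have A: "f ` A \<subseteq> mspace Y" "f ` A \<noteq> {}" using f_cell[of "[L13]"] f_cell[of "[L23]"] cell_nonempty[of "[L13]"] unfolding A_def by (auto simp: image_Un)
  define c where "c = D [] / (2 * HH 32)"
  have c: "0 < c" using D_pos[of "[]"] HH1[of 32] by (simp add: c_def)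
  have far: "c \<le> g x" if x: "x \<in> cell [L67] \<union> cell [L68]" for x
    unfolding g_def
  proof (rule setd_ge[OF A(2)])
    fix p assume "p \<in> f ` A"
    then obtain z where z: "z \<in> A" "p = f z" by blast
    obtain h where h: "h \<in> {L67, L68}" "x \<in> cell [h]" using x by blast
    obtain k where k: "k \<in> {L13, L23}" "z \<in> cell [k]" using z by (auto simp: A_def)
    obtain \<tau> where \<tau>1: "x = P (ext [h] \<tau>)" using h(2) by (rule cellE)
    obtain \<tau>' where \<tau>2: "z = P (ext [k] \<tau>')" using k(2) by (rule cellE)
    note \<tau> = \<tau>1 \<tau>2
    have "\<not> adj [h] [k]" 
    proof
      assume "adj [h] [k]"
      then obtain s s' where "vert [h] s = vert [k] s'" by (auto simp: adj_def)
      then show False using h(1) k(1) by (cases s; cases s') auto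
    qed
    then have "\<not> adj (pre (ext [h] \<tau>) 1) (pre (ext [k] \<tau>') 1)"
      using pre_ext_len[of "[h]" \<tau>] pre_ext_len[of "[k]" \<tau>'] by simp
    from pd_lower[OF quarter this] have "1/4 \<le> pd (1/4) x z" unfolding \<tau> wt_quarter by simp
    then have "D [] \<le> 2 * HH (8 * 4) * mdist Y (f x) (f z)"
      using cell_range[OF h(2)] cell_range[OF k(2)] by (intro D_le_outside) (auto simp: cell_def)
    then show "c \<le> mdist Y (f x) p" using z HH1[of 32] by (simp add: c_def field_simps)
  qed
  have near: "g x \<le> 0" if "x \<in> A" for x
  proof -
    have "f x \<in> f ` A" using that by blast
    moreover then have "f x \<in> mspace Y" using A(1) by blast
    ultimately show ?thesis using setd_le[of "f x" "f ` A" Y "f x"] unfolding g_def by simp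
  qed
  have main: "c powr (3/2) \<le> (\<Sum>w\<in>good n. D w powr (3/2))" if n: "1 \<le> n" for n
  proof -
    \<comment> \<open>A vertex has several descriptions as an end of an edge;
      \<open>corner_eq\<close> makes the value independent of the one chosen.\<close>
    define u where "u v = (let p = (SOME p. length (fst p) = n \<and> vert (fst p) (snd p) = v) in g (corner (fst p) (snd p)))" for v
    have u: "u (vert w s) = g (corner w s)" if w: "length w = n" for w s
    proof -
      define p where "p = (SOME p. length (fst p) = n \<and> vert (fst p) (snd p) = vert w s)"
      have "length (fst p) = n \<and> vert (fst p) (snd p) = vert w s"
        unfolding p_def by (rule someI[of _ "(w, s)"]) (use w in simp)
      then have "corner (fst p) (snd p) = corner w s" using w by (intro corner_eq) auto
      then show ?thesis unfolding u_def Let_def p_def[symmetric] by simp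
    qed
    have grad: "\<bar>gr u w\<bar> \<le> D w" if w: "length w = n" for w
    proof -
      have "\<bar>gr u w\<bar> = \<bar>setd Y (f ` A) (f (corner w True)) - setd Y (f ` A) (f (corner w False))\<bar>"
        using u[OF w] by (simp add: gr_def g_def)
      also have "\<dots> \<le> mdist Y (f (corner w True)) (f (corner w False))"
        by (intro setd_lip A f_in_cell[OF corner_in_cell])
      also have "\<dots> \<le> D w" by (intro D_ge corner_in_cell)
      finally show ?thesis .
    qed
    have corner_top: "corner x s \<in> (\<Union>h\<in>side s. cell [h])" if "length x = n" "set x \<subseteq> side s" for x s
    proof -
      have "x \<noteq> []" using that n by auto
      then obtain y h where y: "x = y @ [h]" by (metis rev_exhaust)
      then have "corner x s \<in> cell [h]" using corner_in_cell[of x s] cell_append[of y "[h]"] by blast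
      then show ?thesis using that y by auto
    qed
    have "c \<le> (avg ^^ n) u (vert [] True)"
    proof (rule avg_pow_ge)
      fix cs :: "bool list" assume cs: "length cs = n"
      obtain x where x: "length x = length cs" "set x \<subseteq> side True" "chs (vert [] True) cs = vert (x @ []) True"
        using chs_vert[of cs True "[]"] by auto
      then have "corner x True \<in> cell [L67] \<union> cell [L68]" using corner_top[of x True] cs by (auto simp: side_def)
      then show "c \<le> u (chs (vert [] True) cs)" using far u[of x True] x cs by simp
    qed
    moreover have "(avg ^^ n) u (vert [] False) \<le> 0"
    proof (rule avg_pow_le)
      fix cs :: "bool list" assume cs: "length cs = n"
      obtain x where x: "length x = length cs" "set x \<subseteq> side False" "chs (vert [] False) cs = vert (x @ []) False"
        using chs_vert[of cs False "[]"] by auto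
      then have "corner x False \<in> A" using corner_top[of x False] cs by (auto simp: side_def A_def)
      then show "u (chs (vert [] False) cs) \<le> 0" using near u[of x False] x cs by simp
    qed
    ultimately have "c \<le> \<bar>gr ((avg ^^ n) u) []\<bar>" by (simp add: gr_def)
    then have "c powr (3/2) \<le> \<bar>gr ((avg ^^ n) u) []\<bar> powr (3/2)" using c by (intro powr_mono2) auto
    also have "\<dots> \<le> (\<Sum>w\<in>good n. \<bar>gr u (w @ [])\<bar> powr (3/2))" by (rule energy_avg_pow)
    also have "\<dots> \<le> (\<Sum>w\<in>good n. D w powr (3/2))"
      using grad by (intro sum_mono powr_mono2) (auto simp: good_def words_def)
    finally show ?thesis .
  qed
  show ?thesis using that[of "c powr (3/2)"] c main by simp
qed

lemma exponent_gt: "3/2 < Q"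
proof (rule ccontr)
  assume "\<not> 3/2 < Q"
  then have Q: "Q \<le> 3/2" by simp
  obtain c where c: "0 < c" "\<And>n. 1 \<le> n \<Longrightarrow> c \<le> (\<Sum>w\<in>good n. D w powr (3/2))" by (rule energy_bound) blast
  obtain T where T: "0 \<le> T" "\<And>N. (\<Sum>n<N. \<Sum>w\<in>good n. D w powr Q) \<le> T" by (rule mass_bound) blast
  \<comment> \<open>For \<open>Q \<le> 3/2\<close> the bound \<open>D w \<le> D []\<close> turns
    sums of \<open>Q\<close>-th powers into sums of 3/2-th powers.\<close>
  define K where "K = D [] powr (3/2 - Q)"
  have K: "0 < K" using D_pos[of "[]"] by (simp add: K_def)
  have DK: "D w powr (3/2) \<le> K * D w powr Q" for w
  proof -
    have "D w powr (3/2) = D w powr (3/2 - Q) * D w powr Q" by (simp add: powr_add[symmetric])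
    also have "\<dots> \<le> K * D w powr Q" unfolding K_def
      using Q D_mono[of w "[]"] cell_append[of w "[]"] D_nonneg by (intro mult_right_mono powr_mono2) auto
    finally show ?thesis .
  qed
  have *: "c / K \<le> (\<Sum>w\<in>good n. D w powr Q)" if "1 \<le> n" for n
  proof -
    have "c \<le> (\<Sum>w\<in>good n. K * D w powr Q)" using c(2)[OF that] sum_mono[OF DK] by (rule order_trans)
    then show ?thesis using K by (simp add: sum_distrib_left[symmetric] field_simps)
  qed
  obtain N :: nat where N: "T < real N * (c / K)"
    using reals_Archimedean3[of "c / K"] c(1) K by auto
  have "real N * (c / K) = (\<Sum>n\<in>{1..<Suc N}. c / K)" by simp
  also have "\<dots> \<le> (\<Sum>n\<in>{1..<Suc N}. \<Sum>w\<in>good n. D w powr Q)" using * by (intro sum_mono) auto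
  also have "\<dots> \<le> (\<Sum>n<Suc N. \<Sum>w\<in>good n. D w powr Q)" by (intro sum_mono2) (auto intro: sum_nonneg)
  also have "\<dots> \<le> T" by (rule T(2))
  finally show False using N by simp
qed

end

section \<open>Curves through chains of cells\<close>

definition steps :: "nat \<Rightarrow> (cv \<times> cv) set" where
  "steps n = {(vert w s, vert w (\<not> s)) | w s. length w = n}"

lemma steps_sym: "(p, q) \<in> steps n \<Longrightarrow> (q, p) \<in> steps n"
proof -
  assume "(p, q) \<in> steps n"
  then obtain w s where "p = vert w s" "q = vert w (\<not> s)" "length w = n" by (auto simp: steps_def)
  then show ?thesis unfolding steps_def by (auto intro!: exI[of _ w] exI[of _ "\<not> s"])
qed

lemma steps_Lip:
  assumes "Lip (1/4) n u" "(p, q) \<in> steps n ^^ j"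
  shows "u p - u q \<le> real j * (1/4) ^ n"
  using assms(2)
proof (induction j arbitrary: q)
  case (Suc j)
  then obtain r where r: "(p, r) \<in> steps n ^^ j" "(r, q) \<in> steps n" by auto
  then obtain w s where w: "r = vert w s" "q = vert w (\<not> s)" "length w = n" by (auto simp: steps_def)
  have "\<bar>gr u w\<bar> \<le> (1/4) ^ n" using LipD[OF assms(1) w(3)] w(3) by (simp add: wt_quarter)
  then have "u r - u q \<le> (1/4) ^ n" unfolding w gr_def by (cases s) (simp_all add: abs_le_iff)
  then show ?case using Suc.IH[OF r(1)] by (simp add: algebra_simps)
qed simp

text \<open>The duality behind \<open>Dn\<close>: the number of steps from a fixed vertex, rescaled
  and cut off, is itself an admissible potential.\<close>

lemma steps_dist:
  assumes l: "length w = n" "length w' = n"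
  shows "\<exists>j. (vert w s, vert w' s') \<in> steps n ^^ j \<and> real j * (1/4) ^ n \<le> Dn (1/4) n (vert w' s') (vert w s)"
proof -
  have q: "0 < (1/4::real)" "(1/4::real) \<le> 1/4" by auto
  \<comment> \<open>Vertices not reached within fewer than \<open>N\<close> steps get the value
    \<open>N\<close>. No potential varies by more than 4, which is 4 * 4 ^ n steps, so the value
    \<open>N\<close> does not occur at the target and the existence of a path comes out as
    well.\<close>
  define N where "N = Suc (4 * 4 ^ n)"
  define R where "R p j \<longleftrightarrow> (vert w s, p) \<in> steps n ^^ j" for p j
  define r where "r p = (if \<exists>j<N. R p j then LEAST j. R p j else N)" for p
  have rN: "r p \<le> N" for p unfolding r_def by (auto intro: order_trans[OF Least_le] less_imp_le)
  have rle: "r p \<le> j" if "R p j" for p j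
  proof (cases "j < N")
    case True
    then have "\<exists>j<N. R p j" using that by blast
    then show ?thesis unfolding r_def using Least_le[of "R p", OF that] by simp
  next
    case False
    then show ?thesis using rN[of p] by simp
  qed
  have rR: "R p (r p)" if "r p < N" for p
    using that unfolding r_def by (auto intro: LeastI split: if_splits)
  have step: "r (vert x a) \<le> Suc (r (vert x (\<not> a)))" if x: "length x = n" for x a
  proof (cases "r (vert x (\<not> a)) < N")
    case True
    have "(vert x (\<not> a), vert x a) \<in> steps n" unfolding steps_def using x by (auto intro!: exI[of _ x] exI[of _ "\<not> a"])
    then have "R (vert x a) (Suc (r (vert x (\<not> a))))" using rR[OF True] unfolding R_def by auto
    then show ?thesis by (rule rle)
  next
    case False
    then show ?thesis using rN[of "vert x a"] by linarith
  qed
  define u where "u p = (1/4) ^ n * real (r p)" for p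
  have Lu: "Lip (1/4) n u"
  proof (rule LipI)
    fix x :: "ltr list" assume x: "length x = n"
    have "\<bar>real (r (vert x True)) - real (r (vert x False))\<bar> \<le> 1"
      using step[OF x, of True] step[OF x, of False] by simp
    then have "(1/4) ^ n * \<bar>real (r (vert x True)) - real (r (vert x False))\<bar> \<le> (1/4) ^ n * 1"
      by (intro mult_left_mono) auto
    moreover have "\<bar>gr u x\<bar> = (1/4) ^ n * \<bar>real (r (vert x True)) - real (r (vert x False))\<bar>"
      unfolding gr_def u_def right_diff_distrib[symmetric] abs_mult by simp
    ultimately show "\<bar>gr u x\<bar> \<le> wt (1/4) x" using x by (simp add: wt_quarter)
  qed
  have "R (vert w s) 0" by (simp add: R_def)
  then have r0: "r (vert w s) = 0" using rle by blast
  have "u (vert w' s') - u (vert w s) \<le> 4" using Lip_bounded[OF q Lu l(2,1)] .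
  then have "(1/4) ^ n * real (r (vert w' s')) \<le> 4" using r0 by (simp add: u_def)
  then have "real (r (vert w' s')) \<le> 4 * 4 ^ n" by (simp add: power_divide field_simps)
  then have "r (vert w' s') \<le> 4 * 4 ^ n" by (metis of_nat_le_iff of_nat_mult of_nat_numeral of_nat_power)
  then have "r (vert w' s') < N" by (simp add: N_def)
  from rR[OF this] have "(vert w s, vert w' s') \<in> steps n ^^ r (vert w' s')" unfolding R_def .
  moreover have "u (vert w' s') - u (vert w s) \<le> Dn (1/4) n (vert w' s') (vert w s)" by (rule Dn_upper[OF q Lu l(2,1)])
  ultimately show ?thesis using r0 by (intro exI[of _ "r (vert w' s')"]) (simp add: u_def mult.commute)
qed

section \<open>Chains of adjacent cells\<close>

primrec nbr :: "ltr list \<Rightarrow> nat \<Rightarrow> ltr list set" where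
  "nbr v 0 = {v}"
| "nbr v (Suc j) = (\<Union>x\<in>nbr v j. star x)"

lemma nbr_length: "x \<in> nbr v j \<Longrightarrow> length x = length v"
  by (induction j arbitrary: x) (auto simp: star_def)

lemma nbr_mono: "i \<le> j \<Longrightarrow> nbr v i \<subseteq> nbr v j"
  by (induction j) (auto simp: le_Suc_eq intro: star_self)

lemma nbr_chain:
  "x \<in> nbr v j \<Longrightarrow> \<exists>c. c 0 = v \<and> c j = x \<and> (\<forall>i\<le>j. length (c i) = length v) \<and> (\<forall>i<j. adj (c i) (c (Suc i)))"
proof (induction j arbitrary: x)
  case 0
  then show ?case by (intro exI[of _ "\<lambda>_. v"]) simp
next
  case (Suc j)
  then obtain y where y: "y \<in> nbr v j" "x \<in> star y" by auto
  then obtain c where c: "c 0 = v" "c j = y" "\<forall>i\<le>j. length (c i) = length v" "\<forall>i<j. adj (c i) (c (Suc i))"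
    using Suc.IH by blast
  have "length x = length v" using nbr_length Suc.prems by blast
  then show ?case using c y
    by (intro exI[of _ "c(Suc j := x)"]) (auto simp: star_def less_Suc_eq le_Suc_eq)
qed

lemma steps_nbr: "(vert w s, p) \<in> steps (length w) ^^ j \<Longrightarrow> \<exists>w'\<in>nbr w j. \<exists>s'. p = vert w' s'"
proof (induction j arbitrary: p)
  case (Suc j)
  then obtain q where q: "(vert w s, q) \<in> steps (length w) ^^ j" "(q, p) \<in> steps (length w)" by auto
  from Suc.IH[OF q(1)] obtain w' s' where w': "w' \<in> nbr w j" "q = vert w' s'" by blast
  obtain x t where x: "q = vert x t" "p = vert x (\<not> t)" "length x = length w" using q(2) by (auto simp: steps_def)
  have "adj w' x" unfolding adj_def using w'(2) x(1) by metis
  then have "x \<in> nbr w (Suc j)" using w'(1) x(3) nbr_length[OF w'(1)] by (auto simp: star_def intro!: bexI[of _ w'])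
  then show ?case using x(2) by blast
qed auto

lemma nbr_all:
  assumes "length v = k" "length v' = k" shows "v' \<in> nbr v (Suc (4 * 4 ^ k))"
proof -
  have q: "0 < (1/4::real)" "(1/4::real) \<le> 1/4" by auto
  obtain j where j: "(vert v False, vert v' False) \<in> steps k ^^ j"
    "real j * (1/4) ^ k \<le> Dn (1/4) k (vert v' False) (vert v False)"
    using steps_dist[OF assms] by blast
  have "Dn (1/4) k (vert v' False) (vert v False) \<le> 4"
    by (rule Dn_least[OF q]) (rule Lip_bounded[OF q _ assms(2,1)])
  then have "real j * (1/4) ^ k \<le> (4 * 4 ^ k) * (1/4) ^ k" using j(2) by (simp add: power_one_over)
  then have "real j \<le> 4 * 4 ^ k" by (rule mult_right_le_imp_le) simp
  then have "real j \<le> real (4 * 4 ^ k)" by simp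
  then have le: "Suc j \<le> Suc (4 * 4 ^ k)" unfolding of_nat_le_iff by simp
  obtain w s where w: "w \<in> nbr v j" "vert v' False = vert w s"
    using steps_nbr[of v False "vert v' False" j] j(1) assms(1) by auto
  have "adj w v'" unfolding adj_def using w(2) by metis
  then have "v' \<in> nbr v (Suc j)" using w(1) assms nbr_length[OF w(1)] by (auto simp: star_def intro!: bexI[of _ w])
  then show ?thesis using nbr_mono[OF le] by blast
qed

context coding
begin

lemma quarter0: "0 < (1/4::real)" "(1/4::real) \<le> 1/4" by auto

abbreviation X0 :: "'p metric" where "X0 \<equiv> MX (1/4)"
abbreviation d0 :: "'p \<Rightarrow> 'p \<Rightarrow> real" where "d0 \<equiv> pd (1/4)"

lemma mspace_X0 [simp]: "mspace X0 = range P" and mdist_X0 [simp]: "mdist X0 = d0"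
  using mspace_MX[OF quarter0] mdist_MX[OF quarter0] by auto

lemma d0_triangle: "x \<in> range P \<Longrightarrow> y \<in> range P \<Longrightarrow> z \<in> range P \<Longrightarrow> d0 x z \<le> d0 x y + d0 y z"
  by (rule Metric_space.triangle[OF Metric_space_pd[OF quarter0]])

lemma d0_commute: "d0 x y = d0 y x"
  by (rule Metric_space.commute[OF Metric_space_pd[OF quarter0]])

lemma d0_nonneg [simp]: "0 \<le> d0 x y"
  by (rule Metric_space.nonneg[OF Metric_space_pd[OF quarter0]])

lemma d0_zero: "x \<in> range P \<Longrightarrow> y \<in> range P \<Longrightarrow> d0 x y = 0 \<longleftrightarrow> x = y"
  by (rule Metric_space.zero[OF Metric_space_pd[OF quarter0]])

lemma d0_self [simp]: "x \<in> range P \<Longrightarrow> d0 x x = 0"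
  using d0_zero[of x x] by simp

lemma cell_d0: "x \<in> cell w \<Longrightarrow> y \<in> cell w \<Longrightarrow> d0 x y \<le> 8 * (1/4) ^ length w"
  using cell_pd[OF quarter0] by (simp add: wt_quarter)

lemma cellD: "x \<in> cell w \<Longrightarrow> x \<in> range P"
  using cell_subset[of w] by blast

section \<open>Lipschitz curves inside cells\<close>

definition lipc :: "'p set \<Rightarrow> (real \<Rightarrow> 'p) \<Rightarrow> bool" where
  "lipc S \<gamma> \<longleftrightarrow> S \<subseteq> range P \<and> (\<forall>t\<in>{0..1}. \<gamma> t \<in> S) \<and> (\<exists>L\<ge>0. \<forall>s\<in>{0..1}. \<forall>t\<in>{0..1}. d0 (\<gamma> s) (\<gamma> t) \<le> L * \<bar>s - t\<bar>)"

lemma adj_cells_d0: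
  assumes "adj v v'" "length v = length v'" "x \<in> cell v" "y \<in> cell v'"
  shows "d0 x y \<le> 16 * (1/4) ^ length v"
proof -
  obtain z where z: "z \<in> cell v" "z \<in> cell v'" using adj_cells[OF assms(1,2)] by blast
  have "d0 x y \<le> d0 x z + d0 z y" using assms z by (intro d0_triangle) (auto dest: cellD)
  then show ?thesis using cell_d0[OF assms(3) z(1)] cell_d0[OF z(2) assms(4)] assms(2) by simp
qed

text \<open>\<open>nbr_all\<close> links the cells of \<open>x\<close> and \<open>y\<close>, taken
  \<open>k\<close> levels below \<open>w\<close>, by 4 * 4 ^ k + 1 steps between adjacent cells;
  running through them at constant speed gives a step function. The 80 is 64 + 16, from the number
  of steps times the jump 16 * (1/4) ^ k, and the jumps themselves make up the error term.\<close>

lemma approx_curve: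
  assumes x: "x \<in> cell w" and y: "y \<in> cell w"
  shows "\<exists>g. (\<forall>t\<in>{0..1}. g t \<in> cell w) \<and> g 0 = x \<and> g 1 = y \<and>
    (\<forall>s\<in>{0..1}. \<forall>t\<in>{0..1}. d0 (g s) (g t) \<le> 80 * \<bar>s - t\<bar> + 64 * (1/4) ^ k)"
proof -
  obtain \<tau> where \<tau>: "x = P (ext w \<tau>)" using x by (rule cellE)
  obtain \<tau>' where \<tau>': "y = P (ext w \<tau>')" using y by (rule cellE)
  define J where "J = Suc (4 * 4 ^ k)"
  obtain c where c: "c 0 = pre \<tau> k" "c J = pre \<tau>' k" "\<forall>i\<le>J. length (c i) = k" "\<forall>i<J. adj (c i) (c (Suc i))"
    using nbr_chain[OF nbr_all[of "pre \<tau> k" k "pre \<tau>' k"]] unfolding J_def by auto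
  define z where "z i = P (ext (c i @ w) (\<lambda>_. L13))" for i
  have zc: "z i \<in> cell (c i @ w)" for i unfolding z_def by (rule cell_ext)
  have zw: "z i \<in> cell w" for i using zc[of i] cell_append[of "c i" w] by blast
  define B where "B = 16 * (1/4::real) ^ (k + length w)"
  have B: "0 \<le> B" "B \<le> 16 * (1/4) ^ k" unfolding B_def by (auto simp: power_add mult_left_le power_le_one)
  have step: "d0 (z i) (z (Suc i)) \<le> B" if "i < J" for i
  proof -
    have "adj (c i @ w) (c (Suc i) @ w)" using c that adj_append_iff[of "c i" "c (Suc i)" w] by simp
    then have "d0 (z i) (z (Suc i)) \<le> 16 * (1/4) ^ length (c i @ w)"
      using c that by (intro adj_cells_d0[OF _ _ zc zc]) auto
    then show ?thesis using c that by (simp add: B_def)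
  qed
  have dist: "d0 (z i) (z (i + j)) \<le> real j * B" if "i + j \<le> J" for i j
    using that
  proof (induction j)
    case 0
    then show ?case using zw[of i] cellD by (simp add: z_def)
  next
    case (Suc j)
    have "d0 (z i) (z (i + Suc j)) \<le> d0 (z i) (z (i + j)) + d0 (z (i + j)) (z (Suc (i + j)))"
      using d0_triangle[OF cellD[OF zw] cellD[OF zw] cellD[OF zw]] by simp
    also have "\<dots> \<le> real j * B + B" using Suc step[of "i + j"] by (intro add_mono) auto
    finally show ?case by (simp add: algebra_simps)
  qed
  have x0: "d0 x (z 0) \<le> B"
  proof -
    have "x \<in> cell (c 0 @ w)" using P_in_cell[of "ext w \<tau>" "length w + k"] unfolding \<tau> c(1) pre_ext .
    then have "d0 x (z 0) \<le> 8 * (1/4) ^ (k + length w)" using cell_d0[OF _ zc, of x 0] c(3) by simp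
    moreover have "0 \<le> (1/4::real) ^ (k + length w)" by simp
    ultimately show ?thesis unfolding B_def by linarith
  qed
  have y0: "d0 y (z J) \<le> B"
  proof -
    have "y \<in> cell (c J @ w)" using P_in_cell[of "ext w \<tau>'" "length w + k"] unfolding \<tau>' c(2) pre_ext .
    then have "d0 y (z J) \<le> 8 * (1/4) ^ (k + length w)" using cell_d0[OF _ zc, of y J] c(3) by simp
    moreover have "0 \<le> (1/4::real) ^ (k + length w)" by simp
    ultimately show ?thesis unfolding B_def by linarith
  qed
  define idx where "idx t = nat \<lfloor>t * real J\<rfloor>" for t :: real
  have idx: "idx t \<le> J" if "t \<in> {0..1}" for t
  proof -
    have "t * real J \<le> real J" using that by (simp add: mult_left_le_one_le)
    then have "\<lfloor>t * real J\<rfloor> \<le> int J" by (simp add: floor_le_iff)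
    then show ?thesis by (simp add: idx_def)
  qed
  define h where "h t = z (idx t)" for t
  have hd1: "d0 (h s) (h t) \<le> (\<bar>s - t\<bar> * real J + 1) * B" if st: "s \<le> t" "s \<in> {0..1}" "t \<in> {0..1}" for s t
  proof -
    have le: "idx s \<le> idx t" unfolding idx_def using st by (intro nat_mono floor_mono mult_right_mono) auto
    then have "d0 (h s) (h t) \<le> real (idx t - idx s) * B"
      using dist[of "idx s" "idx t - idx s"] idx[OF st(3)] by (simp add: h_def)
    also have "real (idx t - idx s) \<le> \<bar>s - t\<bar> * real J + 1"
    proof -
      have "real (idx t) \<le> t * real J" using st by (simp add: idx_def)
      moreover have "s * real J - 1 \<le> real (idx s)" unfolding idx_def using st by linarith
      ultimately show ?thesis using le st by (simp add: of_nat_diff algebra_simps)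
    qed
    finally show ?thesis using B by (simp add: mult_right_mono)
  qed
  have hd: "d0 (h s) (h t) \<le> (\<bar>s - t\<bar> * real J + 1) * B" if st: "s \<in> {0..1}" "t \<in> {0..1}" for s t
    using hd1[of s t] hd1[of t s] st by (cases "s \<le> t") (auto simp: d0_commute abs_minus_commute)
  define g where "g t = (if t = 0 then x else if t = 1 then y else h t)" for t
  have gc: "g t \<in> cell w" for t using x y zw by (simp add: g_def h_def)
  have hr: "h t \<in> range P" for t using cellD[OF zw] by (simp add: h_def)
  have gh: "d0 (g t) (h t) \<le> B" if "t \<in> {0..1}" for t
    using x0 y0 B hr by (auto simp: g_def h_def idx_def)
  have "d0 (g s) (g t) \<le> 80 * \<bar>s - t\<bar> + 64 * (1/4) ^ k" if st: "s \<in> {0..1}" "t \<in> {0..1}" for s t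
  proof -
    have "d0 (g s) (g t) \<le> d0 (g s) (h s) + (d0 (h s) (h t) + d0 (h t) (g t))"
      using d0_triangle[OF cellD[OF gc[of s]] hr[of s] cellD[OF gc[of t]]] d0_triangle[OF hr[of s] hr[of t] cellD[OF gc[of t]]] by linarith
    also have "\<dots> \<le> B + ((\<bar>s - t\<bar> * real J + 1) * B + B)"
      using gh[OF st(1)] gh[OF st(2)] hd[OF st] by (intro add_mono) (auto simp: d0_commute)
    also have "\<dots> = \<bar>s - t\<bar> * (real J * B) + 3 * B" by (simp add: algebra_simps)
    also have "\<dots> \<le> \<bar>s - t\<bar> * 80 + 64 * (1/4) ^ k"
    proof (intro add_mono mult_left_mono)
      have "real J * B \<le> real J * (16 * (1/4) ^ k)" using B by (intro mult_left_mono) auto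
      also have "\<dots> = 16 * (1/4) ^ k + 64" unfolding J_def by (simp add: field_simps power_divide)
      also have "\<dots> \<le> 80" by (simp add: power_le_one)
      finally show "real J * B \<le> 80" .
      show "3 * B \<le> 64 * (1/4) ^ k" using B(2) zero_le_power[of "1/4::real" k] by argo
    qed simp
    finally show ?thesis by (simp add: mult.commute)
  qed
  then show ?thesis using gc by (intro exI[of _ g]) (auto simp: g_def)
qed

text \<open>Tychonoff's theorem: the maps that are Lipschitz up to the error at \<open>k\<close>
  contain nonempty nested closed subsets of a product of copies of the compact cell, and a common
  point of these has no error left.\<close>

lemma cell_curve:
  assumes x: "x \<in> cell w" and y: "y \<in> cell w"
  shows "\<exists>\<gamma>. lipc (cell w) \<gamma> \<and> \<gamma> 0 = x \<and> \<gamma> 1 = y"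
proof -
  define T where "T = subtopology (mtopology_of X0) (cell w)"
  define F where "F = product_topology (\<lambda>_. T) {0..1::real}"
  have topT: "topspace T = cell w" using cell_subset[of w] by (auto simp: T_def)
  have topF: "topspace F = (\<Pi>\<^sub>E t\<in>{0..1}. cell w)" by (simp add: F_def topT)
  have "compact_space T" unfolding T_def by (rule compact_space_subtopology[OF compactin_cell[OF quarter0]])
  then have cF: "compact_space F" unfolding F_def by (simp add: compact_space_product_topology)
  have proj: "continuous_map F (mtopology_of X0) (\<lambda>f. f t)" if "t \<in> {0..1}" for t
  proof -
    have "continuous_map F T (\<lambda>f. f t)" unfolding F_def by (rule continuous_map_product_projection[OF that])
    then show ?thesis unfolding T_def by (rule continuous_map_into_fulltopology)
  qed
  have const: "continuous_map F (mtopology_of X0) (\<lambda>f. z)" if "z \<in> cell w" for z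
    using cellD[OF that] by simp
  have clo: "closedin F {f \<in> topspace F. d0 (a f) (b f) \<le> c}" 
    if "continuous_map F (mtopology_of X0) a" "continuous_map F (mtopology_of X0) b" for a b c
  proof -
    have "continuous_map F euclideanreal (\<lambda>f. d0 (a f) (b f))" using continuous_map_mdist[OF that] by simp
    moreover have "closedin euclideanreal {..c}" by simp
    ultimately have "closedin F {f \<in> topspace F. d0 (a f) (b f) \<in> {..c}}" by (rule closedin_continuous_map_preimage)
    then show ?thesis by simp
  qed
  define C where "C k = {f \<in> topspace F. d0 (f 0) x \<le> 0} \<inter> {f \<in> topspace F. d0 (f 1) y \<le> 0} \<inter>
     (\<Inter>s\<in>{0..1}. \<Inter>t\<in>{0..1}. {f \<in> topspace F. d0 (f s) (f t) \<le> 80 * \<bar>s - t\<bar> + 64 * (1/4) ^ k})" for k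
  have "(\<Inter>k. C k) \<noteq> {}"
  proof (rule compact_space_imp_nest[OF cF])
    fix k
    show "closedin F (C k)" unfolding C_def
      by (intro closedin_Int closedin_INT clo proj const x y) auto
    obtain g where g: "\<forall>t\<in>{0..1}. g t \<in> cell w" "g 0 = x" "g 1 = y" 
      "\<forall>s\<in>{0..1}. \<forall>t\<in>{0..1}. d0 (g s) (g t) \<le> 80 * \<bar>s - t\<bar> + 64 * (1/4) ^ k"
      using approx_curve[OF x y] by blast
    have "restrict g {0..1} \<in> C k"
      unfolding C_def topF using g cellD[OF x] cellD[OF y] by auto
    then show "C k \<noteq> {}" by blast
  next
    show "decseq C"
    proof (rule decseq_SucI)
      fix k
      have le: "64 * (1/4::real) ^ Suc k \<le> 64 * (1/4) ^ k" by simp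
      have "{f \<in> topspace F. d0 (f s) (f t) \<le> a + 64 * (1/4) ^ Suc k} \<subseteq> {f \<in> topspace F. d0 (f s) (f t) \<le> a + 64 * (1/4) ^ k}" for s t a
        by (intro Collect_mono impI conjI; elim conjE) (assumption, use le in linarith)
      then show "C (Suc k) \<subseteq> C k" unfolding C_def by (intro Int_mono subset_refl INF_superset_mono)
    qed
  qed
  then obtain f where f: "f \<in> C k" for k by blast
  have fc: "f t \<in> cell w" if "t \<in> {0..1}" for t
    using f[of 0] that unfolding C_def topF by (auto simp: PiE_iff)
  have "d0 (f 0) x \<le> 0" "d0 (f 1) y \<le> 0" using f[of 0] unfolding C_def by blast+
  then have "d0 (f 0) x = 0" "d0 (f 1) y = 0" by (simp_all add: antisym)
  then have "f 0 = x" "f 1 = y"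
    using fc[of 0] fc[of 1] d0_zero[of "f 0" x, OF cellD[of _ w] cellD[of _ w]] d0_zero[of "f 1" y, OF cellD[of _ w] cellD[of _ w]] x y by simp_all
  moreover have "d0 (f s) (f t) \<le> 80 * \<bar>s - t\<bar>" if st: "s \<in> {0..1}" "t \<in> {0..1}" for s t
  proof (rule LIMSEQ_le_const)
    have "(\<lambda>k. 80 * \<bar>s - t\<bar> + 64 * (1/4) ^ k) \<longlonglongrightarrow> 80 * \<bar>s - t\<bar> + 64 * 0"
      by (intro tendsto_intros LIMSEQ_power_zero) auto
    then show "(\<lambda>k. 80 * \<bar>s - t\<bar> + 64 * (1/4) ^ k) \<longlonglongrightarrow> 80 * \<bar>s - t\<bar>" by simp
    show "\<exists>N. \<forall>k\<ge>N. d0 (f s) (f t) \<le> 80 * \<bar>s - t\<bar> + 64 * (1/4) ^ k"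
      using f st unfolding C_def by blast
  qed
  ultimately show ?thesis
    unfolding lipc_def using fc cell_subset[of w] by (intro exI[of _ f] conjI exI[of _ 80]) auto
qed

lemma lipc_mono: "lipc S \<gamma> \<Longrightarrow> S \<subseteq> S' \<Longrightarrow> S' \<subseteq> range P \<Longrightarrow> lipc S' \<gamma>"
  unfolding lipc_def by blast

lemma lipc_join:
  assumes "lipc S \<gamma>1" "lipc S \<gamma>2" "\<gamma>1 1 = \<gamma>2 0"
  shows "lipc S (\<lambda>t. if t \<le> 1/2 then \<gamma>1 (2 * t) else \<gamma>2 (2 * t - 1))" (is "lipc S ?g")
proof -
  have S: "S \<subseteq> range P" using assms by (simp add: lipc_def)
  have i1: "\<gamma>1 t \<in> S" and i2: "\<gamma>2 t \<in> S" if "t \<in> {0..1}" for t using assms that by (auto simp: lipc_def)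
  obtain L1 where L1: "L1 \<ge> 0" "\<And>s t. s \<in> {0..1} \<Longrightarrow> t \<in> {0..1} \<Longrightarrow> d0 (\<gamma>1 s) (\<gamma>1 t) \<le> L1 * \<bar>s - t\<bar>"
    using assms(1) unfolding lipc_def by blast
  obtain L2 where L2: "L2 \<ge> 0" "\<And>s t. s \<in> {0..1} \<Longrightarrow> t \<in> {0..1} \<Longrightarrow> d0 (\<gamma>2 s) (\<gamma>2 t) \<le> L2 * \<bar>s - t\<bar>"
    using assms(2) unfolding lipc_def by blast
  define L where "L = max L1 L2"
  have gS: "?g t \<in> S" if "t \<in> {0..1}" for t using i1[of "2 * t"] i2[of "2 * t - 1"] that by auto
  have m1: "d0 (\<gamma>1 s) (\<gamma>1 t) \<le> L * \<bar>s - t\<bar>" if "s \<in> {0..1}" "t \<in> {0..1}" for s t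
    using L1(2)[OF that] mult_right_mono[of L1 L "\<bar>s - t\<bar>"] by (simp add: L_def)
  have m2: "d0 (\<gamma>2 s) (\<gamma>2 t) \<le> L * \<bar>s - t\<bar>" if "s \<in> {0..1}" "t \<in> {0..1}" for s t
    using L2(2)[OF that] mult_right_mono[of L2 L "\<bar>s - t\<bar>"] by (simp add: L_def)
  have le: "d0 (?g s) (?g t) \<le> 2 * L * \<bar>s - t\<bar>" if st: "s \<in> {0..1}" "t \<in> {0..1}" "s \<le> t" for s t
  proof -
    consider "t \<le> 1/2" | "1/2 < s" | "s \<le> 1/2" "1/2 < t" using st by linarith
    then show ?thesis
    proof cases
      case 1
      have "\<bar>2 * s - 2 * t\<bar> = 2 * \<bar>s - t\<bar>" using st by (simp add: abs_if)
      then show ?thesis using m1[of "2 * s" "2 * t"] 1 st by (simp add: mult_ac)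
    next
      case 2
      have "\<bar>(2 * s - 1) - (2 * t - 1)\<bar> = 2 * \<bar>s - t\<bar>" using st by (simp add: abs_if)
      then show ?thesis using m2[of "2 * s - 1" "2 * t - 1"] 2 st by (simp add: mult_ac)
    next
      case 3
      have "d0 (\<gamma>1 (2 * s)) (\<gamma>2 (2 * t - 1)) \<le> d0 (\<gamma>1 (2 * s)) (\<gamma>1 1) + d0 (\<gamma>2 0) (\<gamma>2 (2 * t - 1))"
        using d0_triangle[of "\<gamma>1 (2 * s)" "\<gamma>1 1" "\<gamma>2 (2 * t - 1)"] i1[of "2 * s"] i1[of 1] i2[of "2 * t - 1"] S 3 st assms(3) by auto
      also have "\<dots> \<le> L * \<bar>2 * s - 1\<bar> + L * \<bar>0 - (2 * t - 1)\<bar>"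
        using m1[of "2 * s" 1] m2[of 0 "2 * t - 1"] 3 st by (intro add_mono) auto
      also have "\<dots> = 2 * L * \<bar>s - t\<bar>" using 3 st by (simp add: algebra_simps abs_if)
      finally show ?thesis using 3 by simp
    qed
  qed
  have "d0 (?g s) (?g t) \<le> 2 * L * \<bar>s - t\<bar>" if st: "s \<in> {0..1}" "t \<in> {0..1}" for s t
    using le[of s t] le[of t s] st d0_commute[of "?g s" "?g t"] abs_minus_commute[of s t] by (cases "s \<le> t") auto
  then show ?thesis
    unfolding lipc_def using S gS L1 by (intro conjI exI[of _ "2 * L"]) (auto simp: L_def)
qed

lemma chain_curve:
  assumes "ws \<noteq> []" "\<And>w. w \<in> set ws \<Longrightarrow> length w = m" "successively adj ws" "x \<in> cell (hd ws)" "y \<in> cell (last ws)"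
  shows "\<exists>\<gamma>. lipc (\<Union>w\<in>set ws. cell w) \<gamma> \<and> \<gamma> 0 = x \<and> \<gamma> 1 = y"
  using assms
proof (induction ws arbitrary: x rule: list_nonempty_induct)
  case (single w)
  then show ?case using cell_curve[of x w y] by simp
next
  case (cons w ws)
  obtain w' ws' where ws: "ws = w' # ws'" using cons.hyps by (cases ws) auto
  have sub: "(\<Union>w\<in>set (w # ws). cell w) \<subseteq> range P" using cellD by blast
  have "adj w w'" using cons.prems(2) by (simp add: ws)
  then obtain p where p: "p \<in> cell w" "p \<in> cell w'"
    using adj_cells[of w w'] cons.prems(1)[of w] cons.prems(1)[of w'] by (auto simp: ws)
  obtain \<gamma>2 where g2: "lipc (\<Union>w\<in>set ws. cell w) \<gamma>2" "\<gamma>2 0 = p" "\<gamma>2 1 = y"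
    using cons.IH[of p] cons.prems p cons.hyps by (auto simp: ws)
  obtain \<gamma>1 where g1: "lipc (cell w) \<gamma>1" "\<gamma>1 0 = x" "\<gamma>1 1 = p"
    using cell_curve[of x w p] cons.prems(3) p by auto
  have "lipc (\<Union>w\<in>set (w # ws). cell w) \<gamma>1" by (rule lipc_mono[OF g1(1) _ sub]) auto
  moreover have "lipc (\<Union>w\<in>set (w # ws). cell w) \<gamma>2" by (rule lipc_mono[OF g2(1) _ sub]) auto
  ultimately have "lipc (\<Union>w\<in>set (w # ws). cell w) (\<lambda>t. if t \<le> 1/2 then \<gamma>1 (2 * t) else \<gamma>2 (2 * t - 1))"
    by (rule lipc_join) (simp add: g1 g2)
  then show ?case using g1 g2 by (intro exI[of _ "\<lambda>t. if t \<le> 1/2 then \<gamma>1 (2 * t) else \<gamma>2 (2 * t - 1)"]) simp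
qed

lemma lipc_pathin:
  assumes "lipc S \<gamma>" shows "pathin (mtopology_of X0) \<gamma>"
proof -
  obtain L where L: "L \<ge> 0" "\<And>s t. s \<in> {0..1} \<Longrightarrow> t \<in> {0..1} \<Longrightarrow> d0 (\<gamma> s) (\<gamma> t) \<le> L * \<bar>s - t\<bar>"
    using assms unfolding lipc_def by blast
  have r: "\<gamma> t \<in> range P" if "t \<in> {0..1}" for t using assms that unfolding lipc_def by blast
  show ?thesis
    unfolding pathin_def mtopology_of_def Metric_space.continuous_map_to_metric[OF Metric_space_mspace_mdist]
  proof (intro ballI allI impI)
    fix t \<epsilon> :: real assume t: "t \<in> topspace (top_of_set {0..1})" and \<epsilon>: "0 < \<epsilon>"
    define \<delta> where "\<delta> = \<epsilon> / (L + 1)"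
    have \<delta>: "0 < \<delta>" using \<epsilon> L by (simp add: \<delta>_def)
    have 1: "\<gamma> s \<in> Metric_space.mball (mspace X0) (mdist X0) (\<gamma> t) \<epsilon>" if s: "s \<in> {0..1} \<inter> ball t \<delta>" for s
    proof -
      have "d0 (\<gamma> t) (\<gamma> s) \<le> L * \<bar>t - s\<bar>" using L(2)[of t s] t s by auto
      also have "\<dots> \<le> L * \<delta>" using s L by (intro mult_left_mono) (auto simp: dist_real_def)
      also have "\<dots> < \<epsilon>" using \<epsilon> L by (simp add: \<delta>_def field_simps)
      finally show ?thesis using r t s by (simp add: Metric_space.in_mball[OF Metric_space_pd[OF quarter0]])
    qed
    show "\<exists>U. openin (top_of_set {0..1}) U \<and> t \<in> U \<and> (\<forall>y\<in>U. \<gamma> y \<in> Metric_space.mball (mspace X0) (mdist X0) (\<gamma> t) \<epsilon>)"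
      using 1 \<delta> t by (intro exI[of _ "{0..1} \<inter> ball t \<delta>"]) (auto simp: openin_open)
  qed
qed

lemma lipc_rectifiable:
  assumes "lipc S \<gamma>" shows "rectifiable X0 \<gamma>"
  unfolding rectifiable_def
proof
  show "pathin (mtopology_of X0) \<gamma>" by (rule lipc_pathin[OF assms])
  obtain L where L: "L \<ge> 0" "\<And>s t. s \<in> {0..1} \<Longrightarrow> t \<in> {0..1} \<Longrightarrow> d0 (\<gamma> s) (\<gamma> t) \<le> L * \<bar>s - t\<bar>"
    using assms unfolding lipc_def by blast
  have "curve_length X0 \<gamma> 1 \<le> ennreal L"
    unfolding curve_length_def
  proof (rule SUP_least)
    fix ts :: "real list" assume ts: "ts \<in> {ts. sorted ts \<and> set ts \<subseteq> {0..1}}"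
    have tsi: "ts ! i \<in> {0..1}" if "i < length ts" for i using ts nth_mem[OF that] by blast
    have "(\<Sum>i<length ts - 1. ennreal (mdist X0 (\<gamma> (ts ! i)) (\<gamma> (ts ! Suc i)))) \<le> (\<Sum>i<length ts - 1. ennreal (L * (ts ! Suc i - ts ! i)))"
    proof (intro sum_mono ennreal_leI)
      fix i assume i: "i \<in> {..<length ts - 1}"
      then have "ts ! i \<le> ts ! Suc i" using ts by (auto intro: sorted_nth_mono)
      then show "mdist X0 (\<gamma> (ts ! i)) (\<gamma> (ts ! Suc i)) \<le> L * (ts ! Suc i - ts ! i)"
        using L(2)[of "ts ! i" "ts ! Suc i"] tsi[of i] tsi[of "Suc i"] i by auto
    qed
    also have "\<dots> = ennreal (\<Sum>i<length ts - 1. L * (ts ! Suc i - ts ! i))"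
      using ts L(1) by (intro sum_ennreal mult_nonneg_nonneg) (auto intro: sorted_nth_mono)
    also have "(\<Sum>i<length ts - 1. L * (ts ! Suc i - ts ! i)) = L * (ts ! (length ts - 1) - ts ! 0)"
      by (simp add: sum_distrib_left[symmetric] sum_lessThan_telescope)
    also have "ennreal \<dots> \<le> ennreal L"
    proof (cases "ts = []")
      case True
      then show ?thesis using L by (simp add: ennreal_leI)
    next
      case False
      then have "ts ! (length ts - 1) - ts ! 0 \<le> 1" using tsi[of 0] tsi[of "length ts - 1"] by auto
      then have "L * (ts ! (length ts - 1) - ts ! 0) \<le> L * 1" using L(1) by (intro mult_left_mono) auto
      then show ?thesis by (intro ennreal_leI) simp
    qed
    finally show "(\<Sum>i<length ts - 1. ennreal (mdist X0 (\<gamma> (ts ! i)) (\<gamma> (ts ! Suc i)))) \<le> ennreal L" .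
  qed
  also have "\<dots> < \<infinity>" by simp
  finally show "curve_length X0 \<gamma> 1 < \<infinity>" .
qed

lemma connectedin_cell: "connectedin (mtopology_of X0) (cell w)"
proof (rule path_connectedin_imp_connectedin, unfold path_connectedin, intro conjI ballI)
  show "cell w \<subseteq> topspace (mtopology_of X0)" using cell_subset by simp
  fix x y assume "x \<in> cell w" "y \<in> cell w"
  then obtain \<gamma> where "lipc (cell w) \<gamma>" "\<gamma> 0 = x" "\<gamma> 1 = y" using cell_curve by blast
  then show "\<exists>g. pathin (mtopology_of X0) g \<and> g \<in> {0..1} \<rightarrow> cell w \<and> g 0 = x \<and> g 1 = y"
    using lipc_pathin by (intro exI[of _ \<gamma>]) (auto simp: lipc_def)
qed

end

section \<open>Arc length\<close>

fun plen :: "'a metric \<Rightarrow> (real \<Rightarrow> 'a) \<Rightarrow> real list \<Rightarrow> real" where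
  "plen m \<gamma> (a # b # l) = mdist m (\<gamma> a) (\<gamma> b) + plen m \<gamma> (b # l)"
| "plen m \<gamma> l = 0"

lemma plen_nonneg: "0 \<le> plen m \<gamma> l"
  by (induction m \<gamma> l rule: plen.induct) auto

lemma plen_sum: "(\<Sum>i<length ts - 1. ennreal (mdist m (\<gamma> (ts ! i)) (\<gamma> (ts ! Suc i)))) = ennreal (plen m \<gamma> ts)"
proof (induction m \<gamma> ts rule: plen.induct)
  case (1 m \<gamma> a b l)
  have "(\<Sum>i<length (a # b # l) - 1. ennreal (mdist m (\<gamma> ((a # b # l) ! i)) (\<gamma> ((a # b # l) ! Suc i)))) =
     ennreal (mdist m (\<gamma> a) (\<gamma> b)) + (\<Sum>i<length (b # l) - 1. ennreal (mdist m (\<gamma> ((b # l) ! i)) (\<gamma> ((b # l) ! Suc i))))"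
    by (simp add: sum.lessThan_Suc_shift del: sum.lessThan_Suc sum_ennreal)
  then show ?case using 1 by (simp only: plen.simps(1) ennreal_plus[OF mdist_nonneg plen_nonneg])
qed auto

lemma plen_append_ge: "plen m \<gamma> xs + plen m \<gamma> ys \<le> plen m \<gamma> (xs @ ys)"
proof (induction m \<gamma> xs rule: plen.induct)
  case ("2_2" m \<gamma> v)
  then show ?case by (cases ys) auto
qed auto

lemma plen_split: "plen m \<gamma> (xs @ a # ys) = plen m \<gamma> (xs @ [a]) + plen m \<gamma> (a # ys)"
  by (induction m \<gamma> xs rule: plen.induct) auto

lemma plen_insert:
  assumes "\<gamma> ` set (xs @ a # ys) \<subseteq> mspace m"
  shows "plen m \<gamma> (xs @ ys) \<le> plen m \<gamma> (xs @ a # ys)"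
  using assms
proof (induction m \<gamma> xs rule: plen.induct)
  case ("2_1" m \<gamma>)
  then show ?case by (cases ys) auto
next
  case ("2_2" m \<gamma> v)
  then show ?case
  proof (cases ys)
    case (Cons y l)
    then have "mdist m (\<gamma> v) (\<gamma> y) \<le> mdist m (\<gamma> v) (\<gamma> a) + mdist m (\<gamma> a) (\<gamma> y)"
      using "2_2" by (intro mdist_triangle) auto
    then show ?thesis using Cons by simp
  qed auto
qed auto

locale rect_curve =
  fixes m :: "'a metric" and \<gamma> :: "real \<Rightarrow> 'a"
  assumes rect: "rectifiable m \<gamma>"
begin

lemma in_mspace: "t \<in> {0..1} \<Longrightarrow> \<gamma> t \<in> mspace m"
proof -
  assume "t \<in> {0..1}"
  have "continuous_map (top_of_set {0..1}) (mtopology_of m) \<gamma>"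
    using rect unfolding rectifiable_def pathin_def by blast
  from continuous_map_image_subset_topspace[OF this] \<open>t \<in> {0..1}\<close> show ?thesis by auto
qed

definition len :: "real \<Rightarrow> real" where "len t = enn2real (curve_length m \<gamma> t)"

lemma curve_length_plen: "curve_length m \<gamma> t = (SUP ts\<in>{ts. sorted ts \<and> set ts \<subseteq> {0..t}}. ennreal (plen m \<gamma> ts))"
  unfolding curve_length_def plen_sum ..

lemma curve_length_mono: "s \<le> t \<Longrightarrow> curve_length m \<gamma> s \<le> curve_length m \<gamma> t"
  unfolding curve_length_plen by (intro SUP_subset_mono) auto

lemma len_ennreal: "t \<le> 1 \<Longrightarrow> ennreal (len t) = curve_length m \<gamma> t"
proof -
  assume "t \<le> 1"
  then have "curve_length m \<gamma> t < top"
    using curve_length_mono[of t 1] rect unfolding rectifiable_def by (metis infinity_ennreal_def order_le_less_trans)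
  then show ?thesis by (simp add: len_def)
qed

lemma len_nonneg: "0 \<le> len t" by (simp add: len_def)

lemma len_ge: "sorted ts \<Longrightarrow> set ts \<subseteq> {0..t} \<Longrightarrow> t \<le> 1 \<Longrightarrow> plen m \<gamma> ts \<le> len t"
proof -
  assume ts: "sorted ts" "set ts \<subseteq> {0..t}" "t \<le> 1"
  have "ennreal (plen m \<gamma> ts) \<le> curve_length m \<gamma> t"
    unfolding curve_length_plen using ts by (intro SUP_upper) auto
  then have "ennreal (plen m \<gamma> ts) \<le> ennreal (len t)" using len_ennreal ts by simp
  then show ?thesis using len_nonneg by (simp add: ennreal_le_iff)
qed

lemma len_le:
  assumes "t \<le> 1" "0 \<le> B" "\<And>ts. sorted ts \<Longrightarrow> set ts \<subseteq> {0..t} \<Longrightarrow> plen m \<gamma> ts \<le> B"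
  shows "len t \<le> B"
proof -
  have "curve_length m \<gamma> t \<le> ennreal B"
    unfolding curve_length_plen using assms by (intro SUP_least ennreal_leI) auto
  then show ?thesis using len_ennreal[OF assms(1)] assms(2) by (metis ennreal_le_iff)
qed

lemma len_add:
  assumes "0 \<le> t" "t \<le> 1" "sorted us" "set us \<subseteq> {t..1}"
  shows "len t + plen m \<gamma> us \<le> len 1"
proof -
  have "0 \<in> {0..1::real}" by simp
  have "len t \<le> len 1 - plen m \<gamma> us"
  proof (rule len_le[OF assms(2)])
    show "0 \<le> len 1 - plen m \<gamma> us" using len_ge[of us 1] assms by force
    fix ts assume ts: "sorted ts" "set ts \<subseteq> {0..t}"
    have "plen m \<gamma> (ts @ us) \<le> len 1"
      using ts assms by (intro len_ge) (force simp: sorted_append)+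
    then show "plen m \<gamma> ts \<le> len 1 - plen m \<gamma> us" using plen_append_ge[of m \<gamma> ts us] by simp
  qed
  then show ?thesis by simp
qed

lemma len_dist:
  assumes "0 \<le> s" "s \<le> t" "t \<le> 1"
  shows "len s + mdist m (\<gamma> s) (\<gamma> t) \<le> len t"
proof -
  have 1: "plen m \<gamma> [s, t] \<le> len t" using assms by (intro len_ge) auto
  have "len s \<le> len t - mdist m (\<gamma> s) (\<gamma> t)"
  proof (rule len_le)
    fix ts assume ts: "sorted ts" "set ts \<subseteq> {0..s}"
    have "plen m \<gamma> (ts @ [s, t]) \<le> len t"
      using ts assms by (intro len_ge) (force simp: sorted_append)+
    then show "plen m \<gamma> ts \<le> len t - mdist m (\<gamma> s) (\<gamma> t)" using plen_append_ge[of m \<gamma> ts "[s, t]"] by simp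
  qed (use assms 1 in auto)
  then show ?thesis by simp
qed

lemma len_mono: "0 \<le> s \<Longrightarrow> s \<le> t \<Longrightarrow> t \<le> 1 \<Longrightarrow> len s \<le> len t"
  using len_dist[of s t] mdist_nonneg[of m "\<gamma> s" "\<gamma> t"] by linarith

lemma dist_le_len: "s \<in> {0..1} \<Longrightarrow> t \<in> {0..1} \<Longrightarrow> mdist m (\<gamma> s) (\<gamma> t) \<le> \<bar>len s - len t\<bar>"
  using len_dist[of s t] len_dist[of t s] mdist_commute[of m "\<gamma> s" "\<gamma> t"] by (cases "s \<le> t") auto

lemma len_0: "len 0 = 0"
proof -
  have "len 0 \<le> 0"
  proof (rule len_le)
    fix ts :: "real list" assume "set ts \<subseteq> {0..0}"
    then have "set ts \<subseteq> {0}" by auto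
    then show "plen m \<gamma> ts \<le> 0"
    proof (induction ts rule: induct_list012)
      case (3 a b l)
      then show ?case using in_mspace[of 0] by auto
    qed auto
  qed auto
  then show ?thesis using len_nonneg[of 0] by simp
qed

text \<open>If a nearly optimal partition has no point strictly between \<open>s\<close> and \<open>t\<close>, then the piece of
  the curve between \<open>s\<close> and \<open>t\<close> is nearly straight.\<close>

lemma len_gap:
  assumes ts: "sorted ts" "set ts \<subseteq> {0..1}" "len 1 - \<epsilon> < plen m \<gamma> ts"
    and st: "0 \<le> s" "s \<le> t" "t \<le> 1" "\<And>p. p \<in> set ts \<Longrightarrow> p \<le> s \<or> t \<le> p"
  shows "len t \<le> len s + mdist m (\<gamma> s) (\<gamma> t) + \<epsilon>"
proof -
  define vs where "vs = takeWhile (\<lambda>p. p \<le> s) ts"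
  define us where "us = dropWhile (\<lambda>p. p \<le> s) ts"
  have ts_eq: "ts = vs @ us" by (simp add: vs_def us_def)
  have vs: "sorted vs" "\<forall>p\<in>set vs. p \<le> s"
    using ts(1) unfolding ts_eq by (auto simp: sorted_append vs_def dest: set_takeWhileD)
  have us: "sorted us" "\<forall>p\<in>set us. t \<le> p"
  proof -
    show sus: "sorted us" using ts(1) unfolding ts_eq by (simp add: sorted_append)
    show "\<forall>p\<in>set us. t \<le> p"
    proof (cases us)
      case (Cons a l)
      then have "\<not> a \<le> s" unfolding us_def by (metis hd_dropWhile list.distinct(1) list.sel(1))
      then have "t \<le> a" using st(4)[of a] Cons ts_eq by auto
      then show ?thesis using sus Cons by auto
    qed auto
  qed
  have sub: "\<gamma> ` set (vs @ s # t # us) \<subseteq> mspace m"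
  proof -
    have "set (vs @ s # t # us) \<subseteq> {0..1}" using ts(2) st unfolding ts_eq by auto
    then show ?thesis using in_mspace by blast
  qed
  have "plen m \<gamma> ts \<le> plen m \<gamma> (vs @ t # us)"
    unfolding ts_eq using sub by (intro plen_insert) auto
  also have "\<dots> \<le> plen m \<gamma> (vs @ s # t # us)" using sub by (intro plen_insert) auto
  also have "\<dots> = plen m \<gamma> (vs @ [s]) + (mdist m (\<gamma> s) (\<gamma> t) + plen m \<gamma> (t # us))"
    by (subst plen_split) simp
  also have "\<dots> \<le> len s + (mdist m (\<gamma> s) (\<gamma> t) + (len 1 - len t))"
  proof (intro add_mono order_refl)
    show "plen m \<gamma> (vs @ [s]) \<le> len s" using vs ts(2) st unfolding ts_eq
      by (intro len_ge) (auto simp: sorted_append)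
    have "set us \<subseteq> {t..1}" using us(2) ts(2) unfolding ts_eq by auto
    then show "plen m \<gamma> (t # us) \<le> len 1 - len t" using us st len_add[of t "t # us"] by simp
  qed
  finally show ?thesis using ts(3) by simp
qed

text \<open>Take a partition whose polygonal length is within \<open>e/2\<close> of the total
  length. Between \<open>t\<close> and a sufficiently close parameter there is no further partition
  point, so \<open>len_gap\<close> bounds the length of this piece by the distance of its ends plus
  \<open>e/2\<close>.\<close>

lemma continuous_len: "continuous_on {0..1} len"
  unfolding continuous_on_iff
proof (intro ballI allI impI)
  fix t e :: real assume t: "t \<in> {0..1}" and e: "0 < e"
  have "\<exists>ts. sorted ts \<and> set ts \<subseteq> {0..1} \<and> len 1 - e/2 < plen m \<gamma> ts"
  proof (rule ccontr)
    assume no: "\<not> ?thesis"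
    have "len 1 \<le> max 0 (len 1 - e/2)"
    proof (rule len_le)
      fix ts :: "real list" assume "sorted ts" "set ts \<subseteq> {0..1}"
      then show "plen m \<gamma> ts \<le> max 0 (len 1 - e/2)" using no by (force simp: not_less)
    qed auto
    then have "len 1 = 0" using e len_nonneg[of 1] by linarith
    then show False using no e by (auto dest: spec[of _ "[]"])
  qed
  then obtain ts where ts: "sorted ts" "set ts \<subseteq> {0..1}" "len 1 - e/2 < plen m \<gamma> ts" by blast
  obtain \<delta>1 where d1: "0 < \<delta>1" "\<And>s. s \<in> {0..1} \<Longrightarrow> \<bar>s - t\<bar> < \<delta>1 \<Longrightarrow> mdist m (\<gamma> t) (\<gamma> s) < e/2"
  proof -
    have "continuous_map (top_of_set {0..1}) (Metric_space.mtopology (mspace m) (mdist m)) \<gamma>"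
      using rect unfolding rectifiable_def pathin_def mtopology_of_def by blast
    then obtain U where U: "openin (top_of_set {0..1}) U" "t \<in> U" 
      "\<forall>y\<in>U. \<gamma> y \<in> Metric_space.mball (mspace m) (mdist m) (\<gamma> t) (e/2)"
      unfolding Metric_space.continuous_map_to_metric[OF Metric_space_mspace_mdist] using t e 
      by (metis half_gt_zero topspace_euclidean_subtopology)
    from U(1,2) obtain \<delta> where "0 < \<delta>" "\<And>s. s \<in> {0..1} \<Longrightarrow> dist s t < \<delta> \<Longrightarrow> s \<in> U"
      unfolding openin_euclidean_subtopology_iff by blast
    then show ?thesis using that[of \<delta>] U(3) by (auto simp: dist_real_def Metric_space.in_mball[OF Metric_space_mspace_mdist])
  qed
  define \<delta>2 where "\<delta>2 = Min (insert 1 ((\<lambda>p. \<bar>p - t\<bar>) ` (set ts - {t})))"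
  have d2: "0 < \<delta>2" unfolding \<delta>2_def by (subst Min_gr_iff) auto
  have d2le: "\<delta>2 \<le> \<bar>p - t\<bar>" if "p \<in> set ts" "p \<noteq> t" for p
    unfolding \<delta>2_def using that by (intro Min_le) auto
  show "\<exists>d>0. \<forall>x'\<in>{0..1}. dist x' t < d \<longrightarrow> dist (len x') (len t) < e"
  proof (intro exI[of _ "min \<delta>1 \<delta>2"] conjI ballI impI)
    fix s assume s: "s \<in> {0..1}" "dist s t < min \<delta>1 \<delta>2"
    then have st: "\<bar>s - t\<bar> < \<delta>1" "\<bar>s - t\<bar> < \<delta>2" by (auto simp: dist_real_def)
    have gap: "p \<le> min s t \<or> max s t \<le> p" if "p \<in> set ts" for p
      using d2le[OF that] st(2) by (cases "p = t") (auto simp: min_def max_def abs_if split: if_splits)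
    have dd: "mdist m (\<gamma> (min s t)) (\<gamma> (max s t)) < e/2"
      using d1(2)[OF s(1) st(1)] mdist_commute[of m "\<gamma> s" "\<gamma> t"] by (auto simp: min_def max_def)
    have "len (max s t) \<le> len (min s t) + mdist m (\<gamma> (min s t)) (\<gamma> (max s t)) + e/2"
      using s t gap by (intro len_gap[OF ts]) auto
    moreover have "len (min s t) \<le> len (max s t)" using s t by (intro len_mono) auto
    ultimately show "dist (len s) (len t) < e" using dd by (auto simp: dist_real_def min_def max_def split: if_splits)
  qed (use d1 d2 in auto)
qed

lemma len_surj:
  assumes "0 \<le> u" "u \<le> len 1" shows "\<exists>t\<in>{0..1}. len t = u"
  using IVT'[of len 0 u 1] continuous_len len_0 assms by auto

text \<open>In arc length the curve stays in \<open>V i\<close> on a set of parameters of measure at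
  least \<open>h i\<close>: ahead of the given point, or also behind it when too little length is
  left, where \<open>h i \<le> len 1\<close> provides the room. Comparing with indicators of the
  intervals \<open>A i\<close> of lengths avoids the question whether \<open>\<rho>\<close> is
  measurable along the curve.\<close>

lemma curve_integral_ge:
  fixes I :: "'i set"
  assumes I: "finite I" and h: "\<And>i. i \<in> I \<Longrightarrow> 0 \<le> h i" and \<rho>: "\<And>y. y \<in> mspace m \<Longrightarrow> \<rho> y = (\<Sum>i\<in>I. ennreal (c i) * indicator (V i) y)"
    and c: "\<And>i. i \<in> I \<Longrightarrow> 0 \<le> c i"
    and V: "\<And>i. i \<in> J \<Longrightarrow> \<exists>t\<in>{0..1}. \<forall>y\<in>mspace m. mdist m (\<gamma> t) y < h i \<longrightarrow> y \<in> V i"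
    and J: "J \<subseteq> I" and hl: "\<And>i. i \<in> J \<Longrightarrow> h i \<le> len 1"
  shows "ennreal (\<Sum>i\<in>J. c i * h i) \<le> curve_integral m \<rho> \<gamma>"
proof -
  have finJ: "finite J" using I J finite_subset by blast
  define \<tau> where "\<tau> u = (SOME t. t \<in> {0..1} \<and> curve_length m \<gamma> t = ennreal u)" for u
  have \<tau>: "\<tau> u \<in> {0..1} \<and> len (\<tau> u) = u" if "u \<in> {0..len 1}" for u
  proof -
    have "\<exists>t\<in>{0..1}. len t = u" using len_surj[of u] that by simp
    then obtain t where "t \<in> {0..1}" "len t = u" by blast
    then have "\<exists>t. t \<in> {0..1} \<and> curve_length m \<gamma> t = ennreal u" using len_ennreal by auto
    from someI_ex[OF this] have "\<tau> u \<in> {0..1}" "curve_length m \<gamma> (\<tau> u) = ennreal u" unfolding \<tau>_def by blast+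
    then show ?thesis using that by (auto simp: len_def)
  qed
  obtain T where T: "\<And>i. i \<in> J \<Longrightarrow> T i \<in> {0..1}" "\<And>i y. i \<in> J \<Longrightarrow> y \<in> mspace m \<Longrightarrow> mdist m (\<gamma> (T i)) y < h i \<Longrightarrow> y \<in> V i"
    using V by metis
  define A where "A i = {0..len 1} \<inter> {len (T i) - h i<..<len (T i) + h i}" for i
  have Alen: "ennreal (h i) \<le> emeasure lborel (A i)" if i: "i \<in> J" for i
  proof -
    have Tl: "0 \<le> len (T i)" "len (T i) \<le> len 1" using T(1)[OF i] len_nonneg len_mono[of "T i" 1] by auto
    show ?thesis
    proof (cases "len (T i) + h i \<le> len 1")
      case True
      have "{len (T i)<..<len (T i) + h i} \<subseteq> A i" unfolding A_def using Tl True h[of i] J i by auto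
      then have "emeasure lborel {len (T i)<..<len (T i) + h i} \<le> emeasure lborel (A i)"
        by (intro emeasure_mono) (auto simp: A_def)
      then show ?thesis using h[of i] J i by auto
    next
      case False
      define a where "a = max 0 (len (T i) - h i)"
      have "{a<..<len (T i)} \<union> {len (T i)..len 1} \<subseteq> A i" unfolding A_def a_def using Tl False h[of i] J i by auto
      then have sub: "{a<..len 1} \<subseteq> A i" using Tl unfolding a_def by force
      have "emeasure lborel {a<..len 1} \<le> emeasure lborel (A i)"
        using sub by (intro emeasure_mono) (auto simp: A_def)
      moreover have "a \<le> len 1" "h i \<le> len 1 - a" using hl[OF i] Tl h[of i] J i unfolding a_def by auto
      ultimately show ?thesis by (auto intro: order_trans[OF ennreal_leI])
    qed
  qed
  have "ennreal (\<Sum>i\<in>J. c i * h i) = (\<Sum>i\<in>J. ennreal (c i) * ennreal (h i))"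
    using c h J by (subst sum_ennreal[symmetric]) (auto simp: ennreal_mult intro!: sum.cong)
  also have "\<dots> \<le> (\<Sum>i\<in>J. ennreal (c i) * emeasure lborel (A i))"
    by (intro sum_mono mult_left_mono Alen) auto
  also have "\<dots> = (\<integral>\<^sup>+u. (\<Sum>i\<in>J. ennreal (c i) * indicator (A i) u) \<partial>lborel)"
    by (subst nn_integral_sum) (auto simp: nn_integral_cmult_indicator A_def)
  also have "\<dots> \<le> curve_integral m \<rho> \<gamma>"
    unfolding curve_integral_def len_def[symmetric] \<tau>_def[symmetric]
  proof (rule nn_integral_mono)
    fix u :: real
    show "(\<Sum>i\<in>J. ennreal (c i) * indicator (A i) u) \<le> \<rho> (\<gamma> (\<tau> u)) * indicator {0..len 1} u"
    proof (cases "u \<in> {0..len 1}")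
      case True
      have "(\<Sum>i\<in>J. ennreal (c i) * indicator (A i) u) \<le> (\<Sum>i\<in>J. ennreal (c i) * indicator (V i) (\<gamma> (\<tau> u)))"
      proof (intro sum_mono mult_left_mono)
        fix i assume i: "i \<in> J"
        have "\<gamma> (\<tau> u) \<in> V i" if "u \<in> A i"
        proof (rule T(2)[OF i])
          show "\<gamma> (\<tau> u) \<in> mspace m" using in_mspace \<tau>[OF True] by blast
          have "mdist m (\<gamma> (T i)) (\<gamma> (\<tau> u)) \<le> \<bar>len (T i) - u\<bar>" using dist_le_len[of "T i" "\<tau> u"] T(1)[OF i] \<tau>[OF True] by auto
          also have "\<dots> < h i" using that unfolding A_def by auto
          finally show "mdist m (\<gamma> (T i)) (\<gamma> (\<tau> u)) < h i" .
        qed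
        then show "(indicator (A i) u :: ennreal) \<le> indicator (V i) (\<gamma> (\<tau> u))" by (auto simp: indicator_def)
      qed auto
      also have "\<dots> \<le> (\<Sum>i\<in>I. ennreal (c i) * indicator (V i) (\<gamma> (\<tau> u)))" using J I by (intro sum_mono2) auto
      finally show ?thesis using \<rho>[of "\<gamma> (\<tau> u)"] in_mspace[of "\<tau> u"] \<tau>[OF True] True by simp
    next
      case False
      then show ?thesis by (auto simp: A_def indicator_def)
    qed
  qed
  finally show ?thesis .
qed

end

section \<open>Crossing estimates and conformal dimension\<close>

lemma interval_cover:
  fixes a b :: "'i \<Rightarrow> real"
  assumes "finite I" "{\<alpha>..\<beta>} \<subseteq> (\<Union>i\<in>I. {a i..b i})" "\<And>i. i \<in> I \<Longrightarrow> a i \<le> b i"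
  shows "\<beta> - \<alpha> \<le> (\<Sum>i\<in>I. b i - a i)"
proof (cases "\<alpha> \<le> \<beta>")
  case True
  have "ennreal (\<beta> - \<alpha>) = emeasure lborel {\<alpha>..\<beta>}" using True by simp
  also have "\<dots> \<le> emeasure lborel (\<Union>i\<in>I. {a i..b i})" using assms by (intro emeasure_mono) auto
  also have "\<dots> \<le> (\<Sum>i\<in>I. emeasure lborel {a i..b i})" using assms(1) by (intro emeasure_subadditive_finite) auto
  also have "\<dots> = (\<Sum>i\<in>I. ennreal (b i - a i))" using assms(3) by (intro sum.cong) auto
  also have "\<dots> = ennreal (\<Sum>i\<in>I. b i - a i)" using assms(3) by (intro sum_ennreal) auto
  finally show ?thesis using assms(3) by (subst (asm) ennreal_le_iff) (auto intro: sum_nonneg)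
next
  case False
  then show ?thesis using assms(3) sum_nonneg[of I "\<lambda>i. b i - a i"] by auto
qed

text \<open>A maximum principle: \<open>lin_ext\<close> copies values or takes convex combinations
  of the values at the two ends of an edge.\<close>

lemma lin_ext_between:
  assumes "a \<le> u (vert w False)" "u (vert w False) \<le> b" "a \<le> u (vert w True)" "u (vert w True) \<le> b"
  shows "a \<le> (lin_ext ^^ length v) u (vert (v @ w) s) \<and> (lin_ext ^^ length v) u (vert (v @ w) s) \<le> b"
proof (induction v arbitrary: s)
  case Nil
  then show ?case using assms by (cases s) auto
next
  case (Cons f v)
  define g where "g = (lin_ext ^^ length v) u"
  have g: "a \<le> g (vert (v @ w) s)" "g (vert (v @ w) s) \<le> b" for s using Cons unfolding g_def by auto
  have *: "a \<le> x + h * (y - x) \<and> x + h * (y - x) \<le> b" if "a \<le> x" "x \<le> b" "a \<le> y" "y \<le> b" "0 \<le> h" "h \<le> 1" for x y h :: real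
  proof -
    have "x + h * (y - x) = (1 - h) * x + h * y" by (simp add: algebra_simps)
    moreover have "(1 - h) * a + h * a \<le> (1 - h) * x + h * y" using that by (intro add_mono mult_left_mono) auto
    moreover have "(1 - h) * x + h * y \<le> (1 - h) * b + h * b" using that by (intro add_mono mult_left_mono) auto
    ultimately show ?thesis by (simp add: algebra_simps)
  qed
  have "a \<le> lin_ext g (vert (f # v @ w) s) \<and> lin_ext g (vert (f # v @ w) s) \<le> b"
  proof (cases "outl f s")
    case None
    have h: "0 \<le> hgt z" "hgt z \<le> 1" for z by (auto simp: hgt_def)
    show ?thesis using *[OF g[of False] g[of True] h] None by (simp add: vert_Cons gr_def)
  next
    case (Some c)
    then show ?thesis using g[of s] by (simp add: vert_Cons)
  qed
  then show ?case by (simp add: g_def)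
qed

context coding
begin

text \<open>The ranges of \<open>u\<close> on the cells meeting \<open>S\<close> cover the whole
  interval between the two values. A missed value would split these cells into those below and those
  above it; adjacent cells share a vertex and hence a value, so the two unions would be disjoint
  closed sets disconnecting \<open>S\<close>.\<close>

lemma crossing:
  assumes S: "connectedin (mtopology_of X0) S"
    and w0: "w0 \<in> words n" "cell w0 \<inter> S \<noteq> {}" and w1: "w1 \<in> words n" "cell w1 \<inter> S \<noteq> {}"
  shows "u (vert w1 s1) - u (vert w0 s0) \<le> (\<Sum>w\<in>{w\<in>words n. cell w \<inter> S \<noteq> {}}. \<bar>gr u w\<bar>)"
proof -
  define M where "M = {w\<in>words n. cell w \<inter> S \<noteq> {}}"
  define lo' where "lo' w = min (u (vert w False)) (u (vert w True))" for w
  define hi' where "hi' w = max (u (vert w False)) (u (vert w True))" for w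
  have lohi: "lo' w \<le> u (vert w s)" "u (vert w s) \<le> hi' w" for w s
    unfolding lo'_def hi'_def by (cases s; simp)+
  have finM: "finite M" by (simp add: M_def)
  have SP: "S \<subseteq> range P" using S unfolding connectedin_def by simp
  have cover: "{u (vert w0 s0)..u (vert w1 s1)} \<subseteq> (\<Union>w\<in>M. {lo' w..hi' w})"
  proof (rule ccontr)
    assume "\<not> ?thesis"
    then obtain c where c': "c \<in> {u (vert w0 s0)..u (vert w1 s1)}" "c \<notin> (\<Union>w\<in>M. {lo' w..hi' w})" by blast
    have c: "u (vert w0 s0) \<le> c" "c \<le> u (vert w1 s1)" "\<And>w. w \<in> M \<Longrightarrow> \<not> (lo' w \<le> c \<and> c \<le> hi' w)"
      using c' by auto
    define A where "A = {w\<in>M. hi' w < c}"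
    define B where "B = {w\<in>M. c < lo' w}"
    define UA where "UA = (\<Union>w\<in>A. cell w)"
    define UB where "UB = (\<Union>w\<in>B. cell w)"
    have AB: "M = A \<union> B" "finite A" "finite B" using c(3) finM by (fastforce simp: A_def B_def)+
    have cl: "closedin (mtopology_of X0) UA" "closedin (mtopology_of X0) UB"
      unfolding UA_def UB_def using AB closedin_cell[OF quarter0] by (intro closedin_Union; auto)+
    have "S \<subseteq> UA \<union> UB"
    proof
      fix x assume x: "x \<in> S"
      then have "x \<in> (\<Union>w\<in>words n. cell w)" using SP range_cells[of n] by auto
      then obtain w where "w \<in> words n" "x \<in> cell w" by blast
      then have "w \<in> M" using x unfolding M_def by blast
      then show "x \<in> UA \<union> UB" using \<open>x \<in> cell w\<close> AB(1) unfolding UA_def UB_def by blast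
    qed
    moreover have "UA \<inter> UB = {}"
    proof (rule ccontr)
      assume "UA \<inter> UB \<noteq> {}"
      then obtain a b x where ab: "a \<in> A" "b \<in> B" "x \<in> cell a" "x \<in> cell b" unfolding UA_def UB_def by blast
      then have "adj a b" by (intro cells_adj) (auto simp: A_def B_def M_def words_def)
      then obtain s s' where "vert a s = vert b s'" by (auto simp: adj_def)
      then show False using lohi[where w=a and s=s] lohi[where w=b and s=s'] ab(1,2) unfolding A_def B_def by auto
    qed
    moreover have "w0 \<in> A" "w1 \<in> B"
    proof -
      have m: "w0 \<in> M" "w1 \<in> M" using w0 w1 by (auto simp: M_def)
      show "w0 \<in> A" using lohi(1)[where w=w0 and s=s0] c(1) c(3)[OF m(1)] m by (auto simp: A_def)
      show "w1 \<in> B" using lohi(2)[where w=w1 and s=s1] c(2) c(3)[OF m(2)] m by (auto simp: B_def)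
    qed
    then have "UA \<inter> S \<noteq> {}" "UB \<inter> S \<noteq> {}" using w0(2) w1(2) unfolding UA_def UB_def by blast+
    ultimately show False using S cl unfolding connectedin_closedin by blast
  qed
  have "u (vert w1 s1) - u (vert w0 s0) \<le> (\<Sum>w\<in>M. hi' w - lo' w)"
    by (rule interval_cover[OF finM cover]) (auto simp: lo'_def hi'_def)
  also have "\<dots> = (\<Sum>w\<in>M. \<bar>gr u w\<bar>)" by (intro sum.cong) (auto simp: lo'_def hi'_def gr_def)
  finally show ?thesis unfolding M_def .
qed

end

section \<open>Test functions for the continuous modulus\<close>

context qs_target
begin

lemma sides_far:
  assumes h: "h \<in> {L67, L68}" "x \<in> cell [h]" and k: "k \<in> {L13, L23}" "z \<in> cell [k]"
  shows "D [] / (2 * HH 32) \<le> mdist Y (f x) (f z)"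
proof -
  obtain \<tau> where \<tau>1: "x = P (ext [h] \<tau>)" using h(2) by (rule cellE)
  obtain \<tau>' where \<tau>2: "z = P (ext [k] \<tau>')" using k(2) by (rule cellE)
  note \<tau> = \<tau>1 \<tau>2
  have "\<not> adj [h] [k]" 
  proof
    assume "adj [h] [k]"
    then obtain s s' where "vert [h] s = vert [k] s'" by (auto simp: adj_def)
    then show False using h(1) k(1) by (cases s; cases s') auto
  qed
  then have "\<not> adj (pre (ext [h] \<tau>) 1) (pre (ext [k] \<tau>') 1)"
    using pre_ext_len[of "[h]" \<tau>] pre_ext_len[of "[k]" \<tau>'] by simp
  from pd_lower[OF quarter this] have "1/4 \<le> pd (1/4) x z" unfolding \<tau> wt_quarter by simp
  then have "D [] \<le> 2 * HH (8 * 4) * mdist Y (f x) (f z)"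
    using cell_range[OF h(2)] cell_range[OF k(2)] by (intro D_le_outside) (auto simp: cell_def)
  then show ?thesis using HH1[of 32] by (simp add: field_simps)
qed

lemma ball_measure_le:
  obtains C where "0 < C" "\<And>y r. y \<in> mspace Y \<Longrightarrow> 0 < r \<Longrightarrow> hausdorff Y Q (mball_of Y y r) \<le> ennreal (C * r powr Q)"
proof -
  obtain C where C: "C > 1" "\<And>x r. x \<in> mspace Y \<Longrightarrow> r > 0 \<Longrightarrow> ennreal r \<le> mdiam Y (mspace Y) \<Longrightarrow>
        hausdorff Y Q (mball_of Y x r) \<le> ennreal (C * r powr Q)"
    using ar unfolding ahlfors_regular_def by blast
  define M where "M = enn2real (hausdorff Y Q (mspace Y))"
  have M: "hausdorff Y Q (mspace Y) = ennreal M" "0 \<le> M" using hausdorff_finite[OF ar] by (auto simp: M_def)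
  have dY: "mdiam Y (mspace Y) = ennreal (D [])" unfolding D_def using mdiam_Y[OF f_cell[of "[]"]] f_im by (simp add: cell_def)
  define C' where "C' = max C (M / D [] powr Q)"
  show ?thesis
  proof (rule that[of C'])
    show "0 < C'" using C by (simp add: C'_def)
    fix y and r :: real assume y: "y \<in> mspace Y" and r: "0 < r"
    show "hausdorff Y Q (mball_of Y y r) \<le> ennreal (C' * r powr Q)"
    proof (cases "r \<le> D []")
      case True
      then have "hausdorff Y Q (mball_of Y y r) \<le> ennreal (C * r powr Q)" using y r dY by (intro C(2)) (auto intro: ennreal_leI)
      also have "\<dots> \<le> ennreal (C' * r powr Q)" by (intro ennreal_leI mult_right_mono) (auto simp: C'_def)
      finally show ?thesis .
    next
      case False
      have "hausdorff Y Q (mball_of Y y r) \<le> ennreal M" unfolding M(1)[symmetric] by (intro hausdorff_mono) auto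
      also have "M \<le> C' * r powr Q"
      proof -
        have "M = M / D [] powr Q * D [] powr Q" using D_pos[of "[]"] by simp
        also have "\<dots> \<le> C' * r powr Q" using False D_pos[of "[]"] Qpos M C by (intro mult_mono powr_mono2) (auto simp: C'_def)
        finally show ?thesis .
      qed
      then have "ennreal M \<le> ennreal (C' * r powr Q)" by (rule ennreal_leI)
      finally show ?thesis .
    qed
  qed
qed

text \<open>The first bound keeps \<open>V w\<close> over the star of \<open>w\<close>
  (\<open>V_star\<close>), so that at most 8 of these sets overlap. The second keeps
  \<open>\<kappa> * D w\<close> below the length of every curve between the two opposite cells, as
  \<open>curve_integral_ge\<close> requires.\<close>

definition \<kappa> :: real where "\<kappa> = min (1 / (2 * HH 8)) (1 / (2 * HH 32))"

lemma \<kappa>: "0 < \<kappa>" "\<kappa> \<le> 1" "2 * HH 8 * \<kappa> \<le> 1" "2 * HH 32 * \<kappa> \<le> 1"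
proof -
  have 1: "1 \<le> HH 8" "1 \<le> HH 32" by (rule HH1)+
  show "0 < \<kappa>" using 1 by (simp add: \<kappa>_def)
  have "\<kappa> \<le> 1 / (2 * HH 8)" "\<kappa> \<le> 1 / (2 * HH 32)" by (simp_all add: \<kappa>_def)
  then show "2 * HH 8 * \<kappa> \<le> 1" "2 * HH 32 * \<kappa> \<le> 1" using 1 by (simp_all add: field_simps)
  moreover have "1 * \<kappa> \<le> 2 * HH 8 * \<kappa>" using \<open>0 < \<kappa>\<close> 1 by (intro mult_right_mono) auto
  ultimately show "\<kappa> \<le> 1" by linarith
qed

definition V :: "ltr list \<Rightarrow> 'b set" where
  "V w = {y \<in> mspace Y. \<exists>x\<in>cell w. mdist Y (f x) y < \<kappa> * D w}"

lemma V_open: "openin (mtopology_of Y) (V w)"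
proof -
  have "V w = (\<Union>x\<in>cell w. mball_of Y (f x) (\<kappa> * D w))" using f_in_cell by (auto simp: V_def)
  moreover have "openin (mtopology_of Y) (mball_of Y x r)" for x r
    unfolding mtopology_of_def mball_of_def by (rule Metric_space.openin_mball[OF Metric_space_mspace_mdist])
  ultimately show ?thesis by auto
qed

lemma V_star:
  assumes "f (P \<omega>) \<in> V w" "length w = n" shows "w \<in> star (pre \<omega> n)"
proof (rule ccontr)
  assume "w \<notin> star (pre \<omega> n)"
  then have na: "\<not> adj w (pre \<omega> n)" using assms(2) adj_sym by (auto simp: star_def)
  obtain x where x: "x \<in> cell w" "mdist Y (f x) (f (P \<omega>)) < \<kappa> * D w" using assms(1) by (auto simp: V_def)
  obtain \<tau> where \<tau>: "x = P (ext w \<tau>)" using x(1) by (rule cellE)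
  have "\<not> adj (pre (ext w \<tau>) n) (pre \<omega> n)" using na pre_ext_len[of w \<tau>] assms(2) by simp
  from pd_lower[OF quarter this] have "(1/4) ^ length w \<le> 1 * pd (1/4) x (P \<omega>)" using assms(2) unfolding \<tau> wt_quarter by simp
  then have "D w \<le> 2 * HH (8 * 1) * mdist Y (f x) (f (P \<omega>))" using x(1) by (intro D_le_outside) auto
  also have "\<dots> < 2 * HH 8 * (\<kappa> * D w)" using x(2) HH1[of 8] by (auto intro: mult_strict_left_mono)
  also have "\<dots> \<le> 1 * D w" unfolding mult.assoc[symmetric] using \<kappa>(3) D_nonneg by (intro mult_right_mono) auto
  finally show False by simp
qed

lemma V_measure_le:
  assumes C: "\<And>y r. y \<in> mspace Y \<Longrightarrow> 0 < r \<Longrightarrow> hausdorff Y Q (mball_of Y y r) \<le> ennreal (C * r powr Q)"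
  shows "hausdorff Y Q (V w) \<le> ennreal (C * (3 * D w) powr Q)"
proof -
  obtain x0 where x0: "x0 \<in> cell w" using cell_nonempty[of w] by auto
  have "V w \<subseteq> mball_of Y (f x0) (3 * D w)"
  proof
    fix y assume "y \<in> V w"
    then obtain x where x: "x \<in> cell w" "mdist Y (f x) y < \<kappa> * D w" "y \<in> mspace Y" by (auto simp: V_def)
    have "mdist Y (f x0) y \<le> mdist Y (f x0) (f x) + mdist Y (f x) y"
      using f_in_cell[OF x0] f_in_cell[OF x(1)] x(3) by (intro mdist_triangle)
    moreover have "mdist Y (f x0) (f x) \<le> D w" using x0 x(1) by (rule D_ge)
    moreover have "\<kappa> * D w \<le> 1 * D w" using \<kappa>(2) D_nonneg by (intro mult_right_mono)
    ultimately have "mdist Y (f x0) y < 3 * D w" using x(2) D_pos[of w] by linarith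
    then show "y \<in> mball_of Y (f x0) (3 * D w)" using f_in_cell[OF x0] x(3) by simp
  qed
  then have "hausdorff Y Q (V w) \<le> hausdorff Y Q (mball_of Y (f x0) (3 * D w))" by (rule hausdorff_mono)
  also have "\<dots> \<le> ennreal (C * (3 * D w) powr Q)" using f_in_cell[OF x0] D_pos[of w] by (intro C) auto
  finally show ?thesis .
qed

text \<open>\<open>emeasure\<close> of \<open>measure_of\<close> is either the given set function or
  0, the latter whenever the axioms of a measure fail. The inequality therefore holds without
  proving countable additivity, and only upper bounds are wanted.\<close>

lemma emeasure_hausdorff_le: "emeasure (hausdorff_measure Y Q) A \<le> hausdorff Y Q A"
proof -
  have "{U. openin (mtopology_of Y) U} \<subseteq> Pow (mspace Y)"
    using openin_subset[of "mtopology_of Y"] by auto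
  then show ?thesis
    unfolding hausdorff_measure_def by (simp add: emeasure_measure_of_conv)
qed

lemma space_hausdorff: "space (hausdorff_measure Y Q) = mspace Y"
  unfolding hausdorff_measure_def by (simp add: space_measure_of_conv)

lemma V_sets: "V w \<in> sets (hausdorff_measure Y Q)"
proof -
  have "{U. openin (mtopology_of Y) U} \<subseteq> Pow (mspace Y)"
    using openin_subset[of "mtopology_of Y"] by auto
  then show ?thesis unfolding hausdorff_measure_def using V_open by (simp add: sets_measure_of)
qed

text \<open>The test function charges each cell by its weight in the auxiliary metric divided by the
  diameter of its image, so its energy is the sum of the \<open>Q\<close>-th powers of the weights.\<close>

lemma modulus_small:
  assumes d: "0 < d" "d \<le> 1/4" and Q': "8 * (1/4) powr Q' + d powr Q' = 1" "0 < Q'" "Q' < Q" and \<epsilon>: "0 < \<epsilon>"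
  shows "modulus Y Q (curves_between Y (f ` cell [L13]) (f ` cell [L67])) \<le> ennreal \<epsilon>"
proof -
  obtain C where C: "0 < C" "\<And>y r. y \<in> mspace Y \<Longrightarrow> 0 < r \<Longrightarrow> hausdorff Y Q (mball_of Y y r) \<le> ennreal (C * r powr Q)"
    by (rule ball_measure_le) blast
  \<comment> \<open>With this factor a curve meeting the cells in \<open>M\<close> has
    \<open>\<rho>\<close>-length at least twice the sum of their weights, and the potential
    \<open>u\<close> below shows that these weights sum to at least 1/2.\<close>
  define A where "A = 2 / \<kappa>"
  have A: "0 < A" using \<kappa> by (simp add: A_def)
  define K where "K = 8 powr Q * A powr Q * C * 3 powr Q"
  have K: "0 < K" using A C by (simp add: K_def)
  \<comment> \<open>\<open>K\<close> collects the overlap 8, the factor \<open>A\<close> and the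
    measure bound for \<open>V w\<close>. Since the \<open>Q'\<close>-th powers of the weights sum
    to 1, the surplus exponent \<open>Q - Q'\<close> makes the energy at level \<open>n\<close> at
    most this expression.\<close>
  obtain n where n: "1 \<le> n" "K * ((1/4) ^ n) powr (Q - Q') \<le> \<epsilon>"
  proof -
    have "(\<lambda>n. K * ((1/4) powr (Q - Q')) ^ n) \<longlonglongrightarrow> K * 0"
    proof (intro tendsto_intros LIMSEQ_power_zero)
      have "(1/4::real) powr (Q - Q') < 1 powr (Q - Q')" using Q' by (intro powr_less_mono2) auto
      then show "norm ((1/4::real) powr (Q - Q')) < 1" by simp
    qed
    then have "\<forall>\<^sub>F n in sequentially. K * ((1/4) powr (Q - Q')) ^ n < \<epsilon>" using \<epsilon> by (intro order_tendstoD(2)) auto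
    then obtain N where N: "\<And>n. N \<le> n \<Longrightarrow> K * ((1/4) powr (Q - Q')) ^ n < \<epsilon>" by (auto simp: eventually_sequentially)
    have e: "((1/4::real) ^ n) powr (Q - Q') = ((1/4) powr (Q - Q')) ^ n" for n
      by (simp add: powr_realpow[symmetric] powr_powr powr_gt_zero mult.commute)
    show ?thesis using that[of "Suc N"] N[of "Suc N"] e[of "Suc N"] by simp
  qed
  define c where "c w = A * wt d w / D w" for w
  have c: "0 \<le> c w" for w using A wt_pos[OF d, of w] D_pos[of w] by (simp add: c_def)
  define \<rho> :: "'b \<Rightarrow> ennreal" where "\<rho> y = (\<Sum>w\<in>words n. ennreal (c w) * indicator (V w) y)" for y
  have meas: "\<rho> \<in> borel_measurable (hausdorff_measure Y Q)"
    unfolding \<rho>_def using V_sets by measurable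
  have adm: "1 \<le> curve_integral Y \<rho> \<gamma>"
    if \<gamma>: "\<gamma> \<in> curves_between Y (f ` cell [L13]) (f ` cell [L67])" for \<gamma>
  proof -
    interpret rect_curve Y \<gamma> using \<gamma> by unfold_locales (simp add: curves_between_def)
    obtain x0 x1 where x01: "x0 \<in> cell [L13]" "\<gamma> 0 = f x0" "x1 \<in> cell [L67]" "\<gamma> 1 = f x1"
      using \<gamma> by (auto simp: curves_between_def)
    obtain g where g: "homeomorphic_maps (mtopology_of X0) (mtopology_of Y) f g"
      using qs unfolding quasisymmetry_def homeomorphic_map_maps by blast
    have "g ` mspace Y \<subseteq> range P"
      using g continuous_map_image_subset_topspace[of "mtopology_of Y" "mtopology_of X0" g] unfolding homeomorphic_maps_def by auto
    then have fg: "f (g y) = y" "g y \<in> range P" if "y \<in> mspace Y" for y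
      using g that unfolding homeomorphic_maps_def by auto
    have gf: "g (f x) = x" if "x \<in> range P" for x
      using g that unfolding homeomorphic_maps_def by auto
    define S where "S = (g \<circ> \<gamma>) ` {0..1}"
    have "continuous_map (top_of_set {0..1}) (mtopology_of X0) (g \<circ> \<gamma>)"
      using g rect unfolding homeomorphic_maps_def rectifiable_def pathin_def by (auto intro: continuous_map_compose)
    moreover have "connectedin (top_of_set {0..1}) {0..1::real}" by (simp add: connectedin_subtopology)
    ultimately have S: "connectedin (mtopology_of X0) S"
      unfolding S_def by (rule connectedin_continuous_map_image)
    define M where "M = {w\<in>words n. cell w \<inter> S \<noteq> {}}"
    \<comment> \<open>The potential rising from 0 to 1 across the single edge of level 0. Its
      extensions are at most 1/4 at the vertices below \<open>[L13]\<close> and at least 3/4 at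
      those below \<open>[L67]\<close>.\<close>
    define u0 where "u0 v = (if v = Root True then 1 else 0 :: real)" for v
    have u0: "Lip d 0 u0" by (rule LipI) (simp add: gr_def u0_def)
    define u where "u = (lin_ext ^^ n) u0"
    have u: "Lip d n u" using Lip_lin_ext_pow[OF d u0, of n] by (simp add: u_def)
    have ex: "\<exists>w. w \<in> words n \<and> x \<in> cell w \<and> (\<exists>v. w = v @ [h])" if xh: "x \<in> cell [h]" for x h
    proof -
      obtain \<tau> where \<tau>: "x = P (ext [h] \<tau>)" using xh by (rule cellE)
      have "pre (ext [h] \<tau>) n = pre \<tau> (n - 1) @ [h]" using pre_ext[of "[h]" \<tau> "n - 1"] n(1) by simp
      then show ?thesis using P_in_cell[of "ext [h] \<tau>" n] n(1) unfolding \<tau>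
        by (intro exI[of _ "pre \<tau> (n - 1) @ [h]"]) (auto simp: words_def)
    qed
    have un: "u (vert (v @ [h]) s) = (lin_ext ^^ length v) (lin_ext u0) (vert (v @ [h]) s)" if "v @ [h] \<in> words n" for v h s
    proof -
      have "n = Suc (length v)" using that by (simp add: words_def)
      then show ?thesis unfolding u_def by (simp add: funpow_swap1)
    qed
    obtain w0 where w0: "w0 \<in> words n" "x0 \<in> cell w0" "\<exists>v. w0 = v @ [L13]" using ex[OF x01(1)] by blast
    obtain w1 where w1: "w1 \<in> words n" "x1 \<in> cell w1" "\<exists>v. w1 = v @ [L67]" using ex[OF x01(3)] by blast
    have "u (vert w0 True) \<le> 1/4"
    proof -
      obtain v where v: "w0 = v @ [L13]" using w0 by blast
      show ?thesis unfolding v un[OF w0(1)[unfolded v]]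
        using lin_ext_between[of 0 "lin_ext u0" "[L13]" "1/4" v True] by (simp add: u0_def gr_def hgt_def)
    qed
    moreover have "3/4 \<le> u (vert w1 True)"
    proof -
      obtain v where v: "w1 = v @ [L67]" using w1 by blast
      show ?thesis unfolding v un[OF w1(1)[unfolded v]]
        using lin_ext_between[of "3/4" "lin_ext u0" "[L67]" 1 v True] by (simp add: u0_def gr_def hgt_def)
    qed
    moreover have "u (vert w1 True) - u (vert w0 True) \<le> (\<Sum>w\<in>M. \<bar>gr u w\<bar>)"
      unfolding M_def
    proof (rule crossing[OF S])
      have "x0 = (g \<circ> \<gamma>) 0" "x1 = (g \<circ> \<gamma>) 1"
        using x01 gf[OF cell_range[OF x01(1)]] gf[OF cell_range[OF x01(3)]] by simp_all
      then have "x0 \<in> S" "x1 \<in> S" unfolding S_def by (auto intro: rev_image_eqI)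
      then show "cell w0 \<inter> S \<noteq> {}" "cell w1 \<inter> S \<noteq> {}" using w0 w1 by blast+
    qed (use w0 w1 in auto)
    moreover have "(\<Sum>w\<in>M. \<bar>gr u w\<bar>) \<le> (\<Sum>w\<in>M. wt d w)"
      using u by (intro sum_mono) (auto simp: Lip_def M_def words_def)
    ultimately have W: "1/2 \<le> (\<Sum>w\<in>M. wt d w)" by linarith
    have "ennreal (\<Sum>w\<in>M. c w * (\<kappa> * D w)) \<le> curve_integral Y \<rho> \<gamma>"
    proof (rule curve_integral_ge[where I="words n" and V=V])
      fix w assume w: "w \<in> M"
      then obtain x where x: "x \<in> cell w" "x \<in> S" by (auto simp: M_def)
      then obtain t where t: "t \<in> {0..1}" "x = g (\<gamma> t)" by (auto simp: S_def)
      have "f x = \<gamma> t" using fg(1)[OF in_mspace[OF t(1)]] t(2) by simp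
      then show "\<exists>t\<in>{0..1}. \<forall>y\<in>mspace Y. mdist Y (\<gamma> t) y < \<kappa> * D w \<longrightarrow> y \<in> V w"
        using t(1) x(1) by (intro bexI[of _ t]) (auto simp: V_def intro!: bexI[of _ x])
      have "\<kappa> * D w \<le> \<kappa> * D []" using D_mono[of w "[]"] cell_append[of w "[]"] \<kappa> by (intro mult_left_mono) auto
      also have "\<dots> \<le> D [] / (2 * HH 32)"
      proof -
        have "2 * HH 32 * \<kappa> * D [] \<le> 1 * D []" using \<kappa>(4) D_nonneg by (intro mult_right_mono)
        then show ?thesis using HH1[of 32] by (simp add: field_simps)
      qed
      also have "\<dots> \<le> mdist Y (f x1) (f x0)" using x01 by (intro sides_far) auto
      also have "\<dots> \<le> len 1" using dist_le_len[of 1 0] len_0 x01 len_nonneg[of 1] by simp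
      finally show "\<kappa> * D w \<le> len 1" .
    qed (use c \<kappa> D_nonneg in \<open>auto simp: \<rho>_def M_def\<close>)
    moreover have "(\<Sum>w\<in>M. c w * (\<kappa> * D w)) = 2 * (\<Sum>w\<in>M. wt d w)"
      unfolding sum_distrib_left using \<kappa>(1) D_pos by (intro sum.cong) (auto simp: c_def A_def less_imp_neq[symmetric])
    moreover have "ennreal 1 \<le> ennreal (2 * (\<Sum>w\<in>M. wt d w))" using W by (intro ennreal_leI) simp
    ultimately show ?thesis using order_trans[of "ennreal 1"] by (simp only: ennreal_1)
  qed
  have point: "epowr (\<rho> y) Q \<le> (\<Sum>w\<in>words n. ennreal (8 powr Q * c w powr Q) * indicator (V w) y)" if y: "y \<in> mspace Y" for y
  proof -
    obtain \<omega> where \<omega>: "y = f (P \<omega>)" using f_im y by auto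
    define M where "M = {w\<in>words n. y \<in> V w}"
    have finM: "finite M" by (simp add: M_def)
    have "M \<subseteq> star (pre \<omega> n)" using V_star unfolding M_def \<omega> words_def by auto
    then have cM: "card M \<le> 8" using card_mono[OF star_card(1), of M "pre \<omega> n"] star_card(2)[of "pre \<omega> n"] by simp
    have r: "\<rho> y = ennreal (\<Sum>w\<in>M. c w)"
    proof -
      have "\<rho> y = (\<Sum>w\<in>M. ennreal (c w))" unfolding \<rho>_def by (intro sum.mono_neutral_cong_right) (auto simp: M_def)
      then show ?thesis using c by (subst (asm) sum_ennreal) auto
    qed
    have r2: "(\<Sum>w\<in>words n. ennreal (8 powr Q * c w powr Q) * indicator (V w) y) = ennreal (\<Sum>w\<in>M. 8 powr Q * c w powr Q)"
    proof -
      have "(\<Sum>w\<in>words n. ennreal (8 powr Q * c w powr Q) * indicator (V w) y) = (\<Sum>w\<in>M. ennreal (8 powr Q * c w powr Q))"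
        by (intro sum.mono_neutral_cong_right) (auto simp: M_def)
      then show ?thesis by (subst (asm) sum_ennreal) auto
    qed
    have "(\<Sum>w\<in>M. c w) powr Q \<le> (\<Sum>w\<in>M. 8 powr Q * c w powr Q)"
    proof (cases "M = {}")
      case False
      have "Max (c ` M) \<in> c ` M" using finM False by (intro Max_in) auto
      then obtain w where "w \<in> M" "Max (c ` M) = c w" by auto
      then have w: "w \<in> M" "\<And>v. v \<in> M \<Longrightarrow> c v \<le> c w" using finM Max_ge[of "c ` M"] by auto
      have "(\<Sum>w\<in>M. c w) \<le> real (card M) * c w" using w(2) by (intro sum_bounded_above) auto
      also have "\<dots> \<le> 8 * c w" using cM c by (intro mult_right_mono) auto
      finally have "(\<Sum>w\<in>M. c w) powr Q \<le> (8 * c w) powr Q" using Qpos c by (intro powr_mono2) (auto intro: sum_nonneg)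
      also have "\<dots> = 8 powr Q * c w powr Q" by (rule powr_mult)
      also have "\<dots> \<le> (\<Sum>w\<in>M. 8 powr Q * c w powr Q)" using w(1) finM by (intro member_le_sum) auto
      finally show ?thesis .
    qed simp
    then show ?thesis unfolding r r2 using c by (subst epowr_ennreal) (auto intro: sum_nonneg ennreal_leI)
  qed
  have "modulus Y Q (curves_between Y (f ` cell [L13]) (f ` cell [L67])) \<le> (\<integral>\<^sup>+y. epowr (\<rho> y) Q \<partial>hausdorff_measure Y Q)"
    unfolding modulus_def using meas adm by (intro INF_lower) auto
  also have "\<dots> \<le> (\<integral>\<^sup>+y. (\<Sum>w\<in>words n. ennreal (8 powr Q * c w powr Q) * indicator (V w) y) \<partial>hausdorff_measure Y Q)"
    using point by (intro nn_integral_mono) (auto simp: space_hausdorff)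
  also have "\<dots> = (\<Sum>w\<in>words n. ennreal (8 powr Q * c w powr Q) * emeasure (hausdorff_measure Y Q) (V w))"
    using V_sets by (subst nn_integral_sum) (auto simp: nn_integral_cmult_indicator)
  also have "\<dots> \<le> (\<Sum>w\<in>words n. ennreal (8 powr Q * c w powr Q) * ennreal (C * (3 * D w) powr Q))"
    using order_trans[OF emeasure_hausdorff_le V_measure_le[OF C(2)]] by (intro sum_mono mult_left_mono) auto
  also have "\<dots> = (\<Sum>w\<in>words n. ennreal (K * wt d w powr Q))"
  proof (intro sum.cong refl)
    fix w
    have "c w powr Q * (3 * D w) powr Q = (c w * (3 * D w)) powr Q" by (simp add: powr_mult)
    also have "c w * (3 * D w) = A * (3 * wt d w)" using D_pos[of w] by (simp add: c_def)
    also have "\<dots> powr Q = A powr Q * (3 powr Q * wt d w powr Q)" by (simp add: powr_mult)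
    finally have "8 powr Q * c w powr Q * (C * (3 * D w) powr Q) = K * wt d w powr Q"
      unfolding K_def by (simp add: mult_ac)
    then show "ennreal (8 powr Q * c w powr Q) * ennreal (C * (3 * D w) powr Q) = ennreal (K * wt d w powr Q)"
      using C(1) by (subst ennreal_mult[symmetric]) auto
  qed
  also have "\<dots> = ennreal (\<Sum>w\<in>words n. K * wt d w powr Q)" using K by (intro sum_ennreal) auto
  also have "\<dots> \<le> ennreal \<epsilon>"
  proof (rule ennreal_leI)
    have "(\<Sum>w\<in>words n. K * wt d w powr Q) \<le> (\<Sum>w\<in>words n. K * ((1/4) ^ n) powr (Q - Q') * wt d w powr Q')"
    proof (rule sum_mono)
      fix w assume w: "w \<in> words n"
      have "wt d w powr Q = wt d w powr (Q - Q') * wt d w powr Q'" by (simp add: powr_add[symmetric])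
      also have "\<dots> \<le> ((1/4) ^ n) powr (Q - Q') * wt d w powr Q'"
        using wt_le[OF d, of w] wt_pos[OF d, of w] w Q' by (intro mult_right_mono powr_mono2) (auto simp: words_def)
      finally show "K * wt d w powr Q \<le> K * ((1/4) ^ n) powr (Q - Q') * wt d w powr Q'" using K by (simp add: mult.assoc)
    qed
    also have "\<dots> = K * ((1/4) ^ n) powr (Q - Q')"
      using sum_powr_words[OF d Q'(1), of "[]" n] by (simp add: sum_distrib_left[symmetric])
    finally show "(\<Sum>w\<in>words n. K * wt d w powr Q) \<le> \<epsilon>" using n(2) by simp
  qed
  finally show ?thesis .
qed

end

section \<open>Weights of given exponent and the conformal dimension\<close>

lemma three_halves_less: "3/2 < log 4 (9::real)"
proof -
  have "4 powr (3/2) < (9::real)" using powr_three_halves[of 4] by simp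
  then show ?thesis using less_log_iff[of 4 9 "3/2"] by simp
qed

text \<open>Solving for \<open>d powr Q\<close> gives 1 - 8 / 4 powr Q. This is positive because 4
  powr Q exceeds 8 for \<open>Q > 3/2\<close>, and it is at most (1/4) powr Q because 4 powr Q is at
  most 9 for \<open>Q \<le> log 4 9\<close>.\<close>

lemma weight_exists:
  assumes "3/2 < Q" "Q \<le> log 4 9"
  obtains d :: real where "0 < d" "d \<le> 1/4" "8 * (1/4) powr Q + d powr Q = 1"
proof -
  have 4: "(4::real) powr (3/2) = 8" using powr_three_halves[of 4] by simp
  have "4 powr (3/2) < (4::real) powr Q" using assms by (intro powr_less_mono) auto
  then have Q1: "8 < (4::real) powr Q" using 4 by simp
  have "4 powr Q \<le> (4::real) powr (log 4 9)" using assms by (intro powr_mono) auto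
  then have Q2: "(4::real) powr Q \<le> 9" by simp
  have q: "(1/4::real) powr Q = 1 / 4 powr Q" by (simp add: powr_divide)
  define e where "e = 1 - 8 * (1/4::real) powr Q"
  have e: "0 < e" "e \<le> (1/4) powr Q" using Q1 Q2 unfolding e_def q by (simp_all add: field_simps)
  have "e powr (1 / Q) \<le> ((1/4) powr Q) powr (1 / Q)" using e assms by (intro powr_mono2) auto
  then have "e powr (1 / Q) \<le> 1/4" using assms by (simp add: powr_powr)
  moreover have "(e powr (1 / Q)) powr Q = e" using e assms by (simp add: powr_powr)
  ultimately show ?thesis using that[of "e powr (1 / Q)"] e(1) by (simp add: e_def)
qed

context coding
begin

lemma not_qs_loewner:
  assumes "loewner_space Y" shows "\<not> quasisymmetric (MX (1/4)) Y"
proof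
  assume "quasisymmetric (MX (1/4)) Y"
  then obtain f where f: "quasisymmetry (MX (1/4)) Y f" by (auto simp: quasisymmetric_def)
  obtain Q where Q: "Q_loewner Q Y" using assms by (auto simp: loewner_space_def)
  interpret qs_target P Y f Q using f Q by unfold_locales (auto simp: Q_loewner_def)
  \<comment> \<open>Strictly between 3/2 and \<open>Q\<close>, as \<open>exponent_gt\<close> has
    excluded \<open>Q \<le> 3/2\<close>; capped at \<open>log 4 9\<close>, where the weight reaches
    1/4.\<close>
  define Q' where "Q' = min (log 4 9) ((3/2 + Q) / 2)"
  note l = three_halves_less
  have Q': "3/2 < Q'" "Q' \<le> log 4 9" "Q' < Q" 
  proof -
    have "Q' \<le> (3/2 + Q) / 2" "Q' \<le> log 4 9" unfolding Q'_def by (rule min.cobounded2, rule min.cobounded1)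
    moreover have "(3/2 + Q) / 2 < Q" using exponent_gt by (simp add: field_simps)
    ultimately show "Q' \<le> log 4 9" "Q' < Q" by simp_all
    show "3/2 < Q'" unfolding Q'_def using l exponent_gt by simp
  qed
  obtain d where d: "0 < d" "d \<le> 1/4" "8 * (1/4) powr Q' + d powr Q' = 1" by (rule weight_exists[OF Q'(1,2)])
  let ?E = "f ` cell [L13]" and ?F = "f ` cell [L67]"
  let ?\<Delta> = "relative_distance Y ?E ?F"
  obtain \<phi> :: "real \<Rightarrow> real" where \<phi>: "\<And>t. 0 < t \<Longrightarrow> 0 < \<phi> t"
    "\<And>E F. nondegenerate_continuum Y E \<Longrightarrow> nondegenerate_continuum Y F \<Longrightarrow> E \<inter> F = {} \<Longrightarrow>
        ennreal (\<phi> (inverse (relative_distance Y E F))) \<le> modulus Y Q (curves_between Y E F)"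
    using Q unfolding Q_loewner_def by blast
  have cont: "continuous_map (mtopology_of X0) (mtopology_of Y) f"
    using f homeomorphic_imp_continuous_map unfolding quasisymmetry_def by blast
  have mD: "mdiam Y (f ` cell w) = ennreal (D w)" for w unfolding D_def using mdiam_Y[OF f_cell] by simp
  have nc: "nondegenerate_continuum Y (f ` cell w)" for w
    unfolding nondegenerate_continuum_def mD using D_pos[of w]
    by (auto intro: image_compactin[OF compactin_cell[OF quarter0] cont] connectedin_continuous_map_image[OF cont connectedin_cell])
  define c where "c = D [] / (2 * HH 32)"
  have c: "0 < c" using D_pos[of "[]"] HH1[of 32] by (simp add: c_def)
  have far: "c \<le> mdist Y x y" if "x \<in> ?E" "y \<in> ?F" for x y
  proof -
    obtain a b where "x = f a" "a \<in> cell [L13]" "y = f b" "b \<in> cell [L67]" using \<open>x \<in> ?E\<close> \<open>y \<in> ?F\<close> by blast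
    then show ?thesis using sides_far[of L67 b L13 a] mdist_commute[of Y x y] by (simp add: c_def)
  qed
  have disj: "?E \<inter> ?F = {}"
  proof (rule ccontr)
    assume "?E \<inter> ?F \<noteq> {}"
    then obtain x where x: "x \<in> ?E" "x \<in> ?F" by blast
    then have "x \<in> mspace Y" using f_cell by blast
    then show False using far[OF x] c by simp
  qed
  have "c \<le> msetdist Y ?E ?F"
    unfolding msetdist_def
  proof (rule cInf_greatest)
    show "{mdist Y x y |x y. x \<in> ?E \<and> y \<in> ?F} \<noteq> {}" using cell_nonempty[of "[L13]"] cell_nonempty[of "[L67]"] by auto
  qed (use far in blast)
  moreover have "0 < enn2real (min (mdiam Y ?E) (mdiam Y ?F))"
    unfolding mD using D_pos[of "[L13]"] D_pos[of "[L67]"] by (simp add: min_def)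
  ultimately have "0 < ?\<Delta>" using c unfolding relative_distance_def by (intro divide_pos_pos) auto
  then have p: "0 < \<phi> (inverse ?\<Delta>)" using \<phi>(1) by simp
  have "ennreal (\<phi> (inverse ?\<Delta>)) \<le> modulus Y Q (curves_between Y ?E ?F)" by (rule \<phi>(2)[OF nc nc disj])
  also have "\<dots> \<le> ennreal (\<phi> (inverse ?\<Delta>) / 2)"
    using d Q' p by (intro modulus_small[OF d(1,2,3)]) auto
  finally show False using p by (simp add: ennreal_le_iff)
qed

lemma conformal_dimension_MX:
  "conformal_dimension (MX (1/4)) = ereal (3/2) \<and> \<not> conformal_dimension_attained (MX (1/4))"
proof -
  have low: "3/2 < Q" if Q: "Q \<in> ar_exponents (MX (1/4))" for Q
  proof -
    obtain m' where m': "m' \<in> ar_gauge (MX (1/4))" "ahlfors_regular Q m'" using Q by (auto simp: ar_exponents_def)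
    interpret qs_target P m' id Q using m' by unfold_locales (auto simp: ar_gauge_def)
    show ?thesis by (rule exponent_gt)
  qed
  have mem: "Q \<in> ar_exponents (MX (1/4))" if Q: "3/2 < Q" "Q \<le> log 4 9" for Q
  proof -
    obtain d where d: "0 < d" "d \<le> 1/4" "8 * (1/4) powr Q + d powr Q = 1" by (rule weight_exists[OF Q])
    have "ahlfors_regular Q (MX d)" using Q by (intro ahlfors_MX d) auto
    moreover have "MX d \<in> ar_gauge (MX (1/4))"
      unfolding ar_gauge_def
    proof (intro CollectI conjI exI)
      show "mspace (MX d) = mspace (MX (1/4))" using mspace_MX[OF d(1,2)] by simp
      show "quasisymmetry (MX (1/4)) (MX d) id" by (rule quasisymmetry_id[OF d(1,2)])
      show "ahlfors_regular Q (MX d)" by fact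
    qed (use Q in simp)
    ultimately show ?thesis by (auto simp: ar_exponents_def)
  qed
  note l = three_halves_less
  have "conformal_dimension (MX (1/4)) = ereal (3/2)"
    unfolding conformal_dimension_def
  proof (rule antisym)
    show "ereal (3/2) \<le> Inf (ereal ` ar_exponents (MX (1/4)))" using low by (intro Inf_greatest) (auto intro: less_imp_le)
    show "Inf (ereal ` ar_exponents (MX (1/4))) \<le> ereal (3/2)"
    proof (rule ereal_le_epsilon2)
      fix e :: real assume e: "0 < e"
      define Q where "Q = min (log 4 9) (3/2 + e)"
      have "Q \<in> ar_exponents (MX (1/4))" using l e by (intro mem) (auto simp: Q_def)
      then have "Inf (ereal ` ar_exponents (MX (1/4))) \<le> ereal Q" by (intro Inf_lower) auto
      also have "\<dots> \<le> ereal (3/2) + ereal e" by (simp add: Q_def)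
      finally show "Inf (ereal ` ar_exponents (MX (1/4))) \<le> ereal (3/2) + ereal e" .
    qed
  qed
  moreover have "ereal (3/2) \<notin> ereal ` ar_exponents (MX (1/4))" using low[of "3/2"] by auto
  ultimately show ?thesis by (simp add: conformal_dimension_attained_def)
qed

lemma ahlfors_X0: "ahlfors_regular (log 4 9) (MX (1/4))"
proof (rule ahlfors_MX)
  have "(1/4::real) powr (log 4 9) = 1 / 9" by (simp add: powr_divide)
  then show "8 * (1/4) powr log 4 9 + (1/4) powr log 4 9 = (1::real)" by simp
qed auto

end

section \<open>Approximate self-similarity\<close>

lemma outl_one_side: "outl f a \<noteq> None \<Longrightarrow> outl f b \<noteq> None \<Longrightarrow> a = b"
  by (cases f; cases a; cases b) (simp_all add: outl_def num_def)

lemma outl_ex: "\<exists>f. outl f s = Some c"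
  by (cases s; cases c) (auto simp: outl_def num_def intro: exI[of _ L13] exI[of _ L23] exI[of _ L67] exI[of _ L68])

lemma two_ends:
  assumes "length w = length w'" "w \<noteq> w'" "vert w s = vert w' s'"
  shows "vert w a = vert w' b \<longleftrightarrow> a = s \<and> b = s'"
proof
  assume eq: "vert w a = vert w' b"
  show "a = s \<and> b = s'"
  proof (rule ccontr)
    assume ne: "\<not> (a = s \<and> b = s')"
    have "a = s \<longleftrightarrow> b = s'" using eq assms(3) vert_inj by metis
    then have "a = (\<not> s)" "b = (\<not> s')" using ne by auto
    then have "{vert w False, vert w True} = {vert w' False, vert w' True}"
      using eq assms(3) by (cases s; cases s') auto
    then show False using vert_pair_inj assms by blast
  qed
qed (use assms in simp)

text \<open>By recursion on the words, the gluing between descendants of \<open>w\<close> and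
  \<open>w'\<close> is decided by two data: whether the words are equal, and through which ends they
  touch. Both data agree for \<open>u\<close> and \<open>u'\<close>, because distinct edges meet in
  at most one vertex (\<open>two_ends\<close>).\<close>

lemma star_transfer:
  assumes "length x = length x'" and l: "length w = length w'" "length u = length u'"
    and v: "vert w s = vert w' s'" "vert u s = vert u' s'" and eq: "w = w' \<longleftrightarrow> u = u'"
  shows "vert (x @ w) a = vert (x' @ w') b \<longleftrightarrow> vert (x @ u) a = vert (x' @ u') b"
  using assms(1)
proof (induction x x' arbitrary: a b rule: list_induct2)
  case Nil
  show ?case
  proof (cases "w = w'")
    case True
    then show ?thesis using eq by simp
  next
    case False
    then have "u \<noteq> u'" using eq by simp
    show ?thesis using two_ends[OF l(1) False v(1)] two_ends[OF l(2) \<open>u \<noteq> u'\<close> v(2)] by simp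
  qed
next
  case (Cons f x g x')
  have e: "x @ w = x' @ w' \<longleftrightarrow> x @ u = x' @ u'" using Cons.hyps eq by simp
  show ?case
    using Cons.IH[of a b] e by (auto simp: vert_Cons split: option.splits)
qed

lemma inc_Ch: "inc (Ch v c) = {(f # w, s) | f w s. (w, s) \<in> inc v \<and> outl f s = Some c}"
proof -
  have "(y, s) \<in> inc (Ch v c) \<longleftrightarrow> (y, s) \<in> {(f # w, s) | f w s. (w, s) \<in> inc v \<and> outl f s = Some c}" for y s
    by (cases y) (auto simp: inc_def vert_Cons split: option.splits)
  then show ?thesis by auto
qed

lemma inc_New_eq: "inc (New w z) = {(f # w, s) | f s. outl f s = None \<and> num f s = z}"
proof -
  have "(y, s) \<in> inc (New w z) \<longleftrightarrow> (y, s) \<in> {(f # w, s) | f s. outl f s = None \<and> num f s = z}" for y s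
    by (cases y) (auto simp: inc_def vert_Cons split: option.splits)
  then show ?thesis by auto
qed

lemma inc_Root: "inc (Root b) = {([], b)}"
proof -
  have "(y, s) \<in> inc (Root b) \<longleftrightarrow> (y, s) \<in> {([], b)}" for y s
    by (cases y) (auto simp: inc_def vert_Cons split: option.splits)
  then show ?thesis by auto
qed

text \<open>Every vertex looks like a vertex of the first graph.\<close>

lemma star_model:
  assumes "v \<notin> range Root"
  shows "\<exists>v' h. (\<forall>(w, s)\<in>inc v. length (h w) = 1 \<and> (h w, s) \<in> inc v') \<and>
     (\<forall>(w, s)\<in>inc v. \<forall>(w', s')\<in>inc v. h w = h w' \<longleftrightarrow> w = w') \<and>
     (\<forall>(u, s)\<in>inc v'. \<exists>w. (w, s) \<in> inc v \<and> h w = u)"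
  using assms
proof (induction v)
  case (Root b)
  then show ?case by simp
next
  case (New w z)
  show ?case
    by (intro exI[of _ "New [] z"] exI[of _ "\<lambda>w. [hd w]"]) (auto simp: inc_New_eq)
next
  case (Ch v c)
  show ?case
  proof (cases "v \<in> range Root")
    \<comment> \<open>A copy of an end of the level-0 edge is already a vertex of the first graph
      and serves as its own model.\<close>
    case True
    then show ?thesis
      by (intro exI[of _ "Ch v c"] exI[of _ "\<lambda>w. w"]) (auto simp: inc_Ch inc_Root)
  next
    case False
    obtain v' h where h: "\<And>w s. (w, s) \<in> inc v \<Longrightarrow> length (h w) = 1 \<and> (h w, s) \<in> inc v'"
      "\<And>w s w' s'. (w, s) \<in> inc v \<Longrightarrow> (w', s') \<in> inc v \<Longrightarrow> h w = h w' \<longleftrightarrow> w = w'"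
      "\<And>u s. (u, s) \<in> inc v' \<Longrightarrow> \<exists>w. (w, s) \<in> inc v \<and> h w = u"
      using Ch.IH[OF False] by fastforce
    show ?thesis
    \<comment> \<open>The edges at the copy \<open>Ch v c\<close> correspond to the edges at
      \<open>v\<close> by dropping the last letter, so the model of \<open>v\<close> is
      kept.\<close>
    proof (intro exI[of _ v'] exI[of _ "\<lambda>w. h (tl w)"] conjI ballI)
      fix p assume "p \<in> inc (Ch v c)"
      then obtain f w s where p: "p = (f # w, s)" "(w, s) \<in> inc v" "outl f s = Some c" by (auto simp: inc_Ch)
      show "case p of (w, s) \<Rightarrow> length (h (tl w)) = 1 \<and> (h (tl w), s) \<in> inc v'" using h(1)[OF p(2)] p by simp
    next
      fix p assume "p \<in> inc (Ch v c)"
      then obtain f w s where p: "p = (f # w, s)" "(w, s) \<in> inc v" "outl f s = Some c" by (auto simp: inc_Ch)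
      have "h w = h (tl y) \<longleftrightarrow> f # w = y" if y: "(y, s') \<in> inc (Ch v c)" for y s'
      proof -
        obtain g w' where q: "y = g # w'" "(w', s') \<in> inc v" "outl g s' = Some c" using y by (auto simp: inc_Ch)
        have "f = g" if "w = w'"
        proof -
          have "s = s'" using p q that by (auto simp: inc_def)
          then show ?thesis using outl_unique p q by blast
        qed
        then show ?thesis using h(2)[OF p(2) q(2)] q by auto
      qed
      then show "case p of (w, s) \<Rightarrow> \<forall>(w', s')\<in>inc (Ch v c). h (tl w) = h (tl w') \<longleftrightarrow> w = w'"
        using p by auto
    next
      fix p assume "p \<in> inc v'"
      then obtain u s where p: "p = (u, s)" "(u, s) \<in> inc v'" by (cases p) auto
      obtain w where w: "(w, s) \<in> inc v" "h w = u" using h(3)[OF p(2)] by blast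
      obtain f where "outl f s = Some c" using outl_ex by blast
      then show "case p of (u, s) \<Rightarrow> \<exists>w. (w, s) \<in> inc (Ch v c) \<and> h (tl w) = u"
        using p w by (auto simp: inc_Ch intro!: exI[of _ "f # w"])
    qed
  qed
qed

text \<open>\<open>inner v n \<omega>\<close>: the cell of \<open>\<omega>\<close> at level \<open>n\<close> has the vertex \<open>v\<close>, and two levels further down
  it does not touch the opposite end any more.\<close>

definition inner :: "cv \<Rightarrow> nat \<Rightarrow> (nat \<Rightarrow> ltr) \<Rightarrow> bool" where
  "inner v n \<omega> \<longleftrightarrow> (\<exists>s. vert (pre \<omega> n) s = v \<and>
     (\<forall>a. outl (\<omega> (Suc n)) a \<noteq> None \<longrightarrow> outl (\<omega> n) a \<noteq> None \<longrightarrow> a = s))"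

text \<open>If the vertex shared two levels down is a copy of a vertex of level \<open>n\<close>,
  then \<open>inner\<close> forces the latter to be \<open>v\<close>; otherwise the two cells of
  level \<open>n\<close> coincide.\<close>

lemma inner_nbr:
  assumes "inner v n \<omega>" "adj (pre \<omega> (n + 2)) (pre \<xi> (n + 2))"
  shows "\<exists>s. vert (pre \<xi> n) s = v"
proof -
  obtain s where s: "vert (pre \<omega> n) s = v" "\<And>a. outl (\<omega> (Suc n)) a \<noteq> None \<Longrightarrow> outl (\<omega> n) a \<noteq> None \<Longrightarrow> a = s"
    using assms(1) by (auto simp: inner_def)
  obtain a b where "vert (\<omega> (Suc n) # \<omega> n # pre \<omega> n) a = vert (\<xi> (Suc n) # \<xi> n # pre \<xi> n) b"
    using assms(2) by (auto simp: adj_def)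
  from vert_sign[OF this] show ?thesis
  proof (elim disjE exE conjE)
    fix c assume 1: "outl (\<omega> (Suc n)) a = Some c" "vert (\<omega> n # pre \<omega> n) a = vert (\<xi> n # pre \<xi> n) b"
    from vert_sign[OF 1(2)] show ?thesis
    proof (elim disjE exE conjE)
      fix c' assume "outl (\<omega> n) a = Some c'" "vert (pre \<omega> n) a = vert (pre \<xi> n) b"
      then show ?thesis using s(2)[of a] 1 s(1) by auto
    next
      assume "pre \<omega> n = pre \<xi> n"
      then show ?thesis using s(1) by auto
    qed
  next
    assume "\<omega> n # pre \<omega> n = \<xi> n # pre \<xi> n"
    then show ?thesis using s(1) by auto
  qed
qed

text \<open>\<open>v\<close> is the end of \<open>pre \<omega> n\<close> on the side touched by the
  letter \<open>\<omega> n\<close>, and the lower end if this letter touches neither side. A letter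
  touches at most one side (\<open>outl_one_side\<close>), so no cell next to that of
  \<open>\<omega>\<close> two levels down can reach the other end.\<close>

lemma inner_star:
  assumes v: "v = vert (pre \<omega> n) (outl (\<omega> n) True \<noteq> None)"
    and adj: "adj (pre \<omega> (n + 2)) (pre \<xi> (n + 2))"
  shows "inner v n \<xi>"
proof -
  define s0 where "s0 = (outl (\<omega> n) True \<noteq> None)"
  have s0: "a = s0" if "outl (\<omega> n) a \<noteq> None" for a
    using that outl_one_side[of "\<omega> n" a True] unfolding s0_def by (cases "outl (\<omega> n) True = None"; cases a) auto
  obtain a b where "vert (\<omega> (Suc n) # \<omega> n # pre \<omega> n) a = vert (\<xi> (Suc n) # \<xi> n # pre \<xi> n) b"
    using adj by (auto simp: adj_def)
  from vert_sign[OF this] show ?thesis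
  proof (elim disjE exE conjE)
    fix c assume 1: "outl (\<xi> (Suc n)) b = Some c" "vert (\<omega> n # pre \<omega> n) a = vert (\<xi> n # pre \<xi> n) b"
    have only: "a' = b" if "outl (\<xi> (Suc n)) a' \<noteq> None" for a' using that 1(1) outl_one_side[of "\<xi> (Suc n)" a' b] by simp
    from vert_sign[OF 1(2)] show ?thesis
    proof (elim disjE exE conjE)
      fix c' assume "outl (\<omega> n) a = Some c'" "vert (pre \<omega> n) a = vert (pre \<xi> n) b"
      then have "vert (pre \<xi> n) b = v" using s0[of a] v unfolding s0_def by auto
      then show ?thesis unfolding inner_def using only by blast
    next
      assume "outl (\<xi> n) b = None" "pre \<omega> n = pre \<xi> n"
      then show ?thesis unfolding inner_def using v only by metis
    qed
  next
    assume "\<omega> n # pre \<omega> n = \<xi> n # pre \<xi> n"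
    then have "\<omega> n = \<xi> n" "pre \<omega> n = pre \<xi> n" by auto
    then show ?thesis unfolding inner_def using v s0 unfolding s0_def by metis
  qed
qed

lemma vert_length: "vert w s = vert w' s' \<Longrightarrow> length w = length w'"
proof (induction w arbitrary: w' s s')
  case Nil
  then show ?case by (cases w') (auto simp: vert_Cons split: option.splits)
next
  case (Cons f w)
  show ?case
  proof (cases w')
    case Nil
    then show ?thesis using Cons.prems by (auto simp: vert_Cons split: option.splits)
  next
    case (Cons g v)
    from vert_sign[OF Cons.prems[unfolded Cons]] have "vert w s = vert v s' \<or> w = v" by blast
    then show ?thesis using Cons.IH[of s v s'] Cons by auto
  qed
qed

lemma vert_not_Root: "w \<noteq> [] \<Longrightarrow> vert w s \<notin> range Root"
  by (cases w) (auto simp: vert_Cons split: option.splits)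

context coding
begin

lemma separation_bounds:
  assumes "adj (pre \<omega> n) (pre \<omega>' n)" "\<not> adj (pre \<omega> (Suc n)) (pre \<omega>' (Suc n))"
  shows "(1/4) ^ n / 4 \<le> d0 (P \<omega>) (P \<omega>')" "d0 (P \<omega>) (P \<omega>') \<le> 8 * (1/4) ^ n"
  using pd_lower[OF quarter0 assms(2)] pd_upper[OF quarter0 assms(1)] unfolding wt_quarter length_pre by simp_all

lemma d0_ball_adj: "d0 (P \<omega>) (P \<omega>') < (1/4) ^ n \<Longrightarrow> adj (pre \<omega> n) (pre \<omega>' n)"
  using pd_lower[OF quarter0, of \<omega> n \<omega>'] unfolding wt_quarter length_pre by (cases "adj (pre \<omega> n) (pre \<omega>' n)") auto

text \<open>All cells of level \<open>n\<close> that meet the ball share the vertex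
  \<open>v\<close>. Replacing their words by the one-letter words of the model of \<open>v\<close>
  preserves every adjacency (\<open>star_transfer\<close>), hence scales distances by 4 ^ (n - 1) up
  to a constant. The condition \<open>inner\<close> makes the image open: points close to it again
  lie in cells at \<open>v'\<close>, and these have preimages.\<close>

lemma local_model:
  assumes n: "1 \<le> n" and r: "0 < r" "r \<le> (1/4) ^ (n + 2)" "(1/4) ^ (n + 3) < r"
  shows "\<exists>U f. openin (mtopology_of X0) U \<and> f ` mball_of X0 (P \<omega>) r = U \<and>
     (\<forall>y\<in>mball_of X0 (P \<omega>) r. \<forall>z\<in>mball_of X0 (P \<omega>) r.
        1 / 8192 * (d0 y z / r) \<le> d0 (f y) (f z) \<and> d0 (f y) (f z) \<le> 8192 * (d0 y z / r))"
proof -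
  define v where "v = vert (pre \<omega> n) (outl (\<omega> n) True \<noteq> None)"
  have "pre \<omega> n \<noteq> []" using n length_pre[of \<omega> n] by fastforce
  then have "v \<notin> range Root" unfolding v_def by (rule vert_not_Root)
  note star_model[OF this]
  then obtain v' h where h: "\<And>w s. (w, s) \<in> inc v \<Longrightarrow> length (h w) = 1 \<and> (h w, s) \<in> inc v'"
      "\<And>w s w' s'. (w, s) \<in> inc v \<Longrightarrow> (w', s') \<in> inc v \<Longrightarrow> h w = h w' \<longleftrightarrow> w = w'"
      "\<And>u s. (u, s) \<in> inc v' \<Longrightarrow> \<exists>w. (w, s) \<in> inc v \<and> h w = u"
    by fastforce
  define B where "B = mball_of X0 (P \<omega>) r"
  have Badj: "adj (pre \<omega> (n + 2)) (pre \<xi> (n + 2))" if "P \<xi> \<in> B" for \<xi>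
    using that r(2) unfolding B_def by (intro d0_ball_adj) simp
  have Binner: "inner v n \<xi>" if "P \<xi> \<in> B" for \<xi>
    using inner_star[OF v_def Badj[OF that]] .
  have Binc: "\<exists>s. (pre \<xi> n, s) \<in> inc v" if "P \<xi> \<in> B" for \<xi>
    using Binner[OF that] by (auto simp: inner_def inc_def)
  define F where "F \<xi> = ext (h (pre \<xi> n)) (\<lambda>i. \<xi> (n + i))" for \<xi>
  have Fpre: "pre (F \<xi>) (Suc k) = pre (\<lambda>i. \<xi> (n + i)) k @ h (pre \<xi> n)" if "(pre \<xi> n, s) \<in> inc v" for \<xi> s k
    using h(1)[OF that] pre_ext[of "h (pre \<xi> n)" "\<lambda>i. \<xi> (n + i)" k] unfolding F_def by simp
  have trans: "adj (pre \<xi> (n + k)) (pre \<zeta> (n + k)) \<longleftrightarrow> adj (pre (F \<xi>) (Suc k)) (pre (F \<zeta>) (Suc k))"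
    if x: "(pre \<xi> n, s) \<in> inc v" and z: "(pre \<zeta> n, s') \<in> inc v" for \<xi> \<zeta> s s' k
  proof -
    have "vert (pre \<xi> n) s = vert (pre \<zeta> n) s'" "vert (h (pre \<xi> n)) s = vert (h (pre \<zeta> n)) s'"
      using x z h(1)[OF x] h(1)[OF z] by (auto simp: inc_def)
    from star_transfer[OF _ _ _ this, of "pre (\<lambda>i. \<xi> (n + i)) k" "pre (\<lambda>i. \<zeta> (n + i)) k"]
    show ?thesis
      unfolding adj_def pre_add[of \<xi> n k] pre_add[of \<zeta> n k] Fpre[OF x] Fpre[OF z]
      using h(1)[OF x] h(1)[OF z] h(2)[OF x z] by simp
  qed
  have P_F: "P (F \<xi>) = P (F \<zeta>) \<longleftrightarrow> P \<xi> = P \<zeta>" if x: "(pre \<xi> n, s) \<in> inc v" and z: "(pre \<zeta> n, s') \<in> inc v" for \<xi> \<zeta> s s'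
  proof -
    have "(\<forall>k. adj (pre \<xi> k) (pre \<zeta> k)) \<longleftrightarrow> (\<forall>k. adj (pre \<xi> (n + k)) (pre \<zeta> (n + k)))"
      by (meson adj_pre_mono le_add2)
    moreover have "(\<forall>k. adj (pre (F \<xi>) k) (pre (F \<zeta>) k)) \<longleftrightarrow> (\<forall>k. adj (pre (F \<xi>) (Suc k)) (pre (F \<zeta>) (Suc k)))"
      by (meson adj_pre_mono lessI less_imp_le)
    ultimately show ?thesis unfolding P_eq_iff using trans[OF x z] by simp
  qed
  define f where "f y = P (F (code y))" for y
  have fP: "f (P \<xi>) = P (F \<xi>)" if PB: "P \<xi> \<in> B" for \<xi>
  proof -
    have c: "P (code (P \<xi>)) = P \<xi>" by (rule P_code) simp
    obtain s s' where "(pre \<xi> n, s) \<in> inc v" "(pre (code (P \<xi>)) n, s') \<in> inc v"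
      using Binc[OF PB] Binc[of "code (P \<xi>)"] PB c by auto
    then show ?thesis using P_F c unfolding f_def by blast
  qed
  have BP: "\<exists>\<xi>. y = P \<xi>" if "y \<in> B" for y using that unfolding B_def by auto
  have r4: "(1/4::real) ^ (n + 3) = (1/4) ^ n / 64" "(1/4::real) ^ (n + 2) = (1/4) ^ n / 16" by (simp_all add: power_add power3_eq_cube power2_eq_square)
  have lip: "1 / 8192 * (d0 y z / r) \<le> d0 (f y) (f z) \<and> d0 (f y) (f z) \<le> 8192 * (d0 y z / r)"
    if yB: "y \<in> B" and zB: "z \<in> B" for y z
  proof (cases "y = z")
    case True
    have "f y \<in> range P" "y \<in> range P" using BP[OF yB] by (auto simp: f_def)
    then show ?thesis using True by simp
  next
    case False
    obtain \<xi> \<zeta> where yz: "y = P \<xi>" "z = P \<zeta>" using BP yB zB by metis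
    obtain s where s: "(pre \<xi> n, s) \<in> inc v" using Binc yB yz by blast
    obtain s' where s': "(pre \<zeta> n, s') \<in> inc v" using Binc zB yz by blast
    obtain m where m: "adj (pre \<xi> m) (pre \<zeta> m)" "\<not> adj (pre \<xi> (Suc m)) (pre \<zeta> (Suc m))"
      using separation_level False yz by metis
    have an: "adj (pre \<xi> n) (pre \<zeta> n)" using s s' unfolding adj_def inc_def by (intro exI[of _ s] exI[of _ s']) simp
    have "n \<le> m"
    proof (rule ccontr)
      assume "\<not> n \<le> m"
      then show False using m(2) adj_pre_mono[OF an, of "Suc m"] by simp
    qed
    then obtain k where k: "m = n + k" using le_Suc_ex by blast
    have m': "adj (pre (F \<xi>) (Suc k)) (pre (F \<zeta>) (Suc k))" "\<not> adj (pre (F \<xi>) (Suc (Suc k))) (pre (F \<zeta>) (Suc (Suc k)))"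
      using m trans[OF s s', of k] trans[OF s s', of "Suc k"] k by (simp_all del: pre.simps)
    note b = separation_bounds[OF m] and b' = separation_bounds[OF m']
    define q where "q = (1/4::real) ^ k"
    define e where "e = (1/4::real) ^ n"
    have q: "0 < q" and e: "0 < e" by (simp_all add: q_def e_def)
    have yd: "e * q / 4 \<le> d0 y z" "d0 y z \<le> 8 * (e * q)" using b yz k by (simp_all add: q_def e_def power_add)
    have fd: "q / 16 \<le> d0 (f y) (f z)" "d0 (f y) (f z) \<le> 2 * q"
      using b' fP yB zB unfolding yz by (simp_all add: q_def)
    have re: "e / 64 < r" "r \<le> e / 16" using r r4 by (simp_all add: e_def)
    \<comment> \<open>8192 is 16 * 512: this upper bound 512 * q is compared with the lower bound q
      / 16 for the distance of the images.\<close>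
    have "d0 y z / r \<le> 8 * (e * q) / (e / 64)" using yd re e q by (intro frac_le) auto
    then have "d0 y z / r \<le> 512 * q" using e by simp
    moreover have "(e * q / 4) / (e / 16) \<le> d0 y z / r" using yd re e q r(1) by (intro frac_le) auto
    then have "4 * q \<le> d0 y z / r" using e by simp
    ultimately show ?thesis using fd by simp
  qed
  have open_im: "openin (mtopology_of X0) (f ` B)"
    unfolding mtopology_of_def Metric_space.openin_mtopology[OF Metric_space_mspace_mdist]
  proof (intro conjI allI impI)
    show "f ` B \<subseteq> mspace X0" by (auto simp: f_def)
    fix p assume "p \<in> f ` B"
    then obtain \<xi> where \<xi>: "P \<xi> \<in> B" "p = f (P \<xi>)" using BP by blast
    have p: "p = P (F \<xi>)" using \<xi> fP by simp
    have "0 < (r - d0 (P \<omega>) (P \<xi>)) / 8" using \<xi>(1) unfolding B_def by simp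
    from real_arch_pow_inv[OF this, of "1/4"] obtain k0 where k0: "(1/4::real) ^ k0 < (r - d0 (P \<omega>) (P \<xi>)) / 8" by auto
    \<comment> \<open>The 2 guarantees that \<open>Suc k\<close> is at least 3 = 1 + 2, the level
      that \<open>inner_nbr\<close> needs around a vertex of level 1.\<close>
    define k where "k = k0 + 2"
    have k: "8 * (1/4) ^ (n + k) < r - d0 (P \<omega>) (P \<xi>)"
    proof -
      have "(1/4::real) ^ (n + k) \<le> (1/4) ^ k0" unfolding k_def by (intro power_decreasing) auto
      then have "(1/4::real) ^ (n + k) < (r - d0 (P \<omega>) (P \<xi>)) / 8" using k0 by (rule order_le_less_trans)
      then show ?thesis unfolding less_divide_eq_numeral1 by (simp add: mult.commute)
    qed
    obtain s where s: "vert (pre \<xi> n) s = v" "\<And>a. outl (\<xi> (Suc n)) a \<noteq> None \<Longrightarrow> outl (\<xi> n) a \<noteq> None \<Longrightarrow> a = s"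
      using Binner[OF \<xi>(1)] by (auto simp: inner_def)
    have si: "(pre \<xi> n, s) \<in> inc v" using s by (simp add: inc_def)
    have hl: "length (h (pre \<xi> n)) = 1" "vert (h (pre \<xi> n)) s = v'" using h(1)[OF si] by (auto simp: inc_def)
    have F1: "pre (F \<xi>) 1 = h (pre \<xi> n)" using Fpre[OF si, of 0] by simp
    have "pre (F \<xi>) 3 = \<xi> (Suc n) # \<xi> n # h (pre \<xi> n)" using Fpre[OF si, of 2] by (simp add: numeral_2_eq_2 numeral_3_eq_3)
    then have F23: "F \<xi> 2 = \<xi> (Suc n)" "F \<xi> 1 = \<xi> n" by (simp_all add: numeral_3_eq_3 numeral_2_eq_2)
    have innerF: "inner v' 1 (F \<xi>)"
      unfolding inner_def using hl s(2) F1 F23 by (intro exI[of _ s]) (auto simp: numeral_2_eq_2)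
    show "\<exists>e>0. Metric_space.mball (mspace X0) (mdist X0) p e \<subseteq> f ` B"
    proof (intro exI[of _ "(1/4) ^ Suc k"] conjI subsetI)
      fix q assume "q \<in> Metric_space.mball (mspace X0) (mdist X0) p ((1/4) ^ Suc k)"
      then have q: "q \<in> range P" "d0 p q < (1/4) ^ Suc k" by (simp_all add: Metric_space.in_mball[OF Metric_space_pd[OF quarter0]])
      then obtain \<zeta> where \<zeta>: "q = P \<zeta>" by blast
      have a: "adj (pre (F \<xi>) (Suc k)) (pre \<zeta> (Suc k))" using q(2) unfolding p \<zeta> by (rule d0_ball_adj)
      then have "adj (pre (F \<xi>) (1 + 2)) (pre \<zeta> (1 + 2))" by (rule adj_pre_mono) (simp add: k_def)
      from inner_nbr[OF innerF this] obtain t where "vert (pre \<zeta> 1) t = v'" by blast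
      then have "(pre \<zeta> 1, t) \<in> inc v'" by (simp add: inc_def)
      from h(3)[OF this] obtain w where w: "(w, t) \<in> inc v" "h w = pre \<zeta> 1" by blast
      have "length w = n"
      proof -
        have "vert w t = vert (pre \<xi> n) s" using w(1) s(1) by (simp add: inc_def)
        from vert_length[OF this] show ?thesis by simp
      qed
      define \<theta> where "\<theta> = ext w (\<lambda>i. \<zeta> (Suc i))"
      have \<theta>: "pre \<theta> n = w" using pre_ext_len[of w] \<open>length w = n\<close> unfolding \<theta>_def by blast
      have tail: "(\<lambda>i. \<theta> (n + i)) = (\<lambda>i. \<zeta> (Suc i))"
      proof
        fix i
        have "pre \<theta> (n + Suc i) = pre (\<lambda>i. \<zeta> (Suc i)) (Suc i) @ w"
          unfolding \<theta>_def using pre_ext[of w "\<lambda>i. \<zeta> (Suc i)" "Suc i"] \<open>length w = n\<close> by simp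
        then show "\<theta> (n + i) = \<zeta> (Suc i)" by simp
      qed
      have F\<theta>: "F \<theta> = \<zeta>" unfolding F_def tail \<theta> w(2) using ext_pre[of \<zeta> 1] by simp
      have \<theta>i: "(pre \<theta> n, t) \<in> inc v" using w(1) \<theta> by simp
      have "adj (pre \<xi> (n + k)) (pre \<theta> (n + k))" using trans[OF si \<theta>i, of k] a F\<theta> by simp
      from pd_upper[OF quarter0 this] have "d0 (P \<xi>) (P \<theta>) \<le> 8 * (1/4) ^ (n + k)" by (simp add: wt_quarter)
      then have "d0 (P \<omega>) (P \<theta>) < r" using k d0_triangle[of "P \<omega>" "P \<xi>" "P \<theta>"] by simp
      then have "P \<theta> \<in> B" unfolding B_def by simp
      then show "q \<in> f ` B" using fP[of \<theta>] F\<theta> \<zeta> by (intro image_eqI[of _ _ "P \<theta>"]) auto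
    qed simp
  qed
  show ?thesis
    using open_im lip unfolding B_def[symmetric] by (intro exI[of _ "f ` B"] exI[of _ f]) auto
qed

lemma self_similar_X0: "approximately_self_similar (MX (1/4))"
  unfolding approximately_self_similar_def
proof (intro exI[of _ 8192] conjI ballI allI impI)
  fix x and r :: real
  assume x: "x \<in> mspace X0" and r: "0 < r" and rd: "ennreal r \<le> mdiam X0 (mspace X0)"
  obtain \<omega> where \<omega>: "x = P \<omega>" using x by auto
  show "\<exists>U f. openin (mtopology_of X0) U \<and> f ` mball_of X0 x r = U \<and>
     (\<forall>y\<in>mball_of X0 x r. \<forall>z\<in>mball_of X0 x r.
        1 / 8192 * (mdist X0 y z / r) \<le> mdist X0 (f y) (f z) \<and> mdist X0 (f y) (f z) \<le> 8192 * (mdist X0 y z / r))"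
  proof (cases "r \<le> 1/64")
    case True
    then have "r \<le> 1" by simp
    from scale_exists[OF quarter0 r this, of \<omega>] obtain N where
      "r \<le> wt (1/4) (pre \<omega> N)" "1/4 * wt (1/4) (pre \<omega> N) < r" by blast
    then have N: "r \<le> (1/4) ^ N" "(1/4) ^ Suc N < r" by (simp_all add: wt_quarter)
    have "3 \<le> N"
    proof (rule ccontr)
      assume "\<not> 3 \<le> N"
      then have "(1/4::real) ^ 3 \<le> (1/4) ^ Suc N" by (intro power_decreasing) auto
      then show False using N True by (simp add: power3_eq_cube)
    qed
    then obtain n where n: "N = n + 2" "1 \<le> n" using le_Suc_ex[of 3 N] by (auto intro: that[of "N - 2"])
    show ?thesis using local_model[OF n(2) r, of \<omega>] N unfolding n \<omega> by (simp add: eval_nat_numeral)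
  next
    \<comment> \<open>Only radii between 1/64 and the diameter bound 8 remain, for which the
      identity will do.\<close>
    case False
    have "mdiam X0 (range P) \<le> ennreal 8" using pd_le[OF quarter0] by (intro mdiam_le) simp
    then have "ennreal r \<le> ennreal 8" using rd by simp
    then have r8: "r \<le> 8" by (subst (asm) ennreal_le_iff) simp_all
    have op: "openin (mtopology_of X0) (mball_of X0 x r)"
      unfolding mtopology_of_def mball_of_def by (rule Metric_space.openin_mball[OF Metric_space_mspace_mdist])
    have "1 / 8192 * (d0 y z / r) \<le> d0 y z \<and> d0 y z \<le> 8192 * (d0 y z / r)" for y z
    proof -
      have "d0 y z * 1 \<le> d0 y z * (8192 * r)" "d0 y z * r \<le> d0 y z * 8192" using False r8 by (intro mult_left_mono; simp)+
      then show ?thesis using r by (simp add: field_simps)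
    qed
    then show ?thesis using op by (intro exI[of _ "mball_of X0 x r"] exI[of _ id]) auto
  qed
qed simp

end

section \<open>The Loewner lower bound\<close>

lemma path4:
  assumes "\<And>g. \<bar>gr u (g # w)\<bar> \<le> a"
  shows "\<bar>u (vert (f # w) s) - u (Ch (vert w t) c)\<bar> \<le> 4 * a"
proof -
  note * = assms[of L13] assms[of L23] assms[of L34] assms[of L35] assms[of L45] assms[of L46] assms[of L56] assms[of L67] assms[of L68]
  have "0 \<le> a" using assms[of L13] by linarith
  note ** = *[unfolded gr_def vert_simps abs_le_iff] this
  show ?thesis
    using ** unfolding abs_le_iff
    by (cases f; cases s; cases t; cases c; simp only: vert_simps; linarith)
qed

lemma successively_snoc: "successively R (xs @ [y]) \<longleftrightarrow> successively R xs \<and> (xs \<noteq> [] \<longrightarrow> R (last xs) y)"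
  by (auto simp: successively_append_iff)

definition desc :: "nat \<Rightarrow> ltr list \<Rightarrow> ltr list set" where
  "desc m w = {x \<in> words m. \<exists>y. x = y @ w}"

lemma finite_desc [simp]: "finite (desc m w)"
  by (simp add: desc_def)

lemma power_mean_8:
  fixes r :: "'i \<Rightarrow> real"
  assumes "finite S" "card S \<le> 8" "\<And>i. i \<in> S \<Longrightarrow> 0 \<le> r i"
  shows "(\<Sum>i\<in>S. r i) powr (3/2) \<le> 8 powr (3/2) * (\<Sum>i\<in>S. r i powr (3/2))"
proof (cases "S = {}")
  case False
  have "Max (r ` S) \<in> r ` S" using assms False by (intro Max_in) auto
  then obtain k where "k \<in> S" "Max (r ` S) = r k" by auto
  then have k: "k \<in> S" "\<And>i. i \<in> S \<Longrightarrow> r i \<le> r k" using assms Max_ge[of "r ` S"] by auto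
  have "(\<Sum>i\<in>S. r i) \<le> real (card S) * r k" using k(2) by (intro sum_bounded_above) auto
  also have "\<dots> \<le> 8 * r k" using assms k by (intro mult_right_mono) auto
  finally have "(\<Sum>i\<in>S. r i) powr (3/2) \<le> (8 * r k) powr (3/2)" using assms by (intro powr_mono2) (auto intro: sum_nonneg)
  also have "\<dots> = 8 powr (3/2) * r k powr (3/2)" by (rule powr_mult)
  also have "\<dots> \<le> 8 powr (3/2) * (\<Sum>i\<in>S. r i powr (3/2))" 
    using k(1) assms by (intro mult_left_mono member_le_sum) auto
  finally show ?thesis .
qed simp

section \<open>Cells as an approximation of the space, and the selection of points\<close>

context coding
begin

definition ctr0 :: "ltr list \<Rightarrow> 'p" where "ctr0 w = P (ext (L34 # w) (\<lambda>_. L34))"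

lemma ctr0_cell: "ctr0 w \<in> cell w"
  using cell_ext[of "L34 # w" "\<lambda>_. L34"] cell_Cons[of L34 w] unfolding ctr0_def by blast

lemma ctr0_ball:
  assumes "y \<in> mball_of X0 (ctr0 w) ((1/4) ^ Suc (length w))" obtains \<xi> where "y = P \<xi>" "pre \<xi> (length w) = w"
proof -
  obtain \<xi> where \<xi>: "y = P \<xi>" using assms by auto
  define \<omega> where "\<omega> = ext (L34 # w) (\<lambda>_. L34)"
  have p: "pre \<omega> (Suc (length w)) = L34 # w" using pre_ext_len[of "L34 # w"] unfolding \<omega>_def by (simp del: pre_ext_len pre.simps)
  have "d0 (P \<omega>) (P \<xi>) < (1/4) ^ Suc (length w)" using assms unfolding \<xi> ctr0_def \<omega>_def by simp
  then have "adj (L34 # w) (pre \<xi> (Suc (length w)))" using d0_ball_adj[of \<omega> \<xi> "Suc (length w)"] p by simp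
  then obtain s s' where "vert (L34 # w) s = vert (\<xi> (length w) # pre \<xi> (length w)) s'" by (auto simp: adj_def)
  from vert_sign[OF this] have "pre \<xi> (length w) = w" by (auto simp: outl_L34)
  then show ?thesis using that \<xi> by blast
qed

text \<open>No other cell of the same level contains \<open>ctr0 w\<close>, because both ends of
  \<open>L34\<close> are inner. Injectivity lets functions on the vertices of \<open>GG m\<close>,
  which are sets, be handled as functions on words.\<close>

lemma cell_inj:
  assumes "length w = length w'" "cell w = cell w'" shows "w = w'"
proof -
  have "ctr0 w \<in> cell w'" using ctr0_cell[of w] assms(2) by simp
  then obtain \<xi> where \<xi>: "ctr0 w = P \<xi>" "pre \<xi> (length w') = w'" by (auto simp: cell_def)
  define \<omega> where "\<omega> = ext (L34 # w) (\<lambda>_. L34)"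
  have p: "pre \<omega> (Suc (length w)) = L34 # w" using pre_ext_len[of "L34 # w"] unfolding \<omega>_def by (simp del: pre_ext_len pre.simps)
  have "P \<omega> = P \<xi>" using \<xi>(1) by (simp add: ctr0_def \<omega>_def)
  then have "adj (pre \<omega> (Suc (length w))) (pre \<xi> (Suc (length w)))" using P_eq_iff by blast
  then obtain s s' where "vert (L34 # w) s = vert (\<xi> (length w) # pre \<xi> (length w)) s'" unfolding p by (auto simp: adj_def)
  from vert_sign[OF this] have "pre \<xi> (length w) = w" by (auto simp: outl_L34)
  then show ?thesis using \<xi>(2) unfolding assms(1) by (rule trans[OF sym])
qed

lemma inj_cell: "inj_on cell (words m)"
  by (rule inj_onI) (auto simp: words_def intro: cell_inj)

definition GG :: "nat \<Rightarrow> 'p set set \<times> 'p set set set" where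
  "GG k = (cell ` words k, {{v, u} | v u. v \<in> cell ` words k \<and> u \<in> cell ` words k \<and> v \<noteq> u \<and> v \<inter> u \<noteq> {}})"

text \<open>16 exceeds both the 8 in the diameter of a cell and the 4 in the radius of the balls
  around the points \<open>ctr0 w\<close>.\<close>

lemma approximation: "alpha_approximation X0 16 4 GG"
  unfolding alpha_approximation_def
proof (intro allI impI conjI)
  fix k :: nat
  show "finite (fst (GG k))" by (simp add: GG_def)
  show "\<Union> (fst (GG k)) = mspace X0" using range_cells[of k] by (simp add: GG_def)
  show "snd (GG k) = {{v, u} |v u. v \<in> fst (GG k) \<and> u \<in> fst (GG k) \<and> v \<noteq> u \<and> v \<inter> u \<noteq> {}}" by (simp add: GG_def)
  define z where "z v = ctr0 (inv_into (words k) cell v)" for v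
  have z: "z (cell w) = ctr0 w" if "w \<in> words k" for w
    unfolding z_def using inv_into_f_f[OF inj_cell that] by simp
  have rad: "mball_of X0 x (inverse 16 * inverse 4 ^ k) \<subseteq> mball_of X0 x ((1/4) ^ Suc k)" for x
  proof -
    have "inverse 16 * inverse 4 ^ k \<le> (1/4::real) ^ Suc k" by (simp add: inverse_eq_divide power_one_over field_simps)
    then show ?thesis unfolding mball_of_def by (rule Metric_space.mball_subset_concentric[OF Metric_space_mspace_mdist])
  qed
  show "\<exists>z. (\<forall>v\<in>fst (GG k). z v \<in> v \<and> mball_of X0 (z v) (inverse 16 * inverse 4 ^ k) \<subseteq> v \<and>
         v \<subseteq> mball_of X0 (z v) (16 * inverse 4 ^ k)) \<and>
     (\<forall>v\<in>fst (GG k). \<forall>u\<in>fst (GG k). v \<noteq> u \<longrightarrow>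
         mball_of X0 (z v) (inverse 16 * inverse 4 ^ k) \<inter> mball_of X0 (z u) (inverse 16 * inverse 4 ^ k) = {})"
  proof (intro exI[of _ z] conjI ballI impI)
    fix v assume "v \<in> fst (GG k)"
    then obtain w where w: "v = cell w" "w \<in> words k" "length w = k" by (auto simp: GG_def words_def)
    show "z v \<in> v" using ctr0_cell z w by simp
    show "mball_of X0 (z v) (inverse 16 * inverse 4 ^ k) \<subseteq> v"
    proof
      fix y assume "y \<in> mball_of X0 (z v) (inverse 16 * inverse 4 ^ k)"
      then have "y \<in> mball_of X0 (ctr0 w) ((1/4) ^ Suc (length w))"
        using rad[of "ctr0 w"] unfolding w(3) w(1) z[OF w(2)] by blast
      then obtain \<xi> where "y = P \<xi>" "pre \<xi> (length w) = w" by (rule ctr0_ball)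
      then show "y \<in> v" using P_in_cell[of \<xi> "length w"] w by simp
    qed
    show "v \<subseteq> mball_of X0 (z v) (16 * inverse 4 ^ k)"
    proof
      fix y assume y: "y \<in> v"
      have "d0 (ctr0 w) y \<le> 8 * (1/4) ^ k" using cell_d0[OF ctr0_cell[of w] y[unfolded w(1)]] unfolding w(3) .
      moreover have "0 < (1/4::real) ^ k" by simp
      moreover have "inverse 4 ^ k = (1/4::real) ^ k" by (simp add: inverse_eq_divide)
      ultimately have "d0 (ctr0 w) y < 16 * inverse 4 ^ k" by linarith
      then show "y \<in> mball_of X0 (z v) (16 * inverse 4 ^ k)" using cellD[OF y[unfolded w(1)]] cellD[OF ctr0_cell[of w]] unfolding w(1) z[OF w(2)] by simp
    qed
  next
    fix v u assume "v \<in> fst (GG k)" "u \<in> fst (GG k)" and ne: "v \<noteq> u"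
    then obtain w w' where w: "v = cell w" "w \<in> words k" "length w = k" "u = cell w'" "w' \<in> words k" "length w' = k"
      by (auto simp: GG_def words_def)
    have disj: "mball_of X0 (ctr0 w) ((1/4) ^ Suc k) \<inter> mball_of X0 (ctr0 w') ((1/4) ^ Suc k) = {}"
    proof (rule ccontr)
      assume "\<not> ?thesis"
      then obtain y where y: "y \<in> mball_of X0 (ctr0 w) ((1/4) ^ Suc (length w))" "y \<in> mball_of X0 (ctr0 w') ((1/4) ^ Suc (length w'))"
        unfolding w(3,6) by blast
      obtain \<xi> where \<xi>: "y = P \<xi>" "pre \<xi> (length w) = w" using y(1) by (rule ctr0_ball)
      define \<omega> where "\<omega> = ext (L34 # w') (\<lambda>_. L34)"
      have p: "pre \<omega> (Suc (length w')) = L34 # w'" using pre_ext_len[of "L34 # w'"] unfolding \<omega>_def by (simp del: pre_ext_len pre.simps)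
      have "d0 (P \<omega>) (P \<xi>) < (1/4) ^ Suc (length w')" using y(2) unfolding \<xi>(1) ctr0_def \<omega>_def by simp
      then have "adj (L34 # w') (pre \<xi> (Suc (length w')))" using d0_ball_adj[of \<omega> \<xi> "Suc (length w')"] p by simp
      then obtain s s' where "vert (L34 # w') s = vert (\<xi> (length w') # pre \<xi> (length w')) s'" by (auto simp: adj_def)
      from vert_sign[OF this] have "pre \<xi> (length w') = w'" by (auto simp: outl_L34)
      then have "w = w'" using \<xi>(2) unfolding w(3,6) by (metis)
      then show False using ne w by simp
    qed
    then show "mball_of X0 (z v) (inverse 16 * inverse 4 ^ k) \<inter> mball_of X0 (z u) (inverse 16 * inverse 4 ^ k) = {}"
      using rad[of "ctr0 w"] rad[of "ctr0 w'"] unfolding w(1,4) z[OF w(2)] z[OF w(5)] by blast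
  qed
qed

text \<open>The selection step of the Loewner lower bound: a connected set of diameter \<open>l\<close> cannot be covered
  by cells that carry much energy compared with their diameter.\<close>

lemma select_point:
  fixes a :: "ltr list \<Rightarrow> real"
  assumes a: "\<And>x. 0 \<le> a x" and tot: "(\<Sum>x\<in>words m. a x) \<le> \<epsilon>"
    and E: "E \<subseteq> range P" "\<And>c. 0 \<le> c \<Longrightarrow> c \<le> l \<Longrightarrow> \<exists>x\<in>E. d0 p x = c"
    and \<tau>: "0 < \<tau>" "16 * (1/4) ^ j * \<epsilon> < \<tau> * l"
  obtains \<omega> where "P \<omega> \<in> E" "d0 p (P \<omega>) \<le> l"
    "\<And>i. j \<le> i \<Longrightarrow> i \<le> m \<Longrightarrow> (\<Sum>x\<in>desc m (pre \<omega> i). a x) \<le> \<tau> * (1/4) ^ (i - j)"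
proof (rule ccontr)
  note ob = that
  define A where "A w = (\<Sum>x\<in>desc m w. a x)" for w
  define bad where "bad w \<longleftrightarrow> j \<le> length w \<and> length w \<le> m \<and> \<tau> * (1/4) ^ (length w - j) < A w" for w
  assume "\<not> thesis"
  then have nobad: "\<exists>i. bad (pre \<omega> i)" if "P \<omega> \<in> E" "d0 p (P \<omega>) \<le> l" for \<omega>
    using ob[OF that] unfolding bad_def A_def by (force simp: not_le)
  \<comment> \<open>The coarsest bad words, those without a bad proper ancestor. Their sets of
    descendants are disjoint, so their energies add up to at most \<open>\<epsilon>\<close>.\<close>
  define MB where "MB = {w. bad w \<and> (\<forall>y v. w = y @ v \<longrightarrow> y \<noteq> [] \<longrightarrow> \<not> bad v)}"
  have "MB \<subseteq> (\<Union>n\<le>m. words n)" unfolding MB_def bad_def words_def by auto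
  then have finMB: "finite MB" by (rule finite_subset) simp
  have inMB: "\<exists>w\<in>MB. x \<in> cell w" if xE: "x \<in> E" and xl: "d0 p x \<le> l" for x
  proof -
    obtain \<omega> where \<omega>: "x = P \<omega>" using xE E(1) by blast
    have ex: "\<exists>i. bad (pre \<omega> i)" using nobad xE xl \<omega> by blast
    define i where "i = (LEAST i. bad (pre \<omega> i))"
    have i: "bad (pre \<omega> i)" unfolding i_def by (rule LeastI_ex[OF ex])
    have "\<not> bad v" if v: "pre \<omega> i = y @ v" "y \<noteq> []" for y v
    proof -
      have lv: "length v < i" using arg_cong[OF v(1), of length] v(2) by (cases y) auto
      then obtain y' where "pre \<omega> i = y' @ pre \<omega> (length v)" "length y' = i - length v" using pre_drop[of "length v" i \<omega>] by auto
      then have "v = pre \<omega> (length v)" using v(1) by simp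
      then show ?thesis using not_less_Least[of "length v" "\<lambda>i. bad (pre \<omega> i)"] lv unfolding i_def by metis
    qed
    then have "pre \<omega> i \<in> MB" using i unfolding MB_def by blast
    then show ?thesis using P_in_cell[of \<omega> i] \<omega> by blast
  qed
  define h where "h w = 8 * (1/4::real) ^ length w" for w :: "ltr list"
  \<comment> \<open>The distances from \<open>p\<close> to points of one cell lie in an interval of
    length 16 * (1/4) ^ length w. If every point at distance at most \<open>l\<close> lay in a bad
    cell, these intervals would cover \<open>{0..l}\<close>, and badness would bound their total
    length by the energy.\<close>
  have cov: "{0..l} \<subseteq> (\<Union>w\<in>MB. {d0 p (ctr0 w) - h w..d0 p (ctr0 w) + h w})"
  proof
    fix c assume c: "c \<in> {0..l}"
    then obtain x where x: "x \<in> E" "d0 p x = c" using E(2)[of c] by auto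
    then obtain w where w: "w \<in> MB" "x \<in> cell w" using inMB[OF x(1)] c by auto
    have "d0 x (ctr0 w) \<le> h w" using cell_d0[OF w(2) ctr0_cell] by (simp add: h_def)
    moreover have "\<bar>d0 p x - d0 p (ctr0 w)\<bar> \<le> d0 x (ctr0 w)"
    proof (cases "p \<in> range P")
      case True
      then show ?thesis
        using d0_triangle[of p x "ctr0 w"] d0_triangle[of p "ctr0 w" x] cellD[OF w(2)] cellD[OF ctr0_cell[of w]] d0_commute[of x "ctr0 w"] by auto
    next
      case False
      then have "d0 p x = 0" "d0 p (ctr0 w) = 0" unfolding pd_def by argo+
      then show ?thesis by simp
    qed
    ultimately have "c \<in> {d0 p (ctr0 w) - h w..d0 p (ctr0 w) + h w}" using x(2) by auto
    then show "c \<in> (\<Union>w\<in>MB. {d0 p (ctr0 w) - h w..d0 p (ctr0 w) + h w})" using w(1) by blast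
  qed
  have "l - 0 \<le> (\<Sum>w\<in>MB. (d0 p (ctr0 w) + h w) - (d0 p (ctr0 w) - h w))"
    by (rule interval_cover[OF finMB cov]) (simp add: h_def)
  also have "\<dots> = (\<Sum>w\<in>MB. 16 * (1/4) ^ length w)" by (simp add: h_def)
  finally have l: "\<tau> * l \<le> (\<Sum>w\<in>MB. 16 * (1/4) ^ j * (\<tau> * (1/4) ^ (length w - j)))"
  proof -
    assume "l - 0 \<le> (\<Sum>w\<in>MB. 16 * (1/4) ^ length w)"
    then have "\<tau> * l \<le> \<tau> * (\<Sum>w\<in>MB. 16 * (1/4) ^ length w)" using \<tau>(1) by simp
    also have "\<dots> = (\<Sum>w\<in>MB. 16 * (1/4) ^ j * (\<tau> * (1/4) ^ (length w - j)))"
      unfolding sum_distrib_left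
    proof (intro sum.cong refl)
      fix w assume "w \<in> MB"
      then have "length w = j + (length w - j)" by (auto simp: MB_def bad_def)
      then have "(1/4::real) ^ length w = (1/4) ^ j * (1/4) ^ (length w - j)" by (metis power_add)
      then show "\<tau> * (16 * (1/4) ^ length w) = 16 * (1/4) ^ j * (\<tau> * (1/4) ^ (length w - j))" by simp
    qed
    finally show ?thesis .
  qed
  also have "\<dots> \<le> (\<Sum>w\<in>MB. 16 * (1/4) ^ j * A w)"
    by (intro sum_mono mult_left_mono) (auto simp: MB_def bad_def less_imp_le)
  also have "\<dots> = 16 * (1/4) ^ j * (\<Sum>w\<in>MB. A w)" by (simp add: sum_distrib_left)
  also have "\<dots> \<le> 16 * (1/4) ^ j * \<epsilon>"
  proof (intro mult_left_mono)
    have disj: "desc m w \<inter> desc m w' = {}" if w: "w \<in> MB" "w' \<in> MB" "w \<noteq> w'" for w w'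
    proof (rule ccontr)
      assume "desc m w \<inter> desc m w' \<noteq> {}"
      then obtain y y' where "y @ w = y' @ w'" by (auto simp: desc_def)
      then obtain us where "(y = y' @ us \<and> us @ w = w') \<or> (y @ us = y' \<and> w = us @ w')" by (auto simp: append_eq_append_conv2)
      then show False using w unfolding MB_def by (cases us) auto
    qed
    have "(\<Sum>w\<in>MB. A w) = (\<Sum>x\<in>(\<Union>w\<in>MB. desc m w). a x)"
      unfolding A_def using finMB disj by (intro sum.UNION_disjoint[symmetric]) auto
    also have "\<dots> \<le> (\<Sum>x\<in>words m. a x)" using a by (intro sum_mono2) (auto simp: desc_def)
    finally show "(\<Sum>w\<in>MB. A w) \<le> \<epsilon>" using tot by simp
  qed simp
  finally show False using \<tau>(2) by simp
qed

end

section \<open>Potentials built from chains of cells\<close>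

definition chain :: "nat \<Rightarrow> ltr list list \<Rightarrow> bool" where
  "chain m ws \<longleftrightarrow> ws \<noteq> [] \<and> set ws \<subseteq> words m \<and> successively adj ws"

lemma chain_snoc: "chain m ws \<Longrightarrow> w \<in> words m \<Longrightarrow> adj (last ws) w \<Longrightarrow> chain m (ws @ [w])"
  by (simp add: chain_def successively_snoc)

text \<open>\<open>u\<close> is the least \<open>c\<close>-length of a chain from \<open>E\<close>
  ending at the vertex, capped at 1. The inserted 1 is the cap and also keeps the infimum over a
  nonempty set where no chain arrives.\<close>

lemma chain_potential:
  assumes c: "\<And>w. 0 \<le> (c w :: real)"
    and adm: "\<And>ws. chain m ws \<Longrightarrow> hd ws \<in> E \<Longrightarrow> last ws \<in> F \<Longrightarrow> 1 \<le> sum_list (map c ws)"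
    and EF: "E \<subseteq> words m" "F \<subseteq> words m"
  obtains u where "\<And>w. w \<in> words m \<Longrightarrow> \<bar>gr u w\<bar> \<le> c w"
    "\<And>w s. w \<in> E \<Longrightarrow> u (vert w s) \<le> c w" "\<And>w s. w \<in> F \<Longrightarrow> 1 - c w \<le> u (vert w s)"
proof -
  define K where "K v = insert 1 {sum_list (map c ws) | ws. chain m ws \<and> hd ws \<in> E \<and> (\<exists>s. vert (last ws) s = v)}" for v
  define u where "u v = Inf (K v)" for v
  have K0: "0 \<le> x" if "x \<in> K v" for x v
    using that c unfolding K_def by (auto intro!: sum_list_nonneg)
  have bdd: "bdd_below (K v)" for v by (rule bdd_belowI[of _ 0]) (rule K0)
  have lower: "u v \<le> x" if "x \<in> K v" for x v unfolding u_def by (rule cInf_lower[OF that bdd])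
  have greatest: "y \<le> u v" if "\<And>x. x \<in> K v \<Longrightarrow> y \<le> x" for y v
    unfolding u_def by (rule cInf_greatest) (use that in \<open>auto simp: K_def\<close>)
  have step: "u (vert w s') - c w \<le> u (vert w s)" if w: "w \<in> words m" for w s s'
  proof (rule greatest)
    fix x assume "x \<in> K (vert w s)"
    then consider "x = 1" | ws t where "x = sum_list (map c ws)" "chain m ws" "hd ws \<in> E" "vert (last ws) t = vert w s"
      unfolding K_def by blast
    then show "u (vert w s') - c w \<le> x"
    proof cases
      case 1
      have "u (vert w s') \<le> 1" by (rule lower) (simp add: K_def)
      then show ?thesis using 1 c[of w] by simp
    next
      case 2
      have "adj (last ws) w" using 2(4) by (auto simp: adj_def)
      then have "chain m (ws @ [w])" using chain_snoc 2(2) w by blast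
      moreover have "hd (ws @ [w]) \<in> E" using 2 by (simp add: chain_def)
      ultimately have "sum_list (map c (ws @ [w])) \<in> K (vert w s')" unfolding K_def by fastforce
      from lower[OF this] show ?thesis using 2(1) by simp
    qed
  qed
  show ?thesis
  proof (rule that)
    show "\<bar>gr u w\<bar> \<le> c w" if "w \<in> words m" for w
      using step[OF that, of True False] step[OF that, of False True] unfolding gr_def by argo
    show "u (vert w s) \<le> c w" if "w \<in> E" for w s
    proof (rule lower)
      have "chain m [w]" using that EF by (auto simp: chain_def)
      then have "sum_list (map c [w]) \<in> K (vert w s)" using that unfolding K_def by fastforce
      then show "c w \<in> K (vert w s)" by simp
    qed
    show "1 - c w \<le> u (vert w s)" if wF: "w \<in> F" for w s
    proof (rule greatest)
      fix x assume "x \<in> K (vert w s)"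
      then consider "x = 1" | ws t where "x = sum_list (map c ws)" "chain m ws" "hd ws \<in> E" "vert (last ws) t = vert w s"
        unfolding K_def by blast
      then show "1 - c w \<le> x"
      proof cases
        case 1
        then show ?thesis using c[of w] by simp
      next
        case 2
        have "adj (last ws) w" using 2(4) by (auto simp: adj_def)
        then have ch: "chain m (ws @ [w])" using chain_snoc 2(2) wF EF by blast
        have "hd (ws @ [w]) \<in> E" using 2 by (simp add: chain_def)
        from adm[OF ch this] have "1 \<le> sum_list (map c (ws @ [w]))" using wF by simp
        then show ?thesis using 2(1) by simp
      qed
    qed
  qed
qed

lemma powr_le_two_thirds:
  assumes "\<bar>g\<bar> powr (3/2) \<le> (A::real)" shows "\<bar>g\<bar> \<le> A powr (2/3)"
proof -
  have "\<bar>g\<bar> = (\<bar>g\<bar> powr (3/2)) powr (2/3)" by (simp add: powr_powr)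
  also have "\<dots> \<le> A powr (2/3)" using assms by (intro powr_mono2) auto
  finally show ?thesis .
qed

lemma gr_avg_pow_desc:
  assumes "length w + k \<le> m" "k = m - length x" "\<exists>y. x = y @ w"
    and c: "\<And>w. 0 \<le> (c w :: real)" "\<And>w. w \<in> words m \<Longrightarrow> \<bar>gr u w\<bar> \<le> c w" and l: "length x \<le> m"
  shows "\<bar>gr ((avg ^^ k) u) x\<bar> \<le> (\<Sum>z\<in>desc m w. c z powr (3/2)) powr (2/3)"
proof (rule powr_le_two_thirds)
  have "\<bar>gr ((avg ^^ k) u) x\<bar> powr (3/2) \<le> (\<Sum>v\<in>good k. \<bar>gr u (v @ x)\<bar> powr (3/2))" by (rule energy_avg_pow)
  also have "\<dots> \<le> (\<Sum>v\<in>good k. c (v @ x) powr (3/2))"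
    using assms by (intro sum_mono powr_mono2) (auto simp: good_def words_def)
  also have "\<dots> = (\<Sum>z\<in>(\<lambda>v. v @ x) ` good k. c z powr (3/2))"
    by (subst sum.reindex) (auto simp: inj_on_def)
  also have "\<dots> \<le> (\<Sum>z\<in>desc m w. c z powr (3/2))"
    using assms by (intro sum_mono2 finite_desc) (auto simp: good_def words_def desc_def)
  finally show "\<bar>gr ((avg ^^ k) u) x\<bar> powr (3/2) \<le> (\<Sum>z\<in>desc m w. c z powr (3/2))" .
qed

text \<open>Any bound below 1 would serve: it turns the increments of \<open>avg_telescope\<close>
  into a geometric series.\<close>

lemma quarter_two_thirds: "(1/4::real) powr (2/3) \<le> 1/2"
proof -
  have "(1/2::real) = ((1/2) powr (3/2)) powr (2/3)" by (simp add: powr_powr)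
  moreover have "(1/4::real) \<le> (1/2) powr (3/2)"
    using powr_mono'[of "3/2" 2 "1/2::real"] by (simp add: power2_eq_square)
  then have "(1/4::real) powr (2/3) \<le> ((1/2) powr (3/2)) powr (2/3)" by (rule powr_mono2[rotated 2]) auto
  ultimately show ?thesis by simp
qed

lemma power_powr_two_thirds: "((1/4::real) ^ k) powr (2/3) \<le> (1/2) ^ k"
proof -
  have "((1/4::real) ^ k) powr (2/3) = ((1/4) powr (2/3)) ^ k"
    by (simp add: powr_powr powr_realpow[symmetric] mult.commute)
  also have "\<dots> \<le> (1/2) ^ k" by (rule power_mono[OF quarter_two_thirds]) simp
  finally show ?thesis .
qed

text \<open>The energy below \<open>pre \<omega> i\<close> bounds the increments of the averaged
  potential on the children of this cell (\<open>gr_avg_pow_desc\<close>), so passing to the next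
  level changes its value by at most 4 * \<open>\<tau> powr (2/3)\<close> times a power of 1/2.
  These changes sum to less than 8 * \<open>\<tau> powr (2/3)\<close>, however deep the
  level.\<close>

lemma avg_telescope:
  assumes c: "\<And>w. 0 \<le> (c w :: real)" "\<And>w. w \<in> words m \<Longrightarrow> \<bar>gr u w\<bar> \<le> c w" and \<tau>: "0 \<le> \<tau>"
    and dec: "\<And>i. j \<le> i \<Longrightarrow> i \<le> m \<Longrightarrow> (\<Sum>x\<in>desc m (pre \<omega> i). c x powr (3/2)) \<le> \<tau> * (1/4) ^ (i - j)"
    and k: "j + k \<le> m"
  shows "\<bar>(avg ^^ (m - (j + k))) u (vert (pre \<omega> (j + k)) s) - (avg ^^ (m - j)) u (vert (pre \<omega> j) s)\<bar>
    \<le> 8 * \<tau> powr (2/3) * (1 - (1/2) ^ k)"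
  using k
proof (induction k)
  case (Suc k)
  define i where "i = j + k"
  define U where "U = (avg ^^ (m - Suc i)) u"
  have i: "j \<le> i" "i < m" "i - j = k" using Suc.prems by (auto simp: i_def)
  have "m - i = Suc (m - Suc i)" using i by simp
  then have Ui: "(avg ^^ (m - i)) u = avg U" unfolding U_def by simp
  define a where "a = \<tau> powr (2/3) * (1/2) ^ k"
  have g: "\<bar>gr U (g # pre \<omega> i)\<bar> \<le> a" for g
  proof -
    have "\<bar>gr U (g # pre \<omega> i)\<bar> \<le> (\<Sum>z\<in>desc m (pre \<omega> i). c z powr (3/2)) powr (2/3)"
      unfolding U_def using i by (intro gr_avg_pow_desc c) auto
    also have "\<dots> \<le> (\<tau> * (1/4) ^ k) powr (2/3)"
      using dec[of i] i by (intro powr_mono2) (auto intro: sum_nonneg)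
    also have "\<dots> = \<tau> powr (2/3) * ((1/4) ^ k) powr (2/3)" by (rule powr_mult)
    also have "\<dots> \<le> a" unfolding a_def by (intro mult_left_mono power_powr_two_thirds) simp
    finally show ?thesis .
  qed
  have p: "\<bar>U (vert (\<omega> i # pre \<omega> i) s) - U (Ch (vert (pre \<omega> i) s) b)\<bar> \<le> 4 * a" for b
    by (rule path4[OF g])
  have "\<bar>U (vert (pre \<omega> (Suc i)) s) - avg U (vert (pre \<omega> i) s)\<bar> \<le> 4 * a"
    using p[of False] p[of True] unfolding avg_def abs_le_iff pre.simps by argo
  moreover have "\<bar>avg U (vert (pre \<omega> i) s) - (avg ^^ (m - j)) u (vert (pre \<omega> j) s)\<bar> \<le> 8 * \<tau> powr (2/3) * (1 - (1/2) ^ k)"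
    using Suc.IH Suc.prems unfolding Ui[symmetric] i_def by simp
  ultimately have "\<bar>U (vert (pre \<omega> (Suc i)) s) - (avg ^^ (m - j)) u (vert (pre \<omega> j) s)\<bar> \<le> 4 * a + 8 * \<tau> powr (2/3) * (1 - (1/2) ^ k)"
    by linarith
  also have "\<dots> = 8 * \<tau> powr (2/3) * (1 - (1/2) ^ Suc k)" by (simp add: a_def algebra_simps)
  finally show ?case by (simp add: U_def i_def)
qed simp

context coding
begin

text \<open>A diameter of at least 3 * l, being larger than 2 * l, forces a point at distance at
  least \<open>l\<close> from \<open>p\<close>, and the distance from \<open>p\<close> maps the
  connected set onto an interval.\<close>

lemma continuum_spheres:
  assumes E: "connectedin (mtopology_of X0) E" and p: "p \<in> E" and l: "0 < l" "ennreal (3 * l) \<le> mdiam X0 E"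
    and c: "0 \<le> c" "c \<le> l"
  shows "\<exists>x\<in>E. d0 p x = c"
proof -
  have EP: "E \<subseteq> range P" using E unfolding connectedin_def by simp
  have "\<exists>y\<in>E. l \<le> d0 p y"
  proof (rule ccontr)
    assume "\<not> ?thesis"
    then have far: "d0 p y < l" if "y \<in> E" for y using that by force
    have "mdiam X0 E \<le> ennreal (2 * l)"
    proof (rule mdiam_le)
      fix x y assume xy: "x \<in> E" "y \<in> E"
      have "d0 x y \<le> d0 x p + d0 p y" using xy p EP by (intro d0_triangle) auto
      then show "mdist X0 x y \<le> 2 * l" using far[OF xy(1)] far[OF xy(2)] d0_commute[of x p] by simp
    qed
    with l(2) have "ennreal (3 * l) \<le> ennreal (2 * l)" by order
    then show False using l(1) by (subst (asm) ennreal_le_iff) auto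
  qed
  then obtain y where y: "y \<in> E" "l \<le> d0 p y" by blast
  have pX: "p \<in> mspace X0" using p EP by auto
  have "continuous_map (mtopology_of X0) euclideanreal (\<lambda>x. mdist X0 p x)"
    using pX by (intro continuous_map_mdist) auto
  then have "continuous_map (mtopology_of X0) euclideanreal (d0 p)" by simp
  then have "connected (d0 p ` E)"
    using connectedin_continuous_map_image[OF _ E] connectedin_iff_connected by blast
  then have iv: "is_interval (d0 p ` E)" by (simp add: is_interval_connected_1)
  have "0 \<in> d0 p ` E" using p d0_self[of p] EP by (metis image_eqI subsetD)
  moreover have "d0 p y \<in> d0 p ` E" using y(1) by (rule imageI)
  ultimately have "c \<in> d0 p ` E" using iv y(2) c unfolding is_interval_1 by (meson order_trans)
  then show ?thesis by auto
qed

lemma Dn_le_d0: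
  "Dn (1/4) j (vert (pre \<omega> j) False) (vert (pre \<omega>' j) False) \<le> d0 (P \<omega>) (P \<omega>') + 8/3 * (1/4) ^ j"
  using dd_approx[OF quarter0, of \<omega> \<omega>' j] unfolding pd_P[OF quarter0] wt_quarter length_pre abs_le_iff by argo

lemma potential_difference:
  assumes \<epsilon>: "0 < \<epsilon>" and g: "\<And>w. w \<in> words j \<Longrightarrow> \<bar>gr u w\<bar> \<le> \<epsilon>"
  shows "u (vert (pre \<omega> j) False) - u (vert (pre \<omega>' j) False) \<le> \<epsilon> * (4 ^ j * d0 (P \<omega>) (P \<omega>') + 8/3)"
proof -
  define v where "v x = u x / (4 ^ j * \<epsilon>)" for x
  have "Lip (1/4) j v"
  proof (rule LipI)
    fix w :: "ltr list" assume "length w = j"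
    then have "\<bar>gr u w\<bar> \<le> \<epsilon>" using g by (simp add: words_def)
    moreover have "gr v w = gr u w / (4 ^ j * \<epsilon>)" by (simp add: gr_def v_def diff_divide_distrib)
    ultimately have "\<bar>gr v w\<bar> \<le> \<epsilon> / (4 ^ j * \<epsilon>)"
      using \<epsilon> divide_right_mono[of "\<bar>gr u w\<bar>" \<epsilon> "4 ^ j * \<epsilon>"] by (simp only: abs_divide abs_mult abs_of_pos power_abs abs_numeral mult_pos_pos zero_less_power zero_less_numeral) simp
    then show "\<bar>gr v w\<bar> \<le> wt (1/4) w"
      using \<epsilon> \<open>length w = j\<close> by (simp add: wt_quarter power_one_over)
  qed
  then have "v (vert (pre \<omega> j) False) - v (vert (pre \<omega>' j) False) \<le> d0 (P \<omega>) (P \<omega>') + 8/3 * (1/4) ^ j"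
    using Dn_upper[OF quarter0, of j v "pre \<omega> j" "pre \<omega>' j" False False] Dn_le_d0[of j \<omega> \<omega>'] by simp
  then have "(u (vert (pre \<omega> j) False) - u (vert (pre \<omega>' j) False)) / (4 ^ j * \<epsilon>) \<le> d0 (P \<omega>) (P \<omega>') + 8/3 * (1/4) ^ j"
    by (simp add: v_def diff_divide_distrib)
  then have "u (vert (pre \<omega> j) False) - u (vert (pre \<omega>' j) False) \<le> (d0 (P \<omega>) (P \<omega>') + 8/3 * (1/4) ^ j) * (4 ^ j * \<epsilon>)"
    using \<epsilon> by (simp add: pos_divide_le_eq)
  also have "\<dots> = \<epsilon> * (4 ^ j * d0 (P \<omega>) (P \<omega>') + 8/3)" by (simp add: field_simps power_one_over)
  finally show ?thesis .
qed

text \<open>The potential \<open>u\<close> of \<open>chain_potential\<close> is averaged down to the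
  level \<open>j\<close> whose cells have about the size \<open>D\<close>. At codes chosen by
  \<open>select_point\<close> in \<open>E\<close> and \<open>F\<close>, averaging changes
  \<open>u\<close> by at most 8 * \<open>T\<close>, so the averaged potential still rises from
  nearly 0 to nearly 1. Each of its increments is at most \<open>\<epsilon> powr (2/3)\<close>, and
  the two points are only about 1 + \<open>\<Delta>\<close> cells apart.\<close>

lemma energy_lower:
  fixes c :: "ltr list \<Rightarrow> real"
  assumes c: "\<And>w. 0 \<le> c w" and tot: "(\<Sum>w\<in>words m. c w powr (3/2)) \<le> \<epsilon>" and \<epsilon>: "0 < \<epsilon>"
    and adm: "\<And>ws. chain m ws \<Longrightarrow> cell (hd ws) \<inter> E \<noteq> {} \<Longrightarrow> cell (last ws) \<inter> F \<noteq> {} \<Longrightarrow> 1 \<le> sum_list (map c ws)"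
    and E: "connectedin (mtopology_of X0) E" "p \<in> E" "ennreal D \<le> mdiam X0 E"
    and F: "connectedin (mtopology_of X0) F" "q \<in> F" "ennreal D \<le> mdiam X0 F"
    and j: "j \<le> m" "(1/4) ^ j \<le> D" "4 ^ j * D \<le> 8"
    and pq: "d0 p q \<le> D * (\<Delta> + 1)" and \<Delta>: "0 \<le> \<Delta>"
  shows "1 \<le> 400 * (1 + \<Delta>) * \<epsilon> powr (2/3)"
proof -
  define E0 where "E0 = {w\<in>words m. cell w \<inter> E \<noteq> {}}"
  define F0 where "F0 = {w\<in>words m. cell w \<inter> F \<noteq> {}}"
  have EF0: "E0 \<subseteq> words m" "F0 \<subseteq> words m" by (auto simp: E0_def F0_def)
  have adm0: "\<And>ws. chain m ws \<Longrightarrow> hd ws \<in> E0 \<Longrightarrow> last ws \<in> F0 \<Longrightarrow> 1 \<le> sum_list (map c ws)"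
    using adm by (simp add: E0_def F0_def)
  obtain u where u: "\<And>w. w \<in> words m \<Longrightarrow> \<bar>gr u w\<bar> \<le> c w"
    "\<And>w s. w \<in> E0 \<Longrightarrow> u (vert w s) \<le> c w" "\<And>w s. w \<in> F0 \<Longrightarrow> 1 - c w \<le> u (vert w s)"
    using chain_potential[OF c adm0 EF0] by blast
  define l where "l = D / 3"
  have D: "0 < D" using j(2) by (rule less_le_trans[rotated]) simp
  have l: "0 < l" "3 * l = D" using D by (auto simp: l_def)
  \<comment> \<open>\<open>select_point\<close> needs 16 * \<open>D\<close> *
    \<open>\<epsilon>\<close> to be less than \<open>\<tau>\<close> * \<open>D\<close> / 3; 96
    leaves a factor 2.\<close>
  define \<tau> where "\<tau> = 96 * \<epsilon>"
  define T where "T = \<tau> powr (2/3)"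
  have \<tau>: "0 < \<tau>" "16 * (1/4) ^ j * \<epsilon> < \<tau> * l"
  proof -
    have "16 * (1/4) ^ j * \<epsilon> \<le> 16 * D * \<epsilon>" using j(2) \<epsilon> by (intro mult_right_mono mult_left_mono) auto
    also have "\<dots> < \<tau> * l" using D \<epsilon> by (simp add: \<tau>_def l_def)
    finally show "16 * (1/4) ^ j * \<epsilon> < \<tau> * l" .
  qed (use \<epsilon> in \<open>simp add: \<tau>_def\<close>)
  have EP: "E \<subseteq> range P" "F \<subseteq> range P" using E(1) F(1) unfolding connectedin_def by auto
  have sE: "\<exists>x\<in>E. d0 p x = r" if "0 \<le> r" "r \<le> l" for r
    by (rule continuum_spheres[OF E(1,2) l(1) _ that]) (use l(2) E(3) in simp)
  have sF: "\<exists>x\<in>F. d0 q x = r" if "0 \<le> r" "r \<le> l" for r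
    by (rule continuum_spheres[OF F(1,2) l(1) _ that]) (use l(2) F(3) in simp)
  have c3: "0 \<le> c x powr (3/2)" for x by simp
  obtain \<omega> where \<omega>: "P \<omega> \<in> E" "d0 p (P \<omega>) \<le> l"
    "\<And>i. j \<le> i \<Longrightarrow> i \<le> m \<Longrightarrow> (\<Sum>x\<in>desc m (pre \<omega> i). c x powr (3/2)) \<le> \<tau> * (1/4) ^ (i - j)"
    using select_point[OF c3 tot EP(1) sE \<tau>] by blast
  obtain \<xi> where \<xi>: "P \<xi> \<in> F" "d0 q (P \<xi>) \<le> l"
    "\<And>i. j \<le> i \<Longrightarrow> i \<le> m \<Longrightarrow> (\<Sum>x\<in>desc m (pre \<xi> i). c x powr (3/2)) \<le> \<tau> * (1/4) ^ (i - j)"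
    using select_point[OF c3 tot EP(2) sF \<tau>] by blast
  define U where "U = (avg ^^ (m - j)) u"
  have T0: "0 \<le> T" by (simp add: T_def)
  have tele: "\<bar>u (vert (pre \<eta> m) False) - U (vert (pre \<eta> j) False)\<bar> \<le> 8 * T"
    if "\<And>i. j \<le> i \<Longrightarrow> i \<le> m \<Longrightarrow> (\<Sum>x\<in>desc m (pre \<eta> i). c x powr (3/2)) \<le> \<tau> * (1/4) ^ (i - j)" for \<eta>
  proof -
    have "\<bar>u (vert (pre \<eta> m) False) - U (vert (pre \<eta> j) False)\<bar> \<le> 8 * T * (1 - (1/2) ^ (m - j))"
      using avg_telescope[where c=c and u=u and j=j and k="m - j" and s=False and \<tau>=\<tau> and \<omega>=\<eta> and m=m, OF c u(1) less_imp_le[OF \<tau>(1)] that] j(1)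
      unfolding U_def T_def by simp
    also have "\<dots> \<le> 8 * T * 1" using T0 by (intro mult_left_mono) auto
    finally show ?thesis by simp
  qed
  have small: "c (pre \<eta> m) \<le> T"
    if "\<And>i. j \<le> i \<Longrightarrow> i \<le> m \<Longrightarrow> (\<Sum>x\<in>desc m (pre \<eta> i). c x powr (3/2)) \<le> \<tau> * (1/4) ^ (i - j)" for \<eta>
  proof -
    have "pre \<eta> m \<in> desc m (pre \<eta> m)" by (auto simp: desc_def words_def)
    then have "c (pre \<eta> m) powr (3/2) \<le> (\<Sum>x\<in>desc m (pre \<eta> m). c x powr (3/2))" by (intro member_le_sum) auto
    also have "\<dots> \<le> \<tau> * (1/4) ^ (m - j)" by (rule that) (use j in auto)
    also have "\<dots> \<le> \<tau> * 1" using \<tau>(1) by (intro mult_left_mono) (auto intro: power_le_one)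
    finally have "\<bar>c (pre \<eta> m)\<bar> powr (3/2) \<le> \<tau>" using c[of "pre \<eta> m"] by simp
    then show ?thesis using powr_le_two_thirds[of "c (pre \<eta> m)" \<tau>] c[of "pre \<eta> m"] unfolding T_def by simp
  qed
  have m: "pre \<omega> m \<in> E0" "pre \<xi> m \<in> F0"
    using P_in_cell[of \<omega> m] P_in_cell[of \<xi> m] \<omega>(1) \<xi>(1) by (auto simp: E0_def F0_def words_def)
  have gU: "\<bar>gr U w\<bar> \<le> \<epsilon> powr (2/3)" if "w \<in> words j" for w
  proof -
    have "\<bar>gr U w\<bar> \<le> (\<Sum>z\<in>desc m []. c z powr (3/2)) powr (2/3)"
      unfolding U_def using that j(1) by (intro gr_avg_pow_desc c u(1)) (auto simp: words_def)
    also have "desc m [] = words m" by (auto simp: desc_def)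
    also have "(\<Sum>z\<in>words m. c z powr (3/2)) powr (2/3) \<le> \<epsilon> powr (2/3)" using tot by (intro powr_mono2) (auto intro: sum_nonneg)
    finally show ?thesis .
  qed
  have \<epsilon>': "0 < \<epsilon> powr (2/3)" using \<epsilon> by simp
  have top: "U (vert (pre \<xi> j) False) - U (vert (pre \<omega> j) False) \<le> \<epsilon> powr (2/3) * (4 ^ j * d0 (P \<xi>) (P \<omega>) + 8/3)"
    by (rule potential_difference[OF \<epsilon>' gU])
  have t: "\<bar>u (vert (pre \<omega> m) False) - U (vert (pre \<omega> j) False)\<bar> \<le> 8 * T" "c (pre \<omega> m) \<le> T"
    by (rule tele small; rule \<omega>(3); assumption)+
  have t': "\<bar>u (vert (pre \<xi> m) False) - U (vert (pre \<xi> j) False)\<bar> \<le> 8 * T" "c (pre \<xi> m) \<le> T"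
    by (rule tele small; rule \<xi>(3); assumption)+
  \<comment> \<open>18 is 8 + 8 for the averaging at the two points, plus 1 + 1 for the values of
    \<open>c\<close> there.\<close>
  have "1 \<le> 18 * T + \<epsilon> powr (2/3) * (4 ^ j * d0 (P \<xi>) (P \<omega>) + 8/3)"
    using top t t' u(2)[OF m(1), of False] u(3)[OF m(2), of False] by argo
  \<comment> \<open>This is 96 powr (2/3) \<le> 21, that is, 96^2 = 9216 against 21^3 =
    9261.\<close>
  moreover have "T \<le> 21 * \<epsilon> powr (2/3)"
  proof -
    have "(sqrt 21 ^ 3)\<^sup>2 = ((sqrt 21)\<^sup>2) ^ 3" by (metis power_mult mult.commute)
    also have "\<dots> = 9261" by simp
    finally have "(96::real)\<^sup>2 \<le> (sqrt 21 ^ 3)\<^sup>2" by simp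
    then have "96 \<le> sqrt 21 ^ 3" by (rule power2_le_imp_le) simp
    then have "(96::real) \<le> 21 powr (3/2)" using powr_three_halves[of 21] by simp
    then have "(96::real) powr (2/3) \<le> (21 powr (3/2)) powr (2/3)" by (rule powr_mono2[rotated 2]) auto
    then have "(96::real) powr (2/3) \<le> 21" by (simp add: powr_powr)
    moreover have "T = 96 powr (2/3) * \<epsilon> powr (2/3)" unfolding T_def \<tau>_def by (rule powr_mult)
    ultimately show ?thesis using \<epsilon>' by simp
  qed
  moreover have "4 ^ j * d0 (P \<xi>) (P \<omega>) \<le> 8 * (\<Delta> + 5/3)"
  proof -
    have inP: "p \<in> range P" "q \<in> range P" using E(2) F(2) EP by auto
    have "d0 (P \<xi>) (P \<omega>) \<le> d0 (P \<xi>) q + d0 q (P \<omega>)" "d0 q (P \<omega>) \<le> d0 q p + d0 p (P \<omega>)"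
      using inP by (auto intro!: d0_triangle)
    then have "d0 (P \<xi>) (P \<omega>) \<le> D * (\<Delta> + 5/3)"
      using \<omega>(2) \<xi>(2) pq d0_commute[of "P \<xi>" q] d0_commute[of q p] unfolding l_def by (simp add: algebra_simps)
    then have "4 ^ j * d0 (P \<xi>) (P \<omega>) \<le> 4 ^ j * (D * (\<Delta> + 5/3))" by (intro mult_left_mono) auto
    also have "\<dots> = (4 ^ j * D) * (\<Delta> + 5/3)" by simp
    also have "\<dots> \<le> 8 * (\<Delta> + 5/3)" using j(3) \<Delta> by (intro mult_right_mono) auto
    finally show ?thesis .
  qed
  then have "\<epsilon> powr (2/3) * (4 ^ j * d0 (P \<xi>) (P \<omega>) + 8/3) \<le> \<epsilon> powr (2/3) * (8 * (\<Delta> + 5/3) + 8/3)"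
    using \<epsilon>' by (intro mult_left_mono) auto
  ultimately have "1 \<le> \<epsilon> powr (2/3) * (378 + (8 * (\<Delta> + 5/3) + 8/3))" by (simp add: algebra_simps)
  also have "\<dots> \<le> \<epsilon> powr (2/3) * (400 * (1 + \<Delta>))" using \<Delta> \<epsilon>' by (intro mult_left_mono) auto
  finally show ?thesis by (simp add: mult_ac)
qed

end

section \<open>From functions admissible for curves to functions admissible for chains\<close>

lemma sum_stars_le:
  fixes r :: "ltr list \<Rightarrow> real"
  assumes "\<And>w. 0 \<le> r w"
  shows "(\<Sum>w\<in>(\<Union>x\<in>set ws. star x). r w) \<le> sum_list (map (\<lambda>x. \<Sum>w\<in>star x. r w) ws)"
proof (induction ws)
  case (Cons x ws)
  have "(\<Sum>w\<in>star x \<union> (\<Union>x\<in>set ws. star x). r w) + (\<Sum>w\<in>star x \<inter> (\<Union>x\<in>set ws. star x). r w) = (\<Sum>w\<in>star x. r w) + (\<Sum>w\<in>(\<Union>x\<in>set ws. star x). r w)"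
    by (rule sum.union_inter) (auto simp: star_card)
  moreover have "0 \<le> (\<Sum>w\<in>star x \<inter> (\<Union>x\<in>set ws. star x). r w)" by (rule sum_nonneg) (rule assms)
  ultimately show ?case using Cons by simp
qed simp

lemma star_sym: "w' \<in> star w \<longleftrightarrow> w \<in> star w'"
proof -
  have "adj w w' \<longleftrightarrow> adj w' w" unfolding adj_def by metis
  then show ?thesis by (auto simp: star_def)
qed

lemma star_words: "w \<in> words m \<Longrightarrow> star w \<subseteq> words m"
  by (auto simp: star_def words_def)

text \<open>A factor 8 powr (3/2) comes from summing over a star, and a factor 8 from the number of
  stars that contain a given cell.\<close>

lemma star_energy:
  fixes r :: "ltr list \<Rightarrow> real"
  assumes r: "\<And>w. 0 \<le> r w"
  shows "(\<Sum>w\<in>words m. (\<Sum>x\<in>star w. r x) powr (3/2)) \<le> 8 powr (5/2) * (\<Sum>w\<in>words m. r w powr (3/2))"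
proof -
  have "(\<Sum>w\<in>words m. (\<Sum>x\<in>star w. r x) powr (3/2)) \<le> (\<Sum>w\<in>words m. 8 powr (3/2) * (\<Sum>x\<in>star w. r x powr (3/2)))"
    using r star_card by (intro sum_mono power_mean_8) auto
  also have "\<dots> = 8 powr (3/2) * (\<Sum>w\<in>words m. \<Sum>x | x \<in> words m \<and> x \<in> star w. r x powr (3/2))"
    unfolding sum_distrib_left using star_words by (intro sum.cong refl) blast
  also have "(\<Sum>w\<in>words m. \<Sum>x | x \<in> words m \<and> x \<in> star w. r x powr (3/2)) = (\<Sum>x\<in>words m. \<Sum>w | w \<in> words m \<and> x \<in> star w. r x powr (3/2))"
    by (rule sum.swap_restrict) auto
  also have "\<dots> \<le> (\<Sum>x\<in>words m. 8 * r x powr (3/2))"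
  proof (rule sum_mono)
    fix x
    have "{w \<in> words m. x \<in> star w} \<subseteq> star x" using star_sym by blast
    then have "card {w \<in> words m. x \<in> star w} \<le> 8" using card_mono[OF star_card(1)[of x]] star_card(2)[of x] by (meson order_trans)
    then have "real (card {w \<in> words m. x \<in> star w}) * r x powr (3/2) \<le> 8 * r x powr (3/2)" by (intro mult_right_mono) auto
    then show "(\<Sum>w | w \<in> words m \<and> x \<in> star w. r x powr (3/2)) \<le> 8 * r x powr (3/2)" by simp
  qed
  finally have "(\<Sum>w\<in>words m. (\<Sum>x\<in>star w. r x) powr (3/2)) \<le> 8 powr (3/2) * (\<Sum>x\<in>words m. 8 * r x powr (3/2))"
    by simp
  also have "\<dots> = (8 powr (3/2) * 8) * (\<Sum>w\<in>words m. r w powr (3/2))" by (simp add: sum_distrib_left mult_ac)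
  also have "(8::real) powr (3/2) * 8 = 8 powr (5/2)" using powr_add[of "8::real" "3/2" 1] by simp
  finally show ?thesis .
qed

text \<open>\<open>inverse t\<close> stands for the relative distance. 800 is twice the 400 of
  \<open>energy_lower\<close>, so that an energy below this value contradicts it, and 8 powr (5/2)
  is the price of \<open>star_energy\<close>.\<close>

definition lower_bound :: "real \<Rightarrow> real" where
  "lower_bound t = (1 / (800 * (1 + inverse t))) powr (3/2) / 8 powr (5/2)"

lemma lower_bound_pos:
  assumes "0 < t" shows "0 < lower_bound t"
proof -
  have "0 < 800 * (1 + inverse t)" using assms by (simp add: add_pos_pos)
  then show ?thesis unfolding lower_bound_def by (simp del: distrib_left_numeral)
qed

lemma lower_bound_mono: "mono_on {0<..} lower_bound"
proof (rule mono_onI)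
  fix s t :: real assume "s \<in> {0<..}" "s \<le> t"
  then have i: "inverse t \<le> inverse s" "0 < inverse t" by (auto intro: le_imp_inverse_le)
  then have "0 < 800 * (1 + inverse t)" by (intro mult_pos_pos add_pos_pos) auto
  moreover have "800 * (1 + inverse t) \<le> 800 * (1 + inverse s)" using i by simp
  ultimately have "1 / (800 * (1 + inverse s)) \<le> 1 / (800 * (1 + inverse t))" by (intro divide_left_mono mult_pos_pos) auto
  moreover have "0 \<le> 1 / (800 * (1 + inverse s))" 
    using order_trans[OF less_imp_le[OF i(2)] i(1)] by (intro divide_nonneg_nonneg mult_nonneg_nonneg add_nonneg_nonneg) auto
  ultimately show "lower_bound s \<le> lower_bound t" unfolding lower_bound_def
    by (intro divide_right_mono powr_mono2) auto
qed

context coding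
begin

lemma sum_GG: "(\<Sum>v\<in>fst (GG m). h v) = (\<Sum>w\<in>words m. h (cell w))"
  unfolding GG_def using sum.reindex[OF inj_cell[of m], of h] by simp

lemma mdiam_X0_le: "S \<subseteq> range P \<Longrightarrow> mdiam X0 S \<le> ennreal 8"
proof (rule mdiam_le)
  fix x y assume "S \<subseteq> range P" "x \<in> S" "y \<in> S"
  then have "x \<in> cell []" "y \<in> cell []" using range_cells[of 0] by auto
  then show "mdist X0 x y \<le> 8" using cell_d0[of x "[]" y] by simp
qed

text \<open>The cells of a chain carry a Lipschitz curve. It may also meet neighbouring cells that
  are not in the chain, which is why \<open>r\<close> is replaced by its sums over stars.\<close>

lemma chain_admissible:
  fixes r :: "ltr list \<Rightarrow> real"
  assumes r: "\<And>w. 0 \<le> r w"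
    and adm: "\<And>\<gamma>. \<gamma> \<in> curves_between X0 E F \<Longrightarrow> 1 \<le> (\<Sum>w | w \<in> words m \<and> cell w \<inter> \<gamma> ` {0..1} \<noteq> {}. r w)"
    and ws: "chain m ws" "cell (hd ws) \<inter> E \<noteq> {}" "cell (last ws) \<inter> F \<noteq> {}"
  shows "1 \<le> sum_list (map (\<lambda>x. \<Sum>w\<in>star x. r w) ws)"
proof -
  obtain x y where xy: "x \<in> cell (hd ws)" "x \<in> E" "y \<in> cell (last ws)" "y \<in> F" using ws by blast
  have len: "\<And>w. w \<in> set ws \<Longrightarrow> length w = m" using ws(1) by (auto simp: chain_def words_def)
  have "ws \<noteq> []" "successively adj ws" using ws(1) by (auto simp: chain_def)
  then obtain \<gamma> where \<gamma>: "lipc (\<Union>w\<in>set ws. cell w) \<gamma>" "\<gamma> 0 = x" "\<gamma> 1 = y"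
    using chain_curve[of ws m x y] len xy by blast
  have "\<gamma> \<in> curves_between X0 E F" using lipc_rectifiable[OF \<gamma>(1)] \<gamma> xy by (simp add: curves_between_def)
  then have "1 \<le> (\<Sum>w | w \<in> words m \<and> cell w \<inter> \<gamma> ` {0..1} \<noteq> {}. r w)" by (rule adm)
  also have "\<dots> \<le> (\<Sum>w\<in>(\<Union>x\<in>set ws. star x). r w)"
  proof (rule sum_mono2)
    show "{w \<in> words m. cell w \<inter> \<gamma> ` {0..1} \<noteq> {}} \<subseteq> (\<Union>x\<in>set ws. star x)"
    proof
      fix w assume "w \<in> {w \<in> words m. cell w \<inter> \<gamma> ` {0..1} \<noteq> {}}"
      then obtain t where t: "w \<in> words m" "t \<in> {0..1}" "\<gamma> t \<in> cell w" by blast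
      then have "\<gamma> t \<in> (\<Union>w\<in>set ws. cell w)" using \<gamma>(1) unfolding lipc_def by blast
      then obtain v where v: "v \<in> set ws" "\<gamma> t \<in> cell v" by blast
      have "adj v w" using t v len by (intro cells_adj) (auto simp: words_def)
      then show "w \<in> (\<Union>x\<in>set ws. star x)" using v(1) t(1) len[OF v(1)] by (auto simp: star_def words_def intro!: bexI[of _ v])
    qed
  qed (auto simp: star_card r)
  also have "\<dots> \<le> sum_list (map (\<lambda>x. \<Sum>w\<in>star x. r w) ws)" by (rule sum_stars_le[OF r])
  finally show ?thesis .
qed

lemma modulus_lower:
  assumes E: "nondegenerate_continuum X0 E" and F: "nondegenerate_continuum X0 F"
    and D: "ennreal (inverse 4 ^ n) \<le> min (mdiam X0 E) (mdiam X0 F)" and nm: "n \<le> m"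
  shows "ennreal (lower_bound (inverse (relative_distance X0 E F))) \<le> discrete_modulus (3/2) (curves_between X0 E F) (GG m)"
proof -
  define D where "D = enn2real (min (mdiam X0 E) (mdiam X0 F))"
  define \<Delta> where "\<Delta> = relative_distance X0 E F"
  have cE: "connectedin (mtopology_of X0) E" and cF: "connectedin (mtopology_of X0) F"
    using E F by (auto simp: nondegenerate_continuum_def)
  have EP: "E \<subseteq> range P" "F \<subseteq> range P" using cE cF unfolding connectedin_def by auto
  have le8: "min (mdiam X0 E) (mdiam X0 F) \<le> ennreal 8" using mdiam_X0_le[OF EP(1)] by (simp add: min_le_iff_disj)
  then have "min (mdiam X0 E) (mdiam X0 F) < top" by (rule le_less_trans) simp
  then have eD: "ennreal D = min (mdiam X0 E) (mdiam X0 F)" unfolding D_def by simp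
  have D8: "D \<le> 8" unfolding D_def using enn2real_mono[OF le8] by simp
  have "ennreal (inverse 4 ^ n) \<le> ennreal D" using D unfolding eD .
  then have Dn: "(1/4) ^ n \<le> D" unfolding D_def by (subst (asm) ennreal_le_iff) (simp_all add: inverse_eq_divide)
  have "0 < (1/4::real) ^ n" by simp
  with Dn have D0: "0 < D" by linarith
  \<comment> \<open>The level whose cells are as large as the smaller continuum. Minimality gives
    \<open>4 ^ j * D \<le> 8\<close>; for \<open>j = 0\<close> this is the diameter bound of the
    whole space.\<close>
  define j where "j = (LEAST j. (1/4) ^ j \<le> D)"
  have j: "(1/4) ^ j \<le> D" "j \<le> n" unfolding j_def using Dn by (rule LeastI, rule Least_le)
  have jD: "4 ^ j * D \<le> 8"
  proof (cases j)
    case (Suc i)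
    then have "\<not> (1/4) ^ i \<le> D" using not_less_Least[of i "\<lambda>j. (1/4) ^ j \<le> D"] unfolding j_def by simp
    then have "4 ^ j * D \<le> 4 ^ j * (1/4) ^ i" by (intro mult_left_mono) auto
    also have "\<dots> = 4" by (simp add: Suc power_one_over)
    finally show ?thesis by simp
  qed (use D8 in simp)
  have ne: "E \<noteq> {}" "F \<noteq> {}" using E F by (auto simp: nondegenerate_continuum_def)
  define W where "W = {mdist X0 x y | x y. x \<in> E \<and> y \<in> F}"
  have W0: "0 \<le> t" if "t \<in> W" for t using that by (auto simp: W_def d0_nonneg)
  have Wne: "W \<noteq> {}" using ne by (auto simp: W_def)
  have md: "msetdist X0 E F = Inf W" by (simp add: msetdist_def W_def)
  have "0 \<le> Inf W" by (rule cInf_greatest[OF Wne W0])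
  then have \<Delta>0: "0 \<le> \<Delta>" unfolding \<Delta>_def relative_distance_def md by simp
  have "Inf W < D * (\<Delta> + 1)" using D0 unfolding \<Delta>_def relative_distance_def md D_def[symmetric] by (simp add: distrib_left)
  then obtain t where "t \<in> W" "t < D * (\<Delta> + 1)" using cInf_lessD[OF Wne] by blast
  then obtain p q where pq: "p \<in> E" "q \<in> F" "d0 p q \<le> D * (\<Delta> + 1)" unfolding W_def by auto
  have DE: "ennreal D \<le> mdiam X0 E" "ennreal D \<le> mdiam X0 F" unfolding eD by auto
  show ?thesis
    unfolding discrete_modulus_def
  proof (rule INF_greatest)
    fix \<rho> :: "'p set \<Rightarrow> real"
    assume "\<rho> \<in> {\<rho>. (\<forall>v\<in>fst (GG m). 0 \<le> \<rho> v) \<and>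
      (\<forall>\<gamma>\<in>curves_between X0 E F. 1 \<le> (\<Sum>v\<in>{v \<in> fst (GG m). v \<inter> \<gamma> ` {0..1} \<noteq> {}}. \<rho> v))}"
    then have \<rho>: "\<And>v. v \<in> fst (GG m) \<Longrightarrow> 0 \<le> \<rho> v"
      "\<And>\<gamma>. \<gamma> \<in> curves_between X0 E F \<Longrightarrow> 1 \<le> (\<Sum>v\<in>{v \<in> fst (GG m). v \<inter> \<gamma> ` {0..1} \<noteq> {}}. \<rho> v)" by auto
    define r where "r w = (if w \<in> words m then \<rho> (cell w) else 0)" for w
    have r0: "0 \<le> r w" for w using \<rho>(1)[of "cell w"] by (auto simp: r_def GG_def)
    have S: "(\<Sum>v\<in>fst (GG m). \<rho> v powr (3/2)) = (\<Sum>w\<in>words m. r w powr (3/2))"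
      unfolding sum_GG by (simp add: r_def)
    have adm: "1 \<le> (\<Sum>w | w \<in> words m \<and> cell w \<inter> \<gamma> ` {0..1} \<noteq> {}. r w)" if "\<gamma> \<in> curves_between X0 E F" for \<gamma>
    proof -
      let ?h = "\<lambda>v. if v \<inter> \<gamma> ` {0..1} \<noteq> {} then \<rho> v else 0"
      have "(\<Sum>v\<in>{v \<in> fst (GG m). v \<inter> \<gamma> ` {0..1} \<noteq> {}}. \<rho> v) = (\<Sum>v\<in>fst (GG m). ?h v)"
        by (rule sum.inter_filter) (simp add: GG_def)
      also have "\<dots> = (\<Sum>w\<in>words m. if cell w \<inter> \<gamma> ` {0..1} \<noteq> {} then r w else 0)"
        unfolding sum_GG by (intro sum.cong) (auto simp: r_def)
      also have "\<dots> = (\<Sum>w | w \<in> words m \<and> cell w \<inter> \<gamma> ` {0..1} \<noteq> {}. r w)"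
        by (rule sum.inter_filter[symmetric]) simp
      finally show ?thesis using \<rho>(2)[OF that] by simp
    qed
    define c where "c x = (\<Sum>w\<in>star x. r w)" for x
    have c0: "0 \<le> c x" for x unfolding c_def by (rule sum_nonneg) (rule r0)
    have adm': "1 \<le> sum_list (map c ws)" if "chain m ws" "cell (hd ws) \<inter> E \<noteq> {}" "cell (last ws) \<inter> F \<noteq> {}" for ws
      unfolding c_def by (rule chain_admissible[OF r0 adm that])
    have en: "(\<Sum>w\<in>words m. c w powr (3/2)) \<le> 8 powr (5/2) * (\<Sum>w\<in>words m. r w powr (3/2))"
      unfolding c_def by (rule star_energy[OF r0])
    define \<epsilon> where "\<epsilon> = (1 / (800 * (1 + \<Delta>))) powr (3/2)"
    have \<epsilon>0: "0 < \<epsilon>" using \<Delta>0 by (simp add: \<epsilon>_def)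
    have "\<epsilon> / 8 powr (5/2) \<le> (\<Sum>w\<in>words m. r w powr (3/2))"
    proof (rule ccontr)
      assume "\<not> ?thesis"
      then have "(\<Sum>w\<in>words m. c w powr (3/2)) \<le> \<epsilon>" using en by (simp add: field_simps)
      from energy_lower[OF c0 this \<epsilon>0 adm' cE pq(1) DE(1) cF pq(2) DE(2) order_trans[OF j(2) nm] j(1) jD pq(3) \<Delta>0]
      have "1 \<le> 400 * (1 + \<Delta>) * \<epsilon> powr (2/3)" by blast
      moreover have "\<epsilon> powr (2/3) = 1 / (800 * (1 + \<Delta>))" using \<Delta>0 by (simp add: \<epsilon>_def powr_powr)
      ultimately show False using \<Delta>0 by (simp add: field_simps)
    qed
    then show "ennreal (lower_bound (inverse (relative_distance X0 E F))) \<le> ennreal (\<Sum>v\<in>fst (GG m). \<rho> v powr (3/2))"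
      unfolding S by (intro ennreal_leI) (simp add: lower_bound_def \<epsilon>_def \<Delta>_def)
  qed
qed

end

section \<open>The modulus of rings\<close>

lemma card_nbr: "finite (nbr v j) \<and> card (nbr v j) \<le> 8 ^ j"
proof (induction j)
  case (Suc j)
  have "card (\<Union>x\<in>nbr v j. star x) \<le> (\<Sum>x\<in>nbr v j. card (star x))" by (rule card_UN_le) (use Suc in simp)
  also have "\<dots> \<le> card (nbr v j) * 8" using sum_bounded_above[of "nbr v j" "\<lambda>x. card (star x)" 8] star_card by simp
  also have "\<dots> \<le> 8 ^ Suc j" using Suc by simp
  finally show ?case using Suc star_card by simp
qed simp

lemma energy_lin_ext:
  "(\<Sum>w\<in>words (n + k). \<bar>gr ((lin_ext ^^ k) u) w\<bar> powr (3/2)) = (\<Sum>w\<in>words n. \<bar>gr u w\<bar> powr (3/2))"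
proof (induction k)
  case (Suc k)
  have q: "(1/4::real) powr (3/2) = 1/8"
  proof -
    have "sqrt (1/4) = 1/2" by (simp add: real_sqrt_divide)
    then show ?thesis by (subst powr_three_halves) (simp_all add: power3_eq_cube)
  qed
  have "(\<Sum>f\<in>UNIV. \<bar>gr (lin_ext v) (f # w)\<bar> powr (3/2)) = \<bar>gr v w\<bar> powr (3/2)" for v w
    unfolding UNIV_ltr by (simp add: gr_lin_ext kap_def abs_mult powr_mult q)
  then show ?case using Suc by (simp add: sum_words_Suc)
qed simp

context coding
begin

lemma card_ball_words:
  "card {w\<in>words i. \<exists>z\<in>cell w. d0 (P \<omega>) z \<le> real T * (1/4) ^ i} \<le> 8 ^ (T + 4)"
proof -
  have "{w\<in>words i. \<exists>z\<in>cell w. d0 (P \<omega>) z \<le> real T * (1/4) ^ i} \<subseteq> nbr (pre \<omega> i) (T + 4)"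
  proof
    fix w assume "w \<in> {w\<in>words i. \<exists>z\<in>cell w. d0 (P \<omega>) z \<le> real T * (1/4) ^ i}"
    then obtain z where z: "length w = i" "z \<in> cell w" "d0 (P \<omega>) z \<le> real T * (1/4) ^ i" by (auto simp: words_def)
    obtain \<xi> where \<xi>: "z = P \<xi>" "pre \<xi> i = w" using z(1,2) by (auto simp: cell_def)
    obtain j where j: "(vert (pre \<omega> i) False, vert (pre \<xi> i) False) \<in> steps i ^^ j"
      "real j * (1/4) ^ i \<le> Dn (1/4) i (vert (pre \<xi> i) False) (vert (pre \<omega> i) False)"
      using steps_dist[of "pre \<omega> i" i "pre \<xi> i" False False] by auto
    have "real j * (1/4) ^ i \<le> d0 (P \<omega>) z + 8/3 * (1/4) ^ i"
      using j(2) Dn_le_d0[of i \<xi> \<omega>] d0_commute[of z "P \<omega>"] unfolding \<xi>(1) by simp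
    also have "\<dots> \<le> (real T + 8/3) * (1/4) ^ i" using z(3) by (simp add: algebra_simps)
    finally have "real j \<le> real T + 8/3" by (rule mult_right_le_imp_le) simp
    \<comment> \<open>The 8/3 is the error of \<open>Dn_le_d0\<close>; the successor allows for the
      last step from a cell with the right vertex to \<open>w\<close> itself.\<close>
    then have jT: "Suc j \<le> T + 4" by linarith
    obtain w' s' where w': "w' \<in> nbr (pre \<omega> i) j" "vert w False = vert w' s'"
      using steps_nbr[of "pre \<omega> i" False "vert (pre \<xi> i) False" j] j(1) \<xi>(2) by auto
    have "adj w' w" unfolding adj_def using w'(2) by metis
    then have "w \<in> nbr (pre \<omega> i) (Suc j)" using w'(1) z(1) nbr_length[OF w'(1)] by (auto simp: star_def intro!: bexI[of _ w'])
    then show "w \<in> nbr (pre \<omega> i) (T + 4)" using nbr_mono[OF jT] by blast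
  qed
  then have "card {w\<in>words i. \<exists>z\<in>cell w. d0 (P \<omega>) z \<le> real T * (1/4) ^ i} \<le> card (nbr (pre \<omega> i) (T + 4))"
    using card_nbr by (intro card_mono) auto
  also have "\<dots> \<le> 8 ^ (T + 4)" using card_nbr by blast
  finally show ?thesis .
qed

text \<open>\<open>h\<close> stands for the discrete gradient of a function that is 1 on the ball of
  radius \<open>s\<close> and 0 outside the ball of radius \<open>t\<close>: it lives on the
  annulus, has 3/2-energy at most \<open>K\<close>, and is admissible for every connected set
  crossing the annulus.\<close>

definition cutoff :: "'p \<Rightarrow> real \<Rightarrow> real \<Rightarrow> nat \<Rightarrow> real \<Rightarrow> (ltr list \<Rightarrow> real) \<Rightarrow> bool" where
  "cutoff x s t m K h \<longleftrightarrow> (\<forall>w. 0 \<le> h w) \<and>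
    (\<forall>w\<in>words m. h w \<noteq> 0 \<longrightarrow> (\<forall>z\<in>cell w. s < d0 x z \<and> d0 x z \<le> t)) \<and>
    (\<Sum>w\<in>words m. h w powr (3/2)) \<le> K \<and>
    (\<forall>S y z. connectedin (mtopology_of X0) S \<longrightarrow> y \<in> S \<longrightarrow> d0 x y \<le> s \<longrightarrow> z \<in> S \<longrightarrow> t < d0 x z \<longrightarrow>
      1 \<le> (\<Sum>w | w \<in> words m \<and> cell w \<inter> S \<noteq> {}. h w))"

lemma cutoffD:
  assumes "cutoff x s t m K h"
  shows "0 \<le> h w" "(\<Sum>w\<in>words m. h w powr (3/2)) \<le> K"
    "w \<in> words m \<Longrightarrow> h w \<noteq> 0 \<Longrightarrow> z \<in> cell w \<Longrightarrow> s < d0 x z"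
    "w \<in> words m \<Longrightarrow> h w \<noteq> 0 \<Longrightarrow> z \<in> cell w \<Longrightarrow> d0 x z \<le> t"
    "connectedin (mtopology_of X0) S \<Longrightarrow> y \<in> S \<Longrightarrow> d0 x y \<le> s \<Longrightarrow> z \<in> S \<Longrightarrow> t < d0 x z \<Longrightarrow>
      1 \<le> (\<Sum>w | w \<in> words m \<and> cell w \<inter> S \<noteq> {}. h w)"
  using assms unfolding cutoff_def by blast+

text \<open>The function that is 1 at the vertices of the level-\<open>i\<close> cells meeting the
  ball of radius \<open>s\<close>, and 0 at all other vertices, is extended linearly to level
  \<open>m\<close> without change of energy. Its energy is at most the number of
  level-\<open>i\<close> cells with a nonzero increment. \<open>card_ball_words\<close> counts
  these; for \<open>i = 0\<close> there is a single cell. The 16 is the constant for two adjacent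
  cells.\<close>

lemma cutoff_exists:
  assumes im: "i \<le> m" and T: "i = 0 \<or> s + 16 * (1/4) ^ i \<le> real T * (1/4) ^ i"
  obtains h where "cutoff (P \<omega>) s (s + 16 * (1/4) ^ i) m (8 ^ (T + 4)) h"
proof -
  define x where "x = P \<omega>"
  define N where "N = {w\<in>words i. \<exists>y\<in>cell w. d0 x y \<le> s}"
  define g where "g v = (if \<exists>w\<in>N. \<exists>t. v = vert w t then 1 else 0 :: real)" for v
  define u where "u = (lin_ext ^^ (m - i)) g"
  define h where "h w = \<bar>gr u w\<bar>" for w
  have near: "d0 x z \<le> s + 16 * (1/4) ^ i" if w: "w \<in> words i" "w' \<in> N" "adj w w'" "z \<in> cell w" for w w' z
  proof -
    obtain y where y: "y \<in> cell w'" "d0 x y \<le> s" using w(2) by (auto simp: N_def)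
    have "d0 z y \<le> 16 * (1/4) ^ length w" using w y by (intro adj_cells_d0[of w w']) (auto simp: N_def words_def)
    moreover have "d0 x z \<le> d0 x y + d0 y z" using y(1) w(4) cellD by (intro d0_triangle) (auto simp: x_def)
    ultimately show ?thesis using y(2) w(1) d0_commute[of y z] by (simp add: words_def)
  qed
  have gN: "g (vert w t) = 1" if "w \<in> N" for w t using that unfolding g_def by auto
  have g0: "\<exists>w'\<in>N. adj w w'" if "g (vert w t) \<noteq> 0" for w t
    using that unfolding g_def adj_def by (auto split: if_splits)
  have gr01: "\<bar>gr g w\<bar> \<le> 1" for w by (simp add: gr_def g_def)
  have split: "\<exists>v w. x' = v @ w \<and> length v = m - i \<and> w \<in> words i" if "x' \<in> words m" for x'
    using that im by (intro exI[of _ "take (m - i) x'"] exI[of _ "drop (m - i) x'"]) (auto simp: words_def)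
  have sub: "z \<in> cell w" if "z \<in> cell (v @ w)" for v w z using that cell_append by blast
  have grg: "w \<notin> N" "\<exists>w'\<in>N. adj w w'" if "gr g w \<noteq> 0" for w
  proof -
    show "w \<notin> N" using that gN[of w True] gN[of w False] unfolding gr_def by auto
    show "\<exists>w'\<in>N. adj w w'" using that g0[of w True] g0[of w False] unfolding gr_def by fastforce
  qed
  have c1: "0 \<le> h w" for w by (simp add: h_def)
  have c2: "s < d0 (P \<omega>) z \<and> d0 (P \<omega>) z \<le> s + 16 * (1/4) ^ i"
    if x': "x' \<in> words m" "h x' \<noteq> 0" "z \<in> cell x'" for x' z
  proof -
    obtain v w where vw: "x' = v @ w" "length v = m - i" "w \<in> words i" using split[OF x'(1)] by blast
    have gw: "gr g w \<noteq> 0" using gr_lin_ext_pow0[of g w v] x'(2) vw(1,2) by (auto simp: h_def u_def)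
    have z: "z \<in> cell w" using sub x'(3) vw(1) by blast
    have "s < d0 x z" using grg(1)[OF gw] vw(3) z unfolding N_def by force
    moreover obtain w' where "w' \<in> N" "adj w w'" using grg(2)[OF gw] by blast
    then have "d0 x z \<le> s + 16 * (1/4) ^ i" using near vw(3) z by blast
    ultimately show ?thesis by (simp add: x_def)
  qed
  have "(\<Sum>w\<in>words m. h w powr (3/2)) = (\<Sum>w\<in>words i. \<bar>gr g w\<bar> powr (3/2))"
    using energy_lin_ext[of "m - i" g i] im by (simp add: h_def u_def)
  also have "\<dots> = (\<Sum>w\<in>{w\<in>words i. gr g w \<noteq> 0}. \<bar>gr g w\<bar> powr (3/2))"
    by (rule sum.mono_neutral_right) auto
  also have "\<dots> \<le> real (card {w\<in>words i. gr g w \<noteq> 0}) * 1"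
    using gr01 by (intro sum_bounded_above) (auto intro: powr_le1)
  also have "card {w\<in>words i. gr g w \<noteq> 0} \<le> 8 ^ (T + 4)"
  proof (cases "i = 0")
    case True
    have "card {w\<in>words i. gr g w \<noteq> 0} \<le> card (words i)" by (intro card_mono) auto
    also have "\<dots> = 1" using True by simp
    also have "\<dots> \<le> 8 ^ (T + 4)" by simp
    finally show ?thesis .
  next
    case False
    have "{w\<in>words i. gr g w \<noteq> 0} \<subseteq> {w\<in>words i. \<exists>z\<in>cell w. d0 (P \<omega>) z \<le> real T * (1/4) ^ i}"
    proof
      fix w assume w: "w \<in> {w\<in>words i. gr g w \<noteq> 0}"
      then obtain w' where "w' \<in> N" "adj w w'" using grg(2)[of w] by blast
      then have "d0 x (ctr0 w) \<le> s + 16 * (1/4) ^ i" using near[of w w' "ctr0 w"] w ctr0_cell[of w] by blast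
      then show "w \<in> {w\<in>words i. \<exists>z\<in>cell w. d0 (P \<omega>) z \<le> real T * (1/4) ^ i}"
        using T False w ctr0_cell[of w] by (auto simp: x_def intro!: bexI[of _ "ctr0 w"])
    qed
    then have "card {w\<in>words i. gr g w \<noteq> 0} \<le> card {w\<in>words i. \<exists>z\<in>cell w. d0 (P \<omega>) z \<le> real T * (1/4) ^ i}"
      by (intro card_mono) auto
    then show ?thesis using card_ball_words[of i \<omega> T] by linarith
  qed
  finally have c3: "(\<Sum>w\<in>words m. h w powr (3/2)) \<le> 8 ^ (T + 4)" by simp
  have c4: "1 \<le> (\<Sum>w | w \<in> words m \<and> cell w \<inter> S \<noteq> {}. h w)"
    if S: "connectedin (mtopology_of X0) S" "y \<in> S" "d0 (P \<omega>) y \<le> s" "z \<in> S" "s + 16 * (1/4) ^ i < d0 (P \<omega>) z" for S y z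
  proof -
    have "S \<subseteq> (\<Union>w\<in>words m. cell w)" using S(1) range_cells[of m] unfolding connectedin_def by simp
    then obtain a b where ab: "a \<in> words m" "y \<in> cell a" "b \<in> words m" "z \<in> cell b" using S(2,4) by blast
    obtain v w where vw: "a = v @ w" "length v = m - i" "w \<in> words i" using split[OF ab(1)] by blast
    obtain v' w' where vw': "b = v' @ w'" "length v' = m - i" "w' \<in> words i" using split[OF ab(3)] by blast
    have "w \<in> N" using vw S(3) sub[of y v w] ab(2) unfolding N_def x_def by blast
    then have "gr g w = 0" "g (vert w False) = 1" using gN by (simp_all add: gr_def)
    then have ua: "u (vert a False) = 1" using lin_ext_pow_const[of g w v False] vw unfolding u_def by simp
    have na: "\<not> (\<exists>x'\<in>N. adj w' x')" using near[OF vw'(3)] sub[of z v' w'] ab(4) vw'(1) S(5) unfolding x_def by fastforce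
    then have gt: "g (vert w' t) = 0" for t using g0 by blast
    then have "gr g w' = 0" by (simp add: gr_def)
    then have ub: "u (vert b False) = 0" using lin_ext_pow_const[of g w' v' False] vw' gt unfolding u_def by simp
    have "u (vert a False) - u (vert b False) \<le> (\<Sum>w\<in>{w\<in>words m. cell w \<inter> S \<noteq> {}}. \<bar>gr u w\<bar>)"
      using ab S by (intro crossing[OF S(1)]) auto
    then show ?thesis using ua ub by (simp add: h_def)
  qed
  show ?thesis by (rule that[of h]) (unfold cutoff_def, use c1 c2 c3 c4 in blast)
qed

lemma modulus_upper:
  assumes h: "\<And>w. 0 \<le> (h w :: real)"
    and adm: "\<And>S y z. connectedin (mtopology_of X0) S \<Longrightarrow> y \<in> S \<Longrightarrow> y \<in> A \<Longrightarrow> z \<in> S \<Longrightarrow> z \<in> B \<Longrightarrow>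
      1 \<le> (\<Sum>w | w \<in> words m \<and> cell w \<inter> S \<noteq> {}. h w)"
  shows "discrete_modulus (3/2) (curves_between X0 A B) (GG m) \<le> ennreal (\<Sum>w\<in>words m. h w powr (3/2))"
proof -
  define \<rho> where "\<rho> v = h (inv_into (words m) cell v)" for v
  have \<rho>: "\<rho> (cell w) = h w" if "w \<in> words m" for w
    unfolding \<rho>_def using inv_into_f_f[OF inj_cell that] by simp
  have "1 \<le> (\<Sum>v\<in>{v \<in> fst (GG m). v \<inter> \<gamma> ` {0..1} \<noteq> {}}. \<rho> v)" if "\<gamma> \<in> curves_between X0 A B" for \<gamma>
  proof -
    have \<gamma>: "continuous_map (top_of_set {0..1}) (mtopology_of X0) \<gamma>" "\<gamma> 0 \<in> A" "\<gamma> 1 \<in> B"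
      using that by (auto simp: curves_between_def rectifiable_def pathin_def)
    have "connectedin (top_of_set {0..1}) {0..1::real}" by (simp add: connectedin_subtopology)
    then have S: "connectedin (mtopology_of X0) (\<gamma> ` {0..1})" by (rule connectedin_continuous_map_image[OF \<gamma>(1)])
    let ?h = "\<lambda>v. if v \<inter> \<gamma> ` {0..1} \<noteq> {} then \<rho> v else 0"
    have "1 \<le> (\<Sum>w | w \<in> words m \<and> cell w \<inter> \<gamma> ` {0..1} \<noteq> {}. h w)"
      by (rule adm[OF S, of "\<gamma> 0" "\<gamma> 1"]) (use \<gamma> in auto)
    also have "\<dots> = (\<Sum>w\<in>words m. if cell w \<inter> \<gamma> ` {0..1} \<noteq> {} then h w else 0)"
      by (rule sum.inter_filter) simp
    also have "\<dots> = (\<Sum>v\<in>fst (GG m). ?h v)"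
      unfolding sum_GG by (intro sum.cong) (auto simp: \<rho>)
    also have "\<dots> = (\<Sum>v\<in>{v \<in> fst (GG m). v \<inter> \<gamma> ` {0..1} \<noteq> {}}. \<rho> v)"
      by (rule sum.inter_filter[symmetric]) (simp add: GG_def)
    finally show ?thesis .
  qed
  then have "discrete_modulus (3/2) (curves_between X0 A B) (GG m) \<le> ennreal (\<Sum>v\<in>fst (GG m). \<rho> v powr (3/2))"
    unfolding discrete_modulus_def using h by (intro INF_lower) (auto simp: \<rho>_def)
  also have "(\<Sum>v\<in>fst (GG m). \<rho> v powr (3/2)) = (\<Sum>w\<in>words m. h w powr (3/2))"
    unfolding sum_GG by (intro sum.cong) (auto simp: \<rho>)
  finally show ?thesis .
qed

lemma closure_ball_le:
  assumes "y \<in> mtopology_of X0 closure_of mball_of X0 x r" shows "d0 x y \<le> r"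
proof -
  have "Metric_space.mtopology (mspace X0) (mdist X0) closure_of Metric_space.mball (mspace X0) (mdist X0) x r
      \<subseteq> Metric_space.mcball (mspace X0) (mdist X0) x r"
    by (intro closure_of_minimal Metric_space.mball_subset_mcball Metric_space.closedin_mcball Metric_space_mspace_mdist)
  then have "y \<in> Metric_space.mcball (mspace X0) (mdist X0) x r"
    using assms unfolding mtopology_of_def mball_of_def by (rule subsetD)
  then show ?thesis unfolding Metric_space.in_mcball[OF Metric_space_mspace_mdist] by simp
qed

abbreviation ring_curves :: "'p \<Rightarrow> real \<Rightarrow> real \<Rightarrow> (real \<Rightarrow> 'p) set" where
  "ring_curves x r C \<equiv> curves_between X0 (mtopology_of X0 closure_of mball_of X0 x r) (mspace X0 - mball_of X0 x (C * r))"

lemma ring_upper: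
  assumes h: "\<And>w. 0 \<le> (h w :: real)" and x: "x \<in> range P"
    and adm: "\<And>S y z. connectedin (mtopology_of X0) S \<Longrightarrow> y \<in> S \<Longrightarrow> d0 x y \<le> r \<Longrightarrow> z \<in> S \<Longrightarrow> C * r \<le> d0 x z \<Longrightarrow>
      1 \<le> (\<Sum>w | w \<in> words m \<and> cell w \<inter> S \<noteq> {}. h w)"
  shows "discrete_modulus (3/2) (ring_curves x r C) (GG m) \<le> ennreal (\<Sum>w\<in>words m. h w powr (3/2))"
proof (rule modulus_upper[OF h])
  fix S y z
  assume "connectedin (mtopology_of X0) S" "y \<in> S" "y \<in> mtopology_of X0 closure_of mball_of X0 x r"
    "z \<in> S" "z \<in> mspace X0 - mball_of X0 x (C * r)"
  then show "1 \<le> (\<Sum>w | w \<in> words m \<and> cell w \<inter> S \<noteq> {}. h w)"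
    using x closure_ball_le by (intro adm[of S y z]) auto
qed

lemma level_exists:
  assumes "0 < (a::real)" obtains i where "(1/4::real) ^ i \<le> a" "i = 0 \<or> a < 4 * (1/4) ^ i" "\<And>k. (1/4) ^ k \<le> a \<Longrightarrow> i \<le> k"
proof -
  define i where "i = (LEAST i. (1/4::real) ^ i \<le> a)"
  have "\<exists>i. (1/4::real) ^ i < a" using real_arch_pow_inv[of a "1/4"] assms by auto
  then have ex: "\<exists>i. (1/4::real) ^ i \<le> a" using less_imp_le by blast
  have "(1/4::real) ^ i \<le> a" unfolding i_def by (rule LeastI_ex[OF ex])
  moreover have "i = 0 \<or> a < 4 * (1/4) ^ i"
  proof (cases i)
    case (Suc k)
    then have "\<not> (1/4::real) ^ k \<le> a" using not_less_Least[of k "\<lambda>i. (1/4::real) ^ i \<le> a"] unfolding i_def by simp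
    then show ?thesis using Suc by simp
  qed simp
  moreover have "i \<le> k" if "(1/4::real) ^ k \<le> a" for k unfolding i_def using that by (rule Least_le)
  ultimately show ?thesis using that by blast
qed

text \<open>A bound for each fixed ratio \<open>C\<close>, uniform in the ring and the level. It
  makes the function \<open>ring_sup\<close> finite for thin rings, about which
  \<open>ring_decay\<close> says nothing.\<close>

lemma ring_finite:
  assumes C: "1 < C"
  obtains B where "\<And>x r m. x \<in> range P \<Longrightarrow> (1/4) ^ m \<le> r \<Longrightarrow> discrete_modulus (3/2) (ring_curves x r C) (GG m) \<le> ennreal B"
proof -
  define T where "T = nat \<lceil>128 / (C - 1) + 16\<rceil>"
  have T: "128 / (C - 1) + 16 \<le> real T" unfolding T_def by linarith
  show ?thesis
  proof (rule that[of "8 ^ (T + 4)"])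
    fix x :: 'p and r :: real and m :: nat
    assume x: "x \<in> range P" and r: "(1/4) ^ m \<le> r"
    have "0 < (1/4::real) ^ m" by simp
    with r have r0: "0 < r" by linarith
    obtain \<omega> where \<omega>: "x = P \<omega>" using x by blast
    \<comment> \<open>Then 16 * (1/4) ^ i is at most half the width \<open>(C - 1) * r\<close> of
      the ring, so the cutoff at level \<open>i\<close> fits into it.\<close>
    define a where "a = (C - 1) * r / 32"
    have a: "0 < a" using C r0 by (simp add: a_def)
    obtain i where i: "(1/4::real) ^ i \<le> a" "i = 0 \<or> a < 4 * (1/4) ^ i" "\<And>k. (1/4::real) ^ k \<le> a \<Longrightarrow> i \<le> k"
      using level_exists[OF a] by blast
    have ra: "r = 32 * a / (C - 1)" using C by (simp add: a_def)
    have lev: "r + 16 * q \<le> real T * q" if "a \<le> 4 * q" "0 < q" for q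
    proof -
      have "r \<le> 32 * (4 * q) / (C - 1)" unfolding ra using C that by (intro divide_right_mono) auto
      then have "r + 16 * q \<le> (128 / (C - 1) + 16) * q" by (simp add: algebra_simps)
      also have "\<dots> \<le> real T * q" using T that by (intro mult_right_mono) auto
      finally show ?thesis .
    qed
    show "discrete_modulus (3/2) (ring_curves x r C) (GG m) \<le> ennreal (8 ^ (T + 4))"
    proof (cases "i \<le> m")
      case True
      have iT: "i = 0 \<or> r + 16 * (1/4) ^ i \<le> real T * (1/4) ^ i" using i(2) lev[of "(1/4) ^ i"] by auto
      obtain h where h: "cutoff x r (r + 16 * (1/4) ^ i) m (8 ^ (T + 4)) h"
        using cutoff_exists[OF True iT, of \<omega>] unfolding \<omega> by blast
      have Cr: "r + 16 * (1/4) ^ i < C * r"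
      proof -
        have "16 * (1/4) ^ i \<le> 16 * a" using i(1) by simp
        also have "\<dots> < (C - 1) * r" using C r0 by (simp add: a_def)
        finally show ?thesis by (simp add: algebra_simps)
      qed
      have "discrete_modulus (3/2) (ring_curves x r C) (GG m) \<le> ennreal (\<Sum>w\<in>words m. h w powr (3/2))"
      proof (rule ring_upper[OF cutoffD(1)[OF h] x])
        fix S y z assume S: "connectedin (mtopology_of X0) S" "y \<in> S" "d0 x y \<le> r" "z \<in> S" "C * r \<le> d0 x z"
        show "1 \<le> (\<Sum>w | w \<in> words m \<and> cell w \<inter> S \<noteq> {}. h w)"
          by (rule cutoffD(5)[OF h S(1-4)]) (use S(5) Cr in linarith)
      qed
      also have "\<dots> \<le> ennreal (8 ^ (T + 4))" by (rule ennreal_leI[OF cutoffD(2)[OF h]])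
      finally show ?thesis .
    next
      \<comment> \<open>The ring is thin compared with the cells of level \<open>m\<close>. Then
        only boundedly many of these cells meet the inner ball, and giving each of them the value 1
        is good enough.\<close>
      case False
      then have "\<not> (1/4) ^ m \<le> a" using i(3) by blast
      then have "a \<le> 4 * (1/4) ^ m" using \<open>0 < (1/4::real) ^ m\<close> by linarith
      then have "r + 16 * (1/4) ^ m \<le> real T * (1/4) ^ m" using \<open>0 < (1/4::real) ^ m\<close> by (rule lev)
      then have rT: "r \<le> real T * (1/4) ^ m" using \<open>0 < (1/4::real) ^ m\<close> by linarith
      define h where "h w = (if \<exists>z\<in>cell w. d0 x z \<le> r then 1 else 0 :: real)" for w
      have "1 \<le> (\<Sum>w | w \<in> words m \<and> cell w \<inter> S \<noteq> {}. h w)"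
        if S: "connectedin (mtopology_of X0) S" "y \<in> S" "d0 x y \<le> r" for S y
      proof -
        have "S \<subseteq> (\<Union>w\<in>words m. cell w)" using S(1) range_cells[of m] unfolding connectedin_def by simp
        then obtain b where b: "b \<in> words m" "y \<in> cell b" using S(2) by blast
        have "h b \<le> (\<Sum>w | w \<in> words m \<and> cell w \<inter> S \<noteq> {}. h w)"
          using b S by (intro member_le_sum) (auto simp: h_def)
        moreover have "h b = 1" using b S(3) by (auto simp: h_def)
        ultimately show ?thesis by simp
      qed
      then have "discrete_modulus (3/2) (ring_curves x r C) (GG m) \<le> ennreal (\<Sum>w\<in>words m. h w powr (3/2))"
        by (intro ring_upper[OF _ x]) (auto simp: h_def)
      also have "(\<Sum>w\<in>words m. h w powr (3/2)) = (\<Sum>w\<in>words m. if \<exists>z\<in>cell w. d0 x z \<le> r then 1 else 0)"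
        by (intro sum.cong) (auto simp: h_def)
      also have "\<dots> = real (card {w\<in>words m. \<exists>z\<in>cell w. d0 x z \<le> r})"
        by (subst sum.inter_filter[symmetric]) auto
      also have "\<dots> \<le> real (card {w\<in>words m. \<exists>z\<in>cell w. d0 (P \<omega>) z \<le> real T * (1/4) ^ m})"
        unfolding \<omega> using rT by (intro of_nat_mono card_mono) (auto intro: order_trans)
      also have "\<dots> \<le> real (8 ^ (T + 4))" by (rule of_nat_mono[OF card_ball_words])
      finally show ?thesis using ennreal_leI by simp
    qed
  qed
qed

text \<open>Cutoff functions in \<open>N\<close> concentric annuli of ratio 64 are averaged. Each is
  supported between \<open>s l\<close> and 17 * \<open>s l\<close>, so the supports are disjoint and
  the energy is at most N * 8 ^ 24 / N powr (3/2). The 24 is 20 + 4 from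
  \<open>cutoff_exists\<close>, since \<open>s l\<close> is below four times (1/4) ^ i unless
  \<open>i = 0\<close>.\<close>

lemma ring_decay:
  assumes N: "0 < N" and C: "64 ^ N < C" and x: "x \<in> range P" and r: "(1/4) ^ m \<le> r"
  shows "discrete_modulus (3/2) (ring_curves x r C) (GG m) \<le> ennreal (8 ^ 24 / sqrt (real N))"
proof -
  have "0 < (1/4::real) ^ m" by simp
  with r have r0: "0 < r" by linarith
  obtain \<omega> where \<omega>: "x = P \<omega>" using x by blast
  define s where "s l = r * 64 ^ l" for l :: nat
  have s0: "r \<le> s l" for l using r0 by (simp add: s_def)
  have s_pos: "0 < s l" for l using s0[of l] r0 by linarith
  have "\<exists>t h. cutoff x (s l) t m (8 ^ 24) h \<and> t \<le> 17 * s l" for l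
  proof -
    obtain i where i: "(1/4::real) ^ i \<le> s l" "i = 0 \<or> s l < 4 * (1/4) ^ i" "\<And>k. (1/4::real) ^ k \<le> s l \<Longrightarrow> i \<le> k"
      using level_exists[OF s_pos[of l]] by blast
    have im: "i \<le> m" using i(3) r s0[of l] by (meson order_trans)
    have T: "i = 0 \<or> s l + 16 * (1/4) ^ i \<le> real 20 * (1/4) ^ i" using i(2) by auto
    obtain h where "cutoff (P \<omega>) (s l) (s l + 16 * (1/4) ^ i) m (8 ^ (20 + 4)) h"
      using cutoff_exists[OF im T, of \<omega>] by blast
    then have "cutoff x (s l) (s l + 16 * (1/4) ^ i) m (8 ^ 24) h" unfolding \<omega> by simp
    moreover have "s l + 16 * (1/4) ^ i \<le> 17 * s l" using i(1) by simp
    ultimately show ?thesis by blast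
  qed
  then obtain t H where H: "\<And>l. cutoff x (s l) (t l) m (8 ^ 24) (H l)" and t: "\<And>l. t l \<le> 17 * s l" by metis
  note H0 = cutoffD(1)[OF H] and He = cutoffD(2)[OF H]
  have Hs: "s l < d0 x z" "d0 x z \<le> 17 * s l" if "w \<in> words m" "H l w \<noteq> 0" "z \<in> cell w" for l w z
    using cutoffD(3,4)[OF H that] t[of l] by linarith+
  have Ha: "1 \<le> (\<Sum>w | w \<in> words m \<and> cell w \<inter> S \<noteq> {}. H l w)"
    if "connectedin (mtopology_of X0) S" "y \<in> S" "d0 x y \<le> s l" "z \<in> S" "17 * s l < d0 x z" for S y z l
    by (rule cutoffD(5)[OF H that(1-4)]) (use t[of l] that(5) in linarith)
  define h where "h w = (\<Sum>l<N. H l w) / real N" for w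
  have h0: "0 \<le> h w" for w unfolding h_def using H0 by (simp add: sum_nonneg)
  have uniq: "l = l'" if w: "w \<in> words m" "H l w \<noteq> 0" "H l' w \<noteq> 0" for w l l'
  proof -
    have *: False if "l < l'" "H l w \<noteq> 0" "H l' w \<noteq> 0" for l l'
    proof -
      have "s (Suc l) \<le> s l'" unfolding s_def using that(1) r0 by (intro mult_left_mono power_increasing) auto
      moreover have "s (Suc l) = 64 * s l" by (simp add: s_def)
      ultimately show False
        using Hs(2)[OF w(1) that(2) ctr0_cell] Hs(1)[OF w(1) that(3) ctr0_cell] s_pos[of l] by linarith
    qed
    show ?thesis using *[of l l'] *[of l' l] w by (meson linorder_neqE_nat)
  qed
  have pw: "(\<Sum>l<N. H l w) powr (3/2) = (\<Sum>l<N. H l w powr (3/2))" if w: "w \<in> words m" for w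
  proof (cases "\<exists>l<N. H l w \<noteq> 0")
    case True
    then obtain l where l: "l < N" "H l w \<noteq> 0" by blast
    have z: "H k w = 0" if "k \<noteq> l" for k using uniq[OF w l(2), of k] that by blast
    have "(\<Sum>l<N. H l w) = (\<Sum>k\<in>{l}. H k w)" by (rule sum.mono_neutral_right) (use l z in auto)
    moreover have "(\<Sum>l<N. H l w powr (3/2)) = (\<Sum>k\<in>{l}. H k w powr (3/2))" by (rule sum.mono_neutral_right) (use l z in auto)
    ultimately show ?thesis by simp
  qed simp
  have "discrete_modulus (3/2) (ring_curves x r C) (GG m) \<le> ennreal (\<Sum>w\<in>words m. h w powr (3/2))"
  proof (rule ring_upper[OF h0 x])
    fix S y z assume S: "connectedin (mtopology_of X0) S" "y \<in> S" "d0 x y \<le> r" "z \<in> S" "C * r \<le> d0 x z"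
    have one: "1 \<le> (\<Sum>w | w \<in> words m \<and> cell w \<inter> S \<noteq> {}. H l w)" if "l < N" for l
    proof (rule Ha[OF S(1,2) _ S(4)])
      show "d0 x y \<le> s l" using S(3) s0[of l] by linarith
      have "64 * s l \<le> r * 64 ^ N" unfolding s_def using that r0 power_increasing[of "Suc l" N "64::real"] by simp
      also have "\<dots> < r * C" using C r0 by simp
      finally show "17 * s l < d0 x z" using S(5) s_pos[of l] by (simp add: mult.commute)
    qed
    have "1 = (\<Sum>l<N. 1) / real N" using N by simp
    also have "\<dots> \<le> (\<Sum>l<N. \<Sum>w | w \<in> words m \<and> cell w \<inter> S \<noteq> {}. H l w) / real N"
      using one by (intro divide_right_mono sum_mono) auto
    also have "\<dots> = (\<Sum>w | w \<in> words m \<and> cell w \<inter> S \<noteq> {}. h w)"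
      unfolding h_def sum_divide_distrib[symmetric] by (subst sum.swap) simp
    finally show "1 \<le> (\<Sum>w | w \<in> words m \<and> cell w \<inter> S \<noteq> {}. h w)" .
  qed
  also have "(\<Sum>w\<in>words m. h w powr (3/2)) \<le> 8 ^ 24 / sqrt (real N)"
  proof -
    have "(\<Sum>w\<in>words m. h w powr (3/2)) = (\<Sum>w\<in>words m. (\<Sum>l<N. H l w powr (3/2)) / real N powr (3/2))"
      by (intro sum.cong refl) (simp add: h_def powr_divide H0 sum_nonneg pw)
    also have "\<dots> = (\<Sum>l<N. \<Sum>w\<in>words m. H l w powr (3/2)) / real N powr (3/2)"
      unfolding sum_divide_distrib[symmetric] by (subst sum.swap) simp
    also have "\<dots> \<le> (\<Sum>l<N. 8 ^ 24) / real N powr (3/2)" using He by (intro divide_right_mono sum_mono) auto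
    also have "\<dots> = 8 ^ 24 * (real N / real N powr (3/2))" by simp
    also have "real N powr (3/2) = real N * sqrt (real N)"
      using N powr_add[of "real N" 1 "1/2"] by (simp add: powr_half_sqrt)
    also have "8 ^ 24 * (real N / (real N * sqrt (real N))) = 8 ^ 24 / sqrt (real N)" using N by simp
    finally show ?thesis .
  qed
  then have "ennreal (\<Sum>w\<in>words m. h w powr (3/2)) \<le> ennreal (8 ^ 24 / sqrt (real N))" by (rule ennreal_leI)
  finally show ?thesis .
qed

text \<open>\<open>t\<close> is the inverse of the ratio \<open>C\<close>. The supremum over all
  rings and levels is the least admissible bound, and it is monotone because wider rings have fewer
  curves.\<close>

definition ring_sup :: "real \<Rightarrow> ennreal" where
  "ring_sup t = (SUP (x, r, m)\<in>{(x, r, m). x \<in> range P \<and> (1/4) ^ m \<le> r}.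
     discrete_modulus (3/2) (ring_curves x r (inverse t)) (GG m))"

lemma ring_sup_upper:
  "x \<in> range P \<Longrightarrow> (1/4) ^ m \<le> r \<Longrightarrow> discrete_modulus (3/2) (ring_curves x r (inverse t)) (GG m) \<le> ring_sup t"
  unfolding ring_sup_def by (rule SUP_upper2[of "(x, r, m)"]) auto

lemma ring_sup_least:
  assumes "\<And>x r m. x \<in> range P \<Longrightarrow> (1/4) ^ m \<le> r \<Longrightarrow> discrete_modulus (3/2) (ring_curves x r (inverse t)) (GG m) \<le> B"
  shows "ring_sup t \<le> B"
  unfolding ring_sup_def by (rule SUP_least) (use assms in auto)

lemma ring_sup_mono:
  assumes "0 < s" "s \<le> t" shows "ring_sup s \<le> ring_sup t"
proof (rule ring_sup_least)
  fix x :: 'p and r :: real and m :: nat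
  assume x: "x \<in> range P" "(1/4) ^ m \<le> r"
  have "0 < (1/4::real) ^ m" by simp
  with x(2) have r0: "0 < r" by linarith
  have "inverse t * r \<le> inverse s * r" using assms r0 by (intro mult_right_mono le_imp_inverse_le) auto
  then have "ring_curves x r (inverse s) \<subseteq> ring_curves x r (inverse t)"
    by (auto simp: curves_between_def)
  then have "discrete_modulus (3/2) (ring_curves x r (inverse s)) (GG m) \<le> discrete_modulus (3/2) (ring_curves x r (inverse t)) (GG m)"
    unfolding discrete_modulus_def by (intro INF_superset_mono) auto
  also have "\<dots> \<le> ring_sup t" by (rule ring_sup_upper[OF x])
  finally show "discrete_modulus (3/2) (ring_curves x r (inverse s)) (GG m) \<le> ring_sup t" .
qed

lemma ring_sup_finite: "0 < t \<Longrightarrow> t < 1 \<Longrightarrow> ring_sup t < top"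
proof -
  assume t: "0 < t" "t < 1"
  then have "1 < inverse t" by (simp add: one_less_inverse)
  then obtain B where B: "\<And>x r m. x \<in> range P \<Longrightarrow> (1/4) ^ m \<le> r \<Longrightarrow> discrete_modulus (3/2) (ring_curves x r (inverse t)) (GG m) \<le> ennreal B"
    using ring_finite[of "inverse t"] by blast
  have "ring_sup t \<le> ennreal B" by (rule ring_sup_least[OF B])
  then show ?thesis using ennreal_less_top le_less_trans by blast
qed

lemma ring_sup_decay:
  assumes "0 < N" "0 < t" "t < (1/64) ^ N" shows "enn2real (ring_sup t) \<le> 8 ^ 24 / sqrt (real N)"
proof -
  have "64 ^ N < inverse t"
    using less_imp_inverse_less[OF assms(3,2)] by (simp add: power_one_over inverse_eq_divide)
  then have "ring_sup t \<le> ennreal (8 ^ 24 / sqrt (real N))"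
    using ring_decay[OF assms(1)] by (intro ring_sup_least) auto
  then show ?thesis using enn2real_mono[of "ring_sup t" "ennreal (8 ^ 24 / sqrt (real N))"] by simp
qed

lemma ring_sup_tendsto: "((\<lambda>t. enn2real (ring_sup t)) \<longlongrightarrow> 0) (at_right 0)"
proof (rule tendstoI)
  fix e :: real assume e: "0 < e"
  obtain N :: nat where N: "(8 ^ 24 / e)\<^sup>2 < real N" using reals_Archimedean2 by blast
  then have N0: "0 < N" by (metis of_nat_0_less_iff zero_le_power2 order_le_less_trans)
  have "8 ^ 24 / e < sqrt (real N)" using N by (rule real_less_rsqrt)
  then have lt: "8 ^ 24 / sqrt (real N) < e" using e N0 by (simp add: field_simps)
  have "\<forall>\<^sub>F t in at_right 0. t \<in> {0<..<(1/64::real) ^ N}" by (rule eventually_at_right_real) simp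
  then show "\<forall>\<^sub>F t in at_right 0. dist (enn2real (ring_sup t)) 0 < e"
  proof eventually_elim
    case (elim t)
    then show ?case using ring_sup_decay[OF N0, of t] lt by simp
  qed
qed

theorem combinatorial_loewner_X0: "combinatorial_loewner (3/2) X0"
proof -
  \<comment> \<open>The summand \<open>t\<close> makes the function positive without affecting its
    limit or monotonicity.\<close>
  define \<psi> where "\<psi> t = t + enn2real (ring_sup t)" for t
  have "mono_on {0<..<1} \<psi>"
  proof (rule mono_onI)
    fix s t :: real assume st: "s \<in> {0<..<1}" "t \<in> {0<..<1}" "s \<le> t"
    then have "enn2real (ring_sup s) \<le> enn2real (ring_sup t)"
      using ring_sup_mono[of s t] ring_sup_finite[of t] by (intro enn2real_mono) auto
    then show "\<psi> s \<le> \<psi> t" using st by (simp add: \<psi>_def)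
  qed
  moreover have "\<forall>t\<in>{0<..<1}. 0 < \<psi> t" by (auto simp: \<psi>_def intro: add_pos_nonneg)
  moreover have "(\<psi> \<longlongrightarrow> 0) (at_right 0)"
    unfolding \<psi>_def using tendsto_add[OF tendsto_ident_at[of 0 "{0<..}"] ring_sup_tendsto] by simp
  moreover have "discrete_modulus (3/2) (ring_curves x r C) (GG (n + k)) \<le> ennreal (\<psi> (inverse C))"
    if x: "x \<in> mspace X0" and r: "inverse 4 ^ n \<le> r" and C: "1 < C" for x r C n k
  proof -
    have "(1/4::real) ^ (n + k) \<le> (1/4) ^ n" by (rule power_decreasing) auto
    then have "(1/4) ^ (n + k) \<le> r" using r by (simp only: inverse_eq_divide)
    then have "discrete_modulus (3/2) (ring_curves x r (inverse (inverse C))) (GG (n + k)) \<le> ring_sup (inverse C)"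
      using x by (intro ring_sup_upper) auto
    also have "\<dots> = ennreal (enn2real (ring_sup (inverse C)))"
      using ring_sup_finite[of "inverse C"] C by (simp add: inverse_less_1_iff)
    also have "\<dots> \<le> ennreal (\<psi> (inverse C))" using C by (intro ennreal_leI) (simp add: \<psi>_def)
    finally show ?thesis by simp
  qed
  ultimately have "\<exists>\<phi> \<psi> :: real \<Rightarrow> real.
          mono_on {0<..} \<phi> \<and> (\<forall>t>0. \<phi> t > 0) \<and>
          mono_on {0<..<1} \<psi> \<and> (\<forall>t\<in>{0<..<1}. \<psi> t > 0) \<and> (\<psi> \<longlongrightarrow> 0) (at_right 0) \<and>
          (\<forall>E F. \<forall>n\<ge>1. nondegenerate_continuum X0 E \<longrightarrow> nondegenerate_continuum X0 F \<longrightarrow>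
             E \<inter> F = {} \<longrightarrow> ennreal (inverse 4 ^ n) \<le> min (mdiam X0 E) (mdiam X0 F) \<longrightarrow>
             (\<forall>k\<ge>1. ennreal (\<phi> (inverse (relative_distance X0 E F)))
                     \<le> discrete_modulus (3/2) (curves_between X0 E F) (GG (n + k)))) \<and>
          (\<forall>x\<in>mspace X0. \<forall>r C. \<forall>n\<ge>1. inverse 4 ^ n \<le> r \<longrightarrow> 1 < C \<longrightarrow>
             (\<forall>k\<ge>1. discrete_modulus (3/2) (ring_curves x r C) (GG (n + k)) \<le> ennreal (\<psi> (inverse C))))"
    using lower_bound_mono lower_bound_pos modulus_lower
    by (intro exI[of _ lower_bound] exI[of _ \<psi>] conjI) auto
  then show ?thesis
    unfolding combinatorial_loewner_def
    using approximation compact_MX[OF quarter0] compact_space_def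
    by (intro conjI exI[of _ "16::real"] exI[of _ "4::real"] exI[of _ GG]) auto
qed

end

section \<open>The iterated graph system\<close>

abbreviation lev :: "nat \<Rightarrow> (nat, label) level" where "lev \<equiv> igs_level example_igs"

lemma igs_edges_ltr: "igs_edges example_igs = range (\<lambda>f. {num f False, num f True})"
  unfolding UNIV_ltr by (auto simp: example_igs_def num_def)

lemma igs_edgeE:
  assumes "{z1, z2} \<in> igs_edges example_igs"
  obtains f s where "z1 = num f s" "z2 = num f (\<not> s)" "{z1, z2} = {num f False, num f True}"
proof -
  obtain f where f: "{z1, z2} = {num f False, num f True}" using assms unfolding igs_edges_ltr by auto
  then consider "z1 = num f False" "z2 = num f True" | "z1 = num f True" "z2 = num f False"
    by (auto simp: doubleton_eq_iff)
  then show ?thesis using that[of f False] that[of f True] f by cases auto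
qed

definition lab :: "label \<Rightarrow> bool" where "lab c = (c = Label_b)"

definition phis :: "bool \<Rightarrow> label \<Rightarrow> nat" where "phis s = (if s then phi_plus else phi_minus)"

lemma igs_phi_num: "igs_phi example_igs (num f s) {num f False, num f True} = phis s"
  by (cases f; cases s) (simp_all add: num_def example_igs_def phis_def)

lemma num_phis: "num f s = phis a c \<longleftrightarrow> a = s \<and> outl f s = Some (lab c)"
  by (cases f; cases s; cases a; cases c) (simp_all add: num_def outl_def phis_def lab_def)

lemma outl_cong: "num f s = num g s' \<Longrightarrow> outl f s = outl g s'"
  unfolding outl_def by simp

lemma phis_inj: "phis a c = phis a' c' \<longleftrightarrow> a = a' \<and> c = c'"
  by (cases a; cases a'; cases c; cases c') (simp_all add: phis_def)

lemma lab_surj: "\<exists>c. lab c = b"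
  by (cases b) (auto simp: lab_def intro: exI[of _ Label_a])

text \<open>The actual vertices of the levels, and through \<open>ED\<close> their edges, coded by
  words. Words of length k + 1 belong to \<open>lev k\<close>, because the levels start with the
  first graph; the value at the empty word is a dummy.\<close>

fun EV :: "ltr list \<Rightarrow> bool \<Rightarrow> nat vtx" where
  "EV [] s = Base 0"
| "EV [f] s = Base (num f s)"
| "EV (f # g # w) s = glue example_igs (lev (length w)) (num f s) {|EV (g # w) False, EV (g # w) True|}"

definition ED :: "ltr list \<Rightarrow> nat vtx fset" where
  "ED w = {|EV w False, EV w True|}"

lemma EV_Cons: "length w = Suc k \<Longrightarrow> EV (f # w) s = glue example_igs (lev k) (num f s) (ED w)"
  by (cases w) (auto simp: ED_def)

lemma ED_iff: "x |\<in>| ED w \<longleftrightarrow> (\<exists>s. x = EV w s)"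
  unfolding ED_def by (auto intro: exI[of _ False] exI[of _ True]) (metis (full_types))

lemma ED_alt: "ED w = {|EV w s, EV w (\<not> s)|}"
  unfolding ED_def by (cases s) (auto simp: finsert_commute)

text \<open>The induction invariant that identifies the levels with the words. By the last clause
  the gluing map at an end of an edge depends only on its side, and this determines
  \<open>glue_rel\<close> for the next level.\<close>

definition lev_inv :: "nat \<Rightarrow> bool" where
  "lev_inv k \<longleftrightarrow> lv_edges (lev k) = ED ` words (Suc k) \<and>
    (\<forall>w\<in>words (Suc k). \<forall>w'\<in>words (Suc k). \<forall>s s'. EV w s = EV w' s' \<longleftrightarrow> vert w s = vert w' s') \<and>
    (\<forall>w\<in>words (Suc k). \<forall>s. lv_phi (lev k) (EV w s) (ED w) = phis s)"

lemma ED_inj_gen: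
  assumes "\<And>s s'. EV w s = EV w' s' \<longleftrightarrow> vert w s = vert w' s'" "length w = length w'"
  shows "ED w = ED w' \<longleftrightarrow> w = w'"
proof
  assume "ED w = ED w'"
  then have "fset (ED w) = fset (ED w')" by simp
  then have "{EV w False, EV w True} = {EV w' False, EV w' True}" by (simp add: ED_def)
  then have "{vert w False, vert w True} = {vert w' False, vert w' True}"
    by (auto simp: doubleton_eq_iff assms(1))
  then show "w = w'" using vert_pair_inj assms(2) by blast
qed simp

lemma Abs_fset_pair: "Abs_fset {a, b} = {|a, b|}"
proof -
  have "{a, b} = fset {|a, b|}" by simp
  then show ?thesis by (metis fset_inverse)
qed

lemma vert_single: "vert [f] s = vert [g] s' \<longleftrightarrow> num f s = num g s'"
  by (cases f; cases s; cases g; cases s') (simp_all add: num_def)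

lemma lev_inv_0: "lev_inv 0"
proof -
  have w1: "words (Suc 0) = range (\<lambda>f. [f])" unfolding words_Suc by auto
  have e: "Abs_fset (Base ` {num f False, num f True}) = ED [f]" for f
    by (simp add: Abs_fset_pair ED_def)
  have "lv_edges (lev 0) = ED ` words (Suc 0)"
    unfolding w1 using e by (simp add: igs_edges_ltr image_image)
  moreover have "lv_phi (lev 0) (EV [f] s) (ED [f]) = phis s" for f s
    using igs_phi_num[of f s] by (simp add: ED_def insert_commute)
  ultimately show ?thesis unfolding lev_inv_def w1 by (auto simp: vert_single[unfolded])
qed

context
  fixes k :: nat
  assumes inv: "lev_inv k"
begin

lemma lv_edges_k: "lv_edges (lev k) = ED ` words (Suc k)"
  using inv by (simp add: lev_inv_def)

lemma EV_eq: "length w = Suc k \<Longrightarrow> length w' = Suc k \<Longrightarrow> EV w s = EV w' s' \<longleftrightarrow> vert w s = vert w' s'"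
  using inv unfolding lev_inv_def words_def by blast

lemma ED_eq: "length w = Suc k \<Longrightarrow> length w' = Suc k \<Longrightarrow> ED w = ED w' \<longleftrightarrow> w = w'"
  by (rule ED_inj_gen) (simp_all add: EV_eq)

lemma lv_phi_k: "length w = Suc k \<Longrightarrow> lv_phi (lev k) (EV w s) (ED w) = phis s"
  using inv unfolding lev_inv_def words_def by blast

lemma glue_rel_k: "glue_rel example_igs (lev k) =
  {((phis s c, ED w), (phis s' c, ED w')) | w s w' s' c. length w = Suc k \<and> length w' = Suc k \<and> vert w s = vert w' s'}"
  (is "?L = ?R")
proof
  show "?L \<subseteq> ?R"
  proof
    fix p assume "p \<in> ?L"
    then obtain x e f c where p: "p = ((lv_phi (lev k) x e c, e), (lv_phi (lev k) x f c, f))"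
      "e \<in> lv_edges (lev k)" "f \<in> lv_edges (lev k)" "x |\<in>| e" "x |\<in>| f" unfolding glue_rel_def by blast
    obtain w w' where w: "e = ED w" "length w = Suc k" "f = ED w'" "length w' = Suc k"
      using p unfolding lv_edges_k words_def by auto
    obtain s s' where s: "x = EV w s" "x = EV w' s'" using p(4,5) unfolding w ED_iff by blast
    have "vert w s = vert w' s'" using s EV_eq w by metis
    moreover have "lv_phi (lev k) x e = phis s" "lv_phi (lev k) x f = phis s'"
      using lv_phi_k w s by metis+
    ultimately have "p = ((phis s c, ED w), (phis s' c, ED w'))" "vert w s = vert w' s'" using p(1) w by simp_all
    then show "p \<in> ?R" using w by blast
  qed
  show "?R \<subseteq> ?L"
  proof
    fix p assume "p \<in> ?R"
    then obtain w s w' s' c where p: "p = ((phis s c, ED w), (phis s' c, ED w'))" and l: "length w = Suc k" "length w' = Suc k"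
      and v: "vert w s = vert w' s'" by blast
    have ev: "EV w s = EV w' s'" using EV_eq l v by simp
    have "c \<in> igs_labels example_igs" by (cases c) (simp_all add: example_igs_def)
    moreover have "ED w \<in> lv_edges (lev k)" "ED w' \<in> lv_edges (lev k)" using l unfolding lv_edges_k words_def by auto
    moreover have "EV w s |\<in>| ED w" unfolding ED_iff by (intro exI) (rule refl)
    moreover have "EV w s |\<in>| ED w'" unfolding ED_iff ev by (intro exI) (rule refl)
    moreover have "p = ((lv_phi (lev k) (EV w s) (ED w) c, ED w), (lv_phi (lev k) (EV w s) (ED w') c, ED w'))"
      using p lv_phi_k[OF l(1), of s] lv_phi_k[OF l(2), of s'] ev by simp
    ultimately show "p \<in> ?L" unfolding glue_rel_def by blast
  qed
qed

lemma glue_rel_iff: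
  assumes l: "length w = Suc k" "length w' = Suc k"
  shows "((z, ED w), (z', ED w')) \<in> glue_rel example_igs (lev k) \<longleftrightarrow>
    (\<exists>s s' c. z = phis s c \<and> z' = phis s' c \<and> vert w s = vert w' s')"
proof
  assume "((z, ED w), (z', ED w')) \<in> glue_rel example_igs (lev k)"
  then obtain v s v' s' c where v: "z = phis s c" "ED w = ED v" "z' = phis s' c" "ED w' = ED v'"
    "length v = Suc k" "length v' = Suc k" "vert v s = vert v' s'" unfolding glue_rel_k by blast
  have "w = v" "w' = v'" using ED_eq l v by blast+
  then show "\<exists>s s' c. z = phis s c \<and> z' = phis s' c \<and> vert w s = vert w' s'" using v by blast
next
  assume "\<exists>s s' c. z = phis s c \<and> z' = phis s' c \<and> vert w s = vert w' s'"
  then show "((z, ED w), (z', ED w')) \<in> glue_rel example_igs (lev k)" unfolding glue_rel_k using l by blast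
qed

text \<open>The relation is already transitive: a pair \<open>(phis s c, ED w)\<close> determines
  \<open>s\<close>, \<open>c\<close> and \<open>w\<close>, so two consecutive gluings use the same
  vertex and the same label.\<close>

lemma glue_rtrancl: "(glue_rel example_igs (lev k))\<^sup>* = Id \<union> glue_rel example_igs (lev k)"
proof -
  have "trans (glue_rel example_igs (lev k))"
  proof (rule transI)
    fix x y z assume "(x, y) \<in> glue_rel example_igs (lev k)" "(y, z) \<in> glue_rel example_igs (lev k)"
    then obtain w s w' s' c v t v' t' c' where
      1: "x = (phis s c, ED w)" "y = (phis s' c, ED w')" "length w = Suc k" "length w' = Suc k" "vert w s = vert w' s'"
      and 2: "y = (phis t c', ED v)" "z = (phis t' c', ED v')" "length v = Suc k" "length v' = Suc k" "vert v t = vert v' t'"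
      unfolding glue_rel_k by blast
    have "phis s' c = phis t c'" "ED w' = ED v" using 1(2) 2(1) by simp_all
    then have "s' = t" "c = c'" "w' = v" using ED_eq[OF 1(4) 2(3)] by (simp_all add: phis_inj)
    then have "vert w s = vert v' t'" using 1(5) 2(5) by simp
    then show "(x, z) \<in> glue_rel example_igs (lev k)"
      unfolding 1(1) 2(2) \<open>c = c'\<close> glue_rel_iff[OF 1(3) 2(4)] by blast
  qed
  then show ?thesis unfolding rtrancl_trancl_reflcl by (simp add: trancl_id Un_commute)
qed

lemma glue_eq:
  assumes l: "length w = Suc k" "length w' = Suc k"
  shows "glue example_igs (lev k) z (ED w) = glue example_igs (lev k) z' (ED w') \<longleftrightarrow>
    (z = z' \<and> w = w') \<or> (\<exists>s s' c. z = phis s c \<and> z' = phis s' c \<and> vert w s = vert w' s')"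
proof -
  let ?R = "(glue_rel example_igs (lev k))\<^sup>*"
  have "finite (UNIV :: label set)"
    by (rule finite_subset[of _ "{Label_a, Label_b}"]) (auto intro: label.exhaust)
  then have "finite ((\<lambda>(s, c). phis s c) ` (UNIV \<times> UNIV))" by (intro finite_imageI finite_cartesian_product) auto
  then have fin0: "finite (((\<lambda>(s, c). phis s c) ` (UNIV \<times> UNIV)) \<times> ED ` words (Suc k))" by auto
  \<comment> \<open>\<open>Abs_fset\<close> separates finite sets only, so the classes have to be
    finite before glued vertices can be compared.\<close>
  have fin: "finite (?R `` {p})" for p
  proof (rule finite_subset)
    show "?R `` {p} \<subseteq> insert p (((\<lambda>(s, c). phis s c) ` (UNIV \<times> UNIV)) \<times> ED ` words (Suc k))"
      unfolding glue_rtrancl unfolding glue_rel_k words_def by force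
  qed (use fin0 in simp)
  have sym: "sym ?R"
  proof (rule sym_rtrancl, rule symI)
    fix a b assume "(a, b) \<in> glue_rel example_igs (lev k)"
    then show "(b, a) \<in> glue_rel example_igs (lev k)" unfolding glue_rel_k by (force simp: eq_commute)
  qed
  have "glue example_igs (lev k) z (ED w) = glue example_igs (lev k) z' (ED w') \<longleftrightarrow> ?R `` {(z, ED w)} = ?R `` {(z', ED w')}"
    unfolding glue_def using fin by (simp add: Abs_fset_inject)
  also have "\<dots> \<longleftrightarrow> ((z, ED w), (z', ED w')) \<in> ?R"
  proof
    assume "?R `` {(z, ED w)} = ?R `` {(z', ED w')}"
    then show "((z, ED w), (z', ED w')) \<in> ?R" by blast
  next
    assume a: "((z, ED w), (z', ED w')) \<in> ?R"
    then have b: "((z', ED w'), (z, ED w)) \<in> ?R" using sym by (rule symD[rotated])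
    show "?R `` {(z, ED w)} = ?R `` {(z', ED w')}" using a b by (auto intro: rtrancl_trans)
  qed
  also have "\<dots> \<longleftrightarrow> (z = z' \<and> w = w') \<or> (\<exists>s s' c. z = phis s c \<and> z' = phis s' c \<and> vert w s = vert w' s')"
    unfolding glue_rtrancl using ED_eq[OF l] glue_rel_iff[OF l] by auto
  finally show ?thesis .
qed

lemma EV_Suc_eq:
  assumes l: "length w = Suc k" "length w' = Suc k"
  shows "EV (f # w) s = EV (g # w') s' \<longleftrightarrow> vert (f # w) s = vert (g # w') s'"
proof -
  have "EV (f # w) s = EV (g # w') s' \<longleftrightarrow> (num f s = num g s' \<and> w = w') \<or>
     (\<exists>c. outl f s = Some (lab c) \<and> outl g s' = Some (lab c) \<and> vert w s = vert w' s')"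
    unfolding EV_Cons[OF l(1)] EV_Cons[OF l(2)] glue_eq[OF l] num_phis by blast
  also have "\<dots> \<longleftrightarrow> vert (f # w) s = vert (g # w') s'"
  proof (cases "outl f s")
    case None
    then have "outl g s' = None" if "num f s = num g s'" using outl_cong[OF that] by simp
    then show ?thesis using None by (auto simp: vert_Cons split: option.splits)
  next
    case (Some b)
    obtain c where c: "lab c = b" using lab_surj by blast
    have n: "num f s = phis s c" using Some c num_phis by simp
    have "outl g s' = Some b \<and> s = s'" if "num f s = num g s'" using that n num_phis[of g s' s c] c by simp
    then show ?thesis using Some c by (auto simp: vert_Cons split: option.splits)
  qed
  finally show ?thesis .
qed

lemma next_edge:
  assumes "{z1, z2} \<in> igs_edges example_igs" "e \<in> lv_edges (lev k)"
  obtains f s w where "length w = Suc k" "e = ED w" "glue example_igs (lev k) z1 e = EV (f # w) s"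
    "glue example_igs (lev k) z2 e = EV (f # w) (\<not> s)" "igs_phi example_igs z1 {z1, z2} = phis s"
    "{|glue example_igs (lev k) z1 e, glue example_igs (lev k) z2 e|} = ED (f # w)"
proof -
  obtain w where w: "e = ED w" "length w = Suc k" using assms(2) unfolding lv_edges_k words_def by auto
  obtain f s where f: "z1 = num f s" "z2 = num f (\<not> s)" "{z1, z2} = {num f False, num f True}"
    using assms(1) by (rule igs_edgeE)
  show ?thesis
    by (rule that[of w f s]) (use w f EV_Cons[OF w(2)] igs_phi_num[of f s] ED_alt[of "f # w" s] in auto)
qed

lemma lv_edges_Suc: "lv_edges (lev (Suc k)) = ED ` words (Suc (Suc k))"
proof
  show "lv_edges (lev (Suc k)) \<subseteq> ED ` words (Suc (Suc k))"
  proof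
    fix x assume "x \<in> lv_edges (lev (Suc k))"
    then obtain z1 z2 e where x: "{z1, z2} \<in> igs_edges example_igs" "e \<in> lv_edges (lev k)"
      "x = {|glue example_igs (lev k) z1 e, glue example_igs (lev k) z2 e|}"
      by (auto simp: next_level_def)
    obtain f s w where "length w = Suc k" "x = ED (f # w)" using x(3) next_edge[OF x(1,2)] by metis
    then show "x \<in> ED ` words (Suc (Suc k))" by (auto simp: words_def)
  qed
  show "ED ` words (Suc (Suc k)) \<subseteq> lv_edges (lev (Suc k))"
  proof
    fix x assume "x \<in> ED ` words (Suc (Suc k))"
    then obtain f w where x: "x = ED (f # w)" "length w = Suc k" by (auto simp: words_def length_Suc_conv)
    have "{num f False, num f True} \<in> igs_edges example_igs" unfolding igs_edges_ltr by blast
    moreover have "ED w \<in> lv_edges (lev k)" using x unfolding lv_edges_k words_def by blast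
    moreover have "x = {|glue example_igs (lev k) (num f False) (ED w), glue example_igs (lev k) (num f True) (ED w)|}"
      unfolding x(1) ED_def[of "f # w"] EV_Cons[OF x(2)] ..
    ultimately show "x \<in> lv_edges (lev (Suc k))" by (auto simp: next_level_def)
  qed
qed

lemma ED_Suc_eq: "length w = Suc k \<Longrightarrow> length w' = Suc k \<Longrightarrow> ED (f # w) = ED (g # w') \<longleftrightarrow> f # w = g # w'"
  by (rule ED_inj_gen) (simp_all add: EV_Suc_eq)

lemma lv_phi_Suc:
  assumes l: "length w = Suc k" shows "lv_phi (lev (Suc k)) (EV (f # w) s) (ED (f # w)) = phis s"
proof -
  have "(THE g. \<exists>z1 z2 e. {z1, z2} \<in> igs_edges example_igs \<and> e \<in> lv_edges (lev k) \<and>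
    EV (f # w) s = glue example_igs (lev k) z1 e \<and> ED (f # w) = {|glue example_igs (lev k) z1 e, glue example_igs (lev k) z2 e|} \<and>
                  g = igs_phi example_igs z1 {z1, z2}) = phis s"
  proof (rule the_equality)
    have "{num f s, num f (\<not> s)} = {num f False, num f True}" by (cases s) auto
    moreover then have "{num f s, num f (\<not> s)} \<in> igs_edges example_igs" unfolding igs_edges_ltr by blast
    moreover have "ED w \<in> lv_edges (lev k)" using l unfolding lv_edges_k words_def by blast
    moreover have "ED (f # w) = {|glue example_igs (lev k) (num f s) (ED w), glue example_igs (lev k) (num f (\<not> s)) (ED w)|}"
      unfolding ED_alt[of "f # w" s] EV_Cons[OF l] ..
    ultimately show "\<exists>z1 z2 e. {z1, z2} \<in> igs_edges example_igs \<and> e \<in> lv_edges (lev k) \<and>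
      EV (f # w) s = glue example_igs (lev k) z1 e \<and> ED (f # w) = {|glue example_igs (lev k) z1 e, glue example_igs (lev k) z2 e|} \<and>
                  phis s = igs_phi example_igs z1 {z1, z2}"
      using igs_phi_num[of f s] EV_Cons[OF l, of f s] by metis
  next
    fix g assume "\<exists>z1 z2 e. {z1, z2} \<in> igs_edges example_igs \<and> e \<in> lv_edges (lev k) \<and>
      EV (f # w) s = glue example_igs (lev k) z1 e \<and> ED (f # w) = {|glue example_igs (lev k) z1 e, glue example_igs (lev k) z2 e|} \<and>
                  g = igs_phi example_igs z1 {z1, z2}"
    then obtain z1 z2 e where z: "{z1, z2} \<in> igs_edges example_igs" "e \<in> lv_edges (lev k)"
      "EV (f # w) s = glue example_igs (lev k) z1 e" "ED (f # w) = {|glue example_igs (lev k) z1 e, glue example_igs (lev k) z2 e|}"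
      "g = igs_phi example_igs z1 {z1, z2}" by blast
    obtain f' s' w' where w': "length w' = Suc k" "glue example_igs (lev k) z1 e = EV (f' # w') s'"
      "igs_phi example_igs z1 {z1, z2} = phis s'" "{|glue example_igs (lev k) z1 e, glue example_igs (lev k) z2 e|} = ED (f' # w')"
      by (rule next_edge[OF z(1,2)]) blast
    have eq: "f # w = f' # w'" using z(4) w'(4) ED_Suc_eq[OF l w'(1), of f f'] by simp
    then have "EV (f # w) s = EV (f # w) s'" using z(3) w'(2) by simp
    then have "s = s'" using EV_Suc_eq[OF l l, of f s f s'] by simp
    then show "g = phis s" using z(5) w'(3) by simp
  qed
  then show ?thesis by (simp add: next_level_def)
qed

lemma lev_inv_Suc: "lev_inv (Suc k)"
proof -
  have "EV w s = EV w' s' \<longleftrightarrow> vert w s = vert w' s'" if "w \<in> words (Suc (Suc k))" "w' \<in> words (Suc (Suc k))" for w w' s s'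
  proof -
    obtain f v g v' where "w = f # v" "length v = Suc k" "w' = g # v'" "length v' = Suc k"
      using \<open>w \<in> _\<close> \<open>w' \<in> _\<close> unfolding words_def by (auto simp: length_Suc_conv)
    then show ?thesis using EV_Suc_eq by simp
  qed
  moreover have "lv_phi (lev (Suc k)) (EV w s) (ED w) = phis s" if "w \<in> words (Suc (Suc k))" for w s
  proof -
    obtain f v where "w = f # v" "length v = Suc k"
      using \<open>w \<in> _\<close> unfolding words_def by (auto simp: length_Suc_conv)
    then show ?thesis using lv_phi_Suc by simp
  qed
  ultimately show ?thesis unfolding lev_inv_def using lv_edges_Suc by blast
qed

lemma igs_proj_ED:
  assumes l: "length w = Suc k" shows "igs_proj example_igs k (ED (f # w)) = ED w"
  unfolding igs_proj_def
proof (rule the_equality)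
  have "{num f False, num f True} \<in> igs_edges example_igs" unfolding igs_edges_ltr by blast
  moreover have "ED w \<in> lv_edges (lev k)" using l unfolding lv_edges_k words_def by blast
  moreover have "ED (f # w) = {|glue example_igs (lev k) (num f False) (ED w), glue example_igs (lev k) (num f True) (ED w)|}"
    unfolding ED_def[of "f # w"] EV_Cons[OF l] ..
  ultimately show "ED w \<in> lv_edges (lev k) \<and> (\<exists>z1 z2. {z1, z2} \<in> igs_edges example_igs \<and>
    ED (f # w) = {|glue example_igs (lev k) z1 (ED w), glue example_igs (lev k) z2 (ED w)|})" by blast
next
  fix e assume "e \<in> lv_edges (lev k) \<and> (\<exists>z1 z2. {z1, z2} \<in> igs_edges example_igs \<and>
    ED (f # w) = {|glue example_igs (lev k) z1 e, glue example_igs (lev k) z2 e|})"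
  then obtain z1 z2 where z: "{z1, z2} \<in> igs_edges example_igs" "e \<in> lv_edges (lev k)"
    "ED (f # w) = {|glue example_igs (lev k) z1 e, glue example_igs (lev k) z2 e|}" by blast
  obtain f' s' w' where w': "length w' = Suc k" "e = ED w'"
     "{|glue example_igs (lev k) z1 e, glue example_igs (lev k) z2 e|} = ED (f' # w')"
    by (rule next_edge[OF z(1,2)]) blast
  then show "e = ED w" using z(3) ED_Suc_eq[OF l w'(1), of f f'] by simp
qed

end

lemma lev_inv: "lev_inv k"
  by (induction k) (auto intro: lev_inv_0 lev_inv_Suc)

lemma lev_step:
  assumes l: "length w = Suc k"
  shows "{|EV w s, y|} \<in> lv_edges (lev k) \<longleftrightarrow> (\<exists>w' s'. length w' = Suc k \<and> y = EV w' s' \<and> (vert w s, vert w' s') \<in> steps (Suc k))"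
proof
  note inv = lev_inv[of k]
  assume "{|EV w s, y|} \<in> lv_edges (lev k)"
  then obtain v where v: "{|EV w s, y|} = ED v" "length v = Suc k" unfolding lv_edges_k[OF inv] words_def by auto
  then have "fset {|EV w s, y|} = fset (ED v)" by simp
  then have "{EV w s, y} = {EV v False, EV v True}" by (simp add: ED_def)
  then obtain a where a: "EV w s = EV v a" "y = EV v (\<not> a)" by (auto simp: doubleton_eq_iff)
  then have "vert w s = vert v a" using EV_eq[OF inv l v(2)] by simp
  then have "(vert w s, vert v (\<not> a)) \<in> steps (Suc k)" using v(2) by (auto simp: steps_def)
  then show "\<exists>w' s'. length w' = Suc k \<and> y = EV w' s' \<and> (vert w s, vert w' s') \<in> steps (Suc k)"
    using v(2) a(2) by blast
next
  note inv = lev_inv[of k]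
  assume "\<exists>w' s'. length w' = Suc k \<and> y = EV w' s' \<and> (vert w s, vert w' s') \<in> steps (Suc k)"
  then obtain w' s' where w': "length w' = Suc k" "y = EV w' s'" "(vert w s, vert w' s') \<in> steps (Suc k)" by blast
  then obtain v a where v: "vert w s = vert v a" "vert w' s' = vert v (\<not> a)" "length v = Suc k" by (auto simp: steps_def)
  have "EV w s = EV v a" "y = EV v (\<not> a)" using EV_eq[OF inv l v(3)] EV_eq[OF inv w'(1) v(3)] v w'(2) by simp_all
  then have "{|EV w s, y|} = ED v" using ED_alt[of v a] by simp
  then show "{|EV w s, y|} \<in> lv_edges (lev k)" using v(3) unfolding lv_edges_k[OF inv] words_def by simp
qed

lemma lev_path:
  assumes l: "length w = Suc k" "length w' = Suc k"
  shows "(EV w s, EV w' s') \<in> {(u, v). {|u, v|} \<in> lv_edges (lev k)} ^^ j \<longleftrightarrow> (vert w s, vert w' s') \<in> steps (Suc k) ^^ j"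
  using l(2)
proof (induction j arbitrary: w' s')
  case 0
  then show ?case using EV_eq[OF lev_inv l(1)] by simp
next
  case (Suc j)
  let ?E = "{(u, v). {|u, v|} \<in> lv_edges (lev k)}"
  show ?case
  proof
    assume "(EV w s, EV w' s') \<in> ?E ^^ Suc j"
    then obtain y where y: "(EV w s, y) \<in> ?E ^^ j" "{|y, EV w' s'|} \<in> lv_edges (lev k)" by auto
    then have "{|EV w' s', y|} \<in> lv_edges (lev k)" by (simp add: finsert_commute)
    then obtain v t where v: "length v = Suc k" "y = EV v t" "(vert w' s', vert v t) \<in> steps (Suc k)"
      using lev_step[OF Suc.prems] by blast
    have "(vert v t, vert w' s') \<in> steps (Suc k)"
      using v(3) by (rule steps_sym)
    then show "(vert w s, vert w' s') \<in> steps (Suc k) ^^ Suc j" using Suc.IH[OF v(1), of t] y(1) v(2) by auto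
  next
    assume "(vert w s, vert w' s') \<in> steps (Suc k) ^^ Suc j"
    then obtain p where p: "(vert w s, p) \<in> steps (Suc k) ^^ j" "(p, vert w' s') \<in> steps (Suc k)" by auto
    then obtain v t where v: "p = vert v t" "length v = Suc k" by (auto simp: steps_def)
    have "{|EV v t, EV w' s'|} \<in> lv_edges (lev k)" using lev_step[OF v(2)] p(2) Suc.prems unfolding v(1) by blast
    then show "(EV w s, EV w' s') \<in> ?E ^^ Suc j" using Suc.IH[OF v(2), of t] p(1) v(1) by auto
  qed
qed

text \<open>Both halves of the duality: \<open>steps_Lip\<close> bounds every potential difference
  by the length of a path, and \<open>steps_dist\<close> provides a path whose length is at most the
  supremum.\<close>

lemma level_dist_Dn:
  assumes l: "length w = Suc k" "length w' = Suc k"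
  shows "level_dist example_igs 4 k (EV w s) (EV w' s') = Dn (1/4) (Suc k) (vert w s) (vert w' s')"
proof -
  have q: "0 < (1/4::real)" "(1/4::real) \<le> 1/4" by auto
  obtain j where j: "(vert w s, vert w' s') \<in> steps (Suc k) ^^ j" "real j * (1/4) ^ Suc k \<le> Dn (1/4) (Suc k) (vert w' s') (vert w s)"
    using steps_dist[OF l] by blast
  define m where "m = path_dist (lev k) (EV w s) (EV w' s')"
  have m: "m = (LEAST n. (vert w s, vert w' s') \<in> steps (Suc k) ^^ n)"
    unfolding m_def path_dist_def using lev_path[OF l] by simp
  have m1: "(vert w s, vert w' s') \<in> steps (Suc k) ^^ m" unfolding m using j(1) by (rule LeastI)
  have m2: "m \<le> j" unfolding m using j(1) by (rule Least_le)
  have "Dn (1/4) (Suc k) (vert w s) (vert w' s') \<le> real m * (1/4) ^ Suc k"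
    by (rule Dn_least[OF q]) (rule steps_Lip[OF _ m1])
  moreover have "real m * (1/4) ^ Suc k \<le> real j * (1/4) ^ Suc k" using m2 by (intro mult_right_mono) auto
  moreover have "Dn (1/4) (Suc k) (vert w' s') (vert w s) = Dn (1/4) (Suc k) (vert w s) (vert w' s')"
    by (rule Dn_commute[OF q l(2,1)])
  ultimately have "Dn (1/4) (Suc k) (vert w s) (vert w' s') = real m * (1/4) ^ Suc k" using j(2) by linarith
  then show ?thesis unfolding level_dist_def m_def[symmetric] by (simp add: field_simps inverse_eq_divide)
qed

text \<open>The minimum over the ends moves each of the two points across at most one edge.\<close>

lemma edge_dist_approx:
  assumes l: "length w = Suc k" "length w' = Suc k"
  shows "\<bar>edge_dist example_igs 4 k (ED w) (ED w') - Dn (1/4) (Suc k) (vert w False) (vert w' False)\<bar> \<le> 2 * (1/4) ^ Suc k"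
proof -
  have q: "0 < (1/4::real)" "(1/4::real) \<le> 1/4" by auto
  let ?D = "\<lambda>s s'. Dn (1/4) (Suc k) (vert w s) (vert w' s')"
  have e: "Dn (1/4) (Suc k) (vert v a) (vert v b) \<le> (1/4) ^ Suc k" if v: "length v = Suc k" for v a b
  proof (rule Dn_least[OF q])
    fix u assume "Lip (1/4) (Suc k) u"
    then have "\<bar>gr u v\<bar> \<le> (1/4) ^ Suc k" using LipD[of "1/4" "Suc k" u v] v by (simp add: wt_quarter)
    moreover have "0 \<le> (1/4::real) ^ Suc k" by simp
    ultimately have "u (vert v True) - u (vert v False) \<le> (1/4) ^ Suc k" "u (vert v False) - u (vert v True) \<le> (1/4) ^ Suc k" "0 \<le> (1/4::real) ^ Suc k"
      unfolding gr_def by (simp_all only: abs_le_iff minus_diff_eq)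
    then show "u (vert v a) - u (vert v b) \<le> (1/4) ^ Suc k" by (cases a; cases b; simp only: diff_self)
  qed
  have set: "{level_dist example_igs 4 k x y | x y. x |\<in>| ED w \<and> y |\<in>| ED w'} = (\<lambda>(s, s'). ?D s s') ` UNIV"
    (is "?L = ?R")
  proof (intro set_eqI iffI)
    fix a assume "a \<in> ?L"
    then obtain s s' where "a = level_dist example_igs 4 k (EV w s) (EV w' s')" unfolding ED_iff by blast
    then have "a = ?D s s'" using level_dist_Dn[OF l] by simp
    then show "a \<in> ?R" by (intro image_eqI[of _ _ "(s, s')"]) auto
  next
    fix a assume "a \<in> ?R"
    then obtain s s' where "a = ?D s s'" by auto
    then have "a = level_dist example_igs 4 k (EV w s) (EV w' s')" using level_dist_Dn[OF l] by simp
    then show "a \<in> ?L" unfolding ED_iff by blast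
  qed
  have ed: "edge_dist example_igs 4 k (ED w) (ED w') = Min ((\<lambda>(s, s'). ?D s s') ` UNIV)"
    unfolding edge_dist_def set ..
  have up: "edge_dist example_igs 4 k (ED w) (ED w') \<le> ?D False False"
    unfolding ed by (intro Min_le) (auto simp: image_iff)
  have low: "?D False False - 2 * (1/4) ^ Suc k \<le> edge_dist example_igs 4 k (ED w) (ED w')"
    unfolding ed
  proof (rule Min.boundedI)
    fix a assume "a \<in> (\<lambda>(s, s'). ?D s s') ` UNIV"
    then obtain s s' where a: "a = ?D s s'" by auto
    have "?D False False \<le> Dn (1/4) (Suc k) (vert w False) (vert w s) + Dn (1/4) (Suc k) (vert w s) (vert w' False)"
      by (rule Dn_triangle[OF q l(1) l(1) l(2)])
    moreover have "Dn (1/4) (Suc k) (vert w s) (vert w' False) \<le> a + Dn (1/4) (Suc k) (vert w' s') (vert w' False)"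
      unfolding a by (rule Dn_triangle[OF q l(1) l(2) l(2)])
    ultimately show "?D False False - 2 * (1/4) ^ Suc k \<le> a" using e[OF l(1), of False s] e[OF l(2), of s' False] by linarith
  qed auto
  have "0 \<le> (1/4::real) ^ Suc k" by simp
  then show ?thesis using up low unfolding abs_le_iff by linarith
qed

section \<open>Points and distances of the limit space\<close>

definition sym_of :: "(nat \<Rightarrow> ltr) \<Rightarrow> nat \<Rightarrow> nat vtx fset" where
  "sym_of \<omega> k = ED (pre \<omega> (Suc k))"

lemma symbols: "igs_symbols example_igs = range sym_of"
proof
  show "range sym_of \<subseteq> igs_symbols example_igs"
  proof
    fix e assume "e \<in> range sym_of"
    then obtain \<omega> where e: "e = sym_of \<omega>" by blast
    have "e k \<in> lv_edges (lev k)" for k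
      unfolding e sym_of_def lv_edges_k[OF lev_inv] words_def by simp
    moreover have "igs_proj example_igs k (e (Suc k)) = e k" for k
      unfolding e sym_of_def using igs_proj_ED[OF lev_inv, of "pre \<omega> (Suc k)" k "\<omega> (Suc k)"] by simp
    ultimately show "e \<in> igs_symbols example_igs" by (simp add: igs_symbols_def)
  qed
  show "igs_symbols example_igs \<subseteq> range sym_of"
  proof
    fix e assume "e \<in> igs_symbols example_igs"
    then have e: "e k \<in> lv_edges (lev k)" "igs_proj example_igs k (e (Suc k)) = e k" for k by (auto simp: igs_symbols_def)
    have "\<exists>w. e k = ED w \<and> length w = Suc k" for k
      using e(1)[of k] unfolding lv_edges_k[OF lev_inv] words_def by auto
    then obtain W where W: "\<And>k. e k = ED (W k)" "\<And>k. length (W k) = Suc k" by metis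
    have tl: "tl (W (Suc k)) = W k" for k
    proof -
      obtain f w where fw: "W (Suc k) = f # w" "length w = Suc k" using W(2)[of "Suc k"] by (cases "W (Suc k)") auto
      have "ED w = ED (W k)" using e(2)[of k] igs_proj_ED[OF lev_inv fw(2), of f] unfolding W(1) fw(1) by simp
      then show ?thesis using ED_eq[OF lev_inv fw(2) W(2)] fw(1) by simp
    qed
    define \<omega> where "\<omega> k = hd (W k)" for k
    have "pre \<omega> (Suc k) = W k" for k
    proof (induction k)
      case 0
      have "length (W 0) = 1" using W(2)[of 0] by simp
      then show ?case unfolding \<omega>_def by (cases "W 0") auto
    next
      case (Suc k)
      have "W (Suc k) \<noteq> []" using W(2)[of "Suc k"] by auto
      then have "W (Suc k) = \<omega> (Suc k) # W k" unfolding \<omega>_def using tl[of k] by (metis list.collapse)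
      then show ?case using Suc by simp
    qed
    then have "e = sym_of \<omega>" using W(1) by (auto simp: sym_of_def simp del: pre.simps)
    then show "e \<in> range sym_of" by blast
  qed
qed

lemma ED_inter:
  assumes "length w = Suc k" "length w' = Suc k"
  shows "ED w |\<inter>| ED w' \<noteq> {||} \<longleftrightarrow> adj w w'"
proof
  assume "ED w |\<inter>| ED w' \<noteq> {||}"
  then obtain x where "x |\<in>| ED w" "x |\<in>| ED w'" by auto
  then obtain s s' where "EV w s = EV w' s'" unfolding ED_iff by metis
  then show "adj w w'" using EV_eq[OF lev_inv assms] by (auto simp: adj_def)
next
  assume "adj w w'"
  then obtain s s' where "EV w s = EV w' s'" using EV_eq[OF lev_inv assms] by (auto simp: adj_def)
  then have "EV w s |\<in>| ED w |\<inter>| ED w'" unfolding finter_iff ED_iff by metis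
  then show "ED w |\<inter>| ED w' \<noteq> {||}" by auto
qed

lemma equiv_iff: "(sym_of \<omega>, sym_of \<omega>') \<in> igs_equiv example_igs \<longleftrightarrow> dd (1/4) \<omega> \<omega>' = 0"
proof -
  have q: "0 < (1/4::real)" "(1/4::real) \<le> 1/4" by auto
  have "(sym_of \<omega>, sym_of \<omega>') \<in> igs_equiv example_igs \<longleftrightarrow> (\<forall>k. adj (pre \<omega> (Suc k)) (pre \<omega>' (Suc k)))"
    unfolding igs_equiv_def sym_of_def using ED_inter[of "pre \<omega> (Suc _)" _ "pre \<omega>' (Suc _)"]
    by (simp add: symbols sym_of_def[abs_def] del: pre.simps)
  also have "\<dots> \<longleftrightarrow> (\<forall>n. adj (pre \<omega> n) (pre \<omega>' n))"
  proof
    assume a: "\<forall>k. adj (pre \<omega> (Suc k)) (pre \<omega>' (Suc k))"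
    show "\<forall>n. adj (pre \<omega> n) (pre \<omega>' n)"
    proof
      fix n show "adj (pre \<omega> n) (pre \<omega>' n)" using a by (cases n) (auto simp del: pre.simps(2))
    qed
  qed blast
  finally show ?thesis using dd_eq_0_iff[OF q] by simp
qed

definition PP :: "(nat \<Rightarrow> ltr) \<Rightarrow> (nat \<Rightarrow> nat vtx fset) set" where
  "PP \<omega> = igs_equiv example_igs `` {sym_of \<omega>}"

lemma PP_mem: "e \<in> PP \<omega> \<longleftrightarrow> (\<exists>\<omega>'. e = sym_of \<omega>' \<and> dd (1/4) \<omega> \<omega>' = 0)"
proof -
  have "e \<in> PP \<omega> \<Longrightarrow> e \<in> range sym_of" unfolding PP_def igs_equiv_def symbols[symmetric] by blast
  then show ?thesis unfolding PP_def using equiv_iff[of \<omega>] by auto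
qed

lemma PP_eq: "PP \<omega> = PP \<omega>' \<longleftrightarrow> dd (1/4) \<omega> \<omega>' = 0"
proof -
  have q: "0 < (1/4::real)" "(1/4::real) \<le> 1/4" by auto
  have tr: "dd (1/4) \<omega>1 \<omega>3 = 0" if "dd (1/4) \<omega>1 \<omega>2 = 0" "dd (1/4) \<omega>2 \<omega>3 = 0" for \<omega>1 \<omega>2 \<omega>3
    using dd_triangle[OF q, of \<omega>1 \<omega>3 \<omega>2] dd_nonneg[OF q, of \<omega>1 \<omega>3] that by simp
  have self: "dd (1/4) \<omega> \<omega> = 0" for \<omega> using dd_eq_0_iff[OF q] by simp
  show ?thesis
  proof
    assume "PP \<omega> = PP \<omega>'"
    moreover have "sym_of \<omega>' \<in> PP \<omega>'" unfolding PP_mem using self by blast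
    ultimately have "sym_of \<omega>' \<in> PP \<omega>" by simp
    then show "dd (1/4) \<omega> \<omega>' = 0" unfolding PP_def using equiv_iff by simp
  next
    assume a: "dd (1/4) \<omega> \<omega>' = 0"
    then have a': "dd (1/4) \<omega>' \<omega> = 0" using dd_commute[OF q] by metis
    have "e \<in> PP \<omega> \<longleftrightarrow> e \<in> PP \<omega>'" for e unfolding PP_mem using tr a a' by blast
    then show "PP \<omega> = PP \<omega>'" by blast
  qed
qed

global_interpretation code: coding PP
proof
  show "PP \<omega> = PP \<omega>' \<longleftrightarrow> (\<forall>n. adj (pre \<omega> n) (pre \<omega>' n))" for \<omega> \<omega>'
    unfolding PP_eq by (rule dd_eq_0_iff) auto
qed

lemma points: "igs_points example_igs = range PP"
  unfolding igs_points_def quotient_def symbols PP_def by auto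

lemma igs_dist_pd: "igs_dist example_igs 4 = code.pd (1/4)"
proof (intro ext)
  fix x y
  have q: "0 < (1/4::real)" "(1/4::real) \<le> 1/4" by auto
  show "igs_dist example_igs 4 x y = code.pd (1/4) x y"
  proof (cases "x \<in> range PP \<and> y \<in> range PP")
    case False
    then show ?thesis unfolding igs_dist_def points code.pd_def by argo
  next
    case True
    have lim: "(\<lambda>k. edge_dist example_igs 4 k (e k) (f k)) \<longlonglongrightarrow> code.pd (1/4) x y" if ef: "e \<in> x" "f \<in> y" for e f
    proof -
      obtain \<omega> \<omega>' where w: "x = PP \<omega>" "y = PP \<omega>'" using True by blast
      obtain \<xi> \<xi>' where x: "e = sym_of \<xi>" "dd (1/4) \<omega> \<xi> = 0" "f = sym_of \<xi>'" "dd (1/4) \<omega>' \<xi>' = 0"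
        using ef unfolding w PP_mem by blast
      have xy: "x = PP \<xi>" "y = PP \<xi>'" using x w PP_eq by auto
      have 1: "(\<lambda>k. Dn (1/4) (Suc k) (vert (pre \<xi> (Suc k)) False) (vert (pre \<xi>' (Suc k)) False)) \<longlonglongrightarrow> code.pd (1/4) x y"
        unfolding xy code.pd_P[OF q] by (rule LIMSEQ_Suc[OF dd_limit[OF q]])
      have 2: "(\<lambda>k. edge_dist example_igs 4 k (e k) (f k) - Dn (1/4) (Suc k) (vert (pre \<xi> (Suc k)) False) (vert (pre \<xi>' (Suc k)) False)) \<longlonglongrightarrow> 0"
      proof (rule Lim_null_comparison)
        show "\<forall>\<^sub>F k in sequentially. norm (edge_dist example_igs 4 k (e k) (f k) - Dn (1/4) (Suc k) (vert (pre \<xi> (Suc k)) False) (vert (pre \<xi>' (Suc k)) False)) \<le> 2 * (1/4) ^ Suc k"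
          unfolding x sym_of_def real_norm_def by (intro always_eventually allI edge_dist_approx length_pre)
        have "(\<lambda>k. 2 * (1/4::real) ^ k) \<longlonglongrightarrow> 2 * 0" by (intro tendsto_intros LIMSEQ_power_zero) auto
        then show "(\<lambda>k. 2 * (1/4::real) ^ Suc k) \<longlonglongrightarrow> 0" using LIMSEQ_Suc by fastforce
      qed
      show ?thesis using tendsto_add[OF 2 1] by simp
    qed
    have ne: "\<exists>e. e \<in> x" "\<exists>f. f \<in> y"
    proof -
      have "sym_of \<omega> \<in> PP \<omega>" for \<omega> unfolding PP_mem using dd_eq_0_iff[OF q, of \<omega> \<omega>] by auto
      then show "\<exists>e. e \<in> x" "\<exists>f. f \<in> y" using True by blast+
    qed
    have "(THE l. \<forall>e\<in>x. \<forall>f\<in>y. (\<lambda>k. edge_dist example_igs 4 k (e k) (f k)) \<longlonglongrightarrow> l) = code.pd (1/4) x y"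
    proof (rule the_equality)
      fix l assume "\<forall>e\<in>x. \<forall>f\<in>y. (\<lambda>k. edge_dist example_igs 4 k (e k) (f k)) \<longlonglongrightarrow> l"
      then show "l = code.pd (1/4) x y" using lim ne LIMSEQ_unique by blast
    qed (use lim in blast)
    then show ?thesis using True by (simp add: igs_dist_def points)
  qed
qed

lemma igs_limit_MX: "igs_limit example_igs 4 = code.MX (1/4)"
  unfolding igs_limit_def code.MX_def points igs_dist_pd ..

lemma Metric_space_example: "Metric_space (igs_points example_igs) (igs_dist example_igs 4)"
  unfolding points igs_dist_pd by (rule code.Metric_space_pd) auto

theorem proposition1p4:
  fixes X :: "(nat \<Rightarrow> nat vtx fset) set metric"
  assumes X: "X = igs_limit example_igs 4"
  shows "Metric_space (igs_points example_igs) (igs_dist example_igs 4)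
    \<and> ahlfors_regular (log 4 9) X
    \<and> combinatorial_loewner (3 / 2) X
    \<and> approximately_self_similar X
    \<and> conformal_dimension X = ereal (3 / 2)
    \<and> \<not> conformal_dimension_attained X
    \<and> (\<forall>Y :: 'b metric. loewner_space Y \<longrightarrow> \<not> quasisymmetric X Y)"
  unfolding X igs_limit_MX
  using Metric_space_example code.ahlfors_X0 code.combinatorial_loewner_X0 code.self_similar_X0
    code.conformal_dimension_MX code.not_qs_loewner
  by blast

end
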